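(* Let $W\in\mathbb{C}^{n\times n}$ have i.i.d. entries $W_{ij}\sim\mathcal N_{\mathbb C}(0,1)$, let $J$ be the $n\times n$ all-ones matrix, and let \[ P_n(z):=\frac{1}{n!}\operatorname{per}(J+zW),\qquad \log P_n(z)=\sum_{k\ge1} b_{k,n}z^k, \] where $\log P_n$ denotes the branch with $\log P_n(0)=0$ (holomorphic near $0$, since $P_n(0)=1$) and $b_{k,n}$ are its Taylor coefficients at $0$. Fix $\beta\in(0,1/3)$. For each integer $d\ge2$ define \[ \Gamma_{d,\beta}:=\frac{d+1}{6}+\beta(d+1)-\frac12 . \] Then for every $d\ge 2$, every $\gamma<\Gamma_{d,\beta}$ and every $\delta\in(0,1)$ there exists $N=N(\beta,d,\gamma,\delta)$ such that for all $n\ge N$, with probability at least $1-\delta$, the branch of $\log P_n$ determined by $\log P_n(0)=0$ is well defined on the disk $\mathbb D(0,n^{1/3-\beta})=\{|z|<n^{1/3-\beta}\}$ and \[ \sup_{|z|\le n^{1/3-\beta}}\Bigl|\log P_n(z)-\sum_{k=1}^d b_{k,n}z^k\Bigr|\le n^{-\gamma}. \] In particular, to obtain an additive $n^{-\gamma}$-approximation to $\log P_n(z)$ uniformly for $|z|\le n^{1/3-\beta}$, one may take $d=\lceil 6\gamma+3\rceil$, and the corresponding degree-$d$ truncation $\sum_{k=1}^d b_{k,n}z^k$ gives the desired additive approximation (with probability at least $1-\delta$ for $n$ large) and can be computed deterministically from $W$ and $z$ in time $n^{O(\gamma)}$.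
   Context: $\operatorname{per}(A)=\sum_{\sigma\in S_n}\prod_{i}A_{i\sigma(i)}$ is the permanent. $\mathcal N_{\mathbb C}(0,1)$ denotes the standard circularly symmetric complex Gaussian, with density $\pi^{-1}e^{-|w|^2}$ on $\mathbb C$. *)

theory Defs
  imports
    "HOL-Probability.Probability"
    "HOL-Combinatorics.Permutations"
begin

section \<open>The polynomial and the Taylor coefficients of its logarithm\<close>

text \<open>
  Since the size \<open>n\<close> varies, an \<open>n \<times> n\<close> matrix is a function on pairs of indices of which only
  the values at \<open>i, j < n\<close> matter.
\<close>

definition per :: "nat \<Rightarrow> (nat \<Rightarrow> nat \<Rightarrow> complex) \<Rightarrow> complex" where
  "per n A = (\<Sum>\<sigma> | \<sigma> permutes {..<n}. \<Prod>i<n. A i (\<sigma> i))"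

definition perm_poly :: "nat \<Rightarrow> (nat \<Rightarrow> nat \<Rightarrow> complex) \<Rightarrow> complex \<Rightarrow> complex" where
  "perm_poly n A z = per n (\<lambda>i j. 1 + z * A i j) / fact n"

text \<open>
  Near \<open>0\<close> the branch of the logarithm vanishing at \<open>0\<close> is the principal one, because the polynomial
  takes the value \<open>1\<close> there (see \<open>log_perm_poly_near_0\<close> below). So the coefficients are
  defined for every matrix, irrespective of where the zeros lie.
\<close>

definition log_coeff :: "nat \<Rightarrow> (nat \<Rightarrow> nat \<Rightarrow> complex) \<Rightarrow> nat \<Rightarrow> complex" where
  "log_coeff n A k = (deriv ^^ k) (\<lambda>z. Ln (perm_poly n A z)) 0 / fact k"

definition log_trunc :: "nat \<Rightarrow> (nat \<Rightarrow> nat \<Rightarrow> complex) \<Rightarrow> nat \<Rightarrow> complex \<Rightarrow> complex" where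
  "log_trunc n A d z = (\<Sum>k=1..d. log_coeff n A k * z ^ k)"

text \<open>
  The branch is holomorphic on the open disk; as the error is measured on the closed disk, the branch
  is also required to extend continuously, as a logarithm of \<open>f\<close>, to the boundary circle.
  For \<open>r > 0\<close> these conditions determine \<open>L\<close> on the closed disk.
\<close>

definition log_branch :: "real \<Rightarrow> (complex \<Rightarrow> complex) \<Rightarrow> (complex \<Rightarrow> complex) \<Rightarrow> bool" where
  "log_branch r f L \<longleftrightarrow>
     L holomorphic_on ball 0 r \<and> continuous_on (cball 0 r) L \<and> L 0 = 0 \<and>
     (\<forall>z\<in>cball 0 r. exp (L z) = f z)"

definition Gamma_exponent :: "nat \<Rightarrow> real \<Rightarrow> real" where
  "Gamma_exponent d \<beta> = (real d + 1) / 6 + \<beta> * (real d + 1) - 1 / 2"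

text \<open>
  The uniform bound is stated pointwise, since a real-valued supremum carries no information
  for unbounded sets.
\<close>

definition log_approx :: "nat \<Rightarrow> (nat \<Rightarrow> nat \<Rightarrow> complex) \<Rightarrow> nat \<Rightarrow> real \<Rightarrow> real \<Rightarrow> bool" where
  "log_approx n A d r \<epsilon> \<longleftrightarrow>
     (\<exists>L. log_branch r (perm_poly n A) L \<and> (\<forall>z\<in>cball 0 r. cmod (L z - log_trunc n A d z) \<le> \<epsilon>))"


section \<open>The random matrix\<close>

definition std_complex_gaussian :: "'w measure \<Rightarrow> ('w \<Rightarrow> complex) \<Rightarrow> bool" where
  "std_complex_gaussian M X \<longleftrightarrow>
     distributed M lborel X (\<lambda>w. ennreal (exp (- (cmod w)\<^sup>2) / pi))"

definition gaussian_matrix :: "'w measure \<Rightarrow> nat \<Rightarrow> (nat \<Rightarrow> nat \<Rightarrow> 'w \<Rightarrow> complex) \<Rightarrow> bool" where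
  "gaussian_matrix M n W \<longleftrightarrow>
     prob_space M \<and>
     prob_space.indep_vars M (\<lambda>_. borel) (\<lambda>(i, j). W i j) ({..<n} \<times> {..<n}) \<and>
     (\<forall>i<n. \<forall>j<n. std_complex_gaussian M (W i j))"

text \<open>
  For a measurable predicate this is the same as \<open>p \<le> measure M {\<omega> \<in> space M. Q \<omega>}\<close>.
\<close>

definition with_prob_at_least :: "'w measure \<Rightarrow> real \<Rightarrow> ('w \<Rightarrow> bool) \<Rightarrow> bool" where
  "with_prob_at_least M p Q \<longleftrightarrow> (\<exists>E\<in>sets M. p \<le> measure M E \<and> (\<forall>\<omega>\<in>E. Q \<omega>))"


section \<open>Unit-cost algebraic random access machine\<close>

text \<open>
  A machine state consists of index registers holding natural numbers and of a memory of exact complex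
  numbers, addressed indirectly through the index registers. Every elementary instruction, including
  reading an input entry or one exact arithmetic operation on complex numbers, and every test
  costs one step. Index registers can be added and subtracted but not multiplied, so that no
  super-exponentially large integers can be built at unit cost.
\<close>

type_synonym state = "(nat \<Rightarrow> nat) \<times> (nat \<Rightarrow> complex)"

datatype arith_op = Plus | Minus | Times | Divide

fun arith :: "arith_op \<Rightarrow> complex \<Rightarrow> complex \<Rightarrow> complex" where
  "arith Plus x y = x + y"
| "arith Minus x y = x - y"
| "arith Times x y = x * y"
| "arith Divide x y = x / y"

datatype instr =
    Set_Idx nat nat
  | Add_Idx nat nat nat
  | Sub_Idx nat nat nat
  | Read_Entry nat nat nat
  | Read_Point nat
  | Set_Mem nat int
  | Arith arith_op nat nat nat

fun exec_instr :: "(nat \<Rightarrow> nat \<Rightarrow> complex) \<Rightarrow> complex \<Rightarrow> instr \<Rightarrow> state \<Rightarrow> state" where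
  "exec_instr A z (Set_Idx a k) (R, X) = (R(a := k), X)"
| "exec_instr A z (Add_Idx a b c) (R, X) = (R(a := R b + R c), X)"
| "exec_instr A z (Sub_Idx a b c) (R, X) = (R(a := R b - R c), X)"
| "exec_instr A z (Read_Entry a b c) (R, X) = (R, X(R a := A (R b) (R c)))"
| "exec_instr A z (Read_Point a) (R, X) = (R, X(R a := z))"
| "exec_instr A z (Set_Mem a k) (R, X) = (R, X(R a := of_int k))"
| "exec_instr A z (Arith f a b c) (R, X) = (R, X(R a := arith f (X (R b)) (X (R c))))"

datatype prog =
    Instr instr
  | Seq prog prog
  | If_Nonzero nat prog prog
  | While_Nonzero nat prog

text \<open>
  \<open>runs A z p s t s'\<close>: on input \<open>A\<close>, \<open>z\<close>, the program \<open>p\<close> started in \<open>s\<close> halts in \<open>s'\<close> after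
  exactly \<open>t\<close> steps.
\<close>

inductive runs ::
  "(nat \<Rightarrow> nat \<Rightarrow> complex) \<Rightarrow> complex \<Rightarrow> prog \<Rightarrow> state \<Rightarrow> nat \<Rightarrow> state \<Rightarrow> bool"
  for A :: "nat \<Rightarrow> nat \<Rightarrow> complex" and z :: complex where
  Instr: "runs A z (Instr i) s 1 (exec_instr A z i s)"
| Seq: "runs A z p s t s' \<Longrightarrow> runs A z q s' u s'' \<Longrightarrow> runs A z (Seq p q) s (t + u) s''"
| If_True: "fst s a \<noteq> 0 \<Longrightarrow> runs A z p s t s' \<Longrightarrow> runs A z (If_Nonzero a p q) s (t + 1) s'"
| If_False: "fst s a = 0 \<Longrightarrow> runs A z q s t s' \<Longrightarrow> runs A z (If_Nonzero a p q) s (t + 1) s'"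
| While_True:
    "fst s a \<noteq> 0 \<Longrightarrow> runs A z p s t s' \<Longrightarrow> runs A z (While_Nonzero a p) s' u s'' \<Longrightarrow>
     runs A z (While_Nonzero a p) s (t + u + 1) s''"
| While_False: "fst s a = 0 \<Longrightarrow> runs A z (While_Nonzero a p) s 1 s"

text \<open>The size is passed in register \<open>0\<close>, and the result is left in memory cell \<open>0\<close>.\<close>

definition initial_state :: "nat \<Rightarrow> state" where
  "initial_state n = ((\<lambda>_. 0)(0 := n), \<lambda>_. 0)"

definition computes_within ::
  "prog \<Rightarrow> nat \<Rightarrow> (nat \<Rightarrow> nat \<Rightarrow> complex) \<Rightarrow> complex \<Rightarrow> complex \<Rightarrow> real \<Rightarrow> bool" where
  "computes_within p n A z y T \<longleftrightarrow>
     (\<exists>t s. runs A z p (initial_state n) t s \<and> snd s 0 = y \<and> real t \<le> T)"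


section \<open>Consistency of the definitions\<close>

lemma perm_poly_0 [simp]: "perm_poly n A 0 = 1"
  by (simp add: perm_poly_def per_def card_permutations)

lemma perm_poly_holomorphic: "perm_poly n A holomorphic_on S"
  unfolding perm_poly_def[abs_def] per_def by (intro holomorphic_intros) auto

lemma log_perm_poly_near_0:
  "\<exists>r>0. (\<lambda>z. Ln (perm_poly n A z)) holomorphic_on ball 0 r \<and> Ln (perm_poly n A 0) = 0 \<and>
     (\<forall>z\<in>ball 0 r. exp (Ln (perm_poly n A z)) = perm_poly n A z)"
proof -
  have "isCont (perm_poly n A) 0"
    using perm_poly_holomorphic[of n A UNIV] holomorphic_on_imp_continuous_on
      continuous_on_eq_continuous_at open_UNIV by blast
  then obtain r where r: "r > 0" "\<forall>z. dist z 0 < r \<longrightarrow> dist (perm_poly n A z) 1 < 1"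
    unfolding continuous_at_eps_delta by (metis perm_poly_0 zero_less_one)
  have *: "perm_poly n A z \<notin> \<real>\<^sub>\<le>\<^sub>0" if "z \<in> ball 0 r" for z
  proof
    assume "perm_poly n A z \<in> \<real>\<^sub>\<le>\<^sub>0"
    then have "Re (perm_poly n A z) \<le> 0"
      by (simp add: complex_nonpos_Reals_iff)
    moreover have "\<bar>Re (perm_poly n A z - 1)\<bar> < 1"
      using r(2) that abs_Re_le_cmod[of "perm_poly n A z - 1"] by (auto simp: dist_norm)
    ultimately show False by auto
  qed
  then have "(\<lambda>z. Ln (perm_poly n A z)) holomorphic_on ball 0 r"
    by (intro holomorphic_on_Ln' perm_poly_holomorphic) auto
  moreover have "exp (Ln (perm_poly n A z)) = perm_poly n A z" if "z \<in> ball 0 r" for z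
    using *[OF that] by (intro exp_Ln) auto
  ultimately show ?thesis using r(1) by auto
qed

lemma runs_deterministic:
  "runs A z p s t s' \<Longrightarrow> runs A z p s u s'' \<Longrightarrow> t = u \<and> s' = s''"
proof (induction arbitrary: u s'' rule: runs.induct)
  case (Instr i s)
  from Instr.prems show ?case by cases auto
next
  case (Seq p s t s' q u s'')
  from Seq.prems show ?case by cases (use Seq.IH in blast)
next
  case (If_True s a p t s' q)
  from If_True.prems show ?case by cases (use If_True in blast)+
next
  case (If_False s a q t s' p)
  from If_False.prems show ?case by cases (use If_False in blast)+
next
  case (While_True s a p t s' u s'')
  from While_True.prems show ?case
    by cases (use While_True.hyps While_True.IH in \<open>blast+\<close>)
next
  case (While_False s a p)
  from While_False.prems show ?case by cases (use While_False in auto)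
qed

end

(*  Zeros.  Replacing the row means of W, and the projection of its columns onto the vector
    e_i ~ 1 + z (row mean)_i, by independent copies factors P(z) as a product over rows, a product
    over columns, and the normalized permanent of a matrix whose second moment is 1 + o(1).  The
    logarithms of the two products have mean o(1), so the mean of log |P| over a circle is o(1), and
    Jensen's formula excludes zeros in the disk of half the radius.

    Coefficients.  Adding the rows one at a time writes log P as a sum of orthogonal increments
    log (1 + z Y), where Y is linear in the new row with coefficients that are ratios of subpermanents;
    this gives E |b_k|^2 = O(n^(1-k)).  For large k, Borel-Caratheodory on the zero-free disk suffices.

    Algorithm.  The first d coefficients of P are sums of products over pairs of injective index
    tuples of length at most d; those of log P follow by the recursion for the logarithm. *)

theory Submission
  imports
    Defs
    "HOL-Complex_Analysis.Complex_Analysis"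
    "HOL-Combinatorics.Multiset_Permutations"
    "HOL-Computational_Algebra.Fundamental_Theorem_Algebra"
    "HOL-Real_Asymp.Real_Asymp"
begin

section \<open>Sums over tuples and partial permanents\<close>

text \<open>Because E |P(z)|^2 grows like exp (|z|^2), second moments of P itself control the mean
  of log |P| only for bounded z. The growth is due to the row and column sums. For a matrix whose
  weighted row and column sums vanish, injectivity of the index tuples can be traded for weights
  under which an index used only once counts almost nothing; this extends the range to |z| =
  o(n^(1/3)). The two product factors do have large second moments, but log |1 + w| is harmonic, so
  that rotating the Gaussians averages their logarithms out. The exponent: with r = n^(1/3 -
  \<beta>) and |b_k| of size n^((1 - k)/2), the term |b_k| r^k has size n^(1/2 - k (1/6 + \<beta>)),
  which at k = d + 1 is n to the power -Gamma. Only boundedly many k need this estimate: zeros are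
  excluded up to the larger radius n^(1/3 - \<beta>/2), hence beyond a fixed K the terms decay with
  a ratio of order n^(-\<beta>/2) per degree, fast enough to beat the loss of a factor n in the
  Borel-Caratheodory bound.\<close>

definition tup :: "nat \<Rightarrow> 'e set \<Rightarrow> 'e list set" where
 "tup k E = {xs. length xs = k \<and> set xs \<subseteq> E}"

definition dtup :: "nat \<Rightarrow> 'e set \<Rightarrow> 'e list set" where
 "dtup k E = {xs. length xs = k \<and> set xs \<subseteq> E \<and> distinct xs}"

lemma finite_tup [simp, intro]: "finite E \<Longrightarrow> finite (tup k E)"
 unfolding tup_def using finite_lists_length_eq[of E k] by (simp add: conj_commute)

lemma dtup_subset: "dtup k E \<subseteq> tup k E"
 by (auto simp: tup_def dtup_def)

lemma finite_dtup [simp, intro]: "finite E \<Longrightarrow> finite (dtup k E)"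
 by (rule finite_subset[OF dtup_subset]) simp

lemma tup_0 [simp]: "tup 0 E = {[]}" and dtup_0 [simp]: "dtup 0 E = {[]}"
 by (auto simp: tup_def dtup_def)

lemma sum_tup_Suc:
 assumes "finite E"
 shows "(\<Sum>xs\<in>tup (Suc k) E. f xs) = (\<Sum>x\<in>E. \<Sum>xs\<in>tup k E. f (x # xs))"
proof -
 have "(\<Sum>x\<in>E. \<Sum>xs\<in>tup k E. f (x # xs)) = (\<Sum>(x, xs)\<in>E \<times> tup k E. f (x # xs))"
  using assms by (subst sum.cartesian_product) auto
 also have "\<dots> = (\<Sum>xs\<in>tup (Suc k) E. f xs)"
  by (rule sum.reindex_bij_witness[of _ "\<lambda>xs. (hd xs, tl xs)" "\<lambda>(x, xs). x # xs"])
    (auto simp: tup_def length_Suc_conv)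
 finally show ?thesis by simp
qed

lemma sum_dtup_Suc:
 assumes "finite E"
 shows "(\<Sum>xs\<in>dtup (Suc k) E. f xs) = (\<Sum>x\<in>E. \<Sum>xs\<in>dtup k (E - {x}). f (x # xs))"
proof -
 have "(\<Sum>x\<in>E. \<Sum>xs\<in>dtup k (E - {x}). f (x # xs)) =
   (\<Sum>(x, xs)\<in>Sigma E (\<lambda>x. dtup k (E - {x})). f (x # xs))"
  using assms by (subst sum.Sigma) auto
 also have "\<dots> = (\<Sum>xs\<in>dtup (Suc k) E. f xs)"
  by (rule sum.reindex_bij_witness[of _ "\<lambda>xs. (hd xs, tl xs)" "\<lambda>(x, xs). x # xs"])
    (auto simp: dtup_def length_Suc_conv)
 finally show ?thesis by simp
qed

lemma sum_swap_distinct_pairs: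
 assumes "finite S"
 shows "(\<Sum>k\<in>S. \<Sum>l\<in>S - {k}. f k l) = (\<Sum>l\<in>S. \<Sum>k\<in>S - {l}. f k l)"
proof -
 have "(\<Sum>k\<in>S. \<Sum>l\<in>S - {k}. f k l) = (\<Sum>(k, l)\<in>Sigma S (\<lambda>k. S - {k}). f k l)"
  using assms by (subst sum.Sigma) auto
 also have "\<dots> = (\<Sum>(l, k)\<in>Sigma S (\<lambda>l. S - {l}). f k l)"
  by (rule sum.reindex_bij_witness[of _ prod.swap prod.swap]) auto
 also have "\<dots> = (\<Sum>l\<in>S. \<Sum>k\<in>S - {l}. f k l)"
  using assms by (subst sum.Sigma) auto
 finally show ?thesis .
qed

text \<open>Expansion row by row: a sum over the injections of the listed rows into
  \<open>S\<close>, so a permanent if the sizes agree. The rows form a list because they are later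
  added one at a time.\<close>

fun rper :: "(nat \<Rightarrow> nat \<Rightarrow> 'a::comm_ring_1) \<Rightarrow> nat list \<Rightarrow> nat set \<Rightarrow> 'a" where
 "rper A [] S = 1"
| "rper A (i # us) S = (\<Sum>k\<in>S. A i k * rper A us (S - {k}))"

text \<open>An injection of the rows into \<open>S\<close> survives the deletion of precisely those
  columns that lie outside its image, and there are \<open>card S - length us\<close> of
  them.\<close>

lemma rper_sum_delete:
 assumes "finite S" "length us \<le> card S"
 shows "(\<Sum>k\<in>S. rper A us (S - {k})) = of_nat (card S - length us) * rper A us S"
 using assms
proof (induction us arbitrary: S)
 case Nil
 then show ?case by simp
next
 case (Cons i us)
 have "(\<Sum>k\<in>S. rper A (i # us) (S - {k})) =
   (\<Sum>l\<in>S. \<Sum>k\<in>S - {l}. A i l * rper A us (S - {k} - {l}))"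
  using Cons.prems by (simp only: rper.simps) (rule sum_swap_distinct_pairs)
 also have "\<dots> = (\<Sum>l\<in>S. A i l * (\<Sum>k\<in>S - {l}. rper A us (S - {l} - {k})))"
  by (simp add: sum_distrib_left Diff_insert2[symmetric] insert_commute)
 also have "\<dots> = (\<Sum>l\<in>S. A i l * (of_nat (card S - length (i # us)) * rper A us (S - {l})))"
 proof (rule sum.cong[OF refl])
  fix l assume "l \<in> S"
  then show "A i l * (\<Sum>k\<in>S - {l}. rper A us (S - {l} - {k})) =
    A i l * (of_nat (card S - length (i # us)) * rper A us (S - {l}))"
   using Cons.IH[of "S - {l}"] Cons.prems by simp
 qed
 finally show ?case by (simp add: sum_distrib_left mult_ac)
qed

text \<open>The injections are split by whether column \<open>j\<close> is hit and, if so, by the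
  row that hits it.\<close>

lemma rper_col:
 assumes "finite S" "j \<notin> S" "distinct us"
 shows "rper A us (insert j S) = rper A us S + (\<Sum>i\<in>set us. A i j * rper A (remove1 i us) S)"
 using assms
proof (induction us arbitrary: S)
 case Nil
 then show ?case by simp
next
 case (Cons i us)
 have "rper A (i # us) (insert j S) =
   A i j * rper A us S + (\<Sum>k\<in>S. A i k * rper A us (insert j (S - {k})))"
  using Cons.prems by (auto simp: insert_Diff_if intro!: sum.cong)
 also have "(\<Sum>k\<in>S. A i k * rper A us (insert j (S - {k}))) =
   (\<Sum>k\<in>S. A i k * (rper A us (S - {k}) + (\<Sum>i'\<in>set us. A i' j * rper A (remove1 i' us) (S - {k}))))"
  using Cons.prems by (intro sum.cong refl, subst Cons.IH) auto
 also have "\<dots> = rper A (i # us) S + (\<Sum>i'\<in>set us. A i' j * (\<Sum>k\<in>S. A i k * rper A (remove1 i' us) (S - {k})))"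
  by (simp add: algebra_simps sum.distrib sum_distrib_left) (rule sum.swap)
 also have "(\<Sum>i'\<in>set us. A i' j * (\<Sum>k\<in>S. A i k * rper A (remove1 i' us) (S - {k}))) =
   (\<Sum>i'\<in>set us. A i' j * rper A (remove1 i' (i # us)) S)"
  using Cons.prems by (intro sum.cong) auto
 finally show ?case using Cons.prems by (simp add: algebra_simps)
qed

text \<open>The expansion may start with any row, because the choices of two distinct columns for
  two rows commute.\<close>

lemma rper_row:
 assumes "finite S" "i \<in> set us" "distinct us"
 shows "rper A us S = rper A (i # remove1 i us) S"
 using assms
proof (induction us arbitrary: S)
 case Nil
 then show ?case by simp
next
 case (Cons i' us)
 show ?case
 proof (cases "i = i'")
  case False
  have "rper A (i' # us) S = (\<Sum>l\<in>S. A i' l * rper A (i # remove1 i us) (S - {l}))"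
   using Cons False by simp
  also have "\<dots> = (\<Sum>l\<in>S. \<Sum>k\<in>S - {l}. A i' l * (A i k * rper A (remove1 i us) (S - {l} - {k})))"
   by (simp add: sum_distrib_left)
  also have "\<dots> = (\<Sum>k\<in>S. \<Sum>l\<in>S - {k}. A i' l * (A i k * rper A (remove1 i us) (S - {l} - {k})))"
   using Cons.prems by (intro sum_swap_distinct_pairs)
  also have "\<dots> = rper A (i # remove1 i (i' # us)) S"
   using False by (auto simp: sum_distrib_left mult_ac Diff_insert2[symmetric] insert_commute intro!: sum.cong)
  finally show ?thesis .
 qed simp
qed

text \<open>The sum over the \<open>k\<close>-edge matchings between rows \<open>us\<close> and columns \<open>S\<close>.\<close>

fun msum :: "(nat \<Rightarrow> nat \<Rightarrow> 'a::comm_ring_1) \<Rightarrow> nat \<Rightarrow> nat list \<Rightarrow> nat set \<Rightarrow> 'a" where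
 "msum B k [] S = (if k = 0 then 1 else 0)"
| "msum B 0 (i # us) S = 1"
| "msum B (Suc k) (i # us) S = msum B (Suc k) us S + (\<Sum>j\<in>S. B i j * msum B k us (S - {j}))"

lemma msum_0 [simp]: "msum B 0 us S = 1"
 by (cases us) auto

lemma msum_eq_0: "length us < k \<Longrightarrow> msum B k us S = 0"
 by (induction B k us S rule: msum.induct) auto

text \<open>Double counting again: a matching with \<open>k\<close> edges avoids
  \<open>card S - k\<close> of the columns.\<close>

lemma msum_sum_delete:
 assumes "finite S" "k \<le> card S"
 shows "(\<Sum>j\<in>S. msum B k us (S - {j})) = of_nat (card S - k) * msum B k us S"
 using assms
proof (induction B k us S rule: msum.induct)
 case (3 B k i us S)
 have "(\<Sum>j\<in>S. msum B (Suc k) (i # us) (S - {j})) = (\<Sum>j\<in>S. msum B (Suc k) us (S - {j})) +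
   (\<Sum>l\<in>S. \<Sum>j\<in>S - {l}. B i l * msum B k us (S - {j} - {l}))"
  using "3.prems" by (subst sum_swap_distinct_pairs) (auto simp: sum.distrib)
 also have "(\<Sum>l\<in>S. \<Sum>j\<in>S - {l}. B i l * msum B k us (S - {j} - {l})) =
   (\<Sum>l\<in>S. B i l * (\<Sum>j\<in>S - {l}. msum B k us (S - {l} - {j})))"
  by (simp add: sum_distrib_left Diff_insert2[symmetric] insert_commute)
 also have "\<dots> = (\<Sum>l\<in>S. B i l * (of_nat (card S - Suc k) * msum B k us (S - {l})))"
 proof (rule sum.cong[OF refl])
  fix l assume l: "l \<in> S"
  then have "(\<Sum>j\<in>S - {l}. msum B k us (S - {l} - {j})) = of_nat (card S - Suc k) * msum B k us (S - {l})"
   using "3.IH"(2)[of l] "3.prems" by simp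
  then show "B i l * (\<Sum>j\<in>S - {l}. msum B k us (S - {l} - {j})) =
    B i l * (of_nat (card S - Suc k) * msum B k us (S - {l}))" by simp
 qed
 finally show ?case
  using 3 by (simp add: sum_distrib_left algebra_simps)
qed auto

text \<open>Expanding the factors 1 + B singles out a matching of k rows that carry B; the other
  rows can be placed in (card S - k)! / (card S - length us)! ways. Clearing the denominator keeps
  the identity valid over any commutative ring, in particular for power series.\<close>

lemma rper_one_plus:
 assumes "finite S" "length us \<le> card S"
 shows "fact (card S - length us) * rper (\<lambda>i j. 1 + B i j) us S =
      (\<Sum>k\<le>length us. fact (card S - k) * msum B k us S)"
 using assms
proof (induction us arbitrary: S)
 case Nil
 then show ?case by simp
next
 case (Cons i us)
 define s where "s = card S"
 have s: "length us < s" using Cons.prems by (simp add: s_def)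
 have IH: "fact (s - Suc (length us)) * rper (\<lambda>i j. 1 + B i j) us (S - {j}) =
   (\<Sum>k\<le>length us. fact (s - Suc k) * msum B k us (S - {j}))" if "j \<in> S" for j
  using Cons.IH[of "S - {j}"] that Cons.prems s unfolding s_def by (simp)
 have "fact (s - length (i # us)) * rper (\<lambda>i j. 1 + B i j) (i # us) S =
   (\<Sum>j\<in>S. (1 + B i j) * (\<Sum>k\<le>length us. fact (s - Suc k) * msum B k us (S - {j})))"
  using IH by (simp add: sum_distrib_left mult.left_commute)
 also have "\<dots> = (\<Sum>k\<le>length us. fact (s - Suc k) * (\<Sum>j\<in>S. msum B k us (S - {j}))) +
   (\<Sum>k\<le>length us. fact (s - Suc k) * (\<Sum>j\<in>S. B i j * msum B k us (S - {j})))"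
  unfolding sum_distrib_left distrib_right sum.distrib mult_1
  by (subst (1 3) sum.swap) (simp add: mult_ac)
 also have "(\<Sum>k\<le>length us. fact (s - Suc k) * (\<Sum>j\<in>S. msum B k us (S - {j}))) =
   (\<Sum>k\<le>length us. fact (s - k) * msum B k us S)"
 proof (rule sum.cong[OF refl])
  fix k assume "k \<in> {..length us}"
  then have k: "s - k = Suc (s - Suc k)" "k \<le> card S" using s by (auto simp: s_def)
  show "fact (s - Suc k) * (\<Sum>j\<in>S. msum B k us (S - {j})) = fact (s - k) * msum B k us S"
   using msum_sum_delete[OF Cons.prems(1) k(2), of B us] k(1)
   by (metis (no_types, lifting) fact_Suc mult.assoc mult.commute s_def)
 qed
 also have "\<dots> = (\<Sum>k\<le>length (i # us). fact (s - k) * msum B k us S)"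
  by (simp add: msum_eq_0)
 finally show ?case
  by (simp add: s_def[symmetric] sum.atMost_Suc_shift algebra_simps sum.distrib del: sum.atMost_Suc)
qed

text \<open>Each matching with k + 1 edges arises once from each of its edges. This is Euler's
  identity for the homogeneous polynomial \<open>msum\<close>.\<close>

lemma msum_Euler:
 assumes "finite S" "distinct us"
 shows "(\<Sum>i\<in>set us. \<Sum>j\<in>S. B i j * msum B k (remove1 i us) (S - {j})) = of_nat (Suc k) * msum B (Suc k) us S"
 using assms
proof (induction us arbitrary: S k)
 case Nil
 then show ?case by simp
next
 case (Cons i us)
 define D where "D = (\<Sum>j\<in>S. B i j * msum B k us (S - {j}))"
 have "(\<Sum>i'\<in>set (i # us). \<Sum>j\<in>S. B i' j * msum B k (remove1 i' (i # us)) (S - {j})) =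
   D + (\<Sum>i'\<in>set us. \<Sum>j\<in>S. B i' j * msum B k (i # remove1 i' us) (S - {j}))"
  unfolding D_def using Cons.prems by (auto intro!: sum.cong)
 also have "(\<Sum>i'\<in>set us. \<Sum>j\<in>S. B i' j * msum B k (i # remove1 i' us) (S - {j})) =
   of_nat (Suc k) * msum B (Suc k) us S + of_nat k * D"
 proof (cases k)
  case 0
  then show ?thesis using Cons.IH[of S 0] Cons.prems by simp
 next
  case (Suc k')
  have "(\<Sum>i'\<in>set us. \<Sum>j\<in>S. B i' j * msum B k (i # remove1 i' us) (S - {j})) =
    (\<Sum>i'\<in>set us. \<Sum>j\<in>S. B i' j * msum B k (remove1 i' us) (S - {j})) +
    (\<Sum>i'\<in>set us. \<Sum>j\<in>S. \<Sum>l\<in>S - {j}. B i' j * (B i l * msum B k' (remove1 i' us) (S - {j} - {l})))"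
   by (simp add: Suc distrib_left sum.distrib sum_distrib_left)
  also have "(\<Sum>i'\<in>set us. \<Sum>j\<in>S. \<Sum>l\<in>S - {j}. B i' j * (B i l * msum B k' (remove1 i' us) (S - {j} - {l}))) =
    (\<Sum>l\<in>S. B i l * (\<Sum>i'\<in>set us. \<Sum>j\<in>S - {l}. B i' j * msum B k' (remove1 i' us) (S - {l} - {j})))"
   using Cons.prems
   by (subst sum_swap_distinct_pairs)
     (auto simp: sum_distrib_left mult_ac Diff_insert2[symmetric] insert_commute sum.swap[of _ S "set us"])
  also have "\<dots> = of_nat k * D"
   using Cons.prems by (simp add: Cons.IH Suc D_def sum_distrib_left mult_ac)
  finally show ?thesis using Cons by simp
 qed
 finally show ?case by (simp add: D_def[symmetric] algebra_simps)
qed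

text \<open>Ordering the k edges of a matching, in k! ways, turns it into a pair of injective
  tuples. This is the form used both for the moments and by the program.\<close>

lemma fact_msum:
 assumes "finite S" "distinct us"
 shows "fact k * msum B k us S = (\<Sum>is\<in>dtup k (set us). \<Sum>js\<in>dtup k S. prod_list (map2 B is js))"
 using assms
proof (induction k arbitrary: us S)
 case 0
 then show ?case by simp
next
 case (Suc k)
 have "(\<Sum>is\<in>dtup (Suc k) (set us). \<Sum>js\<in>dtup (Suc k) S. prod_list (map2 B is js)) =
   (\<Sum>i\<in>set us. \<Sum>is\<in>dtup k (set us - {i}). \<Sum>j\<in>S. \<Sum>js\<in>dtup k (S - {j}). B i j * prod_list (map2 B is js))"
  using Suc.prems by (simp add: sum_dtup_Suc)
 also have "\<dots> = (\<Sum>i\<in>set us. \<Sum>j\<in>S. B i j * (\<Sum>is\<in>dtup k (set us - {i}). \<Sum>js\<in>dtup k (S - {j}). prod_list (map2 B is js)))"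
  by (simp add: sum_distrib_left sum.swap[of _ S])
 also have "\<dots> = (\<Sum>i\<in>set us. \<Sum>j\<in>S. B i j * (fact k * msum B k (remove1 i us) (S - {j})))"
  using Suc.prems by (intro sum.cong refl, subst Suc.IH) (auto simp: set_remove1_eq)
 also have "\<dots> = fact k * (\<Sum>i\<in>set us. \<Sum>j\<in>S. B i j * msum B k (remove1 i us) (S - {j}))"
  by (simp add: sum_distrib_left mult_ac)
 also have "\<dots> = fact (Suc k) * msum B (Suc k) us S"
  using Suc.prems by (simp add: msum_Euler algebra_simps)
 finally show ?case by simp
qed

lemma rper_dtup:
 assumes "finite S"
 shows "rper A us S = (\<Sum>js\<in>dtup (length us) S. prod_list (map2 A us js))"
 using assms by (induction us arbitrary: S) (auto simp: sum_dtup_Suc sum_distrib_left)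

lemma per_eq_rper: "per n A = rper A [0..<n] {..<n}"
proof -
 have "per n A = (\<Sum>js\<in>dtup n {..<n}. prod_list (map2 A [0..<n] js))"
  unfolding per_def
 proof (rule sum.reindex_bij_witness[of _ "\<lambda>js i. if i < n then js ! i else i" "\<lambda>\<sigma>. map \<sigma> [0..<n]"])
  fix \<sigma> assume \<sigma>: "\<sigma> \<in> {\<sigma>. \<sigma> permutes {..<n}}"
  show "(\<lambda>i. if i < n then map \<sigma> [0..<n] ! i else i) = \<sigma>"
   using \<sigma> by (auto simp: fun_eq_iff permutes_not_in)
  show "map \<sigma> [0..<n] \<in> dtup n {..<n}"
  proof -
   have "\<sigma> permutes {..<n}" using \<sigma> by simp
   then have "inj_on \<sigma> {..<n}" "\<sigma> ` {..<n} = {..<n}"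
    using permutes_inj_on permutes_image by blast+
   then show ?thesis
    by (simp add: dtup_def distinct_map atLeast0LessThan)
  qed
  show "prod_list (map2 A [0..<n] (map \<sigma> [0..<n])) = (\<Prod>i<n. A i (\<sigma> i))"
   by (simp add: prod.list_conv_set_nth atLeast0LessThan)
 next
  fix js assume js: "js \<in> dtup n {..<n}"
  have len: "length js = n" and sub: "set js \<subseteq> {..<n}" and dist: "distinct js"
   using js by (auto simp: dtup_def)
  show "map (\<lambda>i. if i < n then js ! i else i) [0..<n] = js"
   using len by (intro nth_equalityI) auto
  have inj: "inj_on (\<lambda>i. if i < n then js ! i else i) {..<n}"
   using dist len by (auto simp: inj_on_def nth_eq_iff_index_eq)
  have "(\<lambda>i. if i < n then js ! i else i) ` {..<n} \<subseteq> {..<n}"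
  proof (rule image_subsetI)
   fix i assume "i \<in> {..<n}"
   then show "(if i < n then js ! i else i) \<in> {..<n}"
    using subsetD[OF sub nth_mem[of i js]] len by simp
  qed
  then have "bij_betw (\<lambda>i. if i < n then js ! i else i) {..<n} {..<n}"
   using endo_inj_surj[OF finite_lessThan _ inj] inj unfolding bij_betw_def by blast
  then have "(\<lambda>i. if i < n then js ! i else i) permutes {..<n}"
   by (rule bij_imp_permutes) simp
  then show "(\<lambda>i. if i < n then js ! i else i) \<in> {\<sigma>. \<sigma> permutes {..<n}}"
   by simp
 qed
 then show ?thesis by (simp add: rper_dtup)
qed

text \<open>These are the coefficients of \<open>perm_poly\<close>. The value 0 beyond the degree
  lets the recursion for the logarithm run uniformly in k.\<close>

definition pcoeff :: "nat \<Rightarrow> (nat \<Rightarrow> nat \<Rightarrow> complex) \<Rightarrow> nat \<Rightarrow> complex" where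
 "pcoeff n A k = (if k \<le> n then fact (n - k) / (fact n * fact k) *
   (\<Sum>is\<in>dtup k {..<n}. \<Sum>js\<in>dtup k {..<n}. prod_list (map2 A is js)) else 0)"

lemma pcoeff_0 [simp]: "pcoeff n A 0 = 1"
 by (simp add: pcoeff_def)

lemma prod_list_map2_scale:
 "length is = length js \<Longrightarrow>
   prod_list (map2 (\<lambda>i j. (z::'a::comm_monoid_mult) * A i j) is js) = z ^ length is * prod_list (map2 A is js)"
 by (induction "is" js rule: list_induct2) (auto simp: mult_ac)

lemma perm_poly_eq_sum: "perm_poly n A z = (\<Sum>k\<le>n. pcoeff n A k * z ^ k)"
proof -
 have "perm_poly n A z = (\<Sum>k\<le>n. fact (n - k) * msum (\<lambda>i j. z * A i j) k [0..<n] {..<n}) / fact n"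
  using rper_one_plus[of "{..<n}" "[0..<n]" "\<lambda>i j. z * A i j"]
  by (simp add: perm_poly_def per_eq_rper)
 also have "\<dots> = (\<Sum>k\<le>n. pcoeff n A k * z ^ k)"
  unfolding sum_divide_distrib
 proof (rule sum.cong[OF refl])
  fix k assume k: "k \<in> {..n}"
  have "fact k * msum (\<lambda>i j. z * A i j) k [0..<n] {..<n} =
    (\<Sum>is\<in>dtup k {..<n}. \<Sum>js\<in>dtup k {..<n}. prod_list (map2 (\<lambda>i j. z * A i j) is js))"
   using fact_msum[of "{..<n}" "[0..<n]" k "\<lambda>i j. z * A i j"] by (simp add: atLeast0LessThan)
  also have "\<dots> = z ^ k * (\<Sum>is\<in>dtup k {..<n}. \<Sum>js\<in>dtup k {..<n}. prod_list (map2 A is js))"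
   unfolding sum_distrib_left by (intro sum.cong refl) (auto simp: dtup_def prod_list_map2_scale)
  finally show "fact (n - k) * msum (\<lambda>i j. z * A i j) k [0..<n] {..<n} / fact n = pcoeff n A k * z ^ k"
   using k by (simp add: pcoeff_def field_simps)
 qed
 finally show ?thesis .
qed

section \<open>Complex Gaussian vectors\<close>

lemma nn_integral_shear_snd:
 assumes N: "sigma_finite_measure N"
  and \<tau>: "case_prod \<tau> \<in> M \<Otimes>\<^sub>M N \<rightarrow>\<^sub>M N"
  and inv: "\<And>x. x \<in> space M \<Longrightarrow> distr N N (\<tau> x) = N"
  and f: "f \<in> borel_measurable (M \<Otimes>\<^sub>M N)"
 shows "(\<integral>\<^sup>+p. f (fst p, \<tau> (fst p) (snd p)) \<partial>(M \<Otimes>\<^sub>M N)) = (\<integral>\<^sup>+p. f p \<partial>(M \<Otimes>\<^sub>M N))"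
proof -
 interpret N: sigma_finite_measure N by fact
 note [measurable] = \<tau> f
 have \<tau>x: "\<tau> x \<in> N \<rightarrow>\<^sub>M N" if "x \<in> space M" for x
  using measurable_compose[OF measurable_Pair1'[OF that] \<tau>] by simp
 have fx: "(\<lambda>y. f (x, y)) \<in> borel_measurable N" if "x \<in> space M" for x
  using that by measurable
 have m: "(\<lambda>p. f (fst p, \<tau> (fst p) (snd p))) \<in> borel_measurable (M \<Otimes>\<^sub>M N)"
 proof (rule measurable_compose[OF _ f])
  have "(\<lambda>p. \<tau> (fst p) (snd p)) = case_prod \<tau>" by auto
  then show "(\<lambda>p. (fst p, \<tau> (fst p) (snd p))) \<in> M \<Otimes>\<^sub>M N \<rightarrow>\<^sub>M M \<Otimes>\<^sub>M N"
   using \<tau> by simp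
 qed
 have "(\<integral>\<^sup>+y. f (x, \<tau> x y) \<partial>N) = (\<integral>\<^sup>+y. f (x, y) \<partial>N)" if "x \<in> space M" for x
  by (subst (2) inv[OF that, symmetric]) (simp add: nn_integral_distr \<tau>x fx that)
 then have "(\<integral>\<^sup>+x. \<integral>\<^sup>+y. f (x, \<tau> x y) \<partial>N \<partial>M) = (\<integral>\<^sup>+x. \<integral>\<^sup>+y. f (x, y) \<partial>N \<partial>M)"
  by (rule nn_integral_cong)
 then show ?thesis
  using N.nn_integral_fst[OF m] N.nn_integral_fst[OF f] by simp
qed

lemma nn_integral_shear_fst:
 assumes M: "sigma_finite_measure M" and N: "sigma_finite_measure N"
  and \<tau>: "case_prod \<tau> \<in> N \<Otimes>\<^sub>M M \<rightarrow>\<^sub>M M"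
  and inv: "\<And>y. y \<in> space N \<Longrightarrow> distr M M (\<tau> y) = M"
  and f: "f \<in> borel_measurable (M \<Otimes>\<^sub>M N)"
 shows "(\<integral>\<^sup>+p. f (\<tau> (snd p) (fst p), snd p) \<partial>(M \<Otimes>\<^sub>M N)) = (\<integral>\<^sup>+p. f p \<partial>(M \<Otimes>\<^sub>M N))"
proof -
 interpret pair_sigma_finite N M
  using M N by (simp add: pair_sigma_finite_def)
 have swap: "(\<lambda>(x, y). (y, x)) \<in> N \<Otimes>\<^sub>M M \<rightarrow>\<^sub>M M \<Otimes>\<^sub>M N" "(\<lambda>(x, y). (y, x)) \<in> M \<Otimes>\<^sub>M N \<rightarrow>\<^sub>M N \<Otimes>\<^sub>M M"
  by measurable
 have D: "M \<Otimes>\<^sub>M N = distr (N \<Otimes>\<^sub>M M) (M \<Otimes>\<^sub>M N) (\<lambda>(x, y). (y, x))"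
  using M N pair_sigma_finite.distr_pair_swap[of M N] by (simp add: pair_sigma_finite_def)
 have g: "(\<lambda>p. f (snd p, fst p)) \<in> borel_measurable (N \<Otimes>\<^sub>M M)"
  using measurable_compose[OF swap(1) f] by (simp add: split_beta')
 have m: "(\<lambda>p. f (\<tau> (snd p) (fst p), snd p)) \<in> borel_measurable (M \<Otimes>\<^sub>M N)"
 proof (rule measurable_compose[OF _ f])
  have "(\<lambda>p. \<tau> (snd p) (fst p)) \<in> M \<Otimes>\<^sub>M N \<rightarrow>\<^sub>M M"
   using measurable_compose[OF swap(2) \<tau>] by (simp add: split_beta')
  then show "(\<lambda>p. (\<tau> (snd p) (fst p), snd p)) \<in> M \<Otimes>\<^sub>M N \<rightarrow>\<^sub>M M \<Otimes>\<^sub>M N"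
   by simp
 qed
 have "(\<integral>\<^sup>+p. f (\<tau> (snd p) (fst p), snd p) \<partial>(M \<Otimes>\<^sub>M N)) =
   (\<integral>\<^sup>+p. f (\<tau> (fst p) (snd p), fst p) \<partial>(N \<Otimes>\<^sub>M M))"
  using m swap(1) by (subst D) (simp add: nn_integral_distr split_beta')
 also have "\<dots> = (\<integral>\<^sup>+p. f (snd p, fst p) \<partial>(N \<Otimes>\<^sub>M M))"
  using nn_integral_shear_snd[OF M \<tau> inv g] by simp
 also have "\<dots> = (\<integral>\<^sup>+p. f p \<partial>(M \<Otimes>\<^sub>M N))"
  using f swap(1) by (subst D) (simp add: nn_integral_distr split_beta')
 finally show ?thesis .
qed

lemma distr_lborel_affine:
 fixes a :: "'a::euclidean_space"
 assumes "\<bar>c\<bar> = 1"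
 shows "distr lborel lborel (\<lambda>x. a + c *\<^sub>R x) = lborel"
proof -
 have "lborel = density (distr lborel borel (\<lambda>x. a + c *\<^sub>R x)) (\<lambda>_. 1)"
  using lborel_affine[of c a] assms by auto
 then show ?thesis
  by (metis density_1 distr_cong sets_lborel)
qed

lemma lborel_complex_eq: "(lborel :: complex measure) = distr (lborel \<Otimes>\<^sub>M lborel) borel (\<lambda>(x, y). Complex x y)"
proof (rule lborel_eqI)
 have meas: "(\<lambda>(x, y). Complex x y) \<in> borel_measurable (lborel \<Otimes>\<^sub>M lborel)"
  unfolding Complex_eq split_beta' by measurable
 fix l u :: complex assume le: "\<And>b. b \<in> Basis \<Longrightarrow> l \<bullet> b \<le> u \<bullet> b"
 have le': "Re l \<le> Re u" "Im l \<le> Im u"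
  using le[of 1] le[of \<i>] by (auto simp: Basis_complex_def)
 have "(\<lambda>(x, y). Complex x y) -` box l u \<inter> space (lborel \<Otimes>\<^sub>M lborel) =
   {Re l<..<Re u} \<times> {Im l<..<Im u}"
  by (auto simp: box_def Basis_complex_def space_pair_measure)
 then show "emeasure (distr (lborel \<Otimes>\<^sub>M lborel) borel (\<lambda>(x, y). Complex x y)) (box l u) =
   ennreal (\<Prod>b\<in>Basis. (u - l) \<bullet> b)"
  using le' meas
  by (simp add: emeasure_distr lborel.emeasure_pair_measure_Times Basis_complex_def ennreal_mult)
qed simp

lemma nn_integral_lborel_complex:
 assumes f: "f \<in> borel_measurable borel"
 shows "(\<integral>\<^sup>+w. f w \<partial>(lborel :: complex measure)) = (\<integral>\<^sup>+p. f (Complex (fst p) (snd p)) \<partial>(lborel \<Otimes>\<^sub>M lborel))"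
proof -
 have meas: "(\<lambda>(x, y). Complex x y) \<in> borel_measurable (lborel \<Otimes>\<^sub>M lborel)"
  unfolding Complex_eq split_beta' by measurable
 show ?thesis
  by (subst lborel_complex_eq, subst nn_integral_distr[OF meas]) (use f in \<open>simp_all add: split_beta'\<close>)
qed

text \<open>A rotation of the plane is a composition of three shears, each of which preserves
  Lebesgue measure by Fubini and translation invariance. The angles 0 and pi, where the shear
  parameter makes no sense, are treated apart.\<close>

lemma nn_integral_lborel_rotate:
 fixes c :: complex
 assumes c: "cmod c = 1" and f: "f \<in> borel_measurable borel"
 shows "(\<integral>\<^sup>+w. f (c * w) \<partial>lborel) = (\<integral>\<^sup>+w. f w \<partial>lborel)"
proof (cases "Im c = 0")
 case True
 then have "\<bar>Re c\<bar> = 1" using c by (simp add: cmod_def)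
 then have "(\<integral>\<^sup>+w. f w \<partial>lborel) = (\<integral>\<^sup>+w. f (0 + Re c *\<^sub>R w) \<partial>lborel)"
  by (subst distr_lborel_affine[of "Re c" 0, symmetric]) (simp_all add: nn_integral_distr f)
 also have "(\<lambda>w. f (0 + Re c *\<^sub>R w)) = (\<lambda>w. f (c * w))"
  using True by (auto simp: scaleR_conv_of_real complex_eq_iff intro!: arg_cong[of _ _ f])
 finally show ?thesis by simp
next
 case False
 define a b where "a = Re c" and "b = Im c"
 \<comment> \<open>With a = cos \<theta> and b = sin \<theta> this is the tangent of \<theta>/2, the
   parameter of the two outer shears; the middle shear has parameter b.\<close>
 define t where "t = (1 - a) / b"
 have b: "b \<noteq> 0" and ab: "a\<^sup>2 + b\<^sup>2 = 1"
  using False c by (auto simp: a_def b_def cmod_def)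
 define F where "F = (\<lambda>p::real \<times> real. f (Complex (fst p) (snd p)))"
 have meas: "(\<lambda>p. Complex (fst p) (snd p)) \<in> borel_measurable (lborel \<Otimes>\<^sub>M lborel)"
  unfolding Complex_eq split_beta' by measurable
 have F[measurable]: "F \<in> borel_measurable (lborel \<Otimes>\<^sub>M lborel)"
  unfolding F_def by (rule measurable_compose[OF meas f])
 have inv: "distr lborel lborel ((+) (s * x)) = lborel" for s x :: real
  using distr_lborel_affine[of 1 "s * x"] by simp
 have \<tau>: "(\<lambda>(x, y). s * x + y) \<in> lborel \<Otimes>\<^sub>M lborel \<rightarrow>\<^sub>M (lborel :: real measure)" for s :: real
  by measurable
 have shear1: "(\<integral>\<^sup>+p. g (s * snd p + fst p, snd p) \<partial>(lborel \<Otimes>\<^sub>M lborel)) = (\<integral>\<^sup>+p. g p \<partial>(lborel \<Otimes>\<^sub>M lborel))"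
  if "g \<in> borel_measurable (lborel \<Otimes>\<^sub>M lborel)" for g and s :: real
  using nn_integral_shear_fst[OF lborel.sigma_finite_measure_axioms lborel.sigma_finite_measure_axioms \<tau>[of s] inv that]
  by simp
 have shear2: "(\<integral>\<^sup>+p. g (fst p, s * fst p + snd p) \<partial>(lborel \<Otimes>\<^sub>M lborel)) = (\<integral>\<^sup>+p. g p \<partial>(lborel \<Otimes>\<^sub>M lborel))"
  if "g \<in> borel_measurable (lborel \<Otimes>\<^sub>M lborel)" for g and s :: real
  using nn_integral_shear_snd[OF lborel.sigma_finite_measure_axioms \<tau>[of s] inv that] by simp
 define F1 where "F1 = (\<lambda>p. F (- t * snd p + fst p, snd p))"
 define F2 where "F2 = (\<lambda>p. F1 (fst p, b * fst p + snd p))"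
 define F3 where "F3 = (\<lambda>p. F2 (- t * snd p + fst p, snd p))"
 have F1[measurable]: "F1 \<in> borel_measurable (lborel \<Otimes>\<^sub>M lborel)"
  unfolding F1_def by measurable
 have F2[measurable]: "F2 \<in> borel_measurable (lborel \<Otimes>\<^sub>M lborel)"
  unfolding F2_def by measurable
 have "(\<integral>\<^sup>+p. F3 p \<partial>(lborel \<Otimes>\<^sub>M lborel)) = (\<integral>\<^sup>+p. F2 p \<partial>(lborel \<Otimes>\<^sub>M lborel))"
  unfolding F3_def by (rule shear1[OF F2])
 moreover have "(\<integral>\<^sup>+p. F2 p \<partial>(lborel \<Otimes>\<^sub>M lborel)) = (\<integral>\<^sup>+p. F1 p \<partial>(lborel \<Otimes>\<^sub>M lborel))"
  unfolding F2_def by (rule shear2[OF F1])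
 moreover have "(\<integral>\<^sup>+p. F1 p \<partial>(lborel \<Otimes>\<^sub>M lborel)) = (\<integral>\<^sup>+p. F p \<partial>(lborel \<Otimes>\<^sub>M lborel))"
  unfolding F1_def by (rule shear1[OF F])
 moreover have "(\<integral>\<^sup>+w. f w \<partial>lborel) = (\<integral>\<^sup>+p. F p \<partial>(lborel \<Otimes>\<^sub>M lborel))"
  unfolding F_def by (rule nn_integral_lborel_complex[OF f])
 ultimately have "(\<integral>\<^sup>+w. f w \<partial>lborel) = (\<integral>\<^sup>+p. F3 p \<partial>(lborel \<Otimes>\<^sub>M lborel))"
  by simp
 also have "F3 = (\<lambda>p. f (c * Complex (fst p) (snd p)))"
 proof
  fix p :: "real \<times> real"
  obtain x y where p: "p = (x, y)" by (cases p)
  have 1: "b * (- t * y + x) + y = b * x + a * y"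
   using b by (simp add: t_def field_simps)
  have "- t * (b * x + a * y) + (- t * y + x) = (1 - t * b) * x - t * (1 + a) * y"
   by (simp add: algebra_simps)
  also have "1 - t * b = a" using b by (simp add: t_def)
  also have "t * (1 + a) = b"
   using b ab by (simp add: t_def field_simps power2_eq_square)
  finally have 2: "- t * (b * x + a * y) + (- t * y + x) = a * x - b * y" .
  show "F3 p = f (c * Complex (fst p) (snd p))"
   unfolding F3_def F2_def F1_def F_def p using 1 2
   by (auto simp: complex_eq_iff a_def b_def intro!: arg_cong[of _ _ f])
 qed
 also have "(\<integral>\<^sup>+p. f (c * Complex (fst p) (snd p)) \<partial>(lborel \<Otimes>\<^sub>M lborel)) = (\<integral>\<^sup>+w. f (c * w) \<partial>lborel)"
  by (rule nn_integral_lborel_complex[symmetric]) (use f in measurable)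
 finally show ?thesis by simp
qed

section \<open>The standard complex Gaussian and its moments\<close>

definition cgauss :: "complex measure" where
 "cgauss = density lborel (\<lambda>w. ennreal (exp (- (cmod w)\<^sup>2) / pi))"

lemma sets_cgauss [simp, measurable_cong]: "sets cgauss = sets borel"
 and space_cgauss [simp]: "space cgauss = UNIV"
 by (auto simp: cgauss_def)

lemma borel_measurable_cgauss [simp]: "borel_measurable cgauss = borel_measurable borel"
 by (rule measurable_cong_sets) simp_all

lemma nn_integral_cgauss:
 "f \<in> borel_measurable borel \<Longrightarrow>
   (\<integral>\<^sup>+w. f w \<partial>cgauss) = (\<integral>\<^sup>+w. ennreal (exp (- (cmod w)\<^sup>2) / pi) * f w \<partial>lborel)"
 unfolding cgauss_def by (subst nn_integral_density) auto

lemma nn_integral_cgauss_1: "(\<integral>\<^sup>+w. ennreal (exp (- (cmod w)\<^sup>2) / pi) \<partial>lborel) = 1"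
proof -
 let ?d = "normal_density 0 (1 / sqrt 2)"
 have eq: "exp (- (cmod (Complex x y))\<^sup>2) / pi = ?d x * ?d y" for x y
  by (simp add: normal_density_def cmod_power2 exp_add[symmetric] power_divide real_sqrt_mult[symmetric])
 have 1: "(\<integral>\<^sup>+x. ennreal (?d x) \<partial>lborel) = 1"
  using prob_space.emeasure_space_1[OF prob_space_normal_density[of "1 / sqrt 2" 0]]
  by (simp add: emeasure_density)
 have "(\<integral>\<^sup>+w. ennreal (exp (- (cmod w)\<^sup>2) / pi) \<partial>lborel) =
   (\<integral>\<^sup>+p. ennreal (?d (fst p)) * ennreal (?d (snd p)) \<partial>(lborel \<Otimes>\<^sub>M lborel))"
  by (subst nn_integral_lborel_complex) (auto simp: eq ennreal_mult)
 also have "\<dots> = 1"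
  by (subst lborel.nn_integral_fst[symmetric]) (auto simp: nn_integral_cmult 1)
 finally show ?thesis .
qed

lemma prob_space_cgauss: "prob_space cgauss"
 by (rule prob_spaceI) (simp add: cgauss_def emeasure_density nn_integral_cgauss_1)

lemma distr_cgauss_rotate:
 assumes "cmod c = 1"
 shows "distr cgauss cgauss ((*) c) = cgauss"
proof (rule measure_eqI)
 fix A assume "A \<in> sets (distr cgauss cgauss ((*) c))"
 then have A[measurable]: "A \<in> sets borel" by simp
 have "emeasure (distr cgauss cgauss ((*) c)) A = (\<integral>\<^sup>+w. indicator A w \<partial>distr cgauss cgauss ((*) c))"
  by simp
 also have "\<dots> = (\<integral>\<^sup>+w. indicator A (c * w) \<partial>cgauss)"
  by (rule nn_integral_distr) auto
 also have "\<dots> = (\<integral>\<^sup>+w. ennreal (exp (- (cmod (c * w))\<^sup>2) / pi) * indicator A (c * w) \<partial>lborel)"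
  using assms by (subst nn_integral_cgauss) (auto simp: norm_mult)
 also have "\<dots> = (\<integral>\<^sup>+w. ennreal (exp (- (cmod w)\<^sup>2) / pi) * indicator A w \<partial>lborel)"
  by (rule nn_integral_lborel_rotate[OF assms]) auto
 also have "\<dots> = (\<integral>\<^sup>+w. indicator A w \<partial>cgauss)"
  by (subst nn_integral_cgauss) auto
 also have "\<dots> = emeasure cgauss A" by simp
 finally show "emeasure (distr cgauss cgauss ((*) c)) A = emeasure cgauss A" .
qed simp

text \<open>Scaling by sqrt 2 restores the Gaussian density, and the Jacobian in two real dimensions
  is the value 2.\<close>

lemma cgauss_exp_half: "(\<integral>\<^sup>+w. ennreal (exp ((cmod w)\<^sup>2 / 2)) \<partial>cgauss) = 2"
proof -
 have "(\<integral>\<^sup>+w. ennreal (exp ((cmod w)\<^sup>2 / 2)) \<partial>cgauss) = (\<integral>\<^sup>+w. ennreal (exp (- (cmod w)\<^sup>2 / 2) / pi) \<partial>lborel)"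
  by (subst nn_integral_cgauss) (auto simp: ennreal_mult[symmetric] exp_add[symmetric] field_simps intro!: nn_integral_cong)
 also have "lborel = density (distr lborel borel (\<lambda>x::complex. 0 + sqrt 2 *\<^sub>R x)) (\<lambda>_. \<bar>sqrt 2\<bar> ^ DIM(complex))"
  by (rule lborel_affine) simp
 also have "(\<integral>\<^sup>+w. ennreal (exp (- (cmod w)\<^sup>2 / 2) / pi) \<partial>\<dots>) =
   2 * (\<integral>\<^sup>+w. ennreal (exp (- (cmod w)\<^sup>2) / pi) \<partial>lborel)"
  by (subst nn_integral_density)
    (auto simp: nn_integral_distr nn_integral_cmult power_mult_distrib)
 finally show ?thesis by (simp add: nn_integral_cgauss_1)
qed

text \<open>The exact value is m!. The factor 4^m is the price of comparing y^m / m! with exp y at y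
  = |w|^2 / 2, and affects constants only.\<close>

lemma cgauss_moment: "(\<integral>\<^sup>+w. ennreal (cmod w ^ (2 * m)) \<partial>cgauss) \<le> ennreal (4 ^ m * fact m)"
proof (cases "m = 0")
 case True
 then show ?thesis using prob_space.emeasure_space_1[OF prob_space_cgauss] by simp
next
 case False
 have le: "cmod w ^ (2 * m) \<le> 2 ^ m * fact m * exp ((cmod w)\<^sup>2 / 2)" for w
 proof -
  define y where "y = (cmod w)\<^sup>2 / 2"
  have y: "y \<ge> 0" by (simp add: y_def)
  have "(\<Sum>n\<in>{m}. y ^ n /\<^sub>R fact n) \<le> (\<Sum>n. y ^ n /\<^sub>R fact n)"
   using y by (intro sum_le_suminf[OF summable_exp_generic]) auto
  then have "inverse (fact m) * y ^ m \<le> exp y" by (simp add: exp_def)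
  then have "y ^ m \<le> fact m * exp y" by (simp add: divide_simps mult.commute flip: divide_inverse_commute)
  then have "2 ^ m * y ^ m \<le> 2 ^ m * (fact m * exp y)" by (intro mult_left_mono) auto
  moreover have "2 ^ m * y ^ m = cmod w ^ (2 * m)"
   unfolding y_def by (simp add: power_divide power_mult[symmetric])
  ultimately show ?thesis unfolding y_def[symmetric] by (simp only: mult.assoc)
 qed
 have "(\<integral>\<^sup>+w. ennreal (cmod w ^ (2 * m)) \<partial>cgauss) \<le>
   (\<integral>\<^sup>+w. ennreal (2 ^ m * fact m) * ennreal (exp ((cmod w)\<^sup>2 / 2)) \<partial>cgauss)"
  using le by (intro nn_integral_mono) (simp add: ennreal_mult[symmetric])
 also have "\<dots> = ennreal (2 ^ m * fact m) * 2"
  by (subst nn_integral_cmult) (auto simp: cgauss_exp_half)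
 also have "\<dots> = ennreal (2 * (2 ^ m * fact m))"
  by (metis ennreal_mult' ennreal_numeral mult.commute zero_le_numeral)
 also have "\<dots> \<le> ennreal (4 ^ m * fact m)"
 proof (rule ennreal_leI)
  have "2 * 2 ^ m \<le> (4 ^ m :: real)"
  proof -
   have "(2::real) ^ 1 \<le> 2 ^ m" using False by (intro power_increasing) auto
   then have "2 * 2 ^ m \<le> (2 ^ m * 2 ^ m :: real)" by simp
   then show ?thesis by (simp add: power_mult_distrib[symmetric])
  qed
  then have "2 * 2 ^ m * fact m \<le> (4 ^ m * fact m :: real)" by (intro mult_right_mono) auto
  then show "2 * (2 ^ m * fact m) \<le> (4 ^ m * fact m :: real)" by (simp only: mult.assoc)
 qed
 finally show ?thesis .
qed

section \<open>Vectors of independent complex Gaussians\<close>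

abbreviation gvec :: "'e set \<Rightarrow> ('e \<Rightarrow> complex) measure" where
 "gvec E \<equiv> PiM E (\<lambda>_. cgauss)"

lemma cgauss_product_sigma_finite: "product_sigma_finite (\<lambda>_. cgauss)"
 using prob_space_cgauss by (simp add: product_sigma_finite_def prob_space_imp_sigma_finite)

lemma prob_space_gvec: "prob_space (gvec E)"
 by (rule prob_space_PiM) (rule prob_space_cgauss)

lemma gvec_component: "e \<in> E \<Longrightarrow> (\<lambda>w. w e) \<in> borel_measurable (gvec E)"
 using measurable_component_singleton[of e E "\<lambda>_. cgauss"] by (simp add: measurable_def)

lemma integrable_cgauss_monomial: "integrable cgauss (\<lambda>w. w ^ a * cnj w ^ b)"
proof (rule integrableI_bounded)
 have le: "norm (w ^ a * cnj w ^ b) \<le> 1 + cmod w ^ (2 * (a + b))" for w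
 proof -
  have n: "norm (w ^ a * cnj w ^ b) = cmod w ^ (a + b)"
   by (simp add: norm_mult norm_power power_add)
  show ?thesis
  proof (cases "cmod w \<le> 1")
   case True
   then have "cmod w ^ (a + b) \<le> 1" by (intro power_le_one) auto
   then show ?thesis unfolding n by (rule order_trans) simp
  next
   case False
   then have "cmod w ^ (a + b) \<le> cmod w ^ (2 * (a + b))" by (intro power_increasing) auto
   then show ?thesis unfolding n by simp
  qed
 qed
 have "(\<integral>\<^sup>+w. ennreal (norm (w ^ a * cnj w ^ b)) \<partial>cgauss) \<le>
   (\<integral>\<^sup>+w. 1 + ennreal (cmod w ^ (2 * (a + b))) \<partial>cgauss)"
 proof (rule nn_integral_mono)
  fix w
  have "ennreal (norm (w ^ a * cnj w ^ b)) \<le> ennreal (1 + cmod w ^ (2 * (a + b)))"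
   by (rule ennreal_leI[OF le])
  also have "\<dots> = 1 + ennreal (cmod w ^ (2 * (a + b)))" by (subst ennreal_plus) auto
  finally show "ennreal (norm (w ^ a * cnj w ^ b)) \<le> 1 + ennreal (cmod w ^ (2 * (a + b)))" .
 qed
 also have "\<dots> = 1 + (\<integral>\<^sup>+w. ennreal (cmod w ^ (2 * (a + b))) \<partial>cgauss)"
  using prob_space.emeasure_space_1[OF prob_space_cgauss] by (subst nn_integral_add) simp_all
 also have "\<dots> \<le> 1 + ennreal (4 ^ (a + b) * fact (a + b))"
  by (intro add_mono cgauss_moment order_refl)
 also have "\<dots> < \<infinity>" by simp
 finally show "(\<integral>\<^sup>+w. ennreal (norm (w ^ a * cnj w ^ b)) \<partial>cgauss) < \<infinity>" .
 have "(\<lambda>w. w ^ a * cnj w ^ b) \<in> borel_measurable borel"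
  by (intro borel_measurable_continuous_onI continuous_intros)
 then show "(\<lambda>w. w ^ a * cnj w ^ b) \<in> borel_measurable cgauss" by simp
qed

text \<open>The rotation by the angle pi / (a - b) preserves the law but changes the sign of the
  monomial.\<close>

lemma cgauss_monomial_eq_0:
 assumes "a \<noteq> b"
 shows "(\<integral>w. w ^ a * cnj w ^ b \<partial>cgauss) = 0"
proof -
 define c where "c = cis (pi / (real a - real b))"
 have c: "cmod c = 1" by (simp add: c_def)
 have "c ^ a * cnj c ^ b = cis (real a * (pi / (real a - real b)) + real b * - (pi / (real a - real b)))"
  unfolding c_def cis_cnj Complex.DeMoivre cis_mult ..
 also have "real a * (pi / (real a - real b)) + real b * - (pi / (real a - real b)) =
   (real a - real b) * (pi / (real a - real b))"
  by (simp only: left_diff_distrib mult_minus_right add_uminus_conv_diff)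
 also have "\<dots> = pi" using assms by simp
 finally have cc: "c ^ a * cnj c ^ b = -1" by simp
 have "(\<lambda>w. w ^ a * cnj w ^ b) \<in> borel_measurable borel"
  by (intro borel_measurable_continuous_onI continuous_intros)
 then have "(\<integral>w. w ^ a * cnj w ^ b \<partial>distr cgauss cgauss ((*) c)) = (\<integral>w. (c * w) ^ a * cnj (c * w) ^ b \<partial>cgauss)"
  by (intro integral_distr) simp_all
 then have "(\<integral>w. w ^ a * cnj w ^ b \<partial>cgauss) = (\<integral>w. (c * w) ^ a * cnj (c * w) ^ b \<partial>cgauss)"
  unfolding distr_cgauss_rotate[OF c] .
 also have "\<dots> = (\<integral>w. - (w ^ a * cnj w ^ b) \<partial>cgauss)"
 proof (rule Bochner_Integration.integral_cong[OF refl])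
  fix w
  have "(c * w) ^ a * cnj (c * w) ^ b = (c ^ a * cnj c ^ b) * (w ^ a * cnj w ^ b)"
   unfolding complex_cnj_mult power_mult_distrib by (simp only: mult_ac)
  then show "(c * w) ^ a * cnj (c * w) ^ b = - (w ^ a * cnj w ^ b)" unfolding cc by simp
 qed
 finally show ?thesis by simp
qed

lemma prod_list_eq_prod_count:
 assumes "finite E" "set xs \<subseteq> E"
 shows "prod_list (map f xs) = (\<Prod>e\<in>E. f e ^ count_list xs e)"
 using assms(2)
proof (induction xs)
 case (Cons x xs)
 have "(\<Prod>e\<in>E. f e ^ count_list (x # xs) e) = (\<Prod>e\<in>E. (if e = x then f x else 1) * f e ^ count_list xs e)"
  by (intro prod.cong) auto
 also have "\<dots> = f x * (\<Prod>e\<in>E. f e ^ count_list xs e)"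
  using Cons.prems assms(1) by (simp add: prod.distrib)
 finally show ?case using Cons by simp
qed simp

lemma card_same_mset:
 assumes "finite E" "xs \<in> tup k E"
 shows "real (card {ys \<in> tup k E. mset ys = mset xs}) * (\<Prod>e\<in>E. fact (count_list xs e)) = fact k"
proof -
 have "{ys \<in> tup k E. mset ys = mset xs} = permutations_of_multiset (mset xs)"
  using assms by (auto simp: tup_def permutations_of_multiset_def dest: mset_eq_setD mset_eq_length)
 moreover have "(\<Prod>e\<in>E. fact (count_list xs e)) = (\<Prod>e\<in>set_mset (mset xs). fact (count (mset xs) e) :: nat)"
  using assms by (intro prod.mono_neutral_cong_right)
   (auto simp: tup_def count_mset count_list_0_iff)
 moreover have "size (mset xs) = k" using assms by (simp add: tup_def)
 ultimately have "card {ys \<in> tup k E. mset ys = mset xs} * (\<Prod>e\<in>E. fact (count_list xs e)) = (fact k :: nat)"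
  using card_permutations_of_multiset_aux[of "mset xs"] by simp
 then have "real (card {ys \<in> tup k E. mset ys = mset xs} * (\<Prod>e\<in>E. fact (count_list xs e))) = real (fact k)"
  by (simp only:)
 then show ?thesis by simp
qed

text \<open>Two monomials are orthogonal unless they have the same multiset of factors. The entries
  of the Gram matrix are thus dominated by a symmetric kernel \<open>K\<close> whose rows sum to 4^k
  k!, and the Schur test, through a b <= (a^2 + b^2) / 2, gives the bound.\<close>

lemma gvec_tensor_moment:
 fixes t :: "'e list \<Rightarrow> complex"
 assumes E: "finite E"
 shows "(\<integral>\<^sup>+w. ennreal ((cmod (\<Sum>xs\<in>tup k E. t xs * prod_list (map w xs)))\<^sup>2) \<partial>gvec E)
     \<le> ennreal (4 ^ k * fact k * (\<Sum>xs\<in>tup k E. (cmod (t xs))\<^sup>2))"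
proof -
 interpret product_sigma_finite "\<lambda>_. cgauss" by (rule cgauss_product_sigma_finite)
 define m where "m xs ys w = prod_list (map w xs) * cnj (prod_list (map w ys))" for xs ys and w :: "'e \<Rightarrow> complex"
 have m: "m xs ys w = (\<Prod>e\<in>E. w e ^ count_list xs e * cnj (w e) ^ count_list ys e)"
  if "xs \<in> tup k E" "ys \<in> tup k E" for xs ys w
  using that E by (simp add: m_def prod_list_eq_prod_count[of E] tup_def prod.distrib)
 have int: "integrable (gvec E) (m xs ys)" if "xs \<in> tup k E" "ys \<in> tup k E" for xs ys
  unfolding m[OF that]
  using product_integrable_prod[OF E, of "\<lambda>e w. w ^ count_list xs e * cnj w ^ count_list ys e"]
   integrable_cgauss_monomial by blast
 have val: "(\<integral>w. m xs ys w \<partial>gvec E) = (\<Prod>e\<in>E. \<integral>w. w ^ count_list xs e * cnj w ^ count_list ys e \<partial>cgauss)"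
  if "xs \<in> tup k E" "ys \<in> tup k E" for xs ys
  unfolding m[OF that]
  using product_integral_prod[OF E, of "\<lambda>e w. w ^ count_list xs e * cnj w ^ count_list ys e"]
   integrable_cgauss_monomial by blast
 have val0: "(\<integral>w. m xs ys w \<partial>gvec E) = 0"
  if xs: "xs \<in> tup k E" and ys: "ys \<in> tup k E" and ne: "mset xs \<noteq> mset ys" for xs ys
 proof -
  obtain e where e: "count_list xs e \<noteq> count_list ys e"
   using ne by (metis count_mset multiset_eqI)
  then have "e \<in> set xs \<or> e \<in> set ys" by (metis count_notin)
  then have "e \<in> E" using xs ys by (auto simp: tup_def)
  then show ?thesis
   unfolding val[OF xs ys] using E e cgauss_monomial_eq_0[OF e] by (intro prod_zero) auto
 qed
 have val1: "cmod (\<integral>w. m xs ys w \<partial>gvec E) \<le> 4 ^ k * (\<Prod>e\<in>E. fact (count_list xs e))"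
  if xs: "xs \<in> tup k E" and ys: "ys \<in> tup k E" and eq: "mset xs = mset ys" for xs ys
 proof -
  have ceq: "count_list ys e = count_list xs e" for e using eq by (metis count_mset)
  have "cmod (\<integral>w. w ^ a * cnj w ^ a \<partial>cgauss) \<le> 4 ^ a * fact a" for a
  proof -
   have "cmod (\<integral>w. w ^ a * cnj w ^ a \<partial>cgauss) \<le> (\<integral>w. cmod (w ^ a * cnj w ^ a) \<partial>cgauss)"
    by (rule integral_norm_bound)
   also have "\<dots> = enn2real (\<integral>\<^sup>+w. ennreal (cmod w ^ (2 * a)) \<partial>cgauss)"
    by (subst integral_eq_nn_integral)
      (auto simp: norm_mult norm_power power_add[symmetric] mult_2 intro!: borel_measurable_norm
       borel_measurable_integrable integrable_cgauss_monomial)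
   also have "\<dots> \<le> enn2real (ennreal (4 ^ a * fact a))"
    by (intro enn2real_mono cgauss_moment) simp
   finally show ?thesis by simp
  qed
  then have "cmod (\<integral>w. m xs ys w \<partial>gvec E) \<le> (\<Prod>e\<in>E. 4 ^ count_list xs e * fact (count_list xs e))"
   unfolding val[OF xs ys] ceq prod_norm[symmetric] by (intro prod_mono) auto
  also have "\<dots> = 4 ^ (\<Sum>e\<in>E. count_list xs e) * (\<Prod>e\<in>E. fact (count_list xs e))"
   by (simp add: prod.distrib power_sum)
  also have "(\<Sum>e\<in>E. count_list xs e) = k"
   using sum_count_set[of xs E] xs E by (simp add: tup_def)
  finally show ?thesis .
 qed
 define Q where "Q w = (\<Sum>xs\<in>tup k E. t xs * prod_list (map w xs))" for w
 have QQ: "complex_of_real ((cmod (Q w))\<^sup>2) = (\<Sum>xs\<in>tup k E. \<Sum>ys\<in>tup k E. t xs * cnj (t ys) * m xs ys w)" for w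
  unfolding complex_norm_square Q_def cnj_sum sum_product complex_cnj_mult m_def by (simp add: mult_ac)
 have intQ: "integrable (gvec E) (\<lambda>w. complex_of_real ((cmod (Q w))\<^sup>2))"
  unfolding QQ by (intro Bochner_Integration.integrable_sum integrable_mult_right int)
 then have intQ': "integrable (gvec E) (\<lambda>w. (cmod (Q w))\<^sup>2)"
  using integrable_Re[OF intQ] by simp
 have "(\<integral>\<^sup>+w. ennreal ((cmod (Q w))\<^sup>2) \<partial>gvec E) = ennreal (\<integral>w. (cmod (Q w))\<^sup>2 \<partial>gvec E)"
  by (rule nn_integral_eq_integral[OF intQ']) simp
 also have "(\<integral>w. (cmod (Q w))\<^sup>2 \<partial>gvec E) \<le> 4 ^ k * fact k * (\<Sum>xs\<in>tup k E. (cmod (t xs))\<^sup>2)"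
 proof -
  define K where "K xs ys = (if mset xs = mset ys then 4 ^ k * (\<Prod>e\<in>E. fact (count_list xs e)) else 0 :: real)" for xs ys
  have Ksym: "K xs ys = K ys xs" for xs ys
   unfolding K_def by (auto simp: count_mset[symmetric])
  have Knn: "K xs ys \<ge> 0" for xs ys by (auto simp: K_def intro!: mult_nonneg_nonneg prod_nonneg)
  \<comment> \<open>The number of rearrangements of a tuple is a multinomial coefficient, whose
    denominator cancels the factorials in the moment bound.\<close>
  have Ksum: "(\<Sum>ys\<in>tup k E. K xs ys) = 4 ^ k * fact k" if "xs \<in> tup k E" for xs
  proof -
   have "(\<Sum>ys\<in>tup k E. K xs ys) = (\<Sum>ys\<in>{ys \<in> tup k E. mset ys = mset xs}. 4 ^ k * (\<Prod>e\<in>E. fact (count_list xs e)))"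
    using E by (intro sum.mono_neutral_cong_right) (auto simp: K_def)
   also have "\<dots> = 4 ^ k * fact k"
    using card_same_mset[OF E that] by (simp add: mult_ac)
   finally show ?thesis .
  qed
  have bnd: "cmod (\<integral>w. m xs ys w \<partial>gvec E) \<le> K xs ys" if "xs \<in> tup k E" "ys \<in> tup k E" for xs ys
   using val0[OF that] val1[OF that] by (auto simp: K_def)
  have "complex_of_real (\<integral>w. (cmod (Q w))\<^sup>2 \<partial>gvec E) = (\<integral>w. complex_of_real ((cmod (Q w))\<^sup>2) \<partial>gvec E)"
   by (rule integral_complex_of_real[symmetric])
  also have "\<dots> = (\<Sum>xs\<in>tup k E. \<Sum>ys\<in>tup k E. t xs * cnj (t ys) * (\<integral>w. m xs ys w \<partial>gvec E))"
   unfolding QQ using int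
   by (simp add: Bochner_Integration.integral_sum Bochner_Integration.integrable_sum)
  finally have "(\<integral>w. (cmod (Q w))\<^sup>2 \<partial>gvec E) =
    Re (\<Sum>xs\<in>tup k E. \<Sum>ys\<in>tup k E. t xs * cnj (t ys) * (\<integral>w. m xs ys w \<partial>gvec E))"
   by (metis Re_complex_of_real)
  also have "\<dots> \<le> cmod (\<Sum>xs\<in>tup k E. \<Sum>ys\<in>tup k E. t xs * cnj (t ys) * (\<integral>w. m xs ys w \<partial>gvec E))"
   by (rule complex_Re_le_cmod)
  also have "\<dots> \<le> (\<Sum>xs\<in>tup k E. \<Sum>ys\<in>tup k E. ((cmod (t xs))\<^sup>2 + (cmod (t ys))\<^sup>2) / 2 * K xs ys)"
  proof (intro sum_norm_le)
   fix xs ys assume *: "xs \<in> tup k E" "ys \<in> tup k E"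
   have "cmod (t xs) * cmod (t ys) \<le> ((cmod (t xs))\<^sup>2 + (cmod (t ys))\<^sup>2) / 2"
    using sum_squares_bound[of "cmod (t xs)" "cmod (t ys)"] by simp
   then show "norm (t xs * cnj (t ys) * (\<integral>w. m xs ys w \<partial>gvec E)) \<le> ((cmod (t xs))\<^sup>2 + (cmod (t ys))\<^sup>2) / 2 * K xs ys"
    unfolding norm_mult complex_mod_cnj by (intro mult_mono bnd *) auto
  qed
  also have "\<dots> = (\<Sum>xs\<in>tup k E. (cmod (t xs))\<^sup>2 / 2 * (\<Sum>ys\<in>tup k E. K xs ys)) +
    (\<Sum>ys\<in>tup k E. (cmod (t ys))\<^sup>2 / 2 * (\<Sum>xs\<in>tup k E. K ys xs))"
   unfolding add_divide_distrib distrib_right sum.distrib sum_distrib_left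
   by (subst (4) sum.swap) (simp add: Ksym)
  also have "\<dots> = 4 ^ k * fact k * (\<Sum>xs\<in>tup k E. (cmod (t xs))\<^sup>2)"
   by (simp add: Ksum sum_distrib_left sum_distrib_right[symmetric] sum.distrib[symmetric] mult_ac)
  finally show ?thesis .
 qed
 finally show ?thesis unfolding Q_def by (simp add: ennreal_leI)
qed

section \<open>Moments\<close>

lemma power_sum_le:
 fixes x :: "'i \<Rightarrow> real"
 assumes "finite T" "\<And>i. i \<in> T \<Longrightarrow> x i \<ge> 0" "q \<ge> 1"
 shows "(\<Sum>i\<in>T. x i) ^ q \<le> real (card T) ^ (q - 1) * (\<Sum>i\<in>T. x i ^ q)"
proof (cases "T = {}")
 case True
 then show ?thesis using assms by (cases q) auto
next
 case False
 define c where "c = real (card T)"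
 have c: "c > 0" using False assms by (simp add: c_def card_gt_0_iff)
 have conv: "convex_on {0::real..} (\<lambda>x. x ^ q)"
 proof (cases "even q")
  case True
  then show ?thesis using convex_on_subset[OF convex_power_even[OF True]] by simp
 qed (simp add: convex_power_odd)
 have "(\<Sum>i\<in>T. (1 / c) *\<^sub>R x i) ^ q \<le> (\<Sum>i\<in>T. (1 / c) * x i ^ q)"
  using assms False c by (intro convex_on_sum[OF _ _ conv]) (auto simp: c_def)
 then have "(\<Sum>i\<in>T. x i) ^ q / c ^ q \<le> (\<Sum>i\<in>T. x i ^ q) / c"
  by (simp add: sum_divide_distrib[symmetric] power_divide)
 then have "(\<Sum>i\<in>T. x i) ^ q \<le> c ^ q * ((\<Sum>i\<in>T. x i ^ q) / c)"
  using c by (simp add: field_simps)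
 also have "c ^ q = c * c ^ (q - 1)" using assms(3) by (cases q) auto
 finally show ?thesis using c by (simp add: c_def)
qed

text \<open>X has size s^(-r/2) in every L^(2p). The constants do not involve s, which later gives
  uniformity in n. All even moments are tracked since the product rule \<open>mom_mult\<close> uses
  index 2 p of the factors to bound index p.\<close>

definition mom :: "'w measure \<Rightarrow> real \<Rightarrow> nat \<Rightarrow> (nat \<Rightarrow> real) \<Rightarrow> ('w \<Rightarrow> complex) \<Rightarrow> bool" where
 "mom G s r C X \<longleftrightarrow> X \<in> borel_measurable G \<and>
   (\<forall>p\<ge>1. 0 \<le> C p \<and> (\<integral>\<^sup>+w. ennreal (cmod (X w) ^ (2 * p)) \<partial>G) \<le> ennreal (C p / s ^ (r * p)))"

lemma momI:
 assumes "X \<in> borel_measurable G"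
  and "\<And>p. p \<ge> 1 \<Longrightarrow> 0 \<le> C p"
  and "\<And>p. p \<ge> 1 \<Longrightarrow> (\<integral>\<^sup>+w. ennreal (cmod (X w) ^ (2 * p)) \<partial>G) \<le> ennreal (C p / s ^ (r * p))"
 shows "mom G s r C X"
 using assms by (simp add: mom_def)

lemma mom_measurable: "mom G s r C X \<Longrightarrow> X \<in> borel_measurable G"
 and mom_nonneg: "mom G s r C X \<Longrightarrow> p \<ge> 1 \<Longrightarrow> 0 \<le> C p"
 and mom_bound: "mom G s r C X \<Longrightarrow> p \<ge> 1 \<Longrightarrow>
  (\<integral>\<^sup>+w. ennreal (cmod (X w) ^ (2 * p)) \<partial>G) \<le> ennreal (C p / s ^ (r * p))"
 by (auto simp: mom_def)

lemma mom_uminus: "mom G s r C X \<Longrightarrow> mom G s r C (\<lambda>w. - X w)"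
 by (auto simp: mom_def)

lemma mom_cmult:
 assumes "mom G s r C X"
 shows "mom G s r (\<lambda>p. cmod c ^ (2 * p) * C p) (\<lambda>w. c * X w)"
proof (rule momI)
 have [measurable]: "X \<in> borel_measurable G" using assms by (rule mom_measurable)
 show "(\<lambda>w. c * X w) \<in> borel_measurable G" by measurable
 fix p :: nat assume p: "p \<ge> 1"
 show "0 \<le> cmod c ^ (2 * p) * C p" using mom_nonneg[OF assms p] by simp
 have "(\<integral>\<^sup>+w. ennreal (cmod (c * X w) ^ (2 * p)) \<partial>G) =
   ennreal (cmod c ^ (2 * p)) * (\<integral>\<^sup>+w. ennreal (cmod (X w) ^ (2 * p)) \<partial>G)"
  by (subst nn_integral_cmult[symmetric]) (auto simp: norm_mult power_mult_distrib ennreal_mult)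
 also have "\<dots> \<le> ennreal (cmod c ^ (2 * p)) * ennreal (C p / s ^ (r * p))"
  using mom_bound[OF assms p] by (intro mult_left_mono) auto
 also have "\<dots> = ennreal (cmod c ^ (2 * p) * C p / s ^ (r * p))"
  by (subst ennreal_mult'[symmetric]) auto
 finally show "(\<integral>\<^sup>+w. ennreal (cmod (c * X w) ^ (2 * p)) \<partial>G) \<le> ennreal (cmod c ^ (2 * p) * C p / s ^ (r * p))" .
qed

lemma mom_sum:
 assumes "finite R" and X: "\<And>q. q \<in> R \<Longrightarrow> mom G s r (C q) (X q)" and s: "s > 0"
 shows "mom G s r (\<lambda>p. real (card R) ^ (2 * p - 1) * (\<Sum>q\<in>R. C q p)) (\<lambda>w. \<Sum>q\<in>R. X q w)"
proof (rule momI)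
 have meas: "X q \<in> borel_measurable G" if "q \<in> R" for q using X[OF that] by (rule mom_measurable)
 then show "(\<lambda>w. \<Sum>q\<in>R. X q w) \<in> borel_measurable G" by (rule borel_measurable_sum)
 fix p :: nat assume p: "p \<ge> 1"
 have nn: "C q p \<ge> 0" if "q \<in> R" for q using mom_nonneg[OF X[OF that] p] .
 then show "0 \<le> real (card R) ^ (2 * p - 1) * (\<Sum>q\<in>R. C q p)"
  by (intro mult_nonneg_nonneg sum_nonneg) auto
 have le: "cmod (\<Sum>q\<in>R. X q w) ^ (2 * p) \<le> real (card R) ^ (2 * p - 1) * (\<Sum>q\<in>R. cmod (X q w) ^ (2 * p))" for w
 proof -
  have "cmod (\<Sum>q\<in>R. X q w) ^ (2 * p) \<le> (\<Sum>q\<in>R. cmod (X q w)) ^ (2 * p)"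
   by (intro power_mono norm_sum) auto
  also have "\<dots> \<le> real (card R) ^ (2 * p - 1) * (\<Sum>q\<in>R. cmod (X q w) ^ (2 * p))"
   using assms(1) p by (intro power_sum_le) auto
  finally show ?thesis .
 qed
 have "(\<integral>\<^sup>+w. ennreal (cmod (\<Sum>q\<in>R. X q w) ^ (2 * p)) \<partial>G) \<le>
   (\<integral>\<^sup>+w. ennreal (real (card R) ^ (2 * p - 1)) * (\<Sum>q\<in>R. ennreal (cmod (X q w) ^ (2 * p))) \<partial>G)"
  using le by (intro nn_integral_mono) (simp add: sum_ennreal ennreal_mult[symmetric] sum_nonneg ennreal_leI)
 also have "\<dots> = ennreal (real (card R) ^ (2 * p - 1)) * (\<Sum>q\<in>R. \<integral>\<^sup>+w. ennreal (cmod (X q w) ^ (2 * p)) \<partial>G)"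
  using meas by (subst nn_integral_cmult, simp) (subst nn_integral_sum, auto)
 also have "\<dots> \<le> ennreal (real (card R) ^ (2 * p - 1)) * (\<Sum>q\<in>R. ennreal (C q p / s ^ (r * p)))"
  using p by (intro mult_left_mono sum_mono mom_bound[OF X]) auto
 also have "\<dots> = ennreal (real (card R) ^ (2 * p - 1) * (\<Sum>q\<in>R. C q p) / s ^ (r * p))"
  using nn s by (subst sum_ennreal) (auto simp: ennreal_mult[symmetric] sum_nonneg sum_divide_distrib[symmetric])
 finally show "(\<integral>\<^sup>+w. ennreal (cmod (\<Sum>q\<in>R. X q w) ^ (2 * p)) \<partial>G) \<le>
   ennreal (real (card R) ^ (2 * p - 1) * (\<Sum>q\<in>R. C q p) / s ^ (r * p))" .
qed

lemma mom_add:
 assumes X: "mom G s r C X" and Y: "mom G s r D Y" and s: "s > 0"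
 shows "mom G s r (\<lambda>p. 2 ^ (2 * p - 1) * (C p + D p)) (\<lambda>w. X w + Y w)"
 using mom_sum[of "{False, True}" G s r "\<lambda>b. if b then D else C" "\<lambda>b. if b then Y else X"] assms
 by (simp add: add.commute)

text \<open>The inequality 2 x y <= x^2 + y^2, after rescaling the factors by s^(r p) and s^(q p) so
  that both terms on the right get the same order in s.\<close>

lemma mom_mult:
 assumes X: "mom G s r C X" and Y: "mom G s q D Y" and s: "s > 0"
 shows "mom G s (r + q) (\<lambda>p. (C (2 * p) + D (2 * p)) / 2) (\<lambda>w. X w * Y w)"
proof (rule momI)
 have [measurable]: "X \<in> borel_measurable G" "Y \<in> borel_measurable G"
  using X Y by (auto intro: mom_measurable)
 show "(\<lambda>w. X w * Y w) \<in> borel_measurable G" by measurable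
 fix p :: nat assume p: "p \<ge> 1"
 then have p2: "2 * p \<ge> 1" by simp
 note nn = mom_nonneg[OF X p2] mom_nonneg[OF Y p2]
 show "0 \<le> (C (2 * p) + D (2 * p)) / 2" using nn by simp
 define a b where "a = s ^ (r * p)" and "b = s ^ (q * p)"
 have ab: "a > 0" "b > 0" using s by (auto simp: a_def b_def)
 have le: "cmod (X w * Y w) ^ (2 * p) \<le>
   a / (2 * b) * cmod (X w) ^ (2 * (2 * p)) + b / (2 * a) * cmod (Y w) ^ (2 * (2 * p))" for w
 proof -
  define x y where "x = cmod (X w) ^ (2 * p)" and "y = cmod (Y w) ^ (2 * p)"
  have "2 * (a * x) * (b * y) \<le> (a * x)\<^sup>2 + (b * y)\<^sup>2" by (rule sum_squares_bound)
  then have "x * y \<le> ((a * x)\<^sup>2 + (b * y)\<^sup>2) / (2 * a * b)"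
   using ab by (simp add: pos_le_divide_eq mult_ac)
  also have "\<dots> = a / (2 * b) * x\<^sup>2 + b / (2 * a) * y\<^sup>2"
   using ab by (simp add: field_simps power2_eq_square)
  finally show ?thesis
   unfolding x_def y_def power_mult[symmetric] by (simp add: norm_mult power_mult_distrib mult.commute mult.left_commute)
 qed
 have "(\<integral>\<^sup>+w. ennreal (cmod (X w * Y w) ^ (2 * p)) \<partial>G) \<le>
   (\<integral>\<^sup>+w. ennreal (a / (2 * b)) * ennreal (cmod (X w) ^ (2 * (2 * p))) +
    ennreal (b / (2 * a)) * ennreal (cmod (Y w) ^ (2 * (2 * p))) \<partial>G)"
  using le ab by (intro nn_integral_mono)
   (simp add: ennreal_mult[symmetric] ennreal_plus[symmetric] ennreal_leI del: ennreal_plus)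
 also have "\<dots> = ennreal (a / (2 * b)) * (\<integral>\<^sup>+w. ennreal (cmod (X w) ^ (2 * (2 * p))) \<partial>G) +
   ennreal (b / (2 * a)) * (\<integral>\<^sup>+w. ennreal (cmod (Y w) ^ (2 * (2 * p))) \<partial>G)"
  by (subst nn_integral_add) (simp_all add: nn_integral_cmult)
 also have "\<dots> \<le> ennreal (a / (2 * b)) * ennreal (C (2 * p) / s ^ (r * (2 * p))) +
   ennreal (b / (2 * a)) * ennreal (D (2 * p) / s ^ (q * (2 * p)))"
  by (intro add_mono mult_left_mono mom_bound[OF X p2] mom_bound[OF Y p2]) auto
 also have "s ^ (r * (2 * p)) = a\<^sup>2" unfolding a_def power_mult[symmetric] by (simp add: mult_ac)
 also have "s ^ (q * (2 * p)) = b\<^sup>2" unfolding b_def power_mult[symmetric] by (simp add: mult_ac)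
 also have "ennreal (a / (2 * b)) * ennreal (C (2 * p) / a\<^sup>2) + ennreal (b / (2 * a)) * ennreal (D (2 * p) / b\<^sup>2) =
   ennreal (a / (2 * b) * (C (2 * p) / a\<^sup>2) + b / (2 * a) * (D (2 * p) / b\<^sup>2))"
  using nn ab by (subst ennreal_plus) (auto simp: ennreal_mult[symmetric])
 also have "a / (2 * b) * (C (2 * p) / a\<^sup>2) + b / (2 * a) * (D (2 * p) / b\<^sup>2) = (C (2 * p) + D (2 * p)) / 2 / (a * b)"
  using ab by (simp add: field_simps power2_eq_square)
 also have "a * b = s ^ ((r + q) * p)"
  by (simp add: a_def b_def power_add[symmetric] add_mult_distrib)
 finally show "(\<integral>\<^sup>+w. ennreal (cmod (X w * Y w) ^ (2 * p)) \<partial>G) \<le>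
   ennreal ((C (2 * p) + D (2 * p)) / 2 / s ^ ((r + q) * p))" .
qed

lemma mom_const_1: "prob_space G \<Longrightarrow> mom G s 0 (\<lambda>_. 1) (\<lambda>_. 1)"
 by (auto simp: mom_def prob_space.emeasure_space_1)

text \<open>Transfers estimates from \<open>card S - 1\<close> columns back to \<open>card S\<close>
  columns at the cost of a constant.\<close>

lemma mom_rescale:
 assumes X: "mom G s r C X" and s: "s > 0" "s' \<le> 2 * s" "s' > 0"
 shows "mom G s' r (\<lambda>p. 2 ^ (r * p) * C p) X"
proof (rule momI[OF mom_measurable[OF X]])
 fix p :: nat assume p: "p \<ge> 1"
 note nn = mom_nonneg[OF X p]
 show "0 \<le> 2 ^ (r * p) * C p" using nn by simp
 have "s' ^ (r * p) \<le> 2 ^ (r * p) * s ^ (r * p)"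
  using power_mono[OF s(2), of "r * p"] s by (simp add: power_mult_distrib)
 then have "C p * s' ^ (r * p) \<le> C p * (2 ^ (r * p) * s ^ (r * p))" using nn by (rule mult_left_mono)
 then have "C p / s ^ (r * p) \<le> 2 ^ (r * p) * C p / s' ^ (r * p)"
  using s by (simp add: divide_simps mult_ac)
 then show "(\<integral>\<^sup>+w. ennreal (cmod (X w) ^ (2 * p)) \<partial>G) \<le> ennreal (2 ^ (r * p) * C p / s' ^ (r * p))"
  using mom_bound[OF X p] by (meson ennreal_leI order_trans)
qed

text \<open>Convexity: at most s terms divided by s are no larger than a single term, however they
  depend on each other. There is no gain in the order r either, in contrast to
  \<open>mom_linear\<close>.\<close>

lemma mom_average:
 assumes "finite T" and X: "\<And>q. q \<in> T \<Longrightarrow> mom G s r C (X q)" and s: "real (card T) \<le> s" "s > 0"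
  and C: "\<And>p. p \<ge> 1 \<Longrightarrow> C p \<ge> 0"
 shows "mom G s r C (\<lambda>w. \<Sum>q\<in>T. X q w / of_real s)"
proof (rule momI)
 have meas: "X q \<in> borel_measurable G" if "q \<in> T" for q using X[OF that] by (rule mom_measurable)
 then show "(\<lambda>w. \<Sum>q\<in>T. X q w / of_real s) \<in> borel_measurable G"
  by (intro borel_measurable_sum borel_measurable_divide) auto
 fix p :: nat assume p: "p \<ge> 1"
 then show "0 \<le> C p" by (rule C)
 have le: "cmod (\<Sum>q\<in>T. X q w / of_real s) ^ (2 * p) \<le> 1 / s * (\<Sum>q\<in>T. cmod (X q w) ^ (2 * p))" for w
 proof -
  have "cmod (\<Sum>q\<in>T. X q w / of_real s) \<le> (\<Sum>q\<in>T. cmod (X q w) / s)"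
   using s by (intro order_trans[OF norm_sum] sum_mono) (simp add: norm_divide)
  then have "cmod (\<Sum>q\<in>T. X q w / of_real s) ^ (2 * p) \<le> (\<Sum>q\<in>T. cmod (X q w) / s) ^ (2 * p)"
   by (intro power_mono) auto
  also have "\<dots> \<le> real (card T) ^ (2 * p - 1) * (\<Sum>q\<in>T. (cmod (X q w) / s) ^ (2 * p))"
   using assms(1) p s by (intro power_sum_le) auto
  also have "\<dots> \<le> s ^ (2 * p - 1) * (\<Sum>q\<in>T. (cmod (X q w) / s) ^ (2 * p))"
   using s by (intro mult_right_mono power_mono sum_nonneg) auto
  also have "\<dots> = s ^ (2 * p - 1) / s ^ (2 * p) * (\<Sum>q\<in>T. cmod (X q w) ^ (2 * p))"
   by (simp add: power_divide sum_divide_distrib[symmetric])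
  also have "s ^ (2 * p - 1) / s ^ (2 * p) = 1 / s"
   using s p by (cases p) (auto simp: field_simps)
  finally show ?thesis .
 qed
 have "(\<integral>\<^sup>+w. ennreal (cmod (\<Sum>q\<in>T. X q w / of_real s) ^ (2 * p)) \<partial>G) \<le>
   (\<integral>\<^sup>+w. ennreal (1 / s) * (\<Sum>q\<in>T. ennreal (cmod (X q w) ^ (2 * p))) \<partial>G)"
  using le s by (intro nn_integral_mono)
   (simp add: sum_ennreal ennreal_mult[symmetric] sum_nonneg ennreal_leI)
 also have "\<dots> = ennreal (1 / s) * (\<Sum>q\<in>T. \<integral>\<^sup>+w. ennreal (cmod (X q w) ^ (2 * p)) \<partial>G)"
  using meas by (subst nn_integral_cmult, simp) (subst nn_integral_sum, auto)
 also have "\<dots> \<le> ennreal (1 / s) * (\<Sum>q\<in>T. ennreal (C p / s ^ (r * p)))"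
  using p by (intro mult_left_mono sum_mono mom_bound[OF X]) auto
 also have "\<dots> = ennreal (1 / s * (real (card T) * (C p / s ^ (r * p))))"
  using C[OF p] s by (subst sum_ennreal) (auto simp: ennreal_mult[symmetric])
 also have "\<dots> \<le> ennreal (1 / s * (s * (C p / s ^ (r * p))))"
  using C[OF p] s by (intro ennreal_leI mult_left_mono mult_right_mono) auto
 also have "1 / s * (s * (C p / s ^ (r * p))) = C p / s ^ (r * p)" using s by simp
 finally show "(\<integral>\<^sup>+w. ennreal (cmod (\<Sum>q\<in>T. X q w / of_real s) ^ (2 * p)) \<partial>G) \<le> ennreal (C p / s ^ (r * p))" .
qed

lemma power_sum_tup:
 fixes f :: "'e \<Rightarrow> 'a::comm_ring_1"
 assumes "finite E"
 shows "(\<Sum>e\<in>E. f e) ^ p = (\<Sum>xs\<in>tup p E. prod_list (map f xs))"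
proof (induction p)
 case (Suc p)
 then show ?case by (simp add: sum_tup_Suc[OF assms] sum_product)
qed simp

lemma norm_prod_list: "norm (prod_list xs) = prod_list (map norm (xs :: 'a::real_normed_field list))"
 by (induction xs) (auto simp: norm_mult)

lemma prod_list_power: "prod_list xs ^ k = prod_list (map (\<lambda>x. x ^ k) (xs :: 'a::comm_monoid_mult list))"
 by (induction xs) (auto simp: power_mult_distrib)

lemma prod_list_mult: "prod_list (map (\<lambda>x. f x * g x) xs) = prod_list (map f xs) * (prod_list (map g xs) :: 'a::comm_monoid_mult)"
 by (induction xs) (auto simp: mult_ac)

text \<open>The p-th power of a linear form is a tensor form whose weights are products of the
  coefficients, and its squared norm is the p-th power of that of the linear form.\<close>

lemma gvec_linear_moment:
 assumes E: "finite E"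
 shows "(\<integral>\<^sup>+w. ennreal (cmod (\<Sum>e\<in>E. w e * c e) ^ (2 * p)) \<partial>gvec E)
     \<le> ennreal (4 ^ p * fact p * (\<Sum>e\<in>E. (cmod (c e))\<^sup>2) ^ p)"
proof -
 have "cmod (\<Sum>e\<in>E. w e * c e) ^ (2 * p) = (cmod (\<Sum>xs\<in>tup p E. prod_list (map c xs) * prod_list (map w xs)))\<^sup>2" for w
  by (simp add: power_sum_tup[OF E, symmetric] prod_list_mult[symmetric] norm_power power_mult[symmetric] mult.commute)
 moreover have "(\<Sum>xs\<in>tup p E. (cmod (prod_list (map c xs)))\<^sup>2) = (\<Sum>e\<in>E. (cmod (c e))\<^sup>2) ^ p"
  by (simp add: power_sum_tup[OF E] norm_prod_list prod_list_power o_def)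
 ultimately show ?thesis
  using gvec_tensor_moment[OF E, where t = "\<lambda>xs. prod_list (map c xs)" and k = p] by simp
qed

text \<open>Conditionally on the other coordinates the linear form is Gaussian.\<close>

lemma nn_integral_linear_form:
 assumes E: "finite E" and B: "B \<subseteq> E"
  and c: "\<And>e. e \<in> B \<Longrightarrow> c e \<in> borel_measurable (gvec E)"
  and indep: "\<And>e w w'. e \<in> B \<Longrightarrow> (\<And>x. x \<in> E - B \<Longrightarrow> w x = w' x) \<Longrightarrow> c e w = c e w'"
 shows "(\<integral>\<^sup>+w. ennreal (cmod (\<Sum>e\<in>B. w e * c e w) ^ (2 * p)) \<partial>gvec E)
     \<le> (\<integral>\<^sup>+w. ennreal (4 ^ p * fact p * (\<Sum>e\<in>B. (cmod (c e w))\<^sup>2) ^ p) \<partial>gvec E)"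
proof -
 interpret product_sigma_finite "\<lambda>_. cgauss" by (rule cgauss_product_sigma_finite)
 have fin: "finite B" "finite (E - B)" using E B finite_subset by auto
 have EB: "(E - B) \<union> B = E" using B by auto
 have comp: "(\<lambda>w. w e) \<in> borel_measurable (gvec E)" if "e \<in> B" for e
  using that B by (intro gvec_component) auto
 have m1: "(\<lambda>w. ennreal (cmod (\<Sum>e\<in>B. w e * c e w) ^ (2 * p))) \<in> borel_measurable (gvec E)"
  using c comp by (intro measurable_compose[OF _ measurable_ennreal] borel_measurable_power
    borel_measurable_norm borel_measurable_sum borel_measurable_times) auto
 have m2: "(\<lambda>w. ennreal (4 ^ p * fact p * (\<Sum>e\<in>B. (cmod (c e w))\<^sup>2) ^ p)) \<in> borel_measurable (gvec E)"
  using c by (intro measurable_compose[OF _ measurable_ennreal] borel_measurable_power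
    borel_measurable_norm borel_measurable_sum borel_measurable_times) auto
 have fold: "(\<integral>\<^sup>+w. f w \<partial>gvec E) = (\<integral>\<^sup>+x. (\<integral>\<^sup>+y. f (merge (E - B) B (x, y)) \<partial>gvec B) \<partial>gvec (E - B))"
  if "f \<in> borel_measurable (gvec E)" for f
  using product_nn_integral_fold[of "E - B" B f] fin that unfolding EB by auto
 have cm: "c e (merge (E - B) B (x, y)) = c e x" if "e \<in> B" for e x y
  by (rule indep[OF that]) (auto simp: merge_def)
 have "(\<integral>\<^sup>+y. ennreal (cmod (\<Sum>e\<in>B. y e * c e x) ^ (2 * p)) \<partial>gvec B) \<le>
   ennreal (4 ^ p * fact p * (\<Sum>e\<in>B. (cmod (c e x))\<^sup>2) ^ p)" for x
  by (rule gvec_linear_moment[OF fin(1)])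
 also have "\<And>x. ennreal (4 ^ p * fact p * (\<Sum>e\<in>B. (cmod (c e x))\<^sup>2) ^ p) =
   (\<integral>\<^sup>+y. ennreal (4 ^ p * fact p * (\<Sum>e\<in>B. (cmod (c e x))\<^sup>2) ^ p) \<partial>gvec B)"
  using prob_space.emeasure_space_1[OF prob_space_gvec, of B] by simp
 finally have "(\<integral>\<^sup>+x. (\<integral>\<^sup>+y. ennreal (cmod (\<Sum>e\<in>B. y e * c e x) ^ (2 * p)) \<partial>gvec B) \<partial>gvec (E - B)) \<le>
   (\<integral>\<^sup>+x. (\<integral>\<^sup>+y. ennreal (4 ^ p * fact p * (\<Sum>e\<in>B. (cmod (c e x))\<^sup>2) ^ p) \<partial>gvec B) \<partial>gvec (E - B))"
  by (rule nn_integral_mono)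
 moreover have "merge (E - B) B (x, y) e = y e" if "e \<in> B" for x y e
  using that by (auto simp: merge_def)
 ultimately show ?thesis
  by (simp add: fold[OF m1] fold[OF m2] cm)
qed

text \<open>Given the coordinates outside \<open>B\<close>, the summands are independent and
  centred, so they add up in mean square: s terms of size 1/s give s^(-1/2), and r rises by 1. This
  gain drives the induction on the coefficients of the ratios.\<close>

lemma mom_linear:
 assumes E: "finite E" and B: "B \<subseteq> E" and T: "T \<subseteq> B"
  and c: "\<And>e. e \<in> T \<Longrightarrow> mom (gvec E) s r C (c e)"
  and indep: "\<And>e w w'. e \<in> T \<Longrightarrow> (\<And>x. x \<in> E - B \<Longrightarrow> w x = w' x) \<Longrightarrow> c e w = c e w'"
  and s: "real (card T) \<le> s" "s > 0" and C: "\<And>p. p \<ge> 1 \<Longrightarrow> C p \<ge> 0"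
 shows "mom (gvec E) s (Suc r) (\<lambda>p. 4 ^ p * fact p * C p) (\<lambda>w. \<Sum>e\<in>T. w e * c e w / of_real s)"
proof (rule momI)
 have fin: "finite T" using E B T finite_subset by metis
 have meas: "c e \<in> borel_measurable (gvec E)" if "e \<in> T" for e using c[OF that] by (rule mom_measurable)
 have comp: "(\<lambda>w. w e) \<in> borel_measurable (gvec E)" if "e \<in> T" for e
  using that B T by (intro gvec_component) auto
 show "(\<lambda>w. \<Sum>e\<in>T. w e * c e w / of_real s) \<in> borel_measurable (gvec E)"
  using meas comp by (intro borel_measurable_sum borel_measurable_divide borel_measurable_times) auto
 fix p :: nat assume p: "p \<ge> 1"
 show "0 \<le> 4 ^ p * fact p * C p" using C[OF p] by simp
 define K where "K = 4 ^ p * fact p / s ^ (2 * p) * s ^ (p - 1)"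
 have K: "K \<ge> 0" using s by (simp add: K_def)
 have le: "4 ^ p * fact p * (\<Sum>e\<in>T. (cmod (c e w / of_real s))\<^sup>2) ^ p \<le> K * (\<Sum>e\<in>T. cmod (c e w) ^ (2 * p))" for w
 proof -
  have "(\<Sum>e\<in>T. (cmod (c e w / of_real s))\<^sup>2) = (\<Sum>e\<in>T. (cmod (c e w))\<^sup>2) / s\<^sup>2"
   using s by (simp add: norm_divide power_divide sum_divide_distrib)
  then have "(\<Sum>e\<in>T. (cmod (c e w / of_real s))\<^sup>2) ^ p = (\<Sum>e\<in>T. (cmod (c e w))\<^sup>2) ^ p / s ^ (2 * p)"
   by (simp add: power_divide power_mult)
  also have "(\<Sum>e\<in>T. (cmod (c e w))\<^sup>2) ^ p \<le> real (card T) ^ (p - 1) * (\<Sum>e\<in>T. ((cmod (c e w))\<^sup>2) ^ p)"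
   using fin p by (intro power_sum_le) auto
  also have "\<dots> \<le> s ^ (p - 1) * (\<Sum>e\<in>T. ((cmod (c e w))\<^sup>2) ^ p)"
   using s by (intro mult_right_mono power_mono sum_nonneg) auto
  finally have "(\<Sum>e\<in>T. (cmod (c e w / of_real s))\<^sup>2) ^ p \<le> s ^ (p - 1) * (\<Sum>e\<in>T. ((cmod (c e w))\<^sup>2) ^ p) / s ^ (2 * p)"
   using s by (simp add: divide_right_mono)
  then have "4 ^ p * fact p * (\<Sum>e\<in>T. (cmod (c e w / of_real s))\<^sup>2) ^ p \<le>
    4 ^ p * fact p * (s ^ (p - 1) * (\<Sum>e\<in>T. ((cmod (c e w))\<^sup>2) ^ p) / s ^ (2 * p))"
   by (intro mult_left_mono) auto
  moreover have eq: "(\<Sum>e\<in>T. cmod (c e w) ^ (2 * p)) = (\<Sum>e\<in>T. ((cmod (c e w))\<^sup>2) ^ p)"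
   by (simp only: power_mult)
  ultimately show ?thesis unfolding K_def eq by (simp add: mult_ac)
 qed
 \<comment> \<open>The coefficients are extended by 0 from \<open>T\<close> to \<open>B\<close>, so
   that all coordinates in \<open>B\<close> can be integrated out together.\<close>
 define d where "d e w = (if e \<in> T then c e w / of_real s else 0)" for e w
 have sumT: "(\<Sum>e\<in>B. g (d e w) e) = (\<Sum>e\<in>T. g (c e w / of_real s) e)" if "\<And>e. g 0 e = 0" for g :: "complex \<Rightarrow> _ \<Rightarrow> 'b::comm_monoid_add" and w
  using T B E finite_subset[of B E] that by (intro sum.mono_neutral_cong_right) (auto simp: d_def)
 have d_meas: "d e \<in> borel_measurable (gvec E)" for e
 proof (cases "e \<in> T")
  case True
  then have "(\<lambda>w. c e w / of_real s) \<in> borel_measurable (gvec E)"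
   using meas[OF True] by (intro borel_measurable_divide) auto
  then show ?thesis using True by (simp add: d_def[abs_def])
 qed (simp add: d_def[abs_def])
 have d_indep: "d e w = d e w'" if "\<And>x. x \<in> E - B \<Longrightarrow> w x = w' x" for e w w'
  unfolding d_def using indep[of e w w'] that by auto
 have "(\<integral>\<^sup>+w. ennreal (cmod (\<Sum>e\<in>T. w e * c e w / of_real s) ^ (2 * p)) \<partial>gvec E) =
   (\<integral>\<^sup>+w. ennreal (cmod (\<Sum>e\<in>B. w e * d e w) ^ (2 * p)) \<partial>gvec E)"
  using sumT[of "\<lambda>z e. _ e * z"] by simp
 also have "\<dots> \<le> (\<integral>\<^sup>+w. ennreal (4 ^ p * fact p * (\<Sum>e\<in>B. (cmod (d e w))\<^sup>2) ^ p) \<partial>gvec E)"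
 proof (rule nn_integral_linear_form[OF E B])
  show "d e \<in> borel_measurable (gvec E)" for e by (rule d_meas)
  show "d e w = d e w'" if "\<And>x. x \<in> E - B \<Longrightarrow> w x = w' x" for e w w'
   by (rule d_indep) (rule that)
 qed
 also have "\<dots> \<le> (\<integral>\<^sup>+w. ennreal K * (\<Sum>e\<in>T. ennreal (cmod (c e w) ^ (2 * p))) \<partial>gvec E)"
  using le K sumT[of "\<lambda>z e. (cmod z)\<^sup>2"]
  by (intro nn_integral_mono) (simp add: sum_ennreal ennreal_mult[symmetric] sum_nonneg ennreal_leI)
 also have "\<dots> = ennreal K * (\<Sum>e\<in>T. \<integral>\<^sup>+w. ennreal (cmod (c e w) ^ (2 * p)) \<partial>gvec E)"
  using meas by (subst nn_integral_cmult, simp) (subst nn_integral_sum, auto)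
 also have "\<dots> \<le> ennreal K * (\<Sum>e\<in>T. ennreal (C p / s ^ (r * p)))"
  using p by (intro mult_left_mono sum_mono mom_bound[OF c]) auto
 also have "\<dots> = ennreal (K * (real (card T) * (C p / s ^ (r * p))))"
  using C[OF p] s K by (subst sum_ennreal) (auto simp: ennreal_mult[symmetric])
 also have "\<dots> \<le> ennreal (K * (s * (C p / s ^ (r * p))))"
  using C[OF p] s K by (intro ennreal_leI mult_left_mono mult_right_mono) auto
 also have "K * (s * (C p / s ^ (r * p))) = 4 ^ p * fact p * C p / s ^ (Suc r * p)"
 proof -
  have "s ^ (p - 1) * s = s ^ p" using p by (cases p) auto
  then have "K * (s * (C p / s ^ (r * p))) = 4 ^ p * fact p / s ^ (2 * p) * s ^ p * (C p / s ^ (r * p))"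
   by (simp add: K_def mult_ac)
  also have "s ^ (2 * p) = s ^ p * s ^ p" by (simp add: mult_2 power_add)
  finally show ?thesis using s by (simp add: power_add field_simps)
 qed
 finally show "(\<integral>\<^sup>+w. ennreal (cmod (\<Sum>e\<in>T. w e * c e w / of_real s) ^ (2 * p)) \<partial>gvec E) \<le>
   ennreal (4 ^ p * fact p * C p / s ^ (Suc r * p))" .
qed

lemma distr_gvec_rotate:
 assumes E: "finite E" and c: "\<And>e. e \<in> E \<Longrightarrow> cmod (c e) = 1"
 shows "distr (gvec E) (gvec E) (\<lambda>w. \<lambda>e\<in>E. c e * w e) = gvec E"
proof -
 interpret product_sigma_finite "\<lambda>_. cgauss" by (rule cgauss_product_sigma_finite)
 have mc: "(\<lambda>w. c e * w) \<in> cgauss \<rightarrow>\<^sub>M cgauss" for e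
 proof -
  have "(\<lambda>w. c e * w) \<in> borel \<rightarrow>\<^sub>M borel" by simp
  then show ?thesis using measurable_cong_sets[OF sets_cgauss sets_cgauss] by simp
 qed
 have meas: "(\<lambda>w. \<lambda>e\<in>E. c e * w e) \<in> gvec E \<rightarrow>\<^sub>M gvec E"
 proof (rule measurable_restrict)
  fix e assume "e \<in> E"
  from measurable_compose[OF measurable_component_singleton[OF this, of "\<lambda>_. cgauss"] mc[of e]]
  show "(\<lambda>w. c e * w e) \<in> gvec E \<rightarrow>\<^sub>M cgauss" .
 qed
 show ?thesis
 proof (rule PiM_eqI[OF E])
  fix A assume A: "\<And>e. e \<in> E \<Longrightarrow> A e \<in> sets cgauss"
  have "(\<lambda>w. \<lambda>e\<in>E. c e * w e) -` (Pi\<^sub>E E A) \<inter> space (gvec E) = Pi\<^sub>E E (\<lambda>e. (\<lambda>w. c e * w) -` A e)"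
   by (auto simp: space_PiM PiE_iff extensional_def)
  moreover have "(\<lambda>w. c e * w) -` A e \<in> sets cgauss" if "e \<in> E" for e
   using measurable_sets[OF mc A[OF that], of e] by simp
  ultimately have "emeasure (distr (gvec E) (gvec E) (\<lambda>w. \<lambda>e\<in>E. c e * w e)) (Pi\<^sub>E E A) =
    (\<Prod>e\<in>E. emeasure cgauss ((\<lambda>w. c e * w) -` A e))"
   using meas A E by (subst emeasure_distr) (auto intro!: sets_PiM_I_finite emeasure_PiM)
  also have "\<dots> = (\<Prod>e\<in>E. emeasure (distr cgauss cgauss ((*) (c e))) (A e))"
   using A mc by (intro prod.cong refl) (subst emeasure_distr, auto)
  also have "\<dots> = (\<Prod>e\<in>E. emeasure cgauss (A e))"
   using distr_cgauss_rotate c by (intro prod.cong) auto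
  finally show "emeasure (distr (gvec E) (gvec E) (\<lambda>w. \<lambda>e\<in>E. c e * w e)) (Pi\<^sub>E E A) =
    (\<Prod>e\<in>E. emeasure cgauss (A e))" .
 qed simp
qed

lemma nn_integral_gvec_rotate:
 assumes E: "finite E" and c: "\<And>e. e \<in> E \<Longrightarrow> cmod (c e) = 1" and f: "f \<in> borel_measurable (gvec E)"
 shows "(\<integral>\<^sup>+w. f (\<lambda>e\<in>E. c e * w e) \<partial>gvec E) = (\<integral>\<^sup>+w. f w \<partial>gvec E)"
proof -
 have mc: "(\<lambda>w. c e * w) \<in> cgauss \<rightarrow>\<^sub>M cgauss" for e
 proof -
  have "(\<lambda>w. c e * w) \<in> borel \<rightarrow>\<^sub>M borel" by simp
  then show ?thesis using measurable_cong_sets[OF sets_cgauss sets_cgauss] by simp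
 qed
 have meas: "(\<lambda>w. \<lambda>e\<in>E. c e * w e) \<in> gvec E \<rightarrow>\<^sub>M gvec E"
 proof (rule measurable_restrict)
  fix e assume "e \<in> E"
  from measurable_compose[OF measurable_component_singleton[OF this, of "\<lambda>_. cgauss"] mc[of e]]
  show "(\<lambda>w. c e * w e) \<in> gvec E \<rightarrow>\<^sub>M cgauss" .
 qed
 show ?thesis
  by (subst (2) distr_gvec_rotate[OF E c, symmetric]) (auto simp: nn_integral_distr[OF meas] f)
qed

section \<open>Taylor coefficients of the logarithm\<close>

definition fmat :: "(nat \<times> nat \<Rightarrow> complex) \<Rightarrow> nat \<Rightarrow> nat \<Rightarrow> complex fps" where
 "fmat w i j = 1 + fps_const (w (i, j)) * fps_X"

text \<open>The normalization makes the constant term 1, so the series is invertible for every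
  matrix. Ratios of subpermanents therefore exist formally, and no lower bound on a permanent is
  involved.\<close>

definition pm :: "(nat \<times> nat \<Rightarrow> complex) \<Rightarrow> nat list \<Rightarrow> nat set \<Rightarrow> complex fps" where
 "pm w us S = fps_const (fact (card S - length us) / fact (card S)) * rper (fmat w) us S"

definition row_ratio where "row_ratio w us S i = pm w (remove1 i us) S * inverse (pm w us S)"

definition col_ratio where "col_ratio w us S j = pm w us (S - {j}) * inverse (pm w us S)"

lemma pm_Nil [simp]: "pm w [] S = 1"
 by (simp add: pm_def)

text \<open>The constant part 1 of the entries of the new row contributes a sum over deleted
  columns, which \<open>rper_sum_delete\<close> collapses to \<open>pm w us S\<close>. What remains
  is linear in the new row and carries a factor z.\<close>

lemma pm_Cons:
 assumes "finite S" "length us < card S"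
 shows "pm w (i # us) S = pm w us S +
  fps_X * (\<Sum>k\<in>S. fps_const (w (i, k) / of_nat (card S)) * pm w us (S - {k}))"
proof -
 define s u where "s = card S" and "u = length us"
 have us: "u < s" using assms by (simp add: s_def u_def)
 define R where "R k = rper (fmat w) us (S - {k})" for k
 define \<alpha> :: complex where "\<alpha> = fact (s - Suc u) / fact s"
 have "fact (s - u) = (of_nat (s - u) * fact (s - Suc u) :: complex)"
  using us by (metis Suc_diff_Suc fact_Suc)
 then have \<alpha>1: "\<alpha> * of_nat (s - u) = fact (s - u) / fact s"
  by (simp add: \<alpha>_def)
 have "fact s = (of_nat s * fact (s - 1) :: complex)"
  using us by (cases s) auto
 then have \<alpha>2: "\<alpha> = (1 / of_nat s) * (fact (s - 1 - u) / fact (s - 1))"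
  using us by (simp add: \<alpha>_def)
 have "rper (fmat w) (i # us) S = (\<Sum>k\<in>S. R k) + fps_X * (\<Sum>k\<in>S. fps_const (w (i, k)) * R k)"
  by (simp add: R_def fmat_def algebra_simps sum.distrib sum_distrib_left)
 also have "(\<Sum>k\<in>S. R k) = of_nat (s - u) * rper (fmat w) us S"
  using rper_sum_delete[of S us "fmat w"] assms by (simp add: R_def s_def u_def)
 finally have "pm w (i # us) S = fps_const \<alpha> * (of_nat (s - u) * rper (fmat w) us S +
   fps_X * (\<Sum>k\<in>S. fps_const (w (i, k)) * R k))"
  by (simp add: pm_def \<alpha>_def s_def u_def)
 also have "\<dots> = fps_const (\<alpha> * of_nat (s - u)) * rper (fmat w) us S +
   fps_X * (\<Sum>k\<in>S. fps_const (\<alpha> * w (i, k)) * R k)"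
  by (simp add: distrib_left sum_distrib_left fps_of_nat[symmetric] fps_const_mult[symmetric] mult_ac del: fps_const_mult)
 also have "fps_const (\<alpha> * of_nat (s - u)) * rper (fmat w) us S = pm w us S"
  unfolding \<alpha>1 by (simp add: pm_def s_def u_def)
 also have "(\<Sum>k\<in>S. fps_const (\<alpha> * w (i, k)) * R k) =
   (\<Sum>k\<in>S. fps_const (w (i, k) / of_nat (card S)) * pm w us (S - {k}))"
 proof (rule sum.cong[OF refl])
  fix k assume k: "k \<in> S"
  have "fps_const (w (i, k) / of_nat (card S)) * pm w us (S - {k}) =
    fps_const (w (i, k) / of_nat s * (fact (s - 1 - u) / fact (s - 1))) * R k"
   using k assms by (simp add: pm_def R_def s_def u_def mult_ac)
  also have "w (i, k) / of_nat s * (fact (s - 1 - u) / fact (s - 1)) = \<alpha> * w (i, k)"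
   unfolding \<alpha>2 by simp
  finally show "fps_const (\<alpha> * w (i, k)) * R k = fps_const (w (i, k) / of_nat (card S)) * pm w us (S - {k})" ..
 qed
 finally show ?thesis .
qed

text \<open>Expansion along a new column by \<open>rper_col\<close>. With s columns in the end and u
  rows, (s - u)! / s! is 1 - u/s times (s - 1 - u)! / (s - 1)!, and the deficit u/s is distributed
  over the rows; this produces the differences of subpermanents.\<close>

lemma pm_insert:
 assumes "finite S" "j \<notin> S" "distinct us" "length us \<le> card S"
 shows "pm w us (insert j S) = pm w us S +
  (\<Sum>i\<in>set us. fps_const (1 / of_nat (Suc (card S))) * (pm w (remove1 i us) S - pm w us S)) +
  fps_X * (\<Sum>i\<in>set us. fps_const (w (i, j) / of_nat (Suc (card S))) * pm w (remove1 i us) S)"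
proof -
 define s u where "s = Suc (card S)" and "u = length us"
 have us: "u < s" using assms by (simp add: s_def u_def)
 define \<alpha> \<beta> :: complex where "\<alpha> = fact (s - u) / fact s" and "\<beta> = fact (s - 1 - u) / fact (s - 1)"
 have "fact (s - u) = (of_nat (s - u) * fact (s - 1 - u) :: complex)"
  using us by (metis Suc_diff_Suc fact_Suc diff_Suc_eq_diff_pred)
 moreover have f: "fact s = (of_nat s * fact (s - 1) :: complex)"
  by (simp add: s_def)
 moreover have s0: "of_nat s \<noteq> (0::complex)" by (simp add: s_def del: of_nat_Suc)
 ultimately have \<alpha>1: "\<alpha> = \<beta> - of_nat u * (1 / of_nat s) * \<beta>"
  using us by (simp add: \<alpha>_def \<beta>_def of_nat_diff field_simps)
 have \<alpha>2: "fps_const \<alpha> * rper (fmat w) (remove1 i us) S = fps_const (1 / of_nat s) * pm w (remove1 i us) S"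
  if "i \<in> set us" for i
 proof -
  have l: "length (remove1 i us) = u - 1" "u \<ge> 1"
   using that by (auto simp: length_remove1 u_def Suc_le_eq)
  then have "card S - length (remove1 i us) = s - u" using us by (simp add: s_def)
  then have "pm w (remove1 i us) S = fps_const (fact (s - u) / fact (s - 1)) * rper (fmat w) (remove1 i us) S"
   by (simp add: pm_def s_def)
  moreover have "\<alpha> = (1 / of_nat s) * (fact (s - u) / fact (s - 1))"
   unfolding \<alpha>_def f using s0 by simp
  ultimately show ?thesis by (simp add: mult.assoc[symmetric])
 qed
 have pmS: "pm w us S = fps_const \<beta> * rper (fmat w) us S"
  by (simp add: pm_def \<beta>_def s_def u_def)
 have cu: "card (set us) = u" using assms by (simp add: distinct_card u_def)
 have "pm w us (insert j S) = fps_const \<alpha> * rper (fmat w) us (insert j S)"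
  using assms by (simp add: pm_def \<alpha>_def s_def u_def)
 also have "\<dots> = fps_const \<alpha> * rper (fmat w) us S +
   (\<Sum>i\<in>set us. fmat w i j * (fps_const \<alpha> * rper (fmat w) (remove1 i us) S))"
  using rper_col[of S j us "fmat w"] assms by (simp add: distrib_left sum_distrib_left mult_ac)
 also have "(\<Sum>i\<in>set us. fmat w i j * (fps_const \<alpha> * rper (fmat w) (remove1 i us) S)) =
   (\<Sum>i\<in>set us. fps_const (1 / of_nat s) * pm w (remove1 i us) S) +
   fps_X * (\<Sum>i\<in>set us. fps_const (w (i, j) / of_nat s) * pm w (remove1 i us) S)"
 proof -
  have "fmat w i j * (fps_const \<alpha> * rper (fmat w) (remove1 i us) S) = fps_const (1 / of_nat s) * pm w (remove1 i us) S +
    fps_X * (fps_const (w (i, j) / of_nat s) * pm w (remove1 i us) S)" if "i \<in> set us" for i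
  proof -
   have "fps_const (w (i, j) / of_nat s) = fps_const (w (i, j)) * fps_const (1 / of_nat s)" by simp
   then show ?thesis unfolding \<alpha>2[OF that] fmat_def by (simp only: distrib_left distrib_right mult_1_left mult_1_right mult_ac)
  qed
  then show ?thesis by (simp add: sum.distrib sum_distrib_left)
 qed
 also have "fps_const \<alpha> * rper (fmat w) us S = pm w us S - of_nat u * (fps_const (1 / of_nat s) * pm w us S)"
  unfolding \<alpha>1 pmS by (simp add: fps_of_nat[symmetric] left_diff_distrib mult.assoc[symmetric] flip: fps_const_sub)
 finally show ?thesis
  unfolding s_def[symmetric] by (simp add: right_diff_distrib sum_subtractf cu)
qed

lemma pm_nth_0: "finite S \<Longrightarrow> length us \<le> card S \<Longrightarrow> pm w us S $ 0 = 1"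
 by (induction us) (auto simp: pm_Cons)

lemma pm_row:
 assumes "finite S" "i \<in> set us" "distinct us"
 shows "pm w us S = pm w (i # remove1 i us) S"
proof -
 have "length (i # remove1 i us) = length us"
  using assms by (simp add: length_remove1) (metis Suc_pred length_pos_if_in_set)
 then show ?thesis unfolding pm_def using rper_row[OF assms, of "fmat w"] by simp
qed

lemma pm_cong:
 assumes "\<And>i k. i \<in> set us \<Longrightarrow> k \<in> S \<Longrightarrow> w (i, k) = w' (i, k)"
 shows "pm w us S = pm w' us S"
proof -
 have "rper (fmat w) us S = rper (fmat w') us S"
  using assms
 proof (induction us arbitrary: S)
  case (Cons i us)
  have "rper (fmat w) us (S - {k}) = rper (fmat w') us (S - {k})" for k
   by (rule Cons.IH) (use Cons.prems in auto)
  moreover have "fmat w i k = fmat w' i k" if "k \<in> S" for k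
   using Cons.prems that by (simp add: fmat_def)
  ultimately show ?case by simp
 qed simp
 then show ?thesis by (simp add: pm_def)
qed

lemma row_ratio_cong:
 assumes "\<And>i k. i \<in> set us \<Longrightarrow> k \<in> S \<Longrightarrow> w (i, k) = w' (i, k)"
 shows "row_ratio w us S i = row_ratio w' us S i"
proof -
 have "pm w us S = pm w' us S" by (rule pm_cong) (rule assms)
 moreover have "pm w (remove1 i us) S = pm w' (remove1 i us) S"
  using assms set_remove1_subset[of i us] by (intro pm_cong) blast
 ultimately show ?thesis by (simp add: row_ratio_def)
qed

lemma col_ratio_cong:
 assumes "\<And>i k. i \<in> set us \<Longrightarrow> k \<in> S \<Longrightarrow> w (i, k) = w' (i, k)"
 shows "col_ratio w us S j = col_ratio w' us S j"
proof -
 have "pm w us S = pm w' us S" by (rule pm_cong) (rule assms)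
 moreover have "pm w us (S - {j}) = pm w' us (S - {j})"
  using assms by (intro pm_cong) blast
 ultimately show ?thesis by (simp add: col_ratio_def)
qed

text \<open>For a row \<open>i\<close> outside \<open>us\<close> this is linear in row
  \<open>i\<close>, with coefficients that depend on the rows \<open>us\<close> only: given these
  rows it is a Gaussian linear form.\<close>

definition row_form where
 "row_form w us S i = (\<Sum>k\<in>S. fps_const (w (i, k) / of_nat (card S)) * col_ratio w us S k)"

lemma pm_Cons_eq:
 assumes "finite S" "length us < card S"
 shows "pm w (i # us) S = pm w us S * (1 + fps_X * row_form w us S i)"
proof -
 have c: "pm w us S * col_ratio w us S k = pm w us (S - {k})" for k
 proof -
  have "pm w us S * inverse (pm w us S) = 1"
   using pm_nth_0[OF assms(1), of us w] assms(2) by (intro inverse_mult_eq_1') auto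
  then show ?thesis
   unfolding col_ratio_def by (metis mult.left_commute mult.right_neutral)
 qed
 have "pm w us S * row_form w us S i = (\<Sum>k\<in>S. fps_const (w (i, k) / of_nat (card S)) * pm w us (S - {k}))"
  unfolding row_form_def sum_distrib_left
 proof (rule sum.cong[OF refl])
  fix k
  show "pm w us S * (fps_const (w (i, k) / of_nat (card S)) * col_ratio w us S k) =
    fps_const (w (i, k) / of_nat (card S)) * pm w us (S - {k})"
   by (subst mult.left_commute) (simp only: c)
 qed
 then show ?thesis
  unfolding pm_Cons[OF assms] by (simp add: distrib_left mult.left_commute)
qed

lemma row_ratio_eq:
 assumes "finite S" "length us \<le> card S" "i \<in> set us" "distinct us"
 shows "row_ratio w us S i = inverse (1 + fps_X * row_form w (remove1 i us) S i)"
proof -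
 define F0 where "F0 = pm w (remove1 i us) S"
 have l: "length (remove1 i us) < card S"
  using assms by (simp add: length_remove1) (metis Suc_pred length_pos_if_in_set less_eq_Suc_le)
 have F0: "F0 * inverse F0 = 1"
  unfolding F0_def using pm_nth_0[OF assms(1), of "remove1 i us" w] l by (intro inverse_mult_eq_1') auto
 have "row_ratio w us S i = F0 * inverse (F0 * (1 + fps_X * row_form w (remove1 i us) S i))"
  unfolding row_ratio_def pm_row[OF assms(1,3,4)] pm_Cons_eq[OF assms(1) l] F0_def ..
 also have "\<dots> = (F0 * inverse F0) * inverse (1 + fps_X * row_form w (remove1 i us) S i)"
  by (simp add: fps_inverse_mult mult.assoc)
 finally show ?thesis by (simp add: F0)
qed

text \<open>The first sum carries no factor \<open>fps_X\<close>. So coefficient l of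
  \<open>col_ratio\<close> involves coefficient l of \<open>row_ratio\<close>, which dictates the
  order of the induction below.\<close>

definition col_form where
 "col_form w us S j =
   (\<Sum>i\<in>set us. fps_const (1 / of_nat (card S)) * (row_ratio w us (S - {j}) i - 1)) +
   fps_X * (\<Sum>i\<in>set us. fps_const (w (i, j) / of_nat (card S)) * row_ratio w us (S - {j}) i)"

lemma col_ratio_eq:
 assumes "finite S" "length us < card S" "j \<in> S" "distinct us"
 shows "col_ratio w us S j = inverse (1 + col_form w us S j)"
proof -
 define F0 where "F0 = pm w us (S - {j})"
 have l: "length us \<le> card (S - {j})" using assms by simp
 have F0: "F0 * inverse F0 = 1"
  unfolding F0_def using pm_nth_0[of "S - {j}" us w] assms(1) l by (intro inverse_mult_eq_1') auto
 have r: "F0 * row_ratio w us (S - {j}) i = pm w (remove1 i us) (S - {j})" for i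
  unfolding row_ratio_def F0_def[symmetric] using F0 by (metis mult.left_commute mult.right_neutral)
 have r1: "F0 * (c * row_ratio w us (S - {j}) i) = c * pm w (remove1 i us) (S - {j})" for c i
  by (subst mult.left_commute) (simp only: r)
 have r2: "F0 * (fps_X * (c * row_ratio w us (S - {j}) i)) = fps_X * (c * pm w (remove1 i us) (S - {j}))" for c i
  by (subst mult.left_commute) (simp only: r1)
 have c: "Suc (card (S - {j})) = card S" using assms by (metis card_Suc_Diff1)
 have "pm w us S = F0 * (1 + col_form w us S j)"
  using pm_insert[of "S - {j}" j us w] assms(1,3,4) l
  unfolding c col_form_def F0_def[symmetric]
  by (simp add: insert_absorb distrib_left sum_distrib_left right_diff_distrib r1 r2 mult.commute[of F0 "fps_const _"])
 then have "col_ratio w us S j = F0 * inverse (F0 * (1 + col_form w us S j))"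
  unfolding col_ratio_def F0_def by simp
 also have "\<dots> = (F0 * inverse F0) * inverse (1 + col_form w us S j)"
  by (simp add: fps_inverse_mult mult.assoc)
 finally show ?thesis by (simp add: F0)
qed

lemma fps_inverse_nth_rec:
 fixes V :: "complex fps"
 assumes "V $ 0 = 0" "l > 0"
 shows "inverse (1 + V) $ l = - (\<Sum>r=1..l. V $ r * inverse (1 + V) $ (l - r))"
proof -
 have "(1 + V) * inverse (1 + V) = 1"
  using assms by (intro inverse_mult_eq_1') auto
 then have "((1 + V) * inverse (1 + V)) $ l = 0" using assms(2) by simp
 moreover have "((1 + V) * inverse (1 + V)) $ l = (\<Sum>r=0..l. (1 + V) $ r * inverse (1 + V) $ (l - r))"
  by (rule fps_mult_nth)
 moreover have "\<dots> = inverse (1 + V) $ l + (\<Sum>r=1..l. V $ r * inverse (1 + V) $ (l - r))"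
  using assms by (subst sum.atLeast_Suc_atMost) (auto intro!: sum.cong)
 ultimately show ?thesis by (simp add: eq_neg_iff_add_eq_0)
qed

section \<open>Moments of the coefficients of the ratios, by induction on the degree\<close>

abbreviation sq :: "nat \<Rightarrow> (nat \<times> nat) set" where "sq n \<equiv> {..<n} \<times> {..<n}"

text \<open>One sequence of constants serves all n, all row lists and all column sets; the scale s
  is the number of columns.\<close>

definition row_mom :: "nat \<Rightarrow> (nat \<Rightarrow> real) \<Rightarrow> bool" where
 "row_mom l C \<longleftrightarrow> (\<forall>p\<ge>1. 0 \<le> C p) \<and> (\<forall>n us S i. distinct us \<and> set us \<subseteq> {..<n} \<and> S \<subseteq> {..<n} \<and>
   length us \<le> card S \<and> i \<in> set us \<longrightarrow> mom (gvec (sq n)) (real (card S)) l C (\<lambda>w. row_ratio w us S i $ l))"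

definition col_mom :: "nat \<Rightarrow> (nat \<Rightarrow> real) \<Rightarrow> bool" where
 "col_mom l C \<longleftrightarrow> (\<forall>p\<ge>1. 0 \<le> C p) \<and> (\<forall>n us S j. distinct us \<and> set us \<subseteq> {..<n} \<and> S \<subseteq> {..<n} \<and>
   length us < card S \<and> j \<in> S \<longrightarrow> mom (gvec (sq n)) (real (card S)) l C (\<lambda>w. col_ratio w us S j $ l))"

lemma row_form_mom:
 assumes col: "col_mom q C" and us: "distinct us" "set us \<subseteq> {..<n}" "S \<subseteq> {..<n}" "length us < card S"
  and i: "i < n" "i \<notin> set us"
 shows "mom (gvec (sq n)) (real (card S)) (Suc q) (\<lambda>p. 4 ^ p * fact p * C p) (\<lambda>w. row_form w us S i $ q)"
proof -
 have fin: "finite S" by (rule finite_subset[OF us(3)]) simp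
 have "mom (gvec (sq n)) (real (card S)) (Suc q) (\<lambda>p. 4 ^ p * fact p * C p)
   (\<lambda>w. \<Sum>e\<in>{i} \<times> S. w e * col_ratio w us S (snd e) $ q / of_real (real (card S)))"
 proof (rule mom_linear[where B = "{i} \<times> {..<n}"])
  show "mom (gvec (sq n)) (real (card S)) q C (\<lambda>w. col_ratio w us S (snd e) $ q)" if "e \<in> {i} \<times> S" for e
   using col us that unfolding col_mom_def by auto
  show "col_ratio w us S (snd e) $ q = col_ratio w' us S (snd e) $ q"
   if "\<And>x. x \<in> sq n - {i} \<times> {..<n} \<Longrightarrow> w x = w' x" for e w w'
  proof -
   have "col_ratio w us S (snd e) = col_ratio w' us S (snd e)"
    using us i by (intro col_ratio_cong that) auto
   then show ?thesis by simp
  qed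
 qed (use us i col in \<open>auto simp: card_cartesian_product_singleton col_mom_def\<close>)
 also have "(\<lambda>w. \<Sum>e\<in>{i} \<times> S. w e * col_ratio w us S (snd e) $ q / of_real (real (card S))) =
   (\<lambda>w. row_form w us S i $ q)"
 proof
  fix w
  have "{i} \<times> S = Pair i ` S" by auto
  then show "(\<Sum>e\<in>{i} \<times> S. w e * col_ratio w us S (snd e) $ q / of_real (real (card S))) = row_form w us S i $ q"
   by (simp add: row_form_def sum.reindex inj_on_def fps_sum_nth)
 qed
 finally show ?thesis .
qed

text \<open>\<open>row_ratio\<close> is 1 / (1 + z F) with F linear in the deleted row. The factor z
  shifts the index, so that coefficients of \<open>col_ratio\<close> below l suffice, and linearity
  in a fresh row makes up for the order lost by the shift.\<close>

lemma row_step: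
 assumes l: "l > 0" and C: "\<And>r. r < l \<Longrightarrow> col_mom r (C r)" and D: "\<And>r. r < l \<Longrightarrow> row_mom r (D r)"
 shows "\<exists>K. row_mom l K"
proof -
 define H where "H r p = 4 ^ p * fact p * C (r - 1) p" for r p
 define K where "K p = real (card {1..l}) ^ (2 * p - 1) * (\<Sum>r\<in>{1..l}. (H r (2 * p) + D (l - r) (2 * p)) / 2)" for p
 have nnH: "H r p \<ge> 0" if "r \<in> {1..l}" "p \<ge> 1" for r p
  using C[of "r - 1"] that by (auto simp: H_def col_mom_def)
 have nnD: "D (l - r) p \<ge> 0" if "r \<in> {1..l}" "p \<ge> 1" for r p
  using D[of "l - r"] that by (auto simp: row_mom_def)
 have "row_mom l K"
  unfolding row_mom_def
 proof (intro conjI allI impI)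
  show "0 \<le> K p" if "1 \<le> p" for p
   unfolding K_def using that nnH[of _ "2 * p"] nnD[of _ "2 * p"]
   by (intro mult_nonneg_nonneg sum_nonneg) (auto intro!: add_nonneg_nonneg)
 next
  fix n :: nat and us S and i :: nat
  assume "distinct us \<and> set us \<subseteq> {..<n} \<and> S \<subseteq> {..<n} \<and> length us \<le> card S \<and> i \<in> set us"
  then have us: "distinct us" "set us \<subseteq> {..<n}" "S \<subseteq> {..<n}" "length us \<le> card S" "i \<in> set us"
   by auto
  have fin: "finite S" by (rule finite_subset[OF us(3)]) simp
  define us0 where "us0 = remove1 i us"
  have "length us > 0" by (rule length_pos_if_in_set[OF us(5)])
  moreover have "length us0 = length us - 1" using us(5) by (simp add: us0_def length_remove1)
  ultimately have len: "length us0 < card S" using us(4) by linarith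
  have us0: "distinct us0" "set us0 \<subseteq> {..<n}" "length us0 < card S" "i \<notin> set us0" "i < n"
   using us len by (auto simp: us0_def)
  have s: "real (card S) > 0" using us0 by simp
  have eq: "row_ratio w us S i $ l = - (\<Sum>r\<in>{1..l}. row_form w us0 S i $ (r - 1) * row_ratio w us S i $ (l - r))" for w
   unfolding row_ratio_eq[OF fin us(4,5,1)] us0_def using l
   by (subst fps_inverse_nth_rec) (auto intro!: sum.cong)
  have "mom (gvec (sq n)) (real (card S)) l (\<lambda>p. (H r (2 * p) + D (l - r) (2 * p)) / 2)
    (\<lambda>w. row_form w us0 S i $ (r - 1) * row_ratio w us S i $ (l - r))" if r: "r \<in> {1..l}" for r
  proof -
   have "col_mom (r - 1) (C (r - 1))" using r by (intro C) auto
   from row_form_mom[OF this us0(1,2) us(3) us0(3) us0(5,4)]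
   have 1: "mom (gvec (sq n)) (real (card S)) r (H r) (\<lambda>w. row_form w us0 S i $ (r - 1))"
    using r by (simp add: H_def[abs_def])
   have 2: "mom (gvec (sq n)) (real (card S)) (l - r) (D (l - r)) (\<lambda>w. row_ratio w us S i $ (l - r))"
    using D[of "l - r"] r us unfolding row_mom_def by auto
   show ?thesis using mom_mult[OF 1 2 s] r by simp
  qed
  then show "mom (gvec (sq n)) (real (card S)) l K (\<lambda>w. row_ratio w us S i $ l)"
   unfolding eq K_def[abs_def] by (intro mom_uminus mom_sum s finite_atLeastAtMost)
 qed
 then show ?thesis by blast
qed

text \<open>The analogue for columns. The averages of coefficients of \<open>row_ratio\<close> are
  kept by \<open>mom_average\<close>, the form linear in column \<open>j\<close> gains one order; as
  the averages are not shifted, the bound for rows is assumed up to l itself.\<close>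

lemma col_step:
 assumes l: "l > 0" and C: "\<And>r. r < l \<Longrightarrow> col_mom r (C r)" and D: "\<And>r. r \<le> l \<Longrightarrow> row_mom r (D r)"
 shows "\<exists>K. col_mom l K"
proof -
 define H1 where "H1 r p = 2 ^ (r * p) * D r p" for r p
 define H2 where "H2 r p = 4 ^ p * fact p * (2 ^ ((r - 1) * p) * D (r - 1) p)" for r p
 define H where "H r p = 2 ^ (2 * p - 1) * (H1 r p + H2 r p)" for r p
 define K where "K p = real (card {1..l}) ^ (2 * p - 1) * (\<Sum>r\<in>{1..l}. (H r (2 * p) + C (l - r) (2 * p)) / 2)" for p
 have nnD: "D r p \<ge> 0" if "r \<le> l" "p \<ge> 1" for r p
  using D[of r] that by (auto simp: row_mom_def)
 have nnH: "H r p \<ge> 0" if "r \<in> {1..l}" "p \<ge> 1" for r p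
  using nnD[of r p] nnD[of "r - 1" p] that by (auto simp: H_def H1_def H2_def)
 have nnC: "C (l - r) p \<ge> 0" if "r \<in> {1..l}" "p \<ge> 1" for r p
  using C[of "l - r"] that by (auto simp: col_mom_def)
 have "col_mom l K"
  unfolding col_mom_def
 proof (intro conjI allI impI)
  show "0 \<le> K p" if "1 \<le> p" for p
   unfolding K_def using that nnH[of _ "2 * p"] nnC[of _ "2 * p"]
   by (intro mult_nonneg_nonneg sum_nonneg) (auto intro!: add_nonneg_nonneg)
 next
  fix n :: nat and us S and j :: nat
  assume "distinct us \<and> set us \<subseteq> {..<n} \<and> S \<subseteq> {..<n} \<and> length us < card S \<and> j \<in> S"
  then have us: "distinct us" "set us \<subseteq> {..<n}" "S \<subseteq> {..<n}" "length us < card S" "j \<in> S"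
   by auto
  have fin: "finite S" by (rule finite_subset[OF us(3)]) simp
  have s: "real (card S) > 0" using us by simp
  define S0 where "S0 = S - {j}"
  have S0: "S0 \<subseteq> {..<n}" "length us \<le> card S0" "card S0 = card S - 1" "finite S0" "j \<notin> S0"
   using us fin by (auto simp: S0_def)
  have V0: "col_form w us S j $ 0 = 0" for w
  proof -
   have "row_ratio w us S0 i $ 0 = 1" if "i \<in> set us" for i
    unfolding row_ratio_eq[OF S0(4,2) that us(1)] by simp
   then show ?thesis by (simp add: col_form_def S0_def[symmetric] fps_sum_nth)
  qed
  have rr: "mom (gvec (sq n)) (real (card S)) r (\<lambda>p. 2 ^ (r * p) * D r p) (\<lambda>w. row_ratio w us S0 i $ r)"
   if "i \<in> set us" "r \<le> l" for i r
  proof -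
   \<comment> \<open>As there is a row, at least one column is left after deleting \<open>j\<close>,
     so the number of columns at most halves and \<open>mom_rescale\<close> applies.\<close>
   have "length us \<ge> 1" using that by (cases us) auto
   then have "real (card S0) > 0" "real (card S) \<le> 2 * real (card S0)" using S0(2,3) us(4) by auto
   moreover have "mom (gvec (sq n)) (real (card S0)) r (D r) (\<lambda>w. row_ratio w us S0 i $ r)"
    using D[OF that(2)] us S0 that unfolding row_mom_def by blast
   ultimately show ?thesis using s by (intro mom_rescale)
  qed
  have Z: "mom (gvec (sq n)) (real (card S)) r (H r) (\<lambda>w. col_form w us S j $ r)" if r: "r \<in> {1..l}" for r
  proof -
   have 1: "mom (gvec (sq n)) (real (card S)) r (H1 r) (\<lambda>w. \<Sum>i\<in>set us. row_ratio w us S0 i $ r / of_real (real (card S)))"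
    unfolding H1_def using us r nnD s
    by (intro mom_average rr) (auto simp: distinct_card)
   have "mom (gvec (sq n)) (real (card S)) (Suc (r - 1)) (\<lambda>p. 4 ^ p * fact p * (2 ^ ((r - 1) * p) * D (r - 1) p))
     (\<lambda>w. \<Sum>e\<in>set us \<times> {j}. w e * row_ratio w us S0 (fst e) $ (r - 1) / of_real (real (card S)))"
   proof (rule mom_linear[where B = "{..<n} \<times> {j}"])
    show "mom (gvec (sq n)) (real (card S)) (r - 1) (\<lambda>p. 2 ^ ((r - 1) * p) * D (r - 1) p)
      (\<lambda>w. row_ratio w us S0 (fst e) $ (r - 1))" if "e \<in> set us \<times> {j}" for e
     using that r by (intro rr) auto
    show "row_ratio w us S0 (fst e) $ (r - 1) = row_ratio w' us S0 (fst e) $ (r - 1)"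
     if "\<And>x. x \<in> sq n - {..<n} \<times> {j} \<Longrightarrow> w x = w' x" for e w w'
    proof -
     have "row_ratio w us S0 (fst e) = row_ratio w' us S0 (fst e)"
      using us S0 by (intro row_ratio_cong that) auto
     then show ?thesis by simp
    qed
    show "0 \<le> 2 ^ ((r - 1) * p) * D (r - 1) p" if "p \<ge> 1" for p
     using nnD[of "r - 1" p] that r by auto
    show "real (card (set us \<times> {j})) \<le> real (card S)"
     using us by (simp add: card_cartesian_product distinct_card)
   qed (use us s in auto)
   also have "(\<lambda>w. \<Sum>e\<in>set us \<times> {j}. w e * row_ratio w us S0 (fst e) $ (r - 1) / of_real (real (card S))) =
     (\<lambda>w. \<Sum>i\<in>set us. w (i, j) * row_ratio w us S0 i $ (r - 1) / of_real (real (card S)))"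
   proof
    fix w
    have "set us \<times> {j} = (\<lambda>i. (i, j)) ` set us" by auto
    then show "(\<Sum>e\<in>set us \<times> {j}. w e * row_ratio w us S0 (fst e) $ (r - 1) / of_real (real (card S))) =
      (\<Sum>i\<in>set us. w (i, j) * row_ratio w us S0 i $ (r - 1) / of_real (real (card S)))"
     by (simp add: sum.reindex inj_on_def)
   qed
   also have "Suc (r - 1) = r" using r by auto
   finally have 2: "mom (gvec (sq n)) (real (card S)) r (H2 r)
     (\<lambda>w. \<Sum>i\<in>set us. w (i, j) * row_ratio w us S0 i $ (r - 1) / of_real (real (card S)))"
    by (simp add: H2_def[abs_def])
   have "col_form w us S j $ r = (\<Sum>i\<in>set us. row_ratio w us S0 i $ r / of_real (real (card S))) +
     (\<Sum>i\<in>set us. w (i, j) * row_ratio w us S0 i $ (r - 1) / of_real (real (card S)))" for w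
    using r by (auto simp: col_form_def S0_def[symmetric] fps_sum_nth intro!: sum.cong)
   then show ?thesis using mom_add[OF 1 2 s] by (simp add: H_def[abs_def])
  qed
  have eq: "col_ratio w us S j $ l = - (\<Sum>r\<in>{1..l}. col_form w us S j $ r * col_ratio w us S j $ (l - r))" for w
   unfolding col_ratio_eq[OF fin us(4,5,1)] using l V0
   by (subst fps_inverse_nth_rec) auto
  have "mom (gvec (sq n)) (real (card S)) l (\<lambda>p. (H r (2 * p) + C (l - r) (2 * p)) / 2)
    (\<lambda>w. col_form w us S j $ r * col_ratio w us S j $ (l - r))" if r: "r \<in> {1..l}" for r
  proof -
   have 2: "mom (gvec (sq n)) (real (card S)) (l - r) (C (l - r)) (\<lambda>w. col_ratio w us S j $ (l - r))"
    using C[of "l - r"] r us unfolding col_mom_def by auto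
   show ?thesis using mom_mult[OF Z[OF r] 2 s] r by simp
  qed
  then show "mom (gvec (sq n)) (real (card S)) l K (\<lambda>w. col_ratio w us S j $ l)"
   unfolding eq K_def[abs_def] by (intro mom_uminus mom_sum s finite_atLeastAtMost)
 qed
 then show ?thesis by blast
qed

text \<open>At each degree the bound for rows comes first, and the bound for columns uses it at the
  same degree.\<close>

lemma ratio_mom: "(\<exists>C. row_mom l C) \<and> (\<exists>C. col_mom l C)"
proof (induction l rule: less_induct)
 case (less l)
 show ?case
 proof (cases "l = 0")
  case True
  have r: "row_ratio w us S i $ 0 = 1" if "distinct us" "set us \<subseteq> {..<n}" "S \<subseteq> {..<n}" "length us \<le> card S" "i \<in> set us" for w us S i n
   using row_ratio_eq[of S us i w] that finite_subset[OF that(3)] by simp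
  have c: "col_ratio w us S j $ 0 = 1" if "distinct us" "set us \<subseteq> {..<n}" "S \<subseteq> {..<n}" "length us < card S" "j \<in> S" for w us S j n
  proof -
   have fin: "finite S" using finite_subset[OF that(3)] by simp
   have "pm w us S $ 0 = 1" "pm w us (S - {j}) $ 0 = 1"
    using that fin by (auto intro!: pm_nth_0)
   then show ?thesis by (simp add: col_ratio_def)
  qed
  have "row_mom 0 (\<lambda>_. 1)" "col_mom 0 (\<lambda>_. 1)"
   unfolding row_mom_def col_mom_def using mom_const_1[OF prob_space_gvec]
   by (auto simp: r c cong: conj_cong)
  then show ?thesis using True by blast
 next
  case False
  then have l: "l > 0" by simp
  from less obtain C D where C: "\<And>r. r < l \<Longrightarrow> col_mom r (C r)" and D: "\<And>r. r < l \<Longrightarrow> row_mom r (D r)"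
   by metis
  obtain K where K: "row_mom l K" using row_step[OF l C D] by blast
  have "row_mom r ((D(l := K)) r)" if "r \<le> l" for r
   using that D[of r] K by (cases "r = l") auto
  from col_step[OF l C this] K show ?thesis by blast
 qed
qed

section \<open>Coefficients of the formal logarithm, read off from F' / F, and their orthogonal
  increments\<close>

definition logd :: "complex fps \<Rightarrow> nat \<Rightarrow> complex" where
 "logd F k = (fps_deriv F * inverse F) $ (k - 1) / of_nat k"

lemma logd_mult:
 fixes F G :: "complex fps"
 assumes "F $ 0 = 1" "G $ 0 = 1"
 shows "logd (F * G) k = logd F k + logd G k"
proof -
 have F: "F * inverse F = 1" and G: "G * inverse G = 1"
  using assms by (auto intro!: inverse_mult_eq_1')
 have "fps_deriv (F * G) * inverse (F * G) =
   (fps_deriv F * inverse F) * (G * inverse G) + (fps_deriv G * inverse G) * (F * inverse F)"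
  by (simp add: fps_inverse_mult algebra_simps)
 then show ?thesis by (simp add: F G logd_def add_divide_distrib)
qed

lemma fps_mult_nth_low_0:
 fixes f g :: "'a::comm_ring_1 fps"
 assumes "\<And>j. j < k \<Longrightarrow> g $ j = 0" "i < k"
 shows "(f * g) $ i = 0"
 unfolding fps_mult_nth using assms by (intro sum.neutral) auto

text \<open>As U starts in degree 1, coefficient k of log (1 + c U) is a polynomial in c of degree
  at most k without constant term. Each of its powers of c sums to 0 over the N-th roots of unity if
  N > k.\<close>

lemma logd_roots_sum:
 fixes U :: "complex fps"
 assumes U: "U $ 0 = 0" and k: "k \<ge> 1" and N: "N > k"
 defines "\<omega> \<equiv> exp (2 * of_real pi * \<i> * of_nat 1 / of_nat N)"
 shows "(\<Sum>m<N. logd (1 + fps_const (\<omega> ^ m) * U) k) = 0"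
proof -
 have coef: "(fps_deriv (1 + fps_const c * U) * inverse (1 + fps_const c * U)) $ (k - 1) =
   (\<Sum>q<k. c ^ Suc q * (fps_deriv U * (- U) ^ q) $ (k - 1))" for c
 proof -
  define x where "x = - (fps_const c * U)"
  have x: "1 - x = 1 + fps_const c * U" by (simp add: x_def)
  have inv: "(1 - x) * inverse (1 - x) = 1"
   using U by (intro inverse_mult_eq_1') (simp add: x_def)
  \<comment> \<open>Truncated geometric series: x has no constant term, so the remainder, a multiple
    of x^k, does not reach coefficient k - 1.\<close>
  have "1 - x ^ k = (1 - x) * (\<Sum>q<k. x ^ q)" by (rule one_diff_power_eq)
  then have "(1 - x ^ k) * inverse (1 - x) = ((1 - x) * inverse (1 - x)) * (\<Sum>q<k. x ^ q)"
   by (simp only: mult_ac)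
  then have "(1 - x ^ k) * inverse (1 - x) = (\<Sum>q<k. x ^ q)" unfolding inv by simp
  then have e: "inverse (1 - x) = (\<Sum>q<k. x ^ q) + x ^ k * inverse (1 - x)"
   by (simp add: left_diff_distrib diff_eq_eq)
  have low: "x ^ k $ j = 0" if "j < k" for j
   using U startsby_zero_power_prefix[of x k] that by (simp add: x_def)
  have "(fps_deriv (1 - x) * inverse (1 - x)) $ (k - 1) =
    (\<Sum>q<k. (fps_deriv (1 - x) * x ^ q) $ (k - 1)) + (fps_deriv (1 - x) * inverse (1 - x) * x ^ k) $ (k - 1)"
   by (subst e) (simp add: distrib_left sum_distrib_left fps_sum_nth mult_ac)
  also have "(fps_deriv (1 - x) * inverse (1 - x) * x ^ k) $ (k - 1) = 0"
   using k by (intro fps_mult_nth_low_0[of k] low) auto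
  also have "(\<Sum>q<k. (fps_deriv (1 - x) * x ^ q) $ (k - 1)) = (\<Sum>q<k. c ^ Suc q * (fps_deriv U * (- U) ^ q) $ (k - 1))"
  proof (rule sum.cong[OF refl])
   fix q
   have "x = fps_const c * (- U)" by (simp add: x_def)
   then have "x ^ q = fps_const (c ^ q) * (- U) ^ q" by (simp only: power_mult_distrib fps_const_power)
   moreover have "fps_deriv (1 - x) = fps_const c * fps_deriv U" by (simp add: x_def)
   ultimately have "fps_deriv (1 - x) * x ^ q = fps_const (c ^ Suc q) * (fps_deriv U * (- U) ^ q)"
    by (simp add: mult_ac fps_const_mult[symmetric] del: fps_const_mult)
   then show "(fps_deriv (1 - x) * x ^ q) $ (k - 1) = c ^ Suc q * (fps_deriv U * (- U) ^ q) $ (k - 1)"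
    by (simp add: fps_mult_left_const_nth)
  qed
  finally show ?thesis unfolding x by simp
 qed
 have zero: "(\<Sum>m<N. (\<omega> ^ m) ^ Suc q) = 0" if "q < k" for q
 proof -
  have wj: "\<omega> ^ j = exp (2 * of_real pi * \<i> * of_nat j / of_nat N)" for j
   unfolding \<omega>_def exp_of_nat_mult[symmetric] by (simp add: mult_ac)
  have ne: "\<omega> ^ Suc q \<noteq> 1"
   unfolding wj using complex_root_unity_eq_1[of N "Suc q"] that N
   by (auto dest: dvd_imp_le)
  have one: "(\<omega> ^ Suc q) ^ N = 1"
  proof -
   have "\<omega> ^ N = 1" unfolding wj using complex_root_unity_eq_1[of N N] N by auto
   then show ?thesis by (metis mult.commute power_mult power_one)
  qed
  have "(\<Sum>m<N. (\<omega> ^ m) ^ Suc q) = (\<Sum>m<N. (\<omega> ^ Suc q) ^ m)"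
   by (simp only: power_mult[symmetric] mult.commute)
  also have "\<dots> = 0" using geometric_sum[OF ne, of N] one by simp
  finally show ?thesis .
 qed
 have "(\<Sum>m<N. logd (1 + fps_const (\<omega> ^ m) * U) k) =
   (\<Sum>m<N. \<Sum>q<k. (\<omega> ^ m) ^ Suc q * (fps_deriv U * (- U) ^ q) $ (k - 1)) / of_nat k"
  unfolding logd_def coef sum_divide_distrib ..
 also have "\<dots> = (\<Sum>q<k. (\<Sum>m<N. (\<omega> ^ m) ^ Suc q) * (fps_deriv U * (- U) ^ q) $ (k - 1)) / of_nat k"
  by (subst sum.swap) (simp only: sum_distrib_right)
 also have "\<dots> = 0" using zero by simp
 finally show ?thesis .
qed

text \<open>Rotating the coordinates in \<open>B\<close> by roots of unity makes the cross term vanish.\<close>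

lemma nn_integral_orthogonal:
 assumes E: "finite E" and N: "N > 0" and \<omega>: "cmod \<omega> = 1"
  and b: "b \<in> borel_measurable (gvec E)" and d: "d \<in> borel_measurable (gvec E)"
  and b_inv: "\<And>w m. b (\<lambda>e\<in>E. (if e \<in> B then \<omega> ^ m else 1) * w e) = b w"
  and d_sum: "\<And>w. (\<Sum>m<N. d (\<lambda>e\<in>E. (if e \<in> B then \<omega> ^ m else 1) * w e)) = 0"
 shows "(\<integral>\<^sup>+w. ennreal ((cmod (b w + d w))\<^sup>2) \<partial>gvec E) =
     (\<integral>\<^sup>+w. ennreal ((cmod (b w))\<^sup>2) \<partial>gvec E) + (\<integral>\<^sup>+w. ennreal ((cmod (d w))\<^sup>2) \<partial>gvec E)"
proof -
 define R where "R m w = (\<lambda>e\<in>E. (if e \<in> B then \<omega> ^ m else 1) * w e)" for m w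
 have c: "cmod (if e \<in> B then \<omega> ^ m else 1) = 1" for e m
  using \<omega> by (simp add: norm_power)
 have rot: "(\<integral>\<^sup>+w. f (R m w) \<partial>gvec E) = (\<integral>\<^sup>+w. f w \<partial>gvec E)" if "f \<in> borel_measurable (gvec E)" for f m
  unfolding R_def by (rule nn_integral_gvec_rotate[OF E c that])
 have mR: "(\<lambda>w. R m w) \<in> gvec E \<rightarrow>\<^sub>M gvec E" for m
 proof -
  have "(\<lambda>w. (if e \<in> B then \<omega> ^ m else 1) * w e) \<in> gvec E \<rightarrow>\<^sub>M cgauss" if "e \<in> E" for e
  proof -
   have "(\<lambda>w. (if e \<in> B then \<omega> ^ m else 1) * w e) \<in> borel_measurable (gvec E)"
    using gvec_component[OF that] by (intro borel_measurable_times) auto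
   then show ?thesis by (simp add: measurable_def)
  qed
  then show ?thesis unfolding R_def by (rule measurable_restrict)
 qed
 define dm where "dm m w = d (R m w)" for m w
 have dm: "dm m \<in> borel_measurable (gvec E)" for m
  unfolding dm_def by (rule measurable_compose[OF mR d])
 note [measurable] = b d dm
 have mbd: "(\<lambda>w. ennreal ((cmod (b w + d w))\<^sup>2)) \<in> borel_measurable (gvec E)" by measurable
 have mb: "(\<lambda>w. ennreal ((cmod (b w))\<^sup>2)) \<in> borel_measurable (gvec E)" by measurable
 have md: "(\<lambda>w. ennreal ((cmod (d w))\<^sup>2)) \<in> borel_measurable (gvec E)" by measurable
 have mbdR: "(\<lambda>w. ennreal ((cmod (b w + dm m w))\<^sup>2)) \<in> borel_measurable (gvec E)" for m by measurable
 have mdR: "(\<lambda>w. ennreal ((cmod (dm m w))\<^sup>2)) \<in> borel_measurable (gvec E)" for m by measurable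
 have pt: "(\<Sum>m<N. (cmod (b w + dm m w))\<^sup>2) = of_nat N * (cmod (b w))\<^sup>2 + (\<Sum>m<N. (cmod (dm m w))\<^sup>2)" for w
 proof -
  have "(cmod (x + y))\<^sup>2 = (cmod x)\<^sup>2 + 2 * Re (cnj x * y) + (cmod y)\<^sup>2" for x y
   unfolding cmod_power2 by (simp add: power2_eq_square algebra_simps)
  then have "(\<Sum>m<N. (cmod (b w + dm m w))\<^sup>2) =
    of_nat N * (cmod (b w))\<^sup>2 + 2 * Re (cnj (b w) * (\<Sum>m<N. dm m w)) + (\<Sum>m<N. (cmod (dm m w))\<^sup>2)"
   by (simp add: sum.distrib sum_distrib_left Re_sum)
  then show ?thesis using d_sum[of w] by (simp add: dm_def R_def)
 qed
 have "of_nat N * (\<integral>\<^sup>+w. ennreal ((cmod (b w + d w))\<^sup>2) \<partial>gvec E) =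
   (\<Sum>m<N. \<integral>\<^sup>+w. ennreal ((cmod (b (R m w) + dm m w))\<^sup>2) \<partial>gvec E)"
  unfolding dm_def by (subst rot[OF mbd]) simp
 also have "\<dots> = (\<integral>\<^sup>+w. (\<Sum>m<N. ennreal ((cmod (b w + dm m w))\<^sup>2)) \<partial>gvec E)"
  using b_inv by (subst nn_integral_sum[OF mbdR]) (simp_all add: R_def)
 also have "\<dots> = (\<integral>\<^sup>+w. of_nat N * ennreal ((cmod (b w))\<^sup>2) + (\<Sum>m<N. ennreal ((cmod (dm m w))\<^sup>2)) \<partial>gvec E)"
 proof (rule nn_integral_cong)
  fix w
  have "(\<Sum>m<N. ennreal ((cmod (b w + dm m w))\<^sup>2)) = ennreal (of_nat N * (cmod (b w))\<^sup>2 + (\<Sum>m<N. (cmod (dm m w))\<^sup>2))"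
   by (subst sum_ennreal) (simp_all add: pt)
  also have "\<dots> = of_nat N * ennreal ((cmod (b w))\<^sup>2) + (\<Sum>m<N. ennreal ((cmod (dm m w))\<^sup>2))"
   by (subst ennreal_plus) (simp_all add: sum_nonneg ennreal_mult ennreal_of_nat_eq_real_of_nat sum_ennreal)
  finally show "(\<Sum>m<N. ennreal ((cmod (b w + dm m w))\<^sup>2)) =
    of_nat N * ennreal ((cmod (b w))\<^sup>2) + (\<Sum>m<N. ennreal ((cmod (dm m w))\<^sup>2))" .
 qed
 also have "\<dots> = of_nat N * (\<integral>\<^sup>+w. ennreal ((cmod (b w))\<^sup>2) \<partial>gvec E) +
   (\<Sum>m<N. \<integral>\<^sup>+w. ennreal ((cmod (dm m w))\<^sup>2) \<partial>gvec E)"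
 proof -
  have "(\<lambda>w. of_nat N * ennreal ((cmod (b w))\<^sup>2)) \<in> borel_measurable (gvec E)"
   "(\<lambda>w. \<Sum>m<N. ennreal ((cmod (dm m w))\<^sup>2)) \<in> borel_measurable (gvec E)"
   by measurable
  then show ?thesis
   by (simp only: nn_integral_add nn_integral_cmult[OF mb] nn_integral_sum[OF mdR])
 qed
 also have "(\<Sum>m<N. \<integral>\<^sup>+w. ennreal ((cmod (dm m w))\<^sup>2) \<partial>gvec E) = of_nat N * (\<integral>\<^sup>+w. ennreal ((cmod (d w))\<^sup>2) \<partial>gvec E)"
  unfolding dm_def by (subst rot[OF md]) simp
 finally have "of_nat N * (\<integral>\<^sup>+w. ennreal ((cmod (b w + d w))\<^sup>2) \<partial>gvec E) =
   of_nat N * ((\<integral>\<^sup>+w. ennreal ((cmod (b w))\<^sup>2) \<partial>gvec E) + (\<integral>\<^sup>+w. ennreal ((cmod (d w))\<^sup>2) \<partial>gvec E))"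
  by (simp add: distrib_left)
 then show ?thesis
  using N by (subst (asm) ennreal_mult_cancel_left) auto
qed

text \<open>In F' / F for F = 1 + z Y, coefficient r of Y, of order r + 1, meets coefficient k - 1 -
  r of 1 / F, which is a \<open>row_ratio\<close>. The orders always add up to k.\<close>

lemma increment_mom:
 assumes k: "k \<ge> 1"
 shows "\<exists>C. (\<forall>p\<ge>1. 0 \<le> C p) \<and> (\<forall>n t. t < n \<longrightarrow> mom (gvec (sq n)) (real n) k C
      (\<lambda>w. logd (1 + fps_X * row_form w [Suc t..<n] {..<n} t) k))"
proof -
 obtain A where A: "\<And>l. row_mom l (A l)" using ratio_mom by metis
 obtain B where B: "\<And>l. col_mom l (B l)" using ratio_mom by metis
 define Y where "Y r p = 4 ^ p * fact p * B r p" for r p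
 define Z where "Z r p = cmod (of_nat (Suc r) / of_nat k) ^ (2 * p) * Y r p" for r p
 define C where "C p = real (card {0..k-1}) ^ (2 * p - 1) * (\<Sum>r\<in>{0..k-1}. (Z r (2 * p) + A (k - 1 - r) (2 * p)) / 2)" for p
 have nnA: "A l p \<ge> 0" and nnB: "B l p \<ge> 0" if "p \<ge> 1" for l p
  using A[of l] B[of l] that by (auto simp: row_mom_def col_mom_def)
 have nn: "0 \<le> C p" if "p \<ge> 1" for p
  unfolding C_def Z_def Y_def using that nnA[of "2 * p"] nnB[of "2 * p"]
  by (intro mult_nonneg_nonneg sum_nonneg) (auto intro!: add_nonneg_nonneg)
 have "mom (gvec (sq n)) (real n) k C (\<lambda>w. logd (1 + fps_X * row_form w [Suc t..<n] {..<n} t) k)"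
  if t: "t < n" for n t
 proof -
  have n: "real n > 0" using t by simp
  have c: "t # [Suc t..<n] = [t..<n]" using t by (simp add: upt_conv_Cons)
  define F where "F w = row_form w [Suc t..<n] {..<n} t" for w
  define I where "I w = row_ratio w [t..<n] {..<n} t" for w
  have I: "I w = inverse (1 + fps_X * F w)" for w
   unfolding I_def F_def using t by (subst row_ratio_eq) (auto simp: c[symmetric])
  have eq: "logd (1 + fps_X * F w) k = (\<Sum>r\<in>{0..k-1}. of_nat (Suc r) / of_nat k * F w $ r * I w $ (k - 1 - r))" for w
  proof -
   have "fps_deriv (1 + fps_X * F w) $ r = of_nat (Suc r) * F w $ r" for r
    unfolding fps_deriv_nth by simp
   then show ?thesis
    unfolding logd_def I[symmetric] fps_mult_nth sum_divide_distrib by simp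
  qed
  have m: "mom (gvec (sq n)) (real n) k (\<lambda>p. (Z r (2 * p) + A (k - 1 - r) (2 * p)) / 2)
    (\<lambda>w. of_nat (Suc r) / of_nat k * F w $ r * I w $ (k - 1 - r))" if r: "r \<in> {0..k-1}" for r
  proof -
   have "mom (gvec (sq n)) (real (card {..<n})) (Suc r) (Y r) (\<lambda>w. F w $ r)"
    unfolding F_def Y_def by (rule row_form_mom[OF B]) (use t in auto)
   then have "mom (gvec (sq n)) (real n) (Suc r) (Y r) (\<lambda>w. F w $ r)" by simp
   then have 1: "mom (gvec (sq n)) (real n) (Suc r) (Z r) (\<lambda>w. of_nat (Suc r) / of_nat k * F w $ r)"
    unfolding Z_def[abs_def] by (rule mom_cmult)
   have "mom (gvec (sq n)) (real (card {..<n})) (k - 1 - r) (A (k - 1 - r)) (\<lambda>w. I w $ (k - 1 - r))"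
   proof -
    have "distinct [t..<n] \<and> set [t..<n] \<subseteq> {..<n} \<and> {..<n} \<subseteq> {..<n} \<and>
      length [t..<n] \<le> card {..<n} \<and> t \<in> set [t..<n]"
     using t by auto
    then show ?thesis using A[of "k - 1 - r"] unfolding row_mom_def I_def by blast
   qed
   then have 2: "mom (gvec (sq n)) (real n) (k - 1 - r) (A (k - 1 - r)) (\<lambda>w. I w $ (k - 1 - r))" by simp
   have "Suc r + (k - 1 - r) = k" using r k by auto
   then show ?thesis using mom_mult[OF 1 2 n] by simp
  qed
  show ?thesis unfolding F_def[symmetric] eq C_def[abs_def]
   by (intro mom_sum m n finite_atLeastAtMost)
 qed
 with nn show ?thesis by blast
qed

text \<open>Rows are added from the last to the first. Rotating row t alone fixes the logarithm for
  the later rows and multiplies the linear form of the increment by a root of unity, so the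
  increments are orthogonal by \<open>logd_roots_sum\<close>. There are n of them, each with second
  moment of order n^(-k).\<close>

lemma logd_second_moment:
 assumes k: "k \<ge> 1"
 shows "\<exists>C\<ge>0. \<forall>n. (\<lambda>w. logd (pm w [0..<n] {..<n}) k) \<in> borel_measurable (gvec (sq n)) \<and>
  (\<integral>\<^sup>+w. ennreal ((cmod (logd (pm w [0..<n] {..<n}) k))\<^sup>2) \<partial>gvec (sq n)) \<le> ennreal (C * real n / real n ^ k)"
proof -
 obtain C where C0: "\<And>p. p \<ge> 1 \<Longrightarrow> 0 \<le> C p"
  and C: "\<And>n t. t < n \<Longrightarrow> mom (gvec (sq n)) (real n) k C
    (\<lambda>w. logd (1 + fps_X * row_form w [Suc t..<n] {..<n} t) k)"
  using increment_mom[OF k] by blast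
 define N where "N = Suc k"
 define \<omega> :: complex where "\<omega> = exp (2 * of_real pi * \<i> * of_nat 1 / of_nat N)"
 have \<omega>: "cmod \<omega> = 1" by (simp add: \<omega>_def)
 have step: "(\<lambda>w. logd (pm w [n - q..<n] {..<n}) k) \<in> borel_measurable (gvec (sq n)) \<and>
  (\<integral>\<^sup>+w. ennreal ((cmod (logd (pm w [n - q..<n] {..<n}) k))\<^sup>2) \<partial>gvec (sq n)) \<le> ennreal (C 1 * real q / real n ^ k)"
  if "q \<le> n" for n q
  using that
 proof (induction q)
  case 0
  then show ?case by (simp add: logd_def)
 next
  case (Suc q)
  define t where "t = n - Suc q"
  have t: "t < n" "Suc t = n - q" using Suc.prems by (auto simp: t_def)
  define b where "b w = logd (pm w [Suc t..<n] {..<n}) k" for w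
  define d where "d w = logd (1 + fps_X * row_form w [Suc t..<n] {..<n} t) k" for w
  have eq: "logd (pm w [t..<n] {..<n}) k = b w + d w" for w
  proof -
   have "pm w [t..<n] {..<n} = pm w [Suc t..<n] {..<n} * (1 + fps_X * row_form w [Suc t..<n] {..<n} t)"
    using pm_Cons_eq[of "{..<n}" "[Suc t..<n]" w t] t(1) by (simp add: upt_conv_Cons)
   then show ?thesis
    unfolding b_def d_def using t by (simp add: logd_mult pm_nth_0)
  qed
  have IH: "b \<in> borel_measurable (gvec (sq n))"
   "(\<integral>\<^sup>+w. ennreal ((cmod (b w))\<^sup>2) \<partial>gvec (sq n)) \<le> ennreal (C 1 * real q / real n ^ k)"
   using Suc t unfolding b_def[abs_def] by auto
  have d: "d \<in> borel_measurable (gvec (sq n))"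
   "(\<integral>\<^sup>+w. ennreal ((cmod (d w))\<^sup>2) \<partial>gvec (sq n)) \<le> ennreal (C 1 / real n ^ k)"
   using mom_measurable[OF C[OF t(1)]] mom_bound[OF C[OF t(1)], of 1] unfolding d_def[abs_def] by auto
  define B where "B = {t} \<times> {..<n}"
  have "(\<integral>\<^sup>+w. ennreal ((cmod (b w + d w))\<^sup>2) \<partial>gvec (sq n)) =
    (\<integral>\<^sup>+w. ennreal ((cmod (b w))\<^sup>2) \<partial>gvec (sq n)) + (\<integral>\<^sup>+w. ennreal ((cmod (d w))\<^sup>2) \<partial>gvec (sq n))"
  proof (rule nn_integral_orthogonal[where N = N and \<omega> = \<omega> and B = B])
   fix w m
   have "pm (\<lambda>e\<in>sq n. (if e \<in> B then \<omega> ^ m else 1) * w e) [Suc t..<n] {..<n} = pm w [Suc t..<n] {..<n}"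
    by (rule pm_cong) (auto simp: B_def)
   then show "b (\<lambda>e\<in>sq n. (if e \<in> B then \<omega> ^ m else 1) * w e) = b w"
    by (simp only: b_def)
  next
   fix w
   have "row_form (\<lambda>e\<in>sq n. (if e \<in> B then \<omega> ^ m else 1) * w e) [Suc t..<n] {..<n} t =
     fps_const (\<omega> ^ m) * row_form w [Suc t..<n] {..<n} t" for m
    unfolding row_form_def sum_distrib_left
   proof (rule sum.cong[OF refl])
    fix j assume j: "j \<in> {..<n}"
    have "col_ratio (\<lambda>e\<in>sq n. (if e \<in> B then \<omega> ^ m else 1) * w e) [Suc t..<n] {..<n} j = col_ratio w [Suc t..<n] {..<n} j"
     by (rule col_ratio_cong) (auto simp: B_def)
    then show "fps_const ((\<lambda>e\<in>sq n. (if e \<in> B then \<omega> ^ m else 1) * w e) (t, j) / of_nat (card {..<n})) *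
      col_ratio (\<lambda>e\<in>sq n. (if e \<in> B then \<omega> ^ m else 1) * w e) [Suc t..<n] {..<n} j =
      fps_const (\<omega> ^ m) * (fps_const (w (t, j) / of_nat (card {..<n})) * col_ratio w [Suc t..<n] {..<n} j)"
     using j t by (simp add: B_def mult.assoc[symmetric])
   qed
   then have "d (\<lambda>e\<in>sq n. (if e \<in> B then \<omega> ^ m else 1) * w e) =
     logd (1 + fps_const (\<omega> ^ m) * (fps_X * row_form w [Suc t..<n] {..<n} t)) k" for m
    by (simp add: d_def mult.left_commute)
   then show "(\<Sum>m<N. d (\<lambda>e\<in>sq n. (if e \<in> B then \<omega> ^ m else 1) * w e)) = 0"
    using logd_roots_sum[of "fps_X * row_form w [Suc t..<n] {..<n} t" k N] k
    by (simp add: N_def \<omega>_def)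
  qed (use \<omega> IH d in \<open>auto simp: N_def\<close>)
  also have "\<dots> \<le> ennreal (C 1 * real q / real n ^ k) + ennreal (C 1 / real n ^ k)"
   by (intro add_mono IH d)
  also have "\<dots> = ennreal (C 1 * real (Suc q) / real n ^ k)"
   using C0[of 1] by (subst ennreal_plus[symmetric]) (auto simp: field_simps add_divide_distrib[symmetric])
  finally show ?case
   using IH(1) d(1) unfolding t_def[symmetric] eq by (auto intro: borel_measurable_add)
 qed
 show ?thesis
  by (rule exI[of _ "C 1"]) (use C0[of 1] step in \<open>metis diff_self_eq_0 order_refl\<close>)
qed

section \<open>Identification with the Taylor coefficients of the analytic logarithm\<close>

lemma msum_fps_const:
 "msum (\<lambda>i j. fps_const (B i j) * fps_X) k us S = fps_const (msum B k us S) * fps_X ^ k"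
proof (induction B k us S rule: msum.induct)
 case (3 B k i us S)
 have "(\<Sum>j\<in>S. fps_const (B i j) * fps_X * msum (\<lambda>i j. fps_const (B i j) * fps_X) k us (S - {j})) =
   (\<Sum>j\<in>S. fps_const (B i j * msum B k us (S - {j}))) * fps_X ^ Suc k"
  unfolding sum_distrib_right
 proof (rule sum.cong[OF refl])
  fix j assume j: "j \<in> S"
  have ih: "msum (\<lambda>i j. fps_const (B i j) * fps_X) k us (S - {j}) = fps_const (msum B k us (S - {j})) * fps_X ^ k"
   using "3.IH"(2)[of j] j by blast
  show "fps_const (B i j) * fps_X * msum (\<lambda>i j. fps_const (B i j) * fps_X) k us (S - {j}) =
    fps_const (B i j * msum B k us (S - {j})) * fps_X ^ Suc k"
   unfolding ih by (simp only: fps_const_mult[symmetric] power_Suc mult_ac)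
 qed
 moreover have "fps_const (\<Sum>j\<in>S. g j) = (\<Sum>j\<in>S. fps_const (g j))" for g :: "nat \<Rightarrow> 'a"
  by (simp add: fps_eq_iff fps_sum_nth)
 ultimately show ?case
  by (simp add: "3.IH"(1) distrib_right flip: fps_const_add)
qed auto

lemma pm_eq_pcoeff: "pm w [0..<n] {..<n} = (\<Sum>k\<le>n. fps_const (pcoeff n (curry w) k) * fps_X ^ k)"
proof -
 have f: "fmat w = (\<lambda>i j. 1 + fps_const (curry w i j) * fps_X)"
  by (auto simp: fmat_def fun_eq_iff)
 have "rper (fmat w) [0..<n] {..<n} = (\<Sum>k\<le>n. fact (n - k) * msum (\<lambda>i j. fps_const (curry w i j) * fps_X) k [0..<n] {..<n})"
  using rper_one_plus[of "{..<n}" "[0..<n]" "\<lambda>i j. fps_const (curry w i j) * fps_X"] unfolding f by simp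
 then have "pm w [0..<n] {..<n} =
   (\<Sum>k\<le>n. fps_const (1 / fact n) * (fact (n - k) * (fps_const (msum (curry w) k [0..<n] {..<n}) * fps_X ^ k)))"
  by (simp add: pm_def msum_fps_const sum_distrib_left curry_def)
 also have "\<dots> = (\<Sum>k\<le>n. fps_const (pcoeff n (curry w) k) * fps_X ^ k)"
 proof (rule sum.cong[OF refl])
  fix k assume k: "k \<in> {..n}"
  have "fact k * msum (curry w) k [0..<n] {..<n} =
    (\<Sum>is\<in>dtup k {..<n}. \<Sum>js\<in>dtup k {..<n}. prod_list (map2 (curry w) is js))"
   using fact_msum[of "{..<n}" "[0..<n]" k "curry w"] by (simp add: atLeast0LessThan)
  then have "pcoeff n (curry w) k = 1 / fact n * (fact (n - k) * msum (curry w) k [0..<n] {..<n})"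
   using k by (simp add: pcoeff_def field_simps)
  moreover have "(fact (n - k) :: complex fps) = fps_const (fact (n - k))"
   by (metis fps_of_nat of_nat_fact)
  ultimately show "fps_const (1 / fact n) * (fact (n - k) * (fps_const (msum (curry w) k [0..<n] {..<n}) * fps_X ^ k)) =
    fps_const (pcoeff n (curry w) k) * fps_X ^ k"
   by (simp add: mult.assoc[symmetric])
 qed
 finally show ?thesis .
qed

definition pfps :: "nat \<Rightarrow> (nat \<Rightarrow> nat \<Rightarrow> complex) \<Rightarrow> complex fps" where
 "pfps n A = (\<Sum>k\<le>n. fps_const (pcoeff n A k) * fps_X ^ k)"

lemma pfps_nth: "pfps n A $ k = pcoeff n A k"
proof -
 have "pfps n A $ k = (\<Sum>i\<le>n. if i = k then pcoeff n A i else 0)"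
  unfolding pfps_def fps_sum_nth by (intro sum.cong) (auto simp: fps_X_power_nth)
 then show ?thesis by (simp add: pcoeff_def)
qed

text \<open>Near 0 the derivative of Ln P is P' / P, and power series expansions are unique.\<close>

lemma log_coeff_eq_logd:
 assumes "k \<ge> 1"
 shows "log_coeff n A k = logd (pfps n A) k"
proof -
 define P where "P = perm_poly n A"
 define g where "g = (\<lambda>z. Ln (P z))"
 have P: "P has_fps_expansion pfps n A"
  unfolding P_def perm_poly_eq_sum[abs_def] pfps_def
  by (intro has_fps_expansion_sum has_fps_expansion_mult has_fps_expansion_const has_fps_expansion_fps_X_power)
 obtain r where r: "r > 0" "g holomorphic_on ball 0 r" "\<forall>z\<in>ball 0 r. exp (g z) = P z"
  using log_perm_poly_near_0[of n A] unfolding g_def P_def by blast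
 then have "g analytic_on {0}"
  using analytic_at_ball by blast
 then have G: "g has_fps_expansion fps_expansion g 0"
  by (rule analytic_at_imp_has_fps_expansion_0)
 have "deriv g has_fps_expansion fps_deriv (fps_expansion g 0)"
  by (rule has_fps_expansion_deriv[OF G])
 moreover have "(\<lambda>z. deriv P z * inverse (P z)) has_fps_expansion fps_deriv (pfps n A) * inverse (pfps n A)"
  by (intro has_fps_expansion_mult has_fps_expansion_deriv P has_fps_expansion_inverse)
    (simp add: pfps_nth)
 moreover have "eventually (\<lambda>z. deriv g z = deriv P z * inverse (P z)) (nhds 0)"
 proof -
  have "eventually (\<lambda>z. z \<in> ball 0 r) (nhds 0)"
   using r(1) by (intro eventually_nhds_in_open) auto
  then show ?thesis
  proof eventually_elim
   case (elim z)
   have g: "(g has_field_derivative deriv g z) (at z)"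
    using r(2) elim by (metis holomorphic_derivI open_ball)
   have h: "((\<lambda>z. exp (g z)) has_field_derivative exp (g z) * deriv g z) (at z)"
    using g by (rule DERIV_fun_exp)
   have "(P has_field_derivative exp (g z) * deriv g z) (at z)"
    by (rule has_field_derivative_transform_within_open[OF h open_ball elim]) (use r(3) in auto)
   then have "deriv P z = P z * deriv g z" using r(3) elim by (simp add: DERIV_imp_deriv)
   moreover have "P z \<noteq> 0" using r(3) elim by (metis exp_not_eq_zero)
   ultimately show ?case by simp
  qed
 qed
 ultimately have "fps_deriv (fps_expansion g 0) = fps_deriv (pfps n A) * inverse (pfps n A)"
  by (metis has_fps_expansion_cong fps_expansion_unique_complex)
 moreover have "fps_expansion g 0 $ k = log_coeff n A k"
  by (simp add: fps_expansion_def log_coeff_def g_def P_def)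
 moreover have "fps_deriv (fps_expansion g 0) $ (k - 1) = of_nat k * fps_expansion g 0 $ k"
  using assms by simp
 ultimately show ?thesis using assms by (simp add: logd_def)
qed

theorem log_coeff_second_moment:
 assumes k: "k \<ge> 1"
 shows "\<exists>C\<ge>0. \<forall>n. (\<lambda>w. log_coeff n (curry w) k) \<in> borel_measurable (gvec (sq n)) \<and>
  (\<integral>\<^sup>+w. ennreal ((cmod (log_coeff n (curry w) k))\<^sup>2) \<partial>gvec (sq n)) \<le> ennreal (C * real n / real n ^ k)"
 using logd_second_moment[OF k] by (simp add: log_coeff_eq_logd[OF k] pm_eq_pcoeff pfps_def)

section \<open>The algorithm\<close>

text \<open>Comparison of coefficients in P' = (log P)' P, solved for the top coefficient of log
  P.\<close>

lemma log_coeff_rec: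
 assumes k: "k \<ge> 1"
 shows "log_coeff n A k = pcoeff n A k - (\<Sum>j\<leftarrow>[1..<k]. of_nat j * log_coeff n A j * pcoeff n A (k - j)) / of_nat k"
proof -
 define F where "F = pfps n A"
 define V where "V = fps_deriv F * inverse F"
 have "inverse F * F = 1" by (intro inverse_mult_eq_1) (simp add: F_def pfps_nth)
 then have VF: "V * F = fps_deriv F" unfolding V_def by (simp add: mult.assoc)
 have V: "V $ (j - 1) = of_nat j * log_coeff n A j" if "j \<ge> 1" for j
  using log_coeff_eq_logd[OF that, of n A] that by (simp add: logd_def V_def F_def)
 have "of_nat k * pcoeff n A k = (V * F) $ (k - 1)"
  using k unfolding VF by (simp add: F_def pfps_nth)
 also have "\<dots> = (\<Sum>i=0..k-1. V $ i * F $ (k - 1 - i))" by (rule fps_mult_nth)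
 also have "\<dots> = (\<Sum>j=1..k. V $ (j - 1) * F $ (k - j))"
  by (rule sum.reindex_bij_witness[of _ "\<lambda>j. j - 1" Suc]) (use k in auto)
 also have "\<dots> = (\<Sum>j=1..k. of_nat j * log_coeff n A j * pcoeff n A (k - j))"
 proof (rule sum.cong[OF refl])
  fix j assume "j \<in> {1..k}"
  then have "V $ (j - 1) = of_nat j * log_coeff n A j" by (intro V) auto
  then show "V $ (j - 1) * F $ (k - j) = of_nat j * log_coeff n A j * pcoeff n A (k - j)"
   by (simp only: F_def pfps_nth)
 qed
 also have "{1..k} = insert k {1..<k}" using k by auto
 also have "(\<Sum>j\<in>insert k {1..<k}. of_nat j * log_coeff n A j * pcoeff n A (k - j)) =
   of_nat k * log_coeff n A k + (\<Sum>j\<in>{1..<k}. of_nat j * log_coeff n A j * pcoeff n A (k - j))"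
  by (subst sum.insert) auto
 also have "(\<Sum>j\<in>{1..<k}. of_nat j * log_coeff n A j * pcoeff n A (k - j)) =
   (\<Sum>j\<leftarrow>[1..<k]. of_nat j * log_coeff n A j * pcoeff n A (k - j))"
  by (simp add: sum_list_distinct_conv_sum_set)
 finally show ?thesis using k by (simp add: field_simps)
qed

section \<open>Compiling arithmetic expressions\<close>

datatype expr = Cell nat | Const int | Point | Entry nat nat | Bin arith_op expr expr

text \<open>
 Registers \<open>1\<close>, \<open>2\<close>, \<open>3\<close> are scratch, register \<open>4\<close> always holds \<open>0\<close> and register \<open>5\<close> holds \<open>1\<close>.
 An expression is evaluated on a stack of memory cells that starts at cell \<open>t\<close>.
\<close>

fun eval_expr :: "(nat \<Rightarrow> nat \<Rightarrow> complex) \<Rightarrow> complex \<Rightarrow> (nat \<Rightarrow> nat) \<Rightarrow> (nat \<Rightarrow> complex) \<Rightarrow> expr \<Rightarrow> complex" where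
 "eval_expr A z R X (Cell c) = X c"
| "eval_expr A z R X (Const k) = of_int k"
| "eval_expr A z R X Point = z"
| "eval_expr A z R X (Entry a b) = A (R a) (R b)"
| "eval_expr A z R X (Bin f e1 e2) = arith f (eval_expr A z R X e1) (eval_expr A z R X e2)"

fun expr_cells :: "expr \<Rightarrow> nat set" where
 "expr_cells (Cell c) = {c}"
| "expr_cells (Bin f e1 e2) = expr_cells e1 \<union> expr_cells e2"
| "expr_cells _ = {}"

fun expr_regs :: "expr \<Rightarrow> nat set" where
 "expr_regs (Entry a b) = {a, b}"
| "expr_regs (Bin f e1 e2) = expr_regs e1 \<union> expr_regs e2"
| "expr_regs _ = {}"

fun expr_cost :: "expr \<Rightarrow> nat" where
 "expr_cost (Cell c) = 5"
| "expr_cost (Bin f e1 e2) = expr_cost e1 + (expr_cost e2 + 3)"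
| "expr_cost _ = 2"

text \<open>A copy is an addition of the 0 that is first written to cell \<open>u\<close>; hence
  \<open>u\<close> has to differ from the source \<open>c\<close>.\<close>

definition copy_cell :: "nat \<Rightarrow> nat \<Rightarrow> nat \<Rightarrow> prog" where
 "copy_cell t c u = Seq (Instr (Set_Idx 1 t)) (Seq (Instr (Set_Idx 2 c)) (Seq (Instr (Set_Idx 3 u))
   (Seq (Instr (Set_Mem 3 0)) (Instr (Arith Plus 1 2 3)))))"

fun comp_expr :: "expr \<Rightarrow> nat \<Rightarrow> prog" where
 "comp_expr (Cell c) t = copy_cell t c (Suc t)"
| "comp_expr (Const k) t = Seq (Instr (Set_Idx 1 t)) (Instr (Set_Mem 1 k))"
| "comp_expr Point t = Seq (Instr (Set_Idx 1 t)) (Instr (Read_Point 1))"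
| "comp_expr (Entry a b) t = Seq (Instr (Set_Idx 1 t)) (Instr (Read_Entry 1 a b))"
| "comp_expr (Bin f e1 e2) t = Seq (comp_expr e1 t) (Seq (comp_expr e2 (Suc t))
   (Seq (Instr (Set_Idx 1 t)) (Seq (Instr (Set_Idx 2 (Suc t))) (Instr (Arith f 1 1 2)))))"

lemma runs_Instr: "runs A z (Instr i) (R, X) (Suc 0) (exec_instr A z i (R, X))"
 using runs.Instr[of A z i "(R, X)"] by simp

lemma runs_Seq_Instr:
 assumes "runs A z q (exec_instr A z i (R, X)) t s"
 shows "runs A z (Seq (Instr i) q) (R, X) (Suc t) s"
 using runs.Seq[OF runs_Instr assms] by simp

lemma runs_Instr2:
 "runs A z (Seq (Instr a) (Instr b)) s 2 (exec_instr A z b (exec_instr A z a s))"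
proof -
 have "runs A z (Seq (Instr a) (Instr b)) s (1 + 1) (exec_instr A z b (exec_instr A z a s))"
  by (rule runs.Seq[OF runs.Instr runs.Instr])
 then show ?thesis by (simp only: one_add_one)
qed

lemma runs_Instr3:
 "runs A z (Seq (Instr a) (Seq (Instr b) (Instr c))) s 3
   (exec_instr A z c (exec_instr A z b (exec_instr A z a s)))"
proof -
 have "runs A z (Seq (Instr a) (Seq (Instr b) (Instr c))) s (1 + 2)
   (exec_instr A z c (exec_instr A z b (exec_instr A z a s)))"
  by (rule runs.Seq[OF runs.Instr runs_Instr2])
 then show ?thesis by (simp only: one_plus_numeral semiring_norm)
qed

lemma runs_Instr5:
 "runs A z (Seq (Instr a) (Seq (Instr b) (Seq (Instr c) (Seq (Instr d) (Instr e))))) s 5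
   (exec_instr A z e (exec_instr A z d (exec_instr A z c (exec_instr A z b (exec_instr A z a s)))))"
proof -
 have "runs A z (Seq (Instr a) (Seq (Instr b) (Seq (Instr c) (Seq (Instr d) (Instr e))))) s (1 + (1 + 3))
   (exec_instr A z e (exec_instr A z d (exec_instr A z c (exec_instr A z b (exec_instr A z a s)))))"
  by (rule runs.Seq[OF runs.Instr runs.Seq[OF runs.Instr runs_Instr3]])
 then show ?thesis by (simp only: one_plus_numeral semiring_norm)
qed

lemma ex_state: "runs A z p s t (R', X') \<Longrightarrow> Q R' X' \<Longrightarrow> \<exists>R' X'. runs A z p s t (R', X') \<and> Q R' X'"
 by blast

lemma ex_run: "runs A z p s t (R', X') \<Longrightarrow> Q t R' X' \<Longrightarrow> \<exists>t R' X'. runs A z p s t (R', X') \<and> Q t R' X'"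
 by blast

lemma runs_copy_cell:
 assumes "c \<noteq> u"
 shows "runs A z (copy_cell t c u) (R, X) 5
  (R(1 := t, 2 := c, 3 := u), X(u := 0, t := X c))"
 unfolding copy_cell_def
 using runs_Instr5[of A z "Set_Idx 1 t" "Set_Idx 2 c" "Set_Idx 3 u" "Set_Mem 3 0" "Arith Plus 1 2 3" "(R, X)"] assms
 by simp

lemma eval_expr_cong:
 assumes "\<And>r. r \<in> expr_regs e \<Longrightarrow> R r = R' r" "\<And>c. c \<in> expr_cells e \<Longrightarrow> X c = X' c"
 shows "eval_expr A z R X e = eval_expr A z R' X' e"
 using assms by (induction e) auto

text \<open>The first operand waits in cell \<open>t\<close> while the second is evaluated from cell
  \<open>t + 1\<close> on. The invariant that cells below the stack are kept protects both the first
  operand and the inputs; the index registers of entries lie above the scratch registers.\<close>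

lemma runs_comp_expr:
 assumes "expr_cells e \<subseteq> {..<t}" "expr_regs e \<subseteq> {4..}"
 shows "\<exists>R' X'. runs A z (comp_expr e t) (R, X) (expr_cost e) (R', X') \<and> (\<forall>r. r \<notin> {1, 2, 3} \<longrightarrow> R' r = R r) \<and>
  X' t = eval_expr A z R X e \<and> (\<forall>c<t. X' c = X c)"
 using assms
proof (induction e arbitrary: t R X)
 case (Cell c)
 have "runs A z (copy_cell t c (Suc t)) (R, X) 5 (R(1 := t, 2 := c, 3 := Suc t), X(Suc t := 0, t := X c))"
  using Cell by (intro runs_copy_cell) auto
 then show ?case unfolding comp_expr.simps expr_cost.simps by (rule ex_state) auto
next
 case (Const k)
 have "runs A z (comp_expr (Const k) t) (R, X) 2 (R(1 := t), X(t := of_int k))"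
  using runs_Instr2[of A z "Set_Idx 1 t" "Set_Mem 1 k" "(R, X)"] by simp
 then show ?case unfolding expr_cost.simps by (rule ex_state) auto
next
 case Point
 have "runs A z (comp_expr Point t) (R, X) 2 (R(1 := t), X(t := z))"
  using runs_Instr2[of A z "Set_Idx 1 t" "Read_Point 1" "(R, X)"] by simp
 then show ?case unfolding expr_cost.simps by (rule ex_state) auto
next
 case (Entry a b)
 then have ab: "a \<noteq> 1" "b \<noteq> 1" by auto
 have "runs A z (comp_expr (Entry a b) t) (R, X) 2 (R(1 := t), X(t := A (R a) (R b)))"
  using runs_Instr2[of A z "Set_Idx 1 t" "Read_Entry 1 a b" "(R, X)"] ab by simp
 then show ?case unfolding expr_cost.simps by (rule ex_state) auto
next
 case (Bin f e1 e2)
 from Bin.IH(1)[of t R X] Bin.prems obtain R1 X1 where 1: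
  "runs A z (comp_expr e1 t) (R, X) (expr_cost e1) (R1, X1)" "\<forall>r. r \<notin> {1, 2, 3} \<longrightarrow> R1 r = R r"
  "X1 t = eval_expr A z R X e1" "\<forall>c<t. X1 c = X c" by auto
 have "expr_cells e2 \<subseteq> {..<Suc t}" using Bin.prems by auto
 with Bin.IH(2)[of "Suc t" R1 X1] Bin.prems obtain R2 X2 where 2:
  "runs A z (comp_expr e2 (Suc t)) (R1, X1) (expr_cost e2) (R2, X2)" "\<forall>r. r \<notin> {1, 2, 3} \<longrightarrow> R2 r = R1 r"
  "X2 (Suc t) = eval_expr A z R1 X1 e2" "\<forall>c<Suc t. X2 c = X1 c" by auto
 have e2: "eval_expr A z R1 X1 e2 = eval_expr A z R X e2"
 proof (rule eval_expr_cong)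
  fix r assume "r \<in> expr_regs e2"
  then have "r \<ge> 4" using Bin.prems by auto
  then show "R1 r = R r" using 1(2) by auto
 next
  fix c assume "c \<in> expr_cells e2"
  then show "X1 c = X c" using Bin.prems 1(4) by auto
 qed
 define R3 where "R3 = R2(1 := t, 2 := Suc t)"
 define X3 where "X3 = X2(t := arith f (X2 t) (X2 (Suc t)))"
 have 3: "runs A z (Seq (Instr (Set_Idx 1 t)) (Seq (Instr (Set_Idx 2 (Suc t))) (Instr (Arith f 1 1 2)))) (R2, X2) 3 (R3, X3)"
  using runs_Instr3[of A z "Set_Idx 1 t" "Set_Idx 2 (Suc t)" "Arith f 1 1 2" "(R2, X2)"]
  by (simp add: R3_def X3_def)
 have "runs A z (comp_expr (Bin f e1 e2) t) (R, X) (expr_cost (Bin f e1 e2)) (R3, X3)"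
  unfolding comp_expr.simps expr_cost.simps by (rule runs.Seq[OF 1(1) runs.Seq[OF 2(1) 3]])
 moreover have "\<forall>r. r \<notin> {1, 2, 3} \<longrightarrow> R3 r = R r" using 1 2 by (auto simp: R3_def)
 moreover have "X3 t = eval_expr A z R X (Bin f e1 e2)" using 1 2 e2 by (simp add: X3_def)
 moreover have "\<forall>c<t. X3 c = X c" using 1 2 by (auto simp: X3_def)
 ultimately show ?case by blast
qed

text \<open>
 \<open>accum A z n p L c b T g\<close>: in at most \<open>T\<close> steps the program \<open>p\<close> adds \<open>g\<close> of the registers to
 cell \<open>c\<close>, changing only the registers in \<open>L\<close>, the scratch registers and cells from \<open>b\<close> on.
\<close>

definition accum :: "(nat \<Rightarrow> nat \<Rightarrow> complex) \<Rightarrow> complex \<Rightarrow> nat \<Rightarrow> prog \<Rightarrow> nat set \<Rightarrow> nat \<Rightarrow> nat \<Rightarrow> nat \<Rightarrow>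
  ((nat \<Rightarrow> nat) \<Rightarrow> complex) \<Rightarrow> bool" where
 "accum A z n p L c b T g \<longleftrightarrow>
   (\<forall>R R'. (\<forall>r. r \<notin> L \<union> {1, 2, 3} \<longrightarrow> R r = R' r) \<longrightarrow> g R = g R') \<and>
   (\<forall>R X. R 0 = n \<and> R 4 = 0 \<and> R 5 = 1 \<longrightarrow> (\<exists>t R' X'. runs A z p (R, X) t (R', X') \<and> t \<le> T \<and>
    (\<forall>r. r \<notin> L \<union> {1, 2, 3} \<longrightarrow> R' r = R r) \<and> X' c = X c + g R \<and> (\<forall>c'<b. c' \<noteq> c \<longrightarrow> X' c' = X c')))"

definition add_expr :: "nat \<Rightarrow> expr \<Rightarrow> nat \<Rightarrow> prog" where
 "add_expr c e b = Seq (comp_expr (Bin Plus (Cell c) e) b) (copy_cell c b (Suc b))"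

lemma accum_add_expr:
 assumes c: "c < b" and e: "expr_cells e = {}" "expr_regs e \<subseteq> {4..}"
 shows "accum A z n (add_expr c e b) {} c b (expr_cost e + 13) (\<lambda>R. eval_expr A z R (\<lambda>_. 0) e)"
 unfolding accum_def
proof (intro conjI allI impI)
 fix R R' :: "nat \<Rightarrow> nat" assume *: "\<forall>r. r \<notin> {} \<union> {1, 2, 3} \<longrightarrow> R r = R' r"
 show "eval_expr A z R (\<lambda>_. 0) e = eval_expr A z R' (\<lambda>_. 0) e"
 proof (rule eval_expr_cong)
  fix r assume "r \<in> expr_regs e"
  then have "r \<ge> 4" using e by auto
  then show "R r = R' r" using * by auto
 qed simp
next
 fix R :: "nat \<Rightarrow> nat" and X :: "nat \<Rightarrow> complex"
 obtain R1 X1 where 1: "runs A z (comp_expr (Bin Plus (Cell c) e) b) (R, X) (expr_cost (Bin Plus (Cell c) e)) (R1, X1)"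
  "\<forall>r. r \<notin> {1, 2, 3} \<longrightarrow> R1 r = R r" "X1 b = eval_expr A z R X (Bin Plus (Cell c) e)" "\<forall>c<b. X1 c = X c"
  using runs_comp_expr[of "Bin Plus (Cell c) e" b A z R X] c e by auto
 have 2: "runs A z (copy_cell c b (Suc b)) (R1, X1) 5 (R1(1 := c, 2 := b, 3 := Suc b), X1(Suc b := 0, c := X1 b))"
  by (rule runs_copy_cell) simp
 have "eval_expr A z R X e = eval_expr A z R (\<lambda>_. 0) e"
  using e by (intro eval_expr_cong) auto
 then show "\<exists>t R' X'. runs A z (add_expr c e b) (R, X) t (R', X') \<and> t \<le> expr_cost e + 13 \<and>
   (\<forall>r. r \<notin> {} \<union> {1, 2, 3} \<longrightarrow> R' r = R r) \<and> X' c = X c + eval_expr A z R (\<lambda>_. 0) e \<and> (\<forall>c'<b. c' \<noteq> c \<longrightarrow> X' c' = X c')"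
  unfolding add_expr_def by (intro ex_run[OF runs.Seq[OF 1(1) 2]]) (use 1 c in auto)
qed

text \<open>Subtraction of indices is truncated, so (a - b) + (b - a) vanishes exactly if a = b. The
  else branch is an assignment to a scratch register, which serves as an empty program.\<close>

definition guard :: "nat \<times> nat \<Rightarrow> prog \<Rightarrow> prog" where
 "guard = (\<lambda>(a, b) p. Seq (Instr (Sub_Idx 1 a b)) (Seq (Instr (Sub_Idx 2 b a)) (Seq (Instr (Add_Idx 1 1 2))
   (If_Nonzero 1 p (Instr (Set_Idx 1 0))))))"

lemma accum_guard:
 assumes p: "accum A z n p L c b T g" and r: "x \<notin> L \<union> {1, 2, 3}" "y \<notin> L \<union> {1, 2, 3}"
 shows "accum A z n (guard (x, y) p) L c b (T + 5) (\<lambda>R. if R x \<noteq> R y then g R else 0)"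
 unfolding accum_def
proof (intro conjI allI impI)
 fix R R' :: "nat \<Rightarrow> nat" assume *: "\<forall>r. r \<notin> L \<union> {1, 2, 3} \<longrightarrow> R r = R' r"
 then have "g R = g R'" using p unfolding accum_def by blast
 then show "(if R x \<noteq> R y then g R else 0) = (if R' x \<noteq> R' y then g R' else 0)"
  using * r by auto
next
 fix R :: "nat \<Rightarrow> nat" and X :: "nat \<Rightarrow> complex" assume R: "R 0 = n \<and> R 4 = 0 \<and> R 5 = 1"
 define R1 where "R1 = R(1 := (R x - R y) + (R y - R x), 2 := R y - R x)"
 have pre: "runs A z (guard (x, y) p) (R, X) (Suc (Suc (Suc t))) s"
  if "runs A z (If_Nonzero 1 p (Instr (Set_Idx 1 0))) (R1, X) t s" for t s
 proof -
  have "exec_instr A z (Add_Idx 1 1 2) (R(1 := R x - R y, 2 := R y - R x), X) = (R1, X)"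
   by (simp add: R1_def fun_upd_twist)
  then show ?thesis
   unfolding guard_def split using r that
   by (intro runs_Seq_Instr) (simp, intro runs_Seq_Instr, simp, intro runs_Seq_Instr, simp)
 qed
 have R1: "\<forall>r. r \<notin> L \<union> {1, 2, 3} \<longrightarrow> R r = R1 r" by (simp add: R1_def)
 show "\<exists>t R' X'. runs A z (guard (x, y) p) (R, X) t (R', X') \<and> t \<le> T + 5 \<and>
   (\<forall>r. r \<notin> L \<union> {1, 2, 3} \<longrightarrow> R' r = R r) \<and> X' c = X c + (if R x \<noteq> R y then g R else 0) \<and>
   (\<forall>c'<b. c' \<noteq> c \<longrightarrow> X' c' = X c')"
 proof (cases "R x = R y")
  case True
  have "runs A z (If_Nonzero 1 p (Instr (Set_Idx 1 0))) (R1, X) (Suc 0 + 1) (exec_instr A z (Set_Idx 1 0) (R1, X))"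
   using True by (intro runs.If_False runs_Instr) (simp add: R1_def)
  from pre[OF this] have "runs A z (guard (x, y) p) (R, X) 5 (R1(1 := 0), X)"
   by (simp add: eval_nat_numeral)
  then show ?thesis by (rule ex_run) (use True in \<open>auto simp: R1_def\<close>)
 next
  case False
  have "R1 0 = n \<and> R1 4 = 0 \<and> R1 5 = 1" using R by (simp add: R1_def)
  then obtain t R' X' where 1: "runs A z p (R1, X) t (R', X')" "t \<le> T"
   "\<forall>r. r \<notin> L \<union> {1, 2, 3} \<longrightarrow> R' r = R1 r" "X' c = X c + g R1" "\<forall>c'<b. c' \<noteq> c \<longrightarrow> X' c' = X c'"
   using p unfolding accum_def by metis
  have "runs A z (If_Nonzero 1 p (Instr (Set_Idx 1 0))) (R1, X) (t + 1) (R', X')"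
   using False 1(1) by (intro runs.If_True) (auto simp: R1_def)
  from pre[OF this] have "runs A z (guard (x, y) p) (R, X) (t + 4) (R', X')"
   by (simp add: eval_nat_numeral)
  moreover have "g R1 = g R" using p R1 unfolding accum_def by metis
  ultimately show ?thesis by (intro ex_run) (assumption, use 1 R1 False in auto)
 qed
qed

text \<open>Adding register 4, which holds 0, copies n into the counter. The counter is decreased
  before the body is run, so the body sees n - 1, ..., 0.\<close>

definition for_loop :: "nat \<Rightarrow> prog \<Rightarrow> prog" where
 "for_loop r p = Seq (Instr (Add_Idx r 0 4)) (While_Nonzero r (Seq (Instr (Sub_Idx r r 5)) p))"

lemma accum_for_loop:
 assumes p: "accum A z n p L c b T g" and r: "r \<notin> L" "r \<ge> 6"
  and L: "L \<subseteq> {6..}"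
 shows "accum A z n (for_loop r p) (insert r L) c b (n * (T + 2) + 2) (\<lambda>R. \<Sum>i<n. g (R(r := i)))"
proof -
 have gc: "g R = g R'" if "\<forall>r. r \<notin> L \<union> {1, 2, 3} \<longrightarrow> R r = R' r" for R R'
  using p that unfolding accum_def by blast
 have loop: "\<exists>t R' X'. runs A z (While_Nonzero r (Seq (Instr (Sub_Idx r r 5)) p)) (R, X) t (R', X') \<and>
   t \<le> k * (T + 2) + 1 \<and> (\<forall>r'. r' \<notin> insert r L \<union> {1, 2, 3} \<longrightarrow> R' r' = R r') \<and>
   X' c = X c + (\<Sum>i<k. g (R(r := i))) \<and> (\<forall>c'<b. c' \<noteq> c \<longrightarrow> X' c' = X c')"
  if "R 0 = n" "R 4 = 0" "R 5 = 1" "R r = k" for k R X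
  using that
 proof (induction k arbitrary: R X)
  case 0
  then have "runs A z (While_Nonzero r (Seq (Instr (Sub_Idx r r 5)) p)) (R, X) 1 (R, X)"
   by (intro runs.While_False) simp
  then show ?case by (rule ex_run) auto
 next
  case (Suc k)
  define R1 where "R1 = R(r := k)"
  have "R1 0 = n \<and> R1 4 = 0 \<and> R1 5 = 1" using Suc.prems r by (simp add: R1_def)
  then obtain t1 R2 X2 where 1: "runs A z p (R1, X) t1 (R2, X2)" "t1 \<le> T"
   "\<forall>r. r \<notin> L \<union> {1, 2, 3} \<longrightarrow> R2 r = R1 r" "X2 c = X c + g R1" "\<forall>c'<b. c' \<noteq> c \<longrightarrow> X2 c' = X c'"
   using p unfolding accum_def by metis
  have nL: "0 \<notin> L" "4 \<notin> L" "5 \<notin> L" using L by auto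
  have "R2 0 = n" "R2 4 = 0" "R2 5 = 1" "R2 r = k"
   using 1(3) nL r Suc.prems by (auto simp: R1_def)
  from Suc.IH[OF this, of X2] obtain t3 R3 X3 where 3:
   "runs A z (While_Nonzero r (Seq (Instr (Sub_Idx r r 5)) p)) (R2, X2) t3 (R3, X3)" "t3 \<le> k * (T + 2) + 1"
   "\<forall>r'. r' \<notin> insert r L \<union> {1, 2, 3} \<longrightarrow> R3 r' = R2 r'"
   "X3 c = X2 c + (\<Sum>i<k. g (R2(r := i)))" "\<forall>c'<b. c' \<noteq> c \<longrightarrow> X3 c' = X2 c'" by blast
  have "runs A z (Seq (Instr (Sub_Idx r r 5)) p) (R, X) (Suc t1) (R2, X2)"
   using 1(1) Suc.prems by (intro runs_Seq_Instr) (simp add: R1_def)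
  then have run: "runs A z (While_Nonzero r (Seq (Instr (Sub_Idx r r 5)) p)) (R, X) (Suc t1 + t3 + 1) (R3, X3)"
   using Suc.prems 3(1) by (intro runs.While_True) auto
  have "g (R2(r := i)) = g (R(r := i))" for i
   using 1(3) by (intro gc) (auto simp: R1_def)
  then have "X3 c = X c + (\<Sum>i<Suc k. g (R(r := i)))"
   using 1(4) 3(4) by (simp add: R1_def)
  moreover have "\<forall>r'. r' \<notin> insert r L \<union> {1, 2, 3} \<longrightarrow> R3 r' = R r'"
   using 1(3) 3(3) by (auto simp: R1_def)
  moreover have "Suc t1 + t3 + 1 \<le> Suc k * (T + 2) + 1" using 1(2) 3(2) by simp
  moreover have "\<forall>c'<b. c' \<noteq> c \<longrightarrow> X3 c' = X c'" using 1(5) 3(5) by auto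
  ultimately show ?case using run by blast
 qed
 show ?thesis
  unfolding accum_def
 proof (intro conjI allI impI)
  fix R R' :: "nat \<Rightarrow> nat" assume "\<forall>r'. r' \<notin> insert r L \<union> {1, 2, 3} \<longrightarrow> R r' = R' r'"
  then have "g (R(r := i)) = g (R'(r := i))" for i by (intro gc) auto
  then show "(\<Sum>i<n. g (R(r := i))) = (\<Sum>i<n. g (R'(r := i)))" by simp
 next
  fix R :: "nat \<Rightarrow> nat" and X :: "nat \<Rightarrow> complex" assume R: "R 0 = n \<and> R 4 = 0 \<and> R 5 = 1"
  have "(R(r := n)) 0 = n" "(R(r := n)) 4 = 0" "(R(r := n)) 5 = 1" "(R(r := n)) r = n" using R r by auto
  from loop[OF this, of X] obtain t R' X' where 1:
   "runs A z (While_Nonzero r (Seq (Instr (Sub_Idx r r 5)) p)) (R(r := n), X) t (R', X')" "t \<le> n * (T + 2) + 1"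
   "\<forall>r'. r' \<notin> insert r L \<union> {1, 2, 3} \<longrightarrow> R' r' = (R(r := n)) r'"
   "X' c = X c + (\<Sum>i<n. g ((R(r := n))(r := i)))" "\<forall>c'<b. c' \<noteq> c \<longrightarrow> X' c' = X c'" by blast
  have "runs A z (for_loop r p) (R, X) (Suc t) (R', X')"
   unfolding for_loop_def using 1(1) R by (intro runs_Seq_Instr) simp
  then show "\<exists>t R' X'. runs A z (for_loop r p) (R, X) t (R', X') \<and> t \<le> n * (T + 2) + 2 \<and>
    (\<forall>r'. r' \<notin> insert r L \<union> {1, 2, 3} \<longrightarrow> R' r' = R r') \<and> X' c = X c + (\<Sum>i<n. g (R(r := i))) \<and>
    (\<forall>c'<b. c' \<noteq> c \<longrightarrow> X' c' = X c')"
   by (rule ex_run) (use 1 in auto)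
 qed
qed

fun upds :: "(nat \<Rightarrow> nat) \<Rightarrow> nat list \<Rightarrow> nat list \<Rightarrow> nat \<Rightarrow> nat" where
 "upds R (r # rs) (x # xs) = upds (R(r := x)) rs xs"
| "upds R _ _ = R"

lemma upds_notin: "r \<notin> set rs \<Longrightarrow> upds R rs xs r = R r"
 by (induction R rs xs rule: upds.induct) auto

lemma upds_nth: "distinct rs \<Longrightarrow> length xs = length rs \<Longrightarrow> l < length rs \<Longrightarrow> upds R rs xs (rs ! l) = xs ! l"
proof (induction R rs xs arbitrary: l rule: upds.induct)
 case (1 R r rs x xs)
 show ?case
 proof (cases l)
  case 0
  then show ?thesis using 1 by (simp add: upds_notin)
 next
  case (Suc l')
  then show ?thesis using 1(1)[of l'] 1(2-4) unfolding upds.simps by (simp del: fun_upd_apply)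
 qed
qed auto

lemma accum_loops:
 assumes p: "accum A z n p {} c b T g" and rs: "distinct rs" "set rs \<subseteq> {6..}" and n: "n \<ge> 1"
 shows "\<exists>T'. T' \<le> n ^ length rs * (T + 4 * length rs) \<and>
  accum A z n (foldr for_loop rs p) (set rs) c b T' (\<lambda>R. \<Sum>xs\<in>tup (length rs) {..<n}. g (upds R rs xs))"
 using rs
proof (induction rs)
 case Nil
 then show ?case using p by auto
next
 case (Cons r rs)
 then obtain T' where T': "T' \<le> n ^ length rs * (T + 4 * length rs)"
  "accum A z n (foldr for_loop rs p) (set rs) c b T' (\<lambda>R. \<Sum>xs\<in>tup (length rs) {..<n}. g (upds R rs xs))" by auto
 \<comment> \<open>Each loop multiplies the cost by n and adds at most 4 n, which the term 4 per
   loop absorbs.\<close>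
 have "n * (T' + 2) + 2 \<le> n * T' + 4 * n" using n by simp
 also have "\<dots> \<le> n * (n ^ length rs * (T + 4 * length rs)) + 4 * (n ^ Suc (length rs))"
  using T'(1) n by (intro add_mono mult_left_mono) auto
 also have "\<dots> = n ^ length (r # rs) * (T + 4 * length (r # rs))" by (simp add: algebra_simps)
 finally have "n * (T' + 2) + 2 \<le> n ^ length (r # rs) * (T + 4 * length (r # rs))" .
 moreover have "accum A z n (foldr for_loop (r # rs) p) (set (r # rs)) c b (n * (T' + 2) + 2)
   (\<lambda>R. \<Sum>xs\<in>tup (length (r # rs)) {..<n}. g (upds R (r # rs) xs))"
  using accum_for_loop[OF T'(2), of r] Cons.prems by (simp add: sum_tup_Suc)
 ultimately show ?case by blast
qed

lemma accum_guards:
 assumes p: "accum A z n p {} c b T g" and ps: "\<forall>(x, y)\<in>set ps. x \<ge> 4 \<and> y \<ge> 4"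
 shows "accum A z n (foldr guard ps p) {} c b (T + 5 * length ps)
  (\<lambda>R. if \<forall>(x, y)\<in>set ps. R x \<noteq> R y then g R else 0)"
 using ps
proof (induction ps)
 case Nil
 then show ?case using p by simp
next
 case (Cons q ps)
 obtain x y where q: "q = (x, y)" by (cases q)
 have "accum A z n (guard (x, y) (foldr guard ps p)) {} c b (T + 5 * length ps + 5)
  (\<lambda>R. if R x \<noteq> R y then (if \<forall>(x, y)\<in>set ps. R x \<noteq> R y then g R else 0) else 0)"
  using Cons q by (intro accum_guard) auto
 moreover have "(\<lambda>R. if R x \<noteq> R y then (if \<forall>(x, y)\<in>set ps. R x \<noteq> R y then g R else 0) else 0) =
   (\<lambda>R. if \<forall>(x, y)\<in>set (q # ps). R x \<noteq> R y then g R else 0)"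
  using q by (auto simp: fun_eq_iff)
 ultimately show ?case using q by (simp add: add_ac)
qed

section \<open>Enumerating pairs of injective tuples by nested loops\<close>

definition pairs :: "nat \<Rightarrow> nat \<Rightarrow> (nat \<times> nat) list" where
 "pairs a k = [(a + l, a + m). m \<leftarrow> [0..<k], l \<leftarrow> [0..<m]]"

fun entries :: "nat \<Rightarrow> nat \<Rightarrow> expr" where
 "entries k 0 = Const 1"
| "entries k (Suc l) = Bin Times (entries k l) (Entry (6 + l) (6 + k + l))"

text \<open>Registers 6 to 5 + k hold the row indices and the following k registers the column
  indices. All tuples are run through, n^(2 k) pairs, and the guards skip those with a repetition.
  The sum is collected in cell k + 1.\<close>

definition nest :: "nat \<Rightarrow> nat \<Rightarrow> prog" where
 "nest k b = foldr for_loop [6..<6 + 2 * k]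
   (foldr guard (pairs 6 k @ pairs (6 + k) k) (add_expr (Suc k) (entries k k) b))"

lemma sum_tup_add:
 assumes "finite E"
 shows "(\<Sum>xs\<in>tup (k + l) E. f xs) = (\<Sum>xs\<in>tup k E. \<Sum>ys\<in>tup l E. f (xs @ ys))"
 using assms by (induction k arbitrary: f) (auto simp: sum_tup_Suc)

lemma distinct_iff_less: "distinct xs \<longleftrightarrow> (\<forall>l m. l < m \<and> m < length xs \<longrightarrow> xs ! l \<noteq> xs ! m)"
proof
 assume *: "\<forall>l m. l < m \<and> m < length xs \<longrightarrow> xs ! l \<noteq> xs ! m"
 show "distinct xs"
  unfolding distinct_conv_nth
 proof (intro allI impI)
  fix i j assume "i < length xs" "j < length xs" "i \<noteq> j"
  then show "xs ! i \<noteq> xs ! j"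
   using *[rule_format, of i j] *[rule_format, of j i] by (cases "i < j") auto
 qed
qed (auto simp: distinct_conv_nth)

lemma accum_weaken:
 assumes p: "accum A z n p L c b T (\<lambda>_. y)" and L: "L \<subseteq> L'"
 shows "accum A z n p L' c b T (\<lambda>_. y)"
 unfolding accum_def
proof (intro conjI allI impI)
 fix R :: "nat \<Rightarrow> nat" and X :: "nat \<Rightarrow> complex" assume "R 0 = n \<and> R 4 = 0 \<and> R 5 = 1"
 then obtain t R' X' where "runs A z p (R, X) t (R', X')" "t \<le> T"
  "\<forall>r. r \<notin> L \<union> {1, 2, 3} \<longrightarrow> R' r = R r" "X' c = X c + y" "\<forall>c'<b. c' \<noteq> c \<longrightarrow> X' c' = X c'"
  using p unfolding accum_def by blast
 then show "\<exists>t R' X'. runs A z p (R, X) t (R', X') \<and> t \<le> T \<and> (\<forall>r. r \<notin> L' \<union> {1, 2, 3} \<longrightarrow> R' r = R r) \<and>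
   X' c = X c + y \<and> (\<forall>c'<b. c' \<noteq> c \<longrightarrow> X' c' = X c')"
  using L by blast
qed simp

lemma accum_nest:
 assumes b: "Suc k < b"
 shows "\<exists>K. \<forall>n\<ge>1. \<forall>A z. \<exists>T. T \<le> n ^ (2 * k) * K \<and> accum A z n (nest k b) {6..} (Suc k) b T
  (\<lambda>_. \<Sum>is\<in>dtup k {..<n}. \<Sum>js\<in>dtup k {..<n}. prod_list (map2 A is js))"
proof -
 define ps where "ps = pairs 6 k @ pairs (6 + k) k"
 define e where "e = entries k k"
 have e: "expr_cells (entries k l) = {}" "expr_regs (entries k l) \<subseteq> {4..}" for l
  by (induction l) auto
 define T where "T = expr_cost e + 13 + 5 * length ps"
 define rs where "rs = [6..<6 + 2 * k]"
 have rs: "distinct rs" "set rs \<subseteq> {6..}" "length rs = k + k" by (auto simp: rs_def)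
 have nest: "nest k b = foldr for_loop rs (foldr guard ps (add_expr (Suc k) e b))"
  by (simp only: nest_def rs_def ps_def e_def)
 have ps: "set ps = {(6 + l, 6 + m) |l m. l < m \<and> m < k} \<union> {(6 + k + l, 6 + k + m) |l m. l < m \<and> m < k}"
  unfolding ps_def pairs_def by auto
 have "\<exists>T'. T' \<le> n ^ (2 * k) * (T + 8 * k) \<and> accum A z n (nest k b) {6..} (Suc k) b T'
  (\<lambda>_. \<Sum>is\<in>dtup k {..<n}. \<Sum>js\<in>dtup k {..<n}. prod_list (map2 A is js))" if n: "n \<ge> 1" for n A z
 proof -
  have "accum A z n (add_expr (Suc k) e b) {} (Suc k) b (expr_cost e + 13) (\<lambda>R. eval_expr A z R (\<lambda>_. 0) e)"
   unfolding e_def using b e[of k] by (intro accum_add_expr) auto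
  then have "accum A z n (foldr guard ps (add_expr (Suc k) e b)) {} (Suc k) b T
   (\<lambda>R. if \<forall>(x, y)\<in>set ps. R x \<noteq> R y then eval_expr A z R (\<lambda>_. 0) e else 0)"
   unfolding T_def by (rule accum_guards) (auto simp: ps)
  from accum_loops[OF this rs(1,2) n] obtain T' where T': "T' \<le> n ^ length rs * (T + 4 * length rs)"
   "accum A z n (foldr for_loop rs (foldr guard ps (add_expr (Suc k) e b))) (set rs) (Suc k) b T'
    (\<lambda>R. \<Sum>xs\<in>tup (length rs) {..<n}. if \<forall>(x, y)\<in>set ps. upds R rs xs x \<noteq> upds R rs xs y
      then eval_expr A z (upds R rs xs) (\<lambda>_. 0) e else 0)"
   by blast
  have val: "(\<Sum>xs\<in>tup (k + k) {..<n}.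
    if \<forall>(x, y)\<in>set ps. upds R rs xs x \<noteq> upds R rs xs y then eval_expr A z (upds R rs xs) (\<lambda>_. 0) e else 0) =
    (\<Sum>is\<in>dtup k {..<n}. \<Sum>js\<in>dtup k {..<n}. prod_list (map2 A is js))" for R
  proof -
   have "(if \<forall>(x, y)\<in>set ps. upds R rs (is @ js) x \<noteq> upds R rs (is @ js) y then eval_expr A z (upds R rs (is @ js)) (\<lambda>_. 0) e else 0) =
     (if distinct is \<and> distinct js then prod_list (map2 A is js) else 0)"
    if "is \<in> tup k {..<n}" "js \<in> tup k {..<n}" for "is" js
   proof -
    have len: "length is = k" "length js = k" using that by (auto simp: tup_def)
    define R' where "R' = upds R rs (is @ js)"
    have Ri: "R' (6 + l) = is ! l" if "l < k" for l
     using upds_nth[of rs "is @ js" l R] that len rs by (simp add: R'_def nth_append) (simp add: rs_def)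
    have Rj: "R' (6 + k + l) = js ! l" if "l < k" for l
     using upds_nth[of rs "is @ js" "k + l" R] that len rs by (simp add: R'_def nth_append) (simp add: rs_def add_ac)
    have "(\<forall>(x, y)\<in>set ps. R' x \<noteq> R' y) \<longleftrightarrow>
      (\<forall>l m. l < m \<and> m < k \<longrightarrow> is ! l \<noteq> is ! m) \<and> (\<forall>l m. l < m \<and> m < k \<longrightarrow> js ! l \<noteq> js ! m)"
    proof -
     have "(\<forall>(x, y)\<in>set ps. R' x \<noteq> R' y) \<longleftrightarrow>
      (\<forall>l m. l < m \<and> m < k \<longrightarrow> R' (6 + l) \<noteq> R' (6 + m)) \<and>
      (\<forall>l m. l < m \<and> m < k \<longrightarrow> R' (6 + k + l) \<noteq> R' (6 + k + m))"
      unfolding ps by blast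
     then show ?thesis by (simp add: Ri Rj cong: conj_cong imp_cong)
    qed
    also have "(\<forall>l m. l < m \<and> m < k \<longrightarrow> is ! l \<noteq> is ! m) \<longleftrightarrow> distinct is"
     unfolding distinct_iff_less len ..
    also have "(\<forall>l m. l < m \<and> m < k \<longrightarrow> js ! l \<noteq> js ! m) \<longleftrightarrow> distinct js"
     unfolding distinct_iff_less len ..
    finally have guards: "(\<forall>(x, y)\<in>set ps. R' x \<noteq> R' y) \<longleftrightarrow> distinct is \<and> distinct js" .
    have "eval_expr A z R' (\<lambda>_. 0) (entries k l) = (\<Prod>i<l. A (is ! i) (js ! i))" if "l \<le> k" for l
     using that by (induction l) (simp_all add: Ri Rj del: add_Suc_shift)
    then have "eval_expr A z R' (\<lambda>_. 0) e = (\<Prod>i<k. A (is ! i) (js ! i))" by (simp add: e_def)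
    also have "\<dots> = prod_list (map2 A is js)"
     using len by (simp add: prod.list_conv_set_nth atLeast0LessThan)
    finally show ?thesis unfolding R'_def[symmetric] guards by simp
   qed
   then have "(\<Sum>xs\<in>tup (k + k) {..<n}.
     if \<forall>(x, y)\<in>set ps. upds R rs xs x \<noteq> upds R rs xs y then eval_expr A z (upds R rs xs) (\<lambda>_. 0) e else 0) =
     (\<Sum>is\<in>tup k {..<n}. \<Sum>js\<in>tup k {..<n}. if distinct is \<and> distinct js then prod_list (map2 A is js) else 0)"
    by (subst sum_tup_add) (auto intro!: sum.cong)
   also have "\<dots> = (\<Sum>is\<in>dtup k {..<n}. \<Sum>js\<in>tup k {..<n}. if distinct is \<and> distinct js then prod_list (map2 A is js) else 0)"
    by (rule sum.mono_neutral_right[OF finite_tup]) (auto simp: tup_def dtup_def)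
   also have "\<dots> = (\<Sum>is\<in>dtup k {..<n}. \<Sum>js\<in>dtup k {..<n}. prod_list (map2 A is js))"
    by (intro sum.cong refl sum.mono_neutral_cong_right finite_tup) (auto simp: tup_def dtup_def)
   finally show ?thesis .
  qed
  have "accum A z n (nest k b) {6..} (Suc k) b T' (\<lambda>_. \<Sum>is\<in>dtup k {..<n}. \<Sum>js\<in>dtup k {..<n}. prod_list (map2 A is js))"
   using accum_weaken[OF T'(2)[unfolded rs(3) val] rs(2)] unfolding nest .
  moreover have "T' \<le> n ^ (2 * k) * (T + 8 * k)" using T'(1) by (simp add: rs(3) mult_2)
  ultimately show ?thesis by blast
 qed
 then show ?thesis by blast
qed

section \<open>Expressions for the coefficients and the truncated series\<close>

fun fall_expr :: "nat \<Rightarrow> expr" where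
 "fall_expr 0 = Const 1"
| "fall_expr (Suc k) = Bin Times (fall_expr k) (Bin Minus (Cell 1) (Const (int k)))"

text \<open>Cell 1 holds n as a complex number and cell k + 1 the sum over pairs of tuples. The
  ratio n! / (n - k)! enters as a falling factorial, so the length of the expression depends on k
  only.\<close>

definition pcoeff_expr :: "nat \<Rightarrow> expr" where
 "pcoeff_expr k = (if k = 0 then Const 1 else Bin Divide (Cell (Suc k)) (Bin Times (fall_expr k) (Const (fact k))))"

definition sum_expr :: "expr list \<Rightarrow> expr" where
 "sum_expr es = foldr (Bin Plus) es (Const 0)"

text \<open>The recursion \<open>log_coeff_rec\<close> unfolded into a single expression without
  sharing. Its size is exponential in k, but independent of n, and hence part of the constant in the
  running time.\<close>

fun lcoeff_expr :: "nat \<Rightarrow> expr" where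
 "lcoeff_expr k = Bin Minus (pcoeff_expr k) (Bin Divide
   (sum_expr (map (\<lambda>j. Bin Times (Bin Times (Const (int j)) (lcoeff_expr j)) (pcoeff_expr (k - j))) [1..<k]))
   (Const (int k)))"

declare lcoeff_expr.simps [simp del]

fun pow_expr :: "nat \<Rightarrow> expr" where
 "pow_expr 0 = Const 1"
| "pow_expr (Suc k) = Bin Times (pow_expr k) Point"

definition trunc_expr :: "nat \<Rightarrow> expr" where
 "trunc_expr d = sum_expr (map (\<lambda>k. Bin Times (lcoeff_expr k) (pow_expr k)) [1..<Suc d])"

lemma eval_sum_expr: "eval_expr A z R X (sum_expr es) = (\<Sum>e\<leftarrow>es. eval_expr A z R X e)"
 unfolding sum_expr_def by (induction es) auto

lemma cells_sum_expr: "expr_cells (sum_expr es) = (\<Union>e\<in>set es. expr_cells e)"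
 and regs_sum_expr: "expr_regs (sum_expr es) = (\<Union>e\<in>set es. expr_regs e)"
 unfolding sum_expr_def by (induction es) auto

lemma cells_pcoeff_expr: "expr_cells (pcoeff_expr k) \<subseteq> {..Suc k}" "expr_regs (pcoeff_expr k) = {}"
proof -
 have "expr_cells (fall_expr j) \<subseteq> {..1}" "expr_regs (fall_expr j) = {}" for j
  by (induction j) auto
 note f = this
 have "expr_cells (fall_expr k) \<subseteq> {..Suc k}" using f(1)[of k] by (rule order_trans) auto
 then show "expr_cells (pcoeff_expr k) \<subseteq> {..Suc k}" by (auto simp: pcoeff_expr_def)
 show "expr_regs (pcoeff_expr k) = {}" using f(2)[of k] by (simp add: pcoeff_expr_def)
qed

lemma cells_lcoeff_expr: "expr_cells (lcoeff_expr k) \<subseteq> {..Suc k} \<and> expr_regs (lcoeff_expr k) = {}"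
proof (induction k rule: less_induct)
 case (less k)
 have p: "expr_cells (pcoeff_expr (k - j)) \<subseteq> {..Suc k}" for j
  using cells_pcoeff_expr(1)[of "k - j"] by (rule order_trans) auto
 have l: "expr_cells (lcoeff_expr j) \<subseteq> {..Suc k}" if "j < k" for j
 proof -
  have "{..Suc j} \<subseteq> {..Suc k}" using that by auto
  with less[OF that] show ?thesis by (meson order_trans)
 qed
 show ?case
 proof
  show "expr_cells (lcoeff_expr k) \<subseteq> {..Suc k}"
   unfolding lcoeff_expr.simps[of k] using p[of 0] p l by (simp add: cells_sum_expr UN_subset_iff)
  show "expr_regs (lcoeff_expr k) = {}"
   unfolding lcoeff_expr.simps[of k] using less by (simp add: regs_sum_expr cells_pcoeff_expr(2))
 qed
qed

lemma cells_trunc_expr: "expr_cells (trunc_expr d) \<subseteq> {..<d + 2}" "expr_regs (trunc_expr d) = {}"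
proof -
 have p: "expr_cells (pow_expr k) = {}" "expr_regs (pow_expr k) = {}" for k
  by (induction k) auto
 have "expr_cells (lcoeff_expr k) \<subseteq> {..<d + 2}" if "k < Suc d" for k
 proof -
  have "{..Suc k} \<subseteq> {..<d + 2}" using that by auto
  with cells_lcoeff_expr[of k] show ?thesis by (meson order_trans)
 qed
 then show "expr_cells (trunc_expr d) \<subseteq> {..<d + 2}"
  unfolding trunc_expr_def cells_sum_expr by (simp add: UN_subset_iff p) (metis less_Suc_eq)
 show "expr_regs (trunc_expr d) = {}"
  unfolding trunc_expr_def regs_sum_expr by (simp add: p cells_lcoeff_expr)
qed

definition csum :: "nat \<Rightarrow> (nat \<Rightarrow> nat \<Rightarrow> complex) \<Rightarrow> nat \<Rightarrow> complex" where
 "csum n A k = (\<Sum>is\<in>dtup k {..<n}. \<Sum>js\<in>dtup k {..<n}. prod_list (map2 A is js))"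

lemma prod_falling: "k \<le> n \<Longrightarrow> (\<Prod>i<k. of_nat n - of_nat i) * fact (n - k) = (fact n :: complex)"
proof (induction k)
 case (Suc k)
 then have "n - k = Suc (n - Suc k)" by simp
 then have f: "(fact (n - k) :: complex) = of_nat (n - k) * fact (n - Suc k)" by (metis fact_Suc)
 have d: "of_nat n - of_nat k = (of_nat (n - k) :: complex)"
  using Suc.prems by (auto simp: of_nat_diff)
 show ?case using Suc unfolding prod.lessThan_Suc d by (simp only: f mult.assoc)
qed simp

lemma eval_pcoeff_expr:
 assumes N: "X 1 = of_nat n" and C: "k \<ge> 1 \<Longrightarrow> X (Suc k) = csum n A k"
 shows "eval_expr A z R X (pcoeff_expr k) = pcoeff n A k"
proof (cases "k = 0")
 case True
 then show ?thesis by (simp add: pcoeff_expr_def)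
next
 case False
 have f: "eval_expr A z R X (fall_expr j) = (\<Prod>i<j. of_nat n - of_nat i)" for j
  using N by (induction j) (simp_all add: mult.commute)
 have e: "eval_expr A z R X (pcoeff_expr k) = csum n A k / ((\<Prod>i<k. of_nat n - of_nat i) * fact k)"
  using False C by (simp add: pcoeff_expr_def f)
 show ?thesis
 proof (cases "k \<le> n")
  case True
  define P where "P = (\<Prod>i<k. of_nat n - of_nat i :: complex)"
  have "fact (n - k) / (fact n * fact k) = (1 / (P * fact k) :: complex)"
   unfolding prod_falling[OF True, symmetric] P_def[symmetric] by (simp add: mult.commute mult.left_commute)
  then show ?thesis unfolding e P_def[symmetric] using True by (simp add: pcoeff_def csum_def)
 next
  case False
  \<comment> \<open>For k > n the falling factorial contains the factor n - n, and division by 0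
    gives 0, which is the value of \<open>pcoeff\<close> there.\<close>
  then have "(\<Prod>i<k. of_nat n - of_nat i) = (0::complex)"
   by (intro prod_zero) (auto intro!: bexI[of _ n])
  then show ?thesis unfolding e using False by (simp add: pcoeff_def)
 qed
qed

lemma eval_lcoeff_expr:
 assumes N: "X 1 = of_nat n" and C: "\<And>k. k \<in> {1..d} \<Longrightarrow> X (Suc k) = csum n A k"
 shows "k \<in> {1..d} \<Longrightarrow> eval_expr A z R X (lcoeff_expr k) = log_coeff n A k"
proof (induction k rule: less_induct)
 case (less k)
 have p: "eval_expr A z R X (pcoeff_expr j) = pcoeff n A j" if "j \<le> d" for j
  using that C by (intro eval_pcoeff_expr N) auto
 have "(\<Sum>j\<leftarrow>[1..<k]. of_nat j * eval_expr A z R X (lcoeff_expr j) * eval_expr A z R X (pcoeff_expr (k - j))) =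
   (\<Sum>j\<leftarrow>[1..<k]. of_nat j * log_coeff n A j * pcoeff n A (k - j))"
  using less by (intro arg_cong[of _ _ sum_list] map_cong refl) (auto simp: p)
 then show ?case
  unfolding lcoeff_expr.simps[of k] using less.prems log_coeff_rec[of k n A]
  by (simp add: eval_sum_expr p o_def)
qed

lemma eval_trunc_expr:
 assumes N: "X 1 = of_nat n" and C: "\<And>k. k \<in> {1..d} \<Longrightarrow> X (Suc k) = csum n A k"
 shows "eval_expr A z R X (trunc_expr d) = log_trunc n A d z"
proof -
 have pow: "eval_expr A z R X (pow_expr k) = z ^ k" for k
  by (induction k) (auto simp: mult.commute)
 have l: "eval_expr A z R X (lcoeff_expr k) = log_coeff n A k" if "k \<in> {1..d}" for k
  using N C that by (rule eval_lcoeff_expr)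
 have "eval_expr A z R X (trunc_expr d) = (\<Sum>k\<leftarrow>[1..<Suc d]. eval_expr A z R X (lcoeff_expr k) * z ^ k)"
  unfolding trunc_expr_def eval_sum_expr by (simp add: o_def pow)
 also have "\<dots> = (\<Sum>k\<leftarrow>[1..<Suc d]. log_coeff n A k * z ^ k)"
  by (intro arg_cong[of _ _ sum_list] map_cong refl) (auto simp: l)
 also have "\<dots> = log_trunc n A d z"
  unfolding log_trunc_def by (subst sum_list_distinct_conv_sum_set) (auto intro!: sum.cong)
 finally show ?thesis .
qed

section \<open>The complete program and its running time\<close>

fun nests :: "nat \<Rightarrow> nat \<Rightarrow> prog" where
 "nests 0 b = Instr (Set_Idx 1 0)"
| "nests (Suc j) b = Seq (nests j b) (nest (Suc j) b)"

lemma runs_nests: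
 assumes "Suc j < b"
 shows "\<exists>K. \<forall>n\<ge>1. \<forall>A z R X. R 0 = n \<and> R 4 = 0 \<and> R 5 = 1 \<and> (\<forall>k\<in>{1..j}. X (Suc k) = 0) \<longrightarrow>
  (\<exists>t R' X'. runs A z (nests j b) (R, X) t (R', X') \<and> t \<le> n ^ (2 * j) * K \<and> R' 0 = n \<and> R' 4 = 0 \<and> R' 5 = 1 \<and>
    (\<forall>k\<in>{1..j}. X' (Suc k) = csum n A k) \<and> (\<forall>c<b. c \<notin> Suc ` {1..j} \<longrightarrow> X' c = X c))"
 using assms
proof (induction j)
 case 0
 show ?case
 proof (rule exI[of _ 1], intro allI impI)
  fix n :: nat and A z and R :: "nat \<Rightarrow> nat" and X :: "nat \<Rightarrow> complex"
  assume *: "R 0 = n \<and> R 4 = 0 \<and> R 5 = 1 \<and> (\<forall>k\<in>{1..0}. X (Suc k) = 0)"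
  have "runs A z (nests 0 b) (R, X) (Suc 0) (R(1 := 0), X)"
   using runs_Instr[of A z "Set_Idx 1 0" R X] by simp
  then show "\<exists>t R' X'. runs A z (nests 0 b) (R, X) t (R', X') \<and> t \<le> n ^ (2 * 0) * 1 \<and> R' 0 = n \<and> R' 4 = 0 \<and> R' 5 = 1 \<and>
    (\<forall>k\<in>{1..0}. X' (Suc k) = csum n A k) \<and> (\<forall>c<b. c \<notin> Suc ` {1..0} \<longrightarrow> X' c = X c)"
   by (rule ex_run) (use * in auto)
 qed
next
 case (Suc j)
 then obtain K where K0: "\<forall>n\<ge>1. \<forall>A z R X. R 0 = n \<and> R 4 = 0 \<and> R 5 = 1 \<and> (\<forall>k\<in>{1..j}. X (Suc k) = 0) \<longrightarrow>
  (\<exists>t R' X'. runs A z (nests j b) (R, X) t (R', X') \<and> t \<le> n ^ (2 * j) * K \<and> R' 0 = n \<and> R' 4 = 0 \<and> R' 5 = 1 \<and>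
    (\<forall>k\<in>{1..j}. X' (Suc k) = csum n A k) \<and> (\<forall>c<b. c \<notin> Suc ` {1..j} \<longrightarrow> X' c = X c))" by auto
 note K = K0[rule_format]
 obtain K2 where K2: "\<And>n A z. n \<ge> 1 \<Longrightarrow> \<exists>T. T \<le> n ^ (2 * Suc j) * K2 \<and>
   accum A z n (nest (Suc j) b) {6..} (Suc (Suc j)) b T (\<lambda>_. csum n A (Suc j))"
  using accum_nest[of "Suc j" b] Suc.prems unfolding csum_def by blast
 show ?case
 proof (rule exI[of _ "K + K2"], intro allI impI)
  fix n :: nat and A z and R :: "nat \<Rightarrow> nat" and X :: "nat \<Rightarrow> complex"
  assume n: "n \<ge> 1" and *: "R 0 = n \<and> R 4 = 0 \<and> R 5 = 1 \<and> (\<forall>k\<in>{1..Suc j}. X (Suc k) = 0)"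
  have "R 0 = n \<and> R 4 = 0 \<and> R 5 = 1 \<and> (\<forall>k\<in>{1..j}. X (Suc k) = 0)" using * by auto
  from K[OF n this] obtain t1 R1 X1 where 1: "runs A z (nests j b) (R, X) t1 (R1, X1)" "t1 \<le> n ^ (2 * j) * K"
   "R1 0 = n" "R1 4 = 0" "R1 5 = 1" "\<forall>k\<in>{1..j}. X1 (Suc k) = csum n A k"
   "\<forall>c<b. c \<notin> Suc ` {1..j} \<longrightarrow> X1 c = X c"
   by blast
  obtain T where T: "T \<le> n ^ (2 * Suc j) * K2"
   "accum A z n (nest (Suc j) b) {6..} (Suc (Suc j)) b T (\<lambda>_. csum n A (Suc j))"
   using K2[OF n] by blast
  then obtain t2 R2 X2 where 2: "runs A z (nest (Suc j) b) (R1, X1) t2 (R2, X2)" "t2 \<le> T"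
   "\<forall>r. r \<notin> {6..} \<union> {1, 2, 3} \<longrightarrow> R2 r = R1 r" "X2 (Suc (Suc j)) = X1 (Suc (Suc j)) + csum n A (Suc j)"
   "\<forall>c'<b. c' \<noteq> Suc (Suc j) \<longrightarrow> X2 c' = X1 c'"
   using 1(3-5) unfolding accum_def by blast
  have run: "runs A z (nests (Suc j) b) (R, X) (t1 + t2) (R2, X2)"
   unfolding nests.simps by (rule runs.Seq[OF 1(1) 2(1)])
  have "n ^ (2 * j) * K \<le> n ^ (2 * Suc j) * K" using n by (intro mult_right_mono power_increasing) auto
  then have time: "t1 + t2 \<le> n ^ (2 * Suc j) * (K + K2)"
   using 1(2) 2(2) T(1) unfolding distrib_left by linarith
  have "X1 (Suc (Suc j)) = 0" using 1(7) * Suc.prems by auto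
  then have new: "X2 (Suc (Suc j)) = csum n A (Suc j)" using 2(4) by simp
  have cells: "\<forall>k\<in>{1..Suc j}. X2 (Suc k) = csum n A k"
  proof
   fix k assume k: "k \<in> {1..Suc j}"
   show "X2 (Suc k) = csum n A k"
   proof (cases "k = Suc j")
    case False
    then have "X2 (Suc k) = X1 (Suc k)" using 2(5) k Suc.prems by auto
    then show ?thesis using 1(6) k False by auto
   qed (use new in simp)
  qed
  have rest: "\<forall>c<b. c \<notin> Suc ` {1..Suc j} \<longrightarrow> X2 c = X c"
  proof (intro allI impI)
   fix c assume c: "c < b" "c \<notin> Suc ` {1..Suc j}"
   then have "c \<noteq> Suc (Suc j)" "c \<notin> Suc ` {1..j}" by auto
   then show "X2 c = X c" using 2(5) 1(7) c(1) by auto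
  qed
  have "R2 0 = n" "R2 4 = 0" "R2 5 = 1" using 2(3) 1(3-5) by auto
  then show "\<exists>t R' X'. runs A z (nests (Suc j) b) (R, X) t (R', X') \<and> t \<le> n ^ (2 * Suc j) * (K + K2) \<and> R' 0 = n \<and> R' 4 = 0 \<and> R' 5 = 1 \<and>
    (\<forall>k\<in>{1..Suc j}. X' (Suc k) = csum n A k) \<and> (\<forall>c<b. c \<notin> Suc ` {1..Suc j} \<longrightarrow> X' c = X c)"
   using run time cells rest by blast
 qed
qed

text \<open>The loop adds 1 to cell 1 for n times, which is how the index n becomes a complex
  number. Cells 2 to d + 1 receive the sums over tuples, and \<open>d + 2\<close> is the first cell
  free for evaluation.\<close>

definition trunc_prog :: "nat \<Rightarrow> prog" where
 "trunc_prog d = Seq (Instr (Set_Idx 5 1)) (Seq (for_loop 6 (add_expr 1 (Const 1) (d + 2)))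
   (Seq (nests d (d + 2)) (Seq (comp_expr (trunc_expr d) (d + 2)) (copy_cell 0 (d + 2) (d + 3)))))"

lemma trunc_prog_computes:
 assumes d: "d \<ge> 1"
 shows "\<exists>K. \<forall>n\<ge>1. \<forall>A z. computes_within (trunc_prog d) n A z (log_trunc n A d z) (real K * real n ^ (2 * d))"
proof -
 define b where "b = d + 2"
 have "Suc d < b" by (simp add: b_def)
 from runs_nests[OF this] obtain K where K0: "\<forall>n\<ge>1. \<forall>A z R X. R 0 = n \<and> R 4 = 0 \<and> R 5 = 1 \<and> (\<forall>k\<in>{1..d}. X (Suc k) = 0) \<longrightarrow>
  (\<exists>t R' X'. runs A z (nests d b) (R, X) t (R', X') \<and> t \<le> n ^ (2 * d) * K \<and> R' 0 = n \<and> R' 4 = 0 \<and> R' 5 = 1 \<and>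
    (\<forall>k\<in>{1..d}. X' (Suc k) = csum n A k) \<and> (\<forall>c<b. c \<notin> Suc ` {1..d} \<longrightarrow> X' c = X c))"
  ..
 note K = K0[rule_format]
 define K' where "K' = 1 + 17 + 2 + K + expr_cost (trunc_expr d) + 5"
 have "computes_within (trunc_prog d) n A z (log_trunc n A d z) (real K' * real n ^ (2 * d))"
  if n: "n \<ge> 1" for n A z
 proof -
  define R0 :: "nat \<Rightarrow> nat" where "R0 = ((\<lambda>_. 0)(0 := n))(5 := 1)"
  have s0: "runs A z (Instr (Set_Idx 5 1)) (initial_state n) 1 (R0, \<lambda>_. 0)"
   using runs.Instr[of A z "Set_Idx 5 1" "initial_state n"] by (simp add: initial_state_def R0_def)
  have "accum A z n (add_expr 1 (Const 1) b) {} 1 b (expr_cost (Const 1) + 13) (\<lambda>R. eval_expr A z R (\<lambda>_. 0) (Const 1))"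
   by (rule accum_add_expr) (auto simp: b_def)
  from accum_for_loop[OF this, of 6]
  have "accum A z n (for_loop 6 (add_expr 1 (Const 1) b)) {6} 1 b (n * 17 + 2) (\<lambda>R. of_nat n)" by simp
  moreover have "R0 0 = n" "R0 4 = 0" "R0 5 = 1" by (auto simp: R0_def)
  ultimately obtain t1 R1 X1 where 1: "runs A z (for_loop 6 (add_expr 1 (Const 1) b)) (R0, \<lambda>_. 0) t1 (R1, X1)"
   "t1 \<le> n * 17 + 2" "\<forall>r. r \<notin> {6} \<union> {1, 2, 3} \<longrightarrow> R1 r = R0 r" "X1 1 = 0 + of_nat n"
   "\<forall>c'<b. c' \<noteq> 1 \<longrightarrow> X1 c' = 0"
   unfolding accum_def by blast
  have "R1 0 = n \<and> R1 4 = 0 \<and> R1 5 = 1 \<and> (\<forall>k\<in>{1..d}. X1 (Suc k) = 0)"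
   using 1 by (auto simp: R0_def b_def)
  from K[OF n this] obtain t2 R2 X2 where 2: "runs A z (nests d b) (R1, X1) t2 (R2, X2)" "t2 \<le> n ^ (2 * d) * K"
   "\<forall>k\<in>{1..d}. X2 (Suc k) = csum n A k" "\<forall>c<b. c \<notin> Suc ` {1..d} \<longrightarrow> X2 c = X1 c"
   by blast
  have N: "X2 1 = of_nat n" using 2(4) 1(4) by (auto simp: b_def)
  obtain R3 X3 where 3: "runs A z (comp_expr (trunc_expr d) b) (R2, X2) (expr_cost (trunc_expr d)) (R3, X3)"
   "X3 b = eval_expr A z R2 X2 (trunc_expr d)"
   using runs_comp_expr[of "trunc_expr d" b A z R2 X2] cells_trunc_expr[of d] by (auto simp: b_def)
  have v: "X3 b = log_trunc n A d z"
   unfolding 3(2) using 2(3) by (intro eval_trunc_expr N) auto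
  have 4: "runs A z (copy_cell 0 b (d + 3)) (R3, X3) 5 (R3(1 := 0, 2 := b, 3 := d + 3), X3(d + 3 := 0, 0 := X3 b))"
   by (rule runs_copy_cell) (simp add: b_def)
  have run: "runs A z (trunc_prog d) (initial_state n) (1 + (t1 + (t2 + (expr_cost (trunc_expr d) + 5))))
    (R3(1 := 0, 2 := b, 3 := d + 3), X3(d + 3 := 0, 0 := X3 b))"
   unfolding trunc_prog_def b_def[symmetric]
   by (rule runs.Seq[OF s0 runs.Seq[OF 1(1) runs.Seq[OF 2(1) runs.Seq[OF 3(1) 4]]]])
  have n1: "n \<le> n ^ (2 * d)" "1 \<le> n ^ (2 * d)"
   using n d self_le_power[of n "2 * d"] by auto
  have "1 + (t1 + (t2 + (expr_cost (trunc_expr d) + 5))) \<le> K' * n ^ (2 * d)"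
  proof -
   have "expr_cost (trunc_expr d) \<le> expr_cost (trunc_expr d) * n ^ (2 * d)" using n1 by simp
   moreover have "K' * n ^ (2 * d) = n ^ (2 * d) * K + expr_cost (trunc_expr d) * n ^ (2 * d) + 25 * n ^ (2 * d)"
    by (simp add: K'_def algebra_simps)
   ultimately show ?thesis using 1(2) 2(2) n1 by linarith
  qed
  then have "real (1 + (t1 + (t2 + (expr_cost (trunc_expr d) + 5)))) \<le> real K' * real n ^ (2 * d)"
   by (metis of_nat_le_iff of_nat_mult of_nat_power)
  then show ?thesis
   unfolding computes_within_def using run v
   by (intro exI[of _ "1 + (t1 + (t2 + (expr_cost (trunc_expr d) + 5)))"]
     exI[of _ "(R3(1 := 0, 2 := b, 3 := d + 3), X3(d + 3 := 0, 0 := X3 b))"] conjI run) simp_all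
 qed
 then show ?thesis by blast
qed

text \<open>The program for degree d takes O(n^(2 d)) steps, and 2 d <= 12 \<gamma> + 8. The
  additive 8 is a multiple of \<gamma> only as long as \<gamma> stays away from 0, so
  \<open>C\<close> depends on the lower bound \<open>\<gamma>\<^sub>0\<close>; the program and
  \<open>K\<close> may depend on \<gamma>.\<close>

theorem truncation_polynomial_time:
 assumes g0: "(\<gamma>\<^sub>0::real) > 0"
 shows "\<exists>C::real. \<forall>\<gamma>\<ge>\<gamma>\<^sub>0. \<exists>p (K::real). \<forall>n\<ge>1. \<forall>A z.
    computes_within p n A z (log_trunc n A (nat \<lceil>6 * \<gamma> + 3\<rceil>) z) (K * real n powr (C * \<gamma>))"
proof (rule exI[of _ "12 + 8 / \<gamma>\<^sub>0"], intro allI impI)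
 fix \<gamma> :: real assume g: "\<gamma> \<ge> \<gamma>\<^sub>0"
 define d where "d = nat \<lceil>6 * \<gamma> + 3\<rceil>"
 have d: "d \<ge> 1" "real d \<le> 6 * \<gamma> + 4" using g g0 unfolding d_def by linarith+
 obtain K where K: "\<And>n A z. n \<ge> 1 \<Longrightarrow>
   computes_within (trunc_prog d) n A z (log_trunc n A d z) (real K * real n ^ (2 * d))"
  using trunc_prog_computes[OF d(1)] by blast
 have "8 * 1 \<le> 8 * (\<gamma> / \<gamma>\<^sub>0)" using g g0 by (intro mult_left_mono) auto
 then have e: "real (2 * d) \<le> (12 + 8 / \<gamma>\<^sub>0) * \<gamma>" using d(2) by (simp add: distrib_right)
 have "computes_within (trunc_prog d) n A z (log_trunc n A d z) (real K * real n powr ((12 + 8 / \<gamma>\<^sub>0) * \<gamma>))"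
  if n: "n \<ge> 1" for n A z
 proof -
  have "real n ^ (2 * d) = real n powr real (2 * d)" using n by (subst powr_realpow) auto
  also have "\<dots> \<le> real n powr ((12 + 8 / \<gamma>\<^sub>0) * \<gamma>)" using n e by (intro powr_mono) auto
  finally have "real K * real n ^ (2 * d) \<le> real K * real n powr ((12 + 8 / \<gamma>\<^sub>0) * \<gamma>)"
   by (intro mult_left_mono) auto
  then show ?thesis using K[OF n, of A z] unfolding computes_within_def by (meson order_trans)
 qed
 then show "\<exists>p (K::real). \<forall>n\<ge>1. \<forall>A z. computes_within p n A z (log_trunc n A (nat \<lceil>6 * \<gamma> + 3\<rceil>) z)
   (K * real n powr ((12 + 8 / \<gamma>\<^sub>0) * \<gamma>))"
  unfolding d_def[symmetric] by blast
qed

section \<open>Resampling directions of a Gaussian vector\<close>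

abbreviation lvec :: "'e set \<Rightarrow> ('e \<Rightarrow> complex) measure" where
 "lvec A \<equiv> PiM A (\<lambda>_. lborel)"

lemma lborel_product_sigma_finite: "product_sigma_finite (\<lambda>_. lborel :: complex measure)"
 by (simp add: product_sigma_finite_def lborel.sigma_finite_measure_axioms)

lemma sigma_finite_lvec: "finite A \<Longrightarrow> sigma_finite_measure (lvec A)"
 by (rule product_sigma_finite.sigma_finite[OF lborel_product_sigma_finite])

lemma lvec_component: "e \<in> A \<Longrightarrow> (\<lambda>w. w e) \<in> borel_measurable (lvec A)"
 using measurable_component_singleton[of e A "\<lambda>_. lborel :: complex measure"] by simp

definition gdens :: "'e set \<Rightarrow> ('e \<Rightarrow> complex) \<Rightarrow> ennreal" where
 "gdens A w = (\<Prod>a\<in>A. ennreal (exp (- (cmod (w a))\<^sup>2) / pi))"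

lemma gdens_measurable: "gdens A \<in> borel_measurable (lvec A)"
 unfolding gdens_def
proof (intro borel_measurable_prod_ennreal)
 fix a assume "a \<in> A"
 from lvec_component[OF this] have [measurable]: "(\<lambda>w. w a) \<in> borel_measurable (lvec A)" .
 show "(\<lambda>w. ennreal (exp (- (cmod (w a))\<^sup>2) / pi)) \<in> borel_measurable (lvec A)" by measurable
qed

lemma gvec_eq_density:
 assumes A: "finite A"
 shows "gvec A = density (lvec A) (gdens A)"
proof -
 interpret G: product_sigma_finite "\<lambda>_. cgauss" by (rule cgauss_product_sigma_finite)
 interpret L: product_sigma_finite "\<lambda>_. lborel :: complex measure" by (rule lborel_product_sigma_finite)
 have sets: "sets (density (lvec A) (gdens A)) = sets (gvec A)"
  by (simp, rule sets_PiM_cong) auto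
 have "density (lvec A) (gdens A) = gvec A"
 proof (rule G.PiM_eqI[OF A sets])
  fix B :: "'a \<Rightarrow> complex set" assume B: "\<And>i. i \<in> A \<Longrightarrow> B i \<in> sets cgauss"
  then have B': "\<And>i. i \<in> A \<Longrightarrow> B i \<in> sets lborel" by simp
  have "emeasure (density (lvec A) (gdens A)) (Pi\<^sub>E A B) = (\<integral>\<^sup>+w. gdens A w * indicator (Pi\<^sub>E A B) w \<partial>lvec A)"
   using B' A by (intro emeasure_density gdens_measurable sets_PiM_I_finite) auto
  also have "\<dots> = (\<integral>\<^sup>+w. (\<Prod>a\<in>A. ennreal (exp (- (cmod (w a))\<^sup>2) / pi) * indicator (B a) (w a)) \<partial>lvec A)"
  proof (rule nn_integral_cong)
   fix w :: "'a \<Rightarrow> complex" assume w: "w \<in> space (lvec A)"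
   have "indicator (Pi\<^sub>E A B) w = (\<Prod>a\<in>A. indicator (B a) (w a) :: ennreal)"
   proof (cases "w \<in> Pi\<^sub>E A B")
    case True
    then have "indicator (B a) (w a) = (1::ennreal)" if "a \<in> A" for a
     using that by (auto simp: PiE_iff)
    then show ?thesis using True by simp
   next
    case False
    then obtain a where "a \<in> A" "w a \<notin> B a" using w by (auto simp: space_PiM PiE_iff)
    then have "(\<Prod>a\<in>A. indicator (B a) (w a) :: ennreal) = 0"
     using A by (intro prod_zero) (auto intro!: bexI[of _ a])
    then show ?thesis using False by simp
   qed
   then show "gdens A w * indicator (Pi\<^sub>E A B) w = (\<Prod>a\<in>A. ennreal (exp (- (cmod (w a))\<^sup>2) / pi) * indicator (B a) (w a))"
    by (simp add: gdens_def prod.distrib)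
  qed
  also have "\<dots> = (\<Prod>a\<in>A. \<integral>\<^sup>+w. ennreal (exp (- (cmod w)\<^sup>2) / pi) * indicator (B a) w \<partial>lborel)"
   using B' by (intro L.product_nn_integral_prod[OF A]) (auto intro!: borel_measurable_times_ennreal)
  also have "\<dots> = (\<Prod>a\<in>A. emeasure cgauss (B a))"
   using B' unfolding cgauss_def by (intro prod.cong refl) (subst emeasure_density, auto)
  finally show "emeasure (density (lvec A) (gdens A)) (Pi\<^sub>E A B) = (\<Prod>a\<in>A. emeasure cgauss (B a))" .
 qed
 then show ?thesis ..
qed

lemma gdens_eq: "gdens A w = ennreal (exp (- (\<Sum>a\<in>A. (cmod (w a))\<^sup>2)) / pi ^ card A)"
proof -
 have "gdens A w = ennreal (\<Prod>a\<in>A. exp (- (cmod (w a))\<^sup>2) / pi)"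
  unfolding gdens_def by (rule prod_ennreal) simp
 also have "(\<Prod>a\<in>A. exp (- (cmod (w a))\<^sup>2) / pi) = exp (- (\<Sum>a\<in>A. (cmod (w a))\<^sup>2)) / pi ^ card A"
  by (cases "finite A") (simp_all add: prod_dividef exp_sum sum_negf[symmetric])
 finally show ?thesis .
qed

lemma distr_lvec_affine:
 assumes A: "finite A" and c: "\<bar>c\<bar> = 1"
 shows "distr (lvec A) (lvec A) (\<lambda>g. \<lambda>e\<in>A. x e + c *\<^sub>R g e) = lvec A"
proof -
 interpret L: product_sigma_finite "\<lambda>_. lborel :: complex measure" by (rule lborel_product_sigma_finite)
 have mc: "(\<lambda>w. x e + c *\<^sub>R w) \<in> lborel \<rightarrow>\<^sub>M (lborel :: complex measure)" for e by simp
 have meas: "(\<lambda>g. \<lambda>e\<in>A. x e + c *\<^sub>R g e) \<in> lvec A \<rightarrow>\<^sub>M lvec A"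
 proof (rule measurable_restrict)
  fix e assume "e \<in> A"
  from measurable_compose[OF measurable_component_singleton[OF this, of "\<lambda>_. lborel"] mc[of e]]
  show "(\<lambda>g. x e + c *\<^sub>R g e) \<in> lvec A \<rightarrow>\<^sub>M lborel" .
 qed
 show ?thesis
 proof (rule L.PiM_eqI[OF A])
  fix B :: "'a \<Rightarrow> complex set" assume B: "\<And>e. e \<in> A \<Longrightarrow> B e \<in> sets lborel"
  have "(\<lambda>g. \<lambda>e\<in>A. x e + c *\<^sub>R g e) -` (Pi\<^sub>E A B) \<inter> space (lvec A) = Pi\<^sub>E A (\<lambda>e. (\<lambda>w. x e + c *\<^sub>R w) -` B e)"
   by (auto simp: space_PiM PiE_iff extensional_def)
  moreover have "(\<lambda>w. x e + c *\<^sub>R w) -` B e \<in> sets lborel" if "e \<in> A" for e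
   using measurable_sets[OF mc B[OF that], of e] by simp
  ultimately have "emeasure (distr (lvec A) (lvec A) (\<lambda>g. \<lambda>e\<in>A. x e + c *\<^sub>R g e)) (Pi\<^sub>E A B) =
    (\<Prod>e\<in>A. emeasure lborel ((\<lambda>w. x e + c *\<^sub>R w) -` B e))"
   using meas B A by (subst emeasure_distr) (auto intro!: sets_PiM_I_finite L.emeasure_PiM)
  also have "\<dots> = (\<Prod>e\<in>A. emeasure (distr lborel lborel (\<lambda>w. x e + c *\<^sub>R w)) (B e))"
   using B by (intro prod.cong refl) (subst emeasure_distr, auto)
  also have "\<dots> = (\<Prod>e\<in>A. emeasure lborel (B e))"
   by (simp add: distr_lborel_affine[OF c])
  finally show "emeasure (distr (lvec A) (lvec A) (\<lambda>g. \<lambda>e\<in>A. x e + c *\<^sub>R g e)) (Pi\<^sub>E A B) =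
    (\<Prod>e\<in>A. emeasure lborel (B e))" .
 qed simp
qed

text \<open>The rows of \<open>S\<close> are orthonormal vectors indexed by \<open>B\<close>.
  \<open>fwd\<close> takes the coordinates of a vector in these directions, \<open>adj\<close> is
  its adjoint, and \<open>resample\<close> replaces these coordinates by \<open>g\<close> while
  keeping the orthogonal complement.\<close>

locale coisometry =
 fixes A :: "'a set" and B :: "'b set" and S :: "'b \<Rightarrow> 'a \<Rightarrow> complex"
 assumes finA: "finite A" and finB: "finite B"
  and orth: "b \<in> B \<Longrightarrow> b' \<in> B \<Longrightarrow> (\<Sum>a\<in>A. S b a * cnj (S b' a)) = (if b = b' then 1 else 0)"
begin

definition fwd :: "('a \<Rightarrow> complex) \<Rightarrow> 'b \<Rightarrow> complex" where "fwd W b = (\<Sum>a\<in>A. S b a * W a)"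

definition adj :: "('b \<Rightarrow> complex) \<Rightarrow> 'a \<Rightarrow> complex" where "adj g a = (\<Sum>b\<in>B. cnj (S b a) * g b)"

definition resample :: "('a \<Rightarrow> complex) \<Rightarrow> ('b \<Rightarrow> complex) \<Rightarrow> 'a \<Rightarrow> complex" where
 "resample W g = (\<lambda>a\<in>A. W a - adj (fwd W) a + adj g a)"

lemma fwd_adj:
 assumes "b \<in> B"
 shows "fwd (adj g) b = g b"
proof -
 have "fwd (adj g) b = (\<Sum>a\<in>A. \<Sum>b'\<in>B. S b a * (cnj (S b' a) * g b'))"
  by (simp add: fwd_def adj_def sum_distrib_left)
 also have "\<dots> = (\<Sum>b'\<in>B. (\<Sum>a\<in>A. S b a * cnj (S b' a)) * g b')"
  by (subst sum.swap) (simp add: sum_distrib_right mult.assoc)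
 also have "\<dots> = (\<Sum>b'\<in>B. if b = b' then g b' else 0)"
  by (rule sum.cong[OF refl]) (simp add: orth[OF assms])
 also have "\<dots> = g b" using assms finB by simp
 finally show ?thesis .
qed

lemma adj_inner: "(\<Sum>a\<in>A. W a * cnj (adj v a)) = (\<Sum>b\<in>B. fwd W b * cnj (v b))"
proof -
 have "(\<Sum>a\<in>A. W a * cnj (adj v a)) = (\<Sum>a\<in>A. \<Sum>b\<in>B. W a * (S b a * cnj (v b)))"
  by (simp add: adj_def sum_distrib_left)
 also have "\<dots> = (\<Sum>b\<in>B. fwd W b * cnj (v b))"
  unfolding fwd_def sum_distrib_right
  by (subst sum.swap) (intro sum.cong refl, simp add: mult_ac)
 finally show ?thesis .
qed

text \<open>The map from (W, g) to (\<open>resample W g\<close>, \<open>fwd W\<close>) exchanges the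
  coordinates of W in the distinguished directions with g, so it is an isometry.\<close>

lemma norm_resample:
 "(\<Sum>a\<in>A. (cmod (resample W g a))\<^sup>2) + (\<Sum>b\<in>B. (cmod (fwd W b))\<^sup>2) =
  (\<Sum>a\<in>A. (cmod (W a))\<^sup>2) + (\<Sum>b\<in>B. (cmod (g b))\<^sup>2)"
proof -
 define v where "v b = fwd W b - g b" for b
 have res: "resample W g a = W a - adj v a" if "a \<in> A" for a
  using that by (simp add: resample_def v_def adj_def right_diff_distrib sum_subtractf)
 have 1: "(\<Sum>a\<in>A. adj v a * cnj (adj v a)) = (\<Sum>b\<in>B. v b * cnj (v b))"
  unfolding adj_inner by (intro sum.cong refl) (simp add: fwd_adj)
 have 2: "(\<Sum>a\<in>A. adj v a * cnj (W a)) = cnj (\<Sum>b\<in>B. fwd W b * cnj (v b))"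
  unfolding adj_inner[symmetric] cnj_sum by (intro sum.cong refl) (simp add: mult.commute)
 have "complex_of_real ((\<Sum>a\<in>A. (cmod (resample W g a))\<^sup>2) + (\<Sum>b\<in>B. (cmod (fwd W b))\<^sup>2)) =
   (\<Sum>a\<in>A. (W a - adj v a) * cnj (W a - adj v a)) + (\<Sum>b\<in>B. fwd W b * cnj (fwd W b))"
  by (simp add: complex_norm_square res del: of_real_power)
 also have "(\<Sum>a\<in>A. (W a - adj v a) * cnj (W a - adj v a)) =
   (\<Sum>a\<in>A. W a * cnj (W a)) - (\<Sum>a\<in>A. W a * cnj (adj v a)) - (\<Sum>a\<in>A. adj v a * cnj (W a)) + (\<Sum>a\<in>A. adj v a * cnj (adj v a))"
  by (simp add: algebra_simps sum.distrib sum_subtractf)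
 also have "\<dots> = (\<Sum>a\<in>A. W a * cnj (W a)) - (\<Sum>b\<in>B. fwd W b * cnj (v b)) - (\<Sum>b\<in>B. cnj (fwd W b) * v b) + (\<Sum>b\<in>B. v b * cnj (v b))"
  unfolding 1 2 adj_inner by (simp add: cnj_sum)
 also have "\<dots> + (\<Sum>b\<in>B. fwd W b * cnj (fwd W b)) =
   (\<Sum>a\<in>A. W a * cnj (W a)) + (\<Sum>b\<in>B. g b * cnj (g b))"
  unfolding v_def by (simp add: algebra_simps sum.distrib sum_subtractf)
 also have "\<dots> = complex_of_real ((\<Sum>a\<in>A. (cmod (W a))\<^sup>2) + (\<Sum>b\<in>B. (cmod (g b))\<^sup>2))"
  by (simp add: complex_norm_square del: of_real_power)
 finally show ?thesis by (simp only: of_real_eq_iff)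
qed

lemma fwd_measurable: "(\<lambda>W. fwd W b) \<in> borel_measurable (lvec A)"
 unfolding fwd_def using lvec_component by (intro borel_measurable_sum borel_measurable_times) auto

lemma adj_measurable: "(\<lambda>g. adj g a) \<in> borel_measurable (lvec B)"
 unfolding adj_def using lvec_component by (intro borel_measurable_sum borel_measurable_times) auto

lemma resample_measurable: "(\<lambda>p. resample (fst p) (snd p)) \<in> lvec A \<Otimes>\<^sub>M lvec B \<rightarrow>\<^sub>M lvec A"
 unfolding resample_def
proof (rule measurable_restrict)
 fix a assume a: "a \<in> A"
 have 1: "(\<lambda>p. fst p a) \<in> borel_measurable (lvec A \<Otimes>\<^sub>M lvec B)"
  using measurable_compose[OF measurable_fst lvec_component[OF a]] .
 have 2: "(\<lambda>p. adj (fwd (fst p)) a) \<in> borel_measurable (lvec A \<Otimes>\<^sub>M lvec B)"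
  unfolding adj_def using measurable_compose[OF measurable_fst fwd_measurable]
  by (intro borel_measurable_sum borel_measurable_times) auto
 have 3: "(\<lambda>p. adj (snd p) a) \<in> borel_measurable (lvec A \<Otimes>\<^sub>M lvec B)"
  using measurable_compose[OF measurable_snd adj_measurable] .
 show "(\<lambda>p. fst p a - adj (fwd (fst p)) a + adj (snd p) a) \<in> lvec A \<Otimes>\<^sub>M lvec B \<rightarrow>\<^sub>M lborel"
  using borel_measurable_add[OF borel_measurable_diff[OF 1 2] 3] by simp
qed

text \<open>The exchange is composed of three maps that change one component by a translation, once
  combined with a reflection, depending on the other: g becomes g - \<open>fwd W\<close>, then W is
  moved by \<open>adj\<close> of the result, and finally g is reflected. The hypothesis
  \<open>ext\<close> is there because \<open>fwd\<close> is also defined off \<open>B\<close>, where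
  the composition does not reproduce it.\<close>

lemma lebesgue_resample:
 assumes H: "H \<in> borel_measurable (lvec A \<Otimes>\<^sub>M lvec B)"
  and ext: "\<And>W h h'. (\<And>b. b \<in> B \<Longrightarrow> h b = h' b) \<Longrightarrow> H (W, h) = H (W, h')"
 shows "(\<integral>\<^sup>+p. H (resample (fst p) (snd p), fwd (fst p)) \<partial>(lvec A \<Otimes>\<^sub>M lvec B)) = (\<integral>\<^sup>+p. H p \<partial>(lvec A \<Otimes>\<^sub>M lvec B))"
proof -
 note sA = sigma_finite_lvec[OF finA] and sB = sigma_finite_lvec[OF finB]
 have fwd_m: "(\<lambda>p. fwd (fst p) b) \<in> borel_measurable (lvec A \<Otimes>\<^sub>M lvec B)" for b
  using measurable_compose[OF measurable_fst fwd_measurable] .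
 have snd_m: "(\<lambda>p. snd p b) \<in> borel_measurable (lvec A \<Otimes>\<^sub>M lvec B)" if "b \<in> B" for b
  using measurable_compose[OF measurable_snd lvec_component[OF that]] .
 define shift where "shift W g = (\<lambda>b\<in>B. - fwd W b + 1 *\<^sub>R g b)" for W g
 define flip where "flip W g = (\<lambda>b\<in>B. fwd W b + (-1) *\<^sub>R g b)" for W g
 define push where "push g W = (\<lambda>a\<in>A. adj g a + 1 *\<^sub>R W a)" for g W
 have shift_m: "case_prod shift \<in> lvec A \<Otimes>\<^sub>M lvec B \<rightarrow>\<^sub>M lvec B"
  unfolding shift_def split_beta'
 proof (rule measurable_restrict)
  fix b assume b: "b \<in> B"
  show "(\<lambda>p. - fwd (fst p) b + 1 *\<^sub>R snd p b) \<in> lvec A \<Otimes>\<^sub>M lvec B \<rightarrow>\<^sub>M lborel"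
   using borel_measurable_diff[OF snd_m[OF b] fwd_m[of b]] by simp
 qed
 have flip_m: "case_prod flip \<in> lvec A \<Otimes>\<^sub>M lvec B \<rightarrow>\<^sub>M lvec B"
  unfolding flip_def split_beta'
 proof (rule measurable_restrict)
  fix b assume b: "b \<in> B"
  show "(\<lambda>p. fwd (fst p) b + (-1) *\<^sub>R snd p b) \<in> lvec A \<Otimes>\<^sub>M lvec B \<rightarrow>\<^sub>M lborel"
   using borel_measurable_diff[OF fwd_m[of b] snd_m[OF b]] by simp
 qed
 have push_m: "case_prod push \<in> lvec B \<Otimes>\<^sub>M lvec A \<rightarrow>\<^sub>M lvec A"
  unfolding push_def split_beta'
 proof (rule measurable_restrict)
  fix a assume a: "a \<in> A"
  have "(\<lambda>p. adj (fst p) a + snd p a) \<in> borel_measurable (lvec B \<Otimes>\<^sub>M lvec A)"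
   by (intro borel_measurable_add measurable_compose[OF measurable_fst adj_measurable]
     measurable_compose[OF measurable_snd lvec_component[OF a]])
  then show "(\<lambda>p. adj (fst p) a + 1 *\<^sub>R snd p a) \<in> lvec B \<Otimes>\<^sub>M lvec A \<rightarrow>\<^sub>M lborel" by simp
 qed
 have shift_inv: "distr (lvec B) (lvec B) (shift W) = lvec B" for W
  unfolding shift_def by (rule distr_lvec_affine[OF finB]) simp
 have flip_inv: "distr (lvec B) (lvec B) (flip W) = lvec B" for W
  unfolding flip_def by (rule distr_lvec_affine[OF finB]) simp
 have push_inv: "distr (lvec A) (lvec A) (push g) = lvec A" for g
  unfolding push_def by (rule distr_lvec_affine[OF finA]) simp
 have pair_m: "(\<lambda>p. (fst p, flip (fst p) (snd p))) \<in> lvec A \<Otimes>\<^sub>M lvec B \<rightarrow>\<^sub>M lvec A \<Otimes>\<^sub>M lvec B"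
  using flip_m by (simp add: split_beta')
 define H1 where "H1 p = H (fst p, flip (fst p) (snd p))" for p
 have H1: "H1 \<in> borel_measurable (lvec A \<Otimes>\<^sub>M lvec B)"
  unfolding H1_def by (rule measurable_compose[OF pair_m H])
 have push_m': "(\<lambda>p. push (snd p) (fst p)) \<in> lvec A \<Otimes>\<^sub>M lvec B \<rightarrow>\<^sub>M lvec A"
  using measurable_compose[OF measurable_pair_swap' push_m] by (simp add: split_beta')
 define H2 where "H2 p = H1 (push (snd p) (fst p), snd p)" for p
 have H2: "H2 \<in> borel_measurable (lvec A \<Otimes>\<^sub>M lvec B)"
  unfolding H2_def by (rule measurable_compose[OF _ H1]) (use push_m' in simp)
 have "(\<integral>\<^sup>+p. H p \<partial>(lvec A \<Otimes>\<^sub>M lvec B)) = (\<integral>\<^sup>+p. H1 p \<partial>(lvec A \<Otimes>\<^sub>M lvec B))"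
  unfolding H1_def by (rule nn_integral_shear_snd[OF sB flip_m flip_inv H, symmetric])
 also have "\<dots> = (\<integral>\<^sup>+p. H2 p \<partial>(lvec A \<Otimes>\<^sub>M lvec B))"
  unfolding H2_def by (rule nn_integral_shear_fst[OF sA sB push_m push_inv H1, symmetric])
 also have "\<dots> = (\<integral>\<^sup>+p. H2 (fst p, shift (fst p) (snd p)) \<partial>(lvec A \<Otimes>\<^sub>M lvec B))"
  by (rule nn_integral_shear_snd[OF sB shift_m shift_inv H2, symmetric])
 also have "\<dots> = (\<integral>\<^sup>+p. H (resample (fst p) (snd p), fwd (fst p)) \<partial>(lvec A \<Otimes>\<^sub>M lvec B))"
 proof (rule nn_integral_cong)
  fix p assume "p \<in> space (lvec A \<Otimes>\<^sub>M lvec B)"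
  obtain W g where p: "p = (W, g)" by (cases p)
  define g1 where "g1 = shift W g"
  have g1: "g1 b = g b - fwd W b" if "b \<in> B" for b using that by (simp add: g1_def shift_def)
  have adj1: "adj g1 a = adj g a - adj (fwd W) a" for a
   unfolding adj_def sum_subtractf[symmetric] by (intro sum.cong refl) (simp add: g1 right_diff_distrib)
  have push: "push g1 W = resample W g"
   by (auto simp: push_def resample_def adj1 fun_eq_iff)
  have "flip (resample W g) g1 b = fwd W b" if b: "b \<in> B" for b
  proof -
   have "fwd (resample W g) b = fwd (\<lambda>a. adj g1 a + W a) b"
    unfolding fwd_def by (intro sum.cong refl) (simp add: resample_def adj1)
   also have "\<dots> = fwd (adj g1) b + fwd W b"
    by (simp add: fwd_def distrib_left sum.distrib)
   finally have "fwd (resample W g) b = g b" using fwd_adj[OF b, of g1] g1[OF b] by simp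
   then show ?thesis using b g1[OF b] by (simp add: flip_def)
  qed
  then show "H2 (fst p, shift (fst p) (snd p)) = H (resample (fst p) (snd p), fwd (fst p))"
   unfolding H2_def H1_def p fst_conv snd_conv g1_def[symmetric] push by (rule ext)
 qed
 finally show ?thesis ..
qed

text \<open>The exchange preserves Lebesgue measure and, by \<open>norm_resample\<close>, the joint
  Gaussian density; hence \<open>resample W g\<close> has the law of W if g is an independent
  Gaussian vector.\<close>

theorem gvec_resample:
 assumes f: "f \<in> borel_measurable (gvec A)"
 shows "(\<integral>\<^sup>+W. f W \<partial>gvec A) = (\<integral>\<^sup>+g. \<integral>\<^sup>+W. f (resample W g) \<partial>gvec A \<partial>gvec B)"
proof -
 have setsA: "sets (gvec A) = sets (lvec A)" and setsB: "sets (gvec B) = sets (lvec B)"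
  by (rule sets_PiM_cong; simp)+
 have fL: "f \<in> borel_measurable (lvec A)" using f measurable_cong_sets[OF setsA refl] by blast
 note sA = sigma_finite_lvec[OF finA] and sB = sigma_finite_lvec[OF finB]
 interpret sB: sigma_finite_measure "lvec B" by (rule sB)
 interpret P: pair_sigma_finite "lvec A" "lvec B" using sA sB by (simp add: pair_sigma_finite_def)
 note dA = gdens_measurable[of A] and dB = gdens_measurable[of B]
 define H where "H p = f (fst p) * gdens A (fst p) * gdens B (snd p)" for p
 have H: "H \<in> borel_measurable (lvec A \<Otimes>\<^sub>M lvec B)"
  unfolding H_def using measurable_compose[OF measurable_fst fL] measurable_compose[OF measurable_fst dA]
   measurable_compose[OF measurable_snd dB] by (intro borel_measurable_times_ennreal) auto
 have fR: "(\<lambda>p. f (resample (fst p) (snd p))) \<in> borel_measurable (lvec A \<Otimes>\<^sub>M lvec B)"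
  by (rule measurable_compose[OF resample_measurable fL])
 have fRg: "(\<lambda>W. f (resample W g)) \<in> borel_measurable (lvec A)" if "g \<in> space (lvec B)" for g
  using measurable_compose[OF measurable_Pair2'[OF that] fR] by simp
 have dens: "gdens A (resample W g) * gdens B (fwd W) = gdens A W * gdens B g" for W g
 proof -
  have "gdens A (resample W g) * gdens B (fwd W) =
    ennreal (exp (- ((\<Sum>a\<in>A. (cmod (resample W g a))\<^sup>2) + (\<Sum>b\<in>B. (cmod (fwd W b))\<^sup>2))) / (pi ^ card A * pi ^ card B))"
   unfolding gdens_eq by (simp add: ennreal_mult[symmetric] exp_add[symmetric] exp_diff field_simps)
  also have "\<dots> = gdens A W * gdens B g"
   unfolding norm_resample gdens_eq by (simp add: ennreal_mult[symmetric] exp_add[symmetric] exp_diff field_simps)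
  finally show ?thesis .
 qed
 have oneB: "(\<integral>\<^sup>+g. gdens B g \<partial>lvec B) = 1"
  using prob_space.emeasure_space_1[OF prob_space_gvec[of B]] unfolding gvec_eq_density[OF finB]
  by (subst (asm) emeasure_density) (auto simp: dB cong: nn_integral_cong)
 have "(\<integral>\<^sup>+W. f W \<partial>gvec A) = (\<integral>\<^sup>+W. f W * gdens A W \<partial>lvec A)"
  unfolding gvec_eq_density[OF finA] using fL dA by (subst nn_integral_density) (auto simp: mult.commute)
 also have "\<dots> = (\<integral>\<^sup>+W. \<integral>\<^sup>+g. H (W, g) \<partial>lvec B \<partial>lvec A)"
  unfolding H_def using dB by (simp add: nn_integral_cmult oneB)
 also have "\<dots> = (\<integral>\<^sup>+p. H p \<partial>(lvec A \<Otimes>\<^sub>M lvec B))"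
  by (rule sB.nn_integral_fst[OF H])
 also have "\<dots> = (\<integral>\<^sup>+p. H (resample (fst p) (snd p), fwd (fst p)) \<partial>(lvec A \<Otimes>\<^sub>M lvec B))"
 proof (rule lebesgue_resample[OF H, symmetric])
  fix W and h h' :: "'b \<Rightarrow> complex" assume "\<And>b. b \<in> B \<Longrightarrow> h b = h' b"
  then have "gdens B h = gdens B h'" unfolding gdens_def by (intro prod.cong) auto
  then show "H (W, h) = H (W, h')" by (simp add: H_def)
 qed
 also have "\<dots> = (\<integral>\<^sup>+p. f (resample (fst p) (snd p)) * gdens A (fst p) * gdens B (snd p) \<partial>(lvec A \<Otimes>\<^sub>M lvec B))"
  unfolding H_def fst_conv snd_conv mult.assoc dens ..
 also have "\<dots> = (\<integral>\<^sup>+g. \<integral>\<^sup>+W. f (resample W g) * gdens A W * gdens B g \<partial>lvec A \<partial>lvec B)"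
  using measurable_compose[OF measurable_fst dA] measurable_compose[OF measurable_snd dB]
  by (subst P.nn_integral_snd[symmetric]) (auto intro!: borel_measurable_times_ennreal fR)
 also have "\<dots> = (\<integral>\<^sup>+g. gdens B g * (\<integral>\<^sup>+W. gdens A W * f (resample W g) \<partial>lvec A) \<partial>lvec B)"
  using fRg dA
  by (intro nn_integral_cong) (subst nn_integral_cmult[symmetric], auto intro!: borel_measurable_times_ennreal simp: mult_ac)
 also have "\<dots> = (\<integral>\<^sup>+g. gdens B g * (\<integral>\<^sup>+W. f (resample W g) \<partial>gvec A) \<partial>lvec B)"
  unfolding gvec_eq_density[OF finA] using fRg dA
  by (intro nn_integral_cong) (subst nn_integral_density, auto)
 also have "\<dots> = (\<integral>\<^sup>+g. \<integral>\<^sup>+W. f (resample W g) \<partial>gvec A \<partial>gvec B)"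
 proof -
  have "(\<lambda>g. \<integral>\<^sup>+W. gdens A W * f (resample W g) \<partial>lvec A) \<in> borel_measurable (lvec B)"
  proof (rule sigma_finite_measure.borel_measurable_nn_integral[OF sA])
   show "(\<lambda>(g, W). gdens A W * f (resample W g)) \<in> borel_measurable (lvec B \<Otimes>\<^sub>M lvec A)"
    unfolding split_beta' using measurable_compose[OF measurable_snd dA] measurable_compose[OF measurable_pair_swap' fR]
    by (intro borel_measurable_times_ennreal) (auto simp: split_beta')
  qed
  then have "(\<lambda>g. \<integral>\<^sup>+W. f (resample W g) \<partial>gvec A) \<in> borel_measurable (lvec B)"
   unfolding gvec_eq_density[OF finA] using fRg dA
   by (subst measurable_cong[where g = "\<lambda>g. \<integral>\<^sup>+W. gdens A W * f (resample W g) \<partial>lvec A"])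
     (auto simp: nn_integral_density)
  from nn_integral_density[OF dB this] show ?thesis unfolding gvec_eq_density[OF finB] by simp
 qed
 finally show ?thesis .
qed

end

section \<open>Weights of index tuples\<close>

text \<open>\<open>F\<close> collects the indices that have already been given their factor x. An
  index can receive x at most once, but -v any number of times.\<close>

fun tens :: "('e \<Rightarrow> complex) \<Rightarrow> ('e \<Rightarrow> complex) \<Rightarrow> 'e set \<Rightarrow> 'e list \<Rightarrow> complex" where
 "tens x v F [] = 1"
| "tens x v F (i # is) = (if i \<in> F then 0 else x i * tens x v (insert i F) is) - v i * tens x v F is"

fun inj_tens :: "('e \<Rightarrow> complex) \<Rightarrow> 'e set \<Rightarrow> 'e list \<Rightarrow> complex" where
 "inj_tens x F [] = 1"
| "inj_tens x F (i # is) = (if i \<in> F then 0 else x i * inj_tens x (insert i F) is)"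

lemma inj_tens_eq:
 "inj_tens x F is = (if distinct is \<and> set is \<inter> F = {} then prod_list (map x is) else 0)"
 by (induction "is" arbitrary: F) auto

text \<open>The terms with \<open>v\<close> cancel in the sum over the first index, so that the constraint of
 injectivity may be traded for the much smaller weights \<^term>\<open>tens x v {}\<close>.\<close>

lemma sum_tens_eq_inj_tens:
 assumes I: "finite I" and "\<And>j. j \<in> set js \<Longrightarrow> (\<Sum>i\<in>I. v i * N i j) = 0"
 shows "(\<Sum>is\<in>tup (length js) I. tens x v F is * prod_list (map2 N is js)) =
     (\<Sum>is\<in>tup (length js) I. inj_tens x F is * prod_list (map2 N is js))"
 using assms(2)
proof (induction js arbitrary: F)
 case (Cons j js)
 define T where "T F = (\<Sum>is\<in>tup (length js) I. tens x v F is * prod_list (map2 N is js))" for F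
 have IH: "T F = (\<Sum>is\<in>tup (length js) I. inj_tens x F is * prod_list (map2 N is js))" for F
  unfolding T_def using Cons by simp
 have z: "(\<Sum>i\<in>I. v i * N i j) = 0" using Cons.prems by simp
 have "(\<Sum>is\<in>tup (length (j # js)) I. tens x v F is * prod_list (map2 N is (j # js))) =
   (\<Sum>i\<in>I. \<Sum>is\<in>tup (length js) I. tens x v F (i # is) * (N i j * prod_list (map2 N is js)))"
  using I by (simp add: sum_tup_Suc del: tens.simps)
 also have "\<dots> = (\<Sum>i\<in>I. (if i \<in> F then 0 else x i * N i j * T (insert i F)) - v i * N i j * T F)"
  unfolding T_def sum_distrib_left
  by (intro sum.cong refl) (auto simp: left_diff_distrib right_diff_distrib sum_subtractf sum_negf mult_ac)
 also have "\<dots> = (\<Sum>i\<in>I. if i \<in> F then 0 else x i * N i j * T (insert i F))"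
  unfolding sum_subtractf sum_distrib_right[symmetric] z by simp
 also have "\<dots> = (\<Sum>i\<in>I. \<Sum>is\<in>tup (length js) I. inj_tens x F (i # is) * (N i j * prod_list (map2 N is js)))"
  unfolding IH sum_distrib_left by (intro sum.cong refl) (auto simp: mult_ac intro!: sum.cong)
 also have "\<dots> = (\<Sum>is\<in>tup (length (j # js)) I. inj_tens x F is * prod_list (map2 N is (j # js)))"
  using I by (simp add: sum_tup_Suc del: inj_tens.simps)
 finally show ?case .
qed simp

text \<open>The total weight of an index that occurs m times: all factors are -v, or one of the m is
  x, unless \<open>b\<close> says that x is spent. For m = 1 this is x - v, the quantity that will
  be small.\<close>

definition tau :: "complex \<Rightarrow> complex \<Rightarrow> bool \<Rightarrow> nat \<Rightarrow> complex" where
 "tau x v b m = (-v) ^ m + (if b then 0 else of_nat m * x * (-v) ^ (m - 1))"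

lemma tau_Suc: "tau x v b (Suc m) = (if b then 0 else x * (-v) ^ m) - v * tau x v b m"
 by (cases m) (simp_all add: tau_def algebra_simps)

lemma tau_True: "tau x v True m = (-v) ^ m"
 by (simp add: tau_def)

lemma tens_eq_prod:
 assumes I: "finite I" and "set is \<subseteq> I"
 shows "tens x v F is = (\<Prod>p\<in>I. tau (x p) (v p) (p \<in> F) (count_list is p))"
 using assms(2)
proof (induction "is" arbitrary: F)
 case Nil
 have "tau a b c 0 = 1" for a b c by (cases c) (simp_all add: tau_def)
 then show ?case by simp
next
 case (Cons i "is")
 then have i: "i \<in> I" by simp
 define Q where "Q = (\<Prod>p\<in>I - {i}. tau (x p) (v p) (p \<in> F) (count_list is p))"
 have 1: "tens x v F is = tau (x i) (v i) (i \<in> F) (count_list is i) * Q"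
  using Cons by (simp add: prod.remove[OF I i] Q_def)
 have 2: "tens x v (insert i F) is = tau (x i) (v i) True (count_list is i) * Q"
 proof -
  have "(\<Prod>p\<in>I - {i}. tau (x p) (v p) (p \<in> insert i F) (count_list is p)) = Q"
   unfolding Q_def by (intro prod.cong) auto
  then show ?thesis using Cons by (simp add: prod.remove[OF I i])
 qed
 have 3: "(\<Prod>p\<in>I. tau (x p) (v p) (p \<in> F) (count_list (i # is) p)) =
   tau (x i) (v i) (i \<in> F) (Suc (count_list is i)) * Q"
 proof -
  have "(\<Prod>p\<in>I - {i}. tau (x p) (v p) (p \<in> F) (count_list (i # is) p)) = Q"
   unfolding Q_def by (intro prod.cong) auto
  then show ?thesis by (simp add: prod.remove[OF I i])
 qed
 show ?case unfolding 3 tau_Suc tens.simps 1 2 tau_True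
  by (simp add: left_diff_distrib mult.assoc)
qed

lemma tau_bound:
 assumes "cmod x \<le> 2" "cmod v \<le> 2"
 shows "(cmod (tau x v b m))\<^sup>2 \<le> 16 ^ m"
proof -
 have v: "cmod ((-v) ^ k) \<le> 2 ^ k" for k
  using assms(2) by (simp add: norm_power power_mono)
 have "cmod (of_nat m * x * (-v) ^ (m - 1)) \<le> real m * 2 ^ m"
 proof (cases m)
  case (Suc l)
  have "cmod x * cmod ((-v) ^ l) \<le> 2 * 2 ^ l" using assms(1) v by (intro mult_mono) auto
  then have "real m * (cmod x * cmod ((-v) ^ l)) \<le> real m * 2 ^ m" unfolding Suc by (intro mult_left_mono) auto
  then show ?thesis unfolding Suc by (simp only: norm_mult norm_of_nat mult.assoc diff_Suc_1)
 qed simp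
 then have "cmod (if b then 0 else of_nat m * x * (-v) ^ (m - 1)) \<le> real m * 2 ^ m" by auto
 then have "cmod (tau x v b m) \<le> 2 ^ m + real m * 2 ^ m"
  unfolding tau_def using v[of m] norm_triangle_ineq[of "(-v) ^ m"] by (meson add_mono order_trans)
 also have "\<dots> = (1 + real m) * 2 ^ m" by (simp add: distrib_right)
 also have "\<dots> \<le> 2 ^ m * 2 ^ m"
 proof (rule mult_right_mono)
  have "1 + m \<le> 2 ^ m" using Suc_leI[OF less_exp[of m]] by (simp only: plus_1_eq_Suc)
  then have "real (1 + m) \<le> real (2 ^ m)" by (simp only: of_nat_le_iff)
  then show "1 + real m \<le> 2 ^ m" by simp
 qed simp
 also have "\<dots> = (4::real) ^ m" by (simp flip: power_mult_distrib)
 finally have "(cmod (tau x v b m))\<^sup>2 \<le> (4 ^ m)\<^sup>2" by (intro power_mono) auto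
 also have "\<dots> = (16::real) ^ m" by (simp add: power2_eq_square flip: power_mult_distrib)
 finally show ?thesis .
qed

lemma fps_deriv_prod:
 fixes f :: "'e \<Rightarrow> 'a::comm_ring_1 fps"
 assumes "finite I"
 shows "fps_deriv (\<Prod>p\<in>I. f p) = (\<Sum>i\<in>I. fps_deriv (f i) * (\<Prod>p\<in>I - {i}. f p))"
 using assms
proof (induction I)
 case (insert a I)
 have "(\<Sum>i\<in>I. fps_deriv (f i) * (\<Prod>p\<in>insert a I - {i}. f p)) = (\<Sum>i\<in>I. f a * (fps_deriv (f i) * (\<Prod>p\<in>I - {i}. f p)))"
 proof (rule sum.cong[OF refl])
  fix i assume "i \<in> I"
  then have "insert a I - {i} = insert a (I - {i})" using insert by auto
  then show "fps_deriv (f i) * (\<Prod>p\<in>insert a I - {i}. f p) = f a * (fps_deriv (f i) * (\<Prod>p\<in>I - {i}. f p))"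
   using insert by (simp add: mult.left_commute)
 qed
 moreover have "insert a I - {a} = I" using insert by auto
 ultimately show ?case using insert by (simp add: sum_distrib_left add.commute)
qed simp

text \<open>The rule for products of exponential generating functions: a tuple distributes its k
  positions among the indices. Fixing the first entry of the tuple corresponds to differentiating
  the product.\<close>

lemma sum_tup_prod_count:
 fixes w :: "'e \<Rightarrow> nat \<Rightarrow> real"
 assumes I: "finite I"
 shows "(\<Sum>is\<in>tup k I. \<Prod>p\<in>I. w p (count_list is p)) = fact k * fps_nth (\<Prod>p\<in>I. Abs_fps (\<lambda>m. w p m / fact m)) k"
proof (induction k arbitrary: w)
 case 0
 have "fps_nth (\<Prod>p\<in>I. Abs_fps (\<lambda>m. w p m / fact m)) 0 = (\<Prod>p\<in>I. w p 0)"
  using I by (induction I) auto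
 then show ?case by simp
next
 case (Suc k)
 define F where "F w p = Abs_fps (\<lambda>m. w p m / fact m)" for w :: "'e \<Rightarrow> nat \<Rightarrow> real" and p
 define sh where "sh i p m = (if p = i then w p (Suc m) else w p m)" for i p m
 have D: "fps_deriv (\<Prod>p\<in>I. F w p) = (\<Sum>i\<in>I. \<Prod>p\<in>I. F (sh i) p)"
  unfolding fps_deriv_prod[OF I]
 proof (rule sum.cong[OF refl])
  fix i assume i: "i \<in> I"
  have "fps_deriv (F w i) = F (sh i) i"
  proof (rule fps_ext)
   fix m
   show "fps_nth (fps_deriv (F w i)) m = fps_nth (F (sh i) i) m"
    by (simp add: F_def sh_def del: of_nat_Suc)
  qed
  moreover have "(\<Prod>p\<in>I - {i}. F w p) = (\<Prod>p\<in>I - {i}. F (sh i) p)"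
   by (intro prod.cong refl) (simp add: F_def sh_def)
  ultimately show "fps_deriv (F w i) * (\<Prod>p\<in>I - {i}. F w p) = (\<Prod>p\<in>I. F (sh i) p)"
   by (simp add: prod.remove[OF I i])
 qed
 have "(\<Sum>is\<in>tup (Suc k) I. \<Prod>p\<in>I. w p (count_list is p)) = (\<Sum>i\<in>I. \<Sum>is\<in>tup k I. \<Prod>p\<in>I. sh i p (count_list is p))"
  unfolding sum_tup_Suc[OF I] by (intro sum.cong prod.cong refl) (auto simp: sh_def)
 also have "\<dots> = fact k * fps_nth (fps_deriv (\<Prod>p\<in>I. F w p)) k"
  unfolding D fps_sum_nth sum_distrib_left by (intro sum.cong refl Suc[folded F_def])
 also have "\<dots> = fact (Suc k) * fps_nth (\<Prod>p\<in>I. F w p) (Suc k)"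
  by (simp add: mult.assoc mult.commute mult.left_commute)
 finally show ?case unfolding F_def .
qed

text \<open>With nonnegative coefficients, truncating a product loses more than multiplying the
  truncations.\<close>

lemma fps_prod_coeff_bound:
 fixes F :: "'e \<Rightarrow> real fps"
 assumes "finite I" and "\<And>p m. p \<in> I \<Longrightarrow> fps_nth (F p) m \<ge> 0" and s: "\<sigma> \<ge> 0"
 shows "(\<forall>k. fps_nth (\<Prod>p\<in>I. F p) k \<ge> 0) \<and>
  (\<Sum>k\<le>K. fps_nth (\<Prod>p\<in>I. F p) k * \<sigma> ^ k) \<le> (\<Prod>p\<in>I. \<Sum>m\<le>K. fps_nth (F p) m * \<sigma> ^ m)"
 using assms(1,2)
proof (induction I)
 case empty
 have "(\<Sum>k\<le>K. fps_nth (1 :: real fps) k * \<sigma> ^ k) = (\<Sum>k\<le>K. if k = 0 then 1 else 0)"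
  by (intro sum.cong refl) auto
 then show ?case by simp
next
 case (insert a I)
 define G where "G = (\<Prod>p\<in>I. F p)"
 have G: "\<And>k. fps_nth G k \<ge> 0" "(\<Sum>k\<le>K. fps_nth G k * \<sigma> ^ k) \<le> (\<Prod>p\<in>I. \<Sum>m\<le>K. fps_nth (F p) m * \<sigma> ^ m)"
  using insert unfolding G_def by auto
 have Fa: "\<And>m. fps_nth (F a) m \<ge> 0" using insert.prems by simp
 define g where "g i j = (fps_nth (F a) i * \<sigma> ^ i) * (fps_nth G j * \<sigma> ^ j)" for i j
 have g0: "g i j \<ge> 0" for i j unfolding g_def using G(1) Fa s by simp
 have "(\<Sum>k\<le>K. fps_nth (F a * G) k * \<sigma> ^ k) = (\<Sum>k\<le>K. \<Sum>i\<le>k. g i (k - i))"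
  unfolding fps_mult_nth sum_distrib_right atLeast0AtMost
 proof (intro sum.cong refl)
  fix k i :: nat assume "i \<in> {..k}"
  then have "\<sigma> ^ k = \<sigma> ^ i * \<sigma> ^ (k - i)" by (simp flip: power_add)
  then show "fps_nth (F a) i * fps_nth G (k - i) * \<sigma> ^ k = g i (k - i)" by (simp add: g_def mult_ac)
 qed
 also have "\<dots> = (\<Sum>(i, j)\<in>{(i, j). i + j \<le> K}. g i j)" by (rule sum.triangle_reindex_eq[symmetric])
 also have "\<dots> \<le> (\<Sum>(i, j)\<in>{..K} \<times> {..K}. g i j)"
  using g0 by (intro sum_mono2) auto
 also have "\<dots> = (\<Sum>m\<le>K. fps_nth (F a) m * \<sigma> ^ m) * (\<Sum>k\<le>K. fps_nth G k * \<sigma> ^ k)"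
  unfolding g_def sum_product sum.cartesian_product ..
 also have "\<dots> \<le> (\<Sum>m\<le>K. fps_nth (F a) m * \<sigma> ^ m) * (\<Prod>p\<in>I. \<Sum>m\<le>K. fps_nth (F p) m * \<sigma> ^ m)"
  using Fa s by (intro mult_left_mono G(2) sum_nonneg) auto
 finally have "(\<Sum>k\<le>K. fps_nth (F a * G) k * \<sigma> ^ k) \<le>
   (\<Sum>m\<le>K. fps_nth (F a) m * \<sigma> ^ m) * (\<Prod>p\<in>I. \<Sum>m\<le>K. fps_nth (F p) m * \<sigma> ^ m)" .
 moreover have "fps_nth (F a * G) k \<ge> 0" for k
  unfolding fps_mult_nth using Fa G(1) by (intro sum_nonneg) auto
 ultimately show ?case using insert(1,2) by (simp add: G_def)
qed

lemma exp_partial_sum: "x \<ge> 0 \<Longrightarrow> (\<Sum>m\<le>K. x ^ m / fact m) \<le> exp (x::real)"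
 using sum_le_suminf[OF summable_exp[of x], of "{..K}"]
 by (simp add: exp_def divide_inverse scaleR_conv_of_real mult.commute)

text \<open>A coefficient of a series with nonnegative coefficients is bounded by the value at
  \<sigma> divided by \<sigma>^k. Each index contributes a factor 1 + \<sigma> |x - v|^2 +
  O(\<sigma>^2); if x were equal to v, indices occurring once would drop out altogether.\<close>

lemma sum_tens_bound:
 assumes I: "finite I" and x: "\<And>p. p \<in> I \<Longrightarrow> cmod (x p) \<le> 2" and v: "\<And>p. p \<in> I \<Longrightarrow> cmod (v p) \<le> 2"
  and xv: "\<And>p. p \<in> I \<Longrightarrow> (cmod (x p - v p))\<^sup>2 \<le> \<zeta>" and s: "0 < \<sigma>" "\<sigma> \<le> 1"
 shows "(\<Sum>is\<in>tup k I. (cmod (tens x v {} is))\<^sup>2) \<le> fact k / \<sigma> ^ k * exp (real (card I) * (\<sigma> * \<zeta> + exp 16 * \<sigma>\<^sup>2))"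
proof -
 define w where "w p m = (cmod (tau (x p) (v p) False m))\<^sup>2" for p m
 define F where "F p = Abs_fps (\<lambda>m. w p m / fact m)" for p
 have "(\<Sum>is\<in>tup k I. (cmod (tens x v {} is))\<^sup>2) = (\<Sum>is\<in>tup k I. \<Prod>p\<in>I. w p (count_list is p))"
  by (intro sum.cong refl) (simp add: tens_eq_prod[OF I] tup_def w_def prod_norm[symmetric] prod_power_distrib)
 also have "\<dots> = fact k * fps_nth (\<Prod>p\<in>I. F p) k" unfolding F_def by (rule sum_tup_prod_count[OF I])
 finally have eq: "(\<Sum>is\<in>tup k I. (cmod (tens x v {} is))\<^sup>2) = fact k * fps_nth (\<Prod>p\<in>I. F p) k" .
 have F0: "fps_nth (F p) m \<ge> 0" for p m by (simp add: F_def w_def)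
 have bd: "(\<forall>k. fps_nth (\<Prod>p\<in>I. F p) k \<ge> 0) \<and>
   (\<Sum>j\<le>k. fps_nth (\<Prod>p\<in>I. F p) j * \<sigma> ^ j) \<le> (\<Prod>p\<in>I. \<Sum>m\<le>k. fps_nth (F p) m * \<sigma> ^ m)"
  by (rule fps_prod_coeff_bound[OF I]) (use F0 s in auto)
 have "fps_nth (\<Prod>p\<in>I. F p) k * \<sigma> ^ k \<le> (\<Sum>j\<le>k. fps_nth (\<Prod>p\<in>I. F p) j * \<sigma> ^ j)"
  using bd s by (intro member_le_sum) auto
 also have "\<dots> \<le> (\<Prod>p\<in>I. \<Sum>m\<le>k. fps_nth (F p) m * \<sigma> ^ m)" using bd by blast
 also have "\<dots> \<le> (\<Prod>p\<in>I. exp (\<sigma> * \<zeta> + exp 16 * \<sigma>\<^sup>2))"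
 proof (rule prod_mono)
  fix p assume p: "p \<in> I"
  have z: "\<zeta> \<ge> 0" using xv[OF p] by (meson order_trans zero_le_power2)
  have t: "fps_nth (F p) m * \<sigma> ^ m \<le> (if m = 0 then 1 else 0) + (if m = 1 then \<sigma> * \<zeta> else 0) + \<sigma>\<^sup>2 * (16 ^ m / fact m)" for m
  proof -
   consider "m = 0" | "m = 1" | "m \<ge> 2" by linarith
   then show ?thesis
   proof cases
    case 3
    have "w p m \<le> 16 ^ m" unfolding w_def by (rule tau_bound[OF x[OF p] v[OF p]])
    moreover have "\<sigma> ^ m \<le> \<sigma>\<^sup>2" using s 3 by (intro power_decreasing) auto
    ultimately have "w p m * \<sigma> ^ m \<le> 16 ^ m * \<sigma>\<^sup>2" using s by (intro mult_mono) (auto simp: w_def)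
    then have "w p m * \<sigma> ^ m / fact m \<le> 16 ^ m * \<sigma>\<^sup>2 / fact m" by (intro divide_right_mono) auto
    then show ?thesis using 3 by (simp add: F_def mult.commute)
   next
    case 2
    have "w p 1 \<le> \<zeta>" using xv[OF p] by (simp add: w_def tau_def)
    then have "w p 1 * \<sigma> \<le> \<sigma> * \<zeta>" using s by (simp add: mult.commute)
    then have "w p 1 * \<sigma> \<le> \<sigma> * \<zeta> + \<sigma>\<^sup>2 * 16" by (rule order_trans) simp
    then show ?thesis using 2 by (simp add: F_def)
   qed (simp add: F_def w_def tau_def)
  qed
  have "(\<Sum>m\<le>k. fps_nth (F p) m * \<sigma> ^ m) \<le>
    (\<Sum>m\<le>k. (if m = 0 then 1 else 0) + (if m = 1 then \<sigma> * \<zeta> else 0) + \<sigma>\<^sup>2 * (16 ^ m / fact m))"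
   by (rule sum_mono) (rule t)
  also have "\<dots> = 1 + (if 1 \<le> k then \<sigma> * \<zeta> else 0) + \<sigma>\<^sup>2 * (\<Sum>m\<le>k. 16 ^ m / fact m)"
   by (simp add: sum.distrib sum_distrib_left)
  also have "\<dots> \<le> 1 + \<sigma> * \<zeta> + \<sigma>\<^sup>2 * exp 16"
   using s z by (intro add_mono mult_left_mono exp_partial_sum) auto
  also have "\<dots> \<le> exp (\<sigma> * \<zeta> + exp 16 * \<sigma>\<^sup>2)"
   using exp_ge_add_one_self[of "\<sigma> * \<zeta> + exp 16 * \<sigma>\<^sup>2"] by (simp add: mult.commute add.assoc)
  finally show "0 \<le> (\<Sum>m\<le>k. fps_nth (F p) m * \<sigma> ^ m) \<and>
    (\<Sum>m\<le>k. fps_nth (F p) m * \<sigma> ^ m) \<le> exp (\<sigma> * \<zeta> + exp 16 * \<sigma>\<^sup>2)"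
   using F0 s by (auto intro!: sum_nonneg)
 qed
 also have "\<dots> = exp (real (card I) * (\<sigma> * \<zeta> + exp 16 * \<sigma>\<^sup>2))"
  by (simp add: exp_of_nat_mult)
 finally have "fact k * (fps_nth (\<Prod>p\<in>I. F p) k * \<sigma> ^ k) \<le> fact k * exp (real (card I) * (\<sigma> * \<zeta> + exp 16 * \<sigma>\<^sup>2))"
  by (intro mult_left_mono) auto
 then show ?thesis unfolding eq using s by (simp add: pos_le_divide_eq mult.assoc)
qed

text \<open>If the weighted row and column sums of W vanish, this is the sum over pairs of injective
  tuples; for a Gaussian W its second moment is far smaller than the one of that sum.\<close>

definition tsum :: "nat \<Rightarrow> nat \<Rightarrow> (nat \<Rightarrow> complex) \<Rightarrow> (nat \<Rightarrow> complex) \<Rightarrow> (nat \<Rightarrow> complex) \<Rightarrow> (nat \<Rightarrow> complex) \<Rightarrow>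
  (nat \<times> nat \<Rightarrow> complex) \<Rightarrow> complex" where
 "tsum n k x v y u W = (\<Sum>is\<in>tup k {..<n}. \<Sum>js\<in>tup k {..<n}. tens x v {} is * tens y u {} js * prod_list (map W (zip is js)))"

lemma map2_flip: "map2 (\<lambda>j i. N i j) js is = map2 N is js"
 by (induction "is" js rule: list_induct2') auto

text \<open>\<open>sum_tens_eq_inj_tens\<close> is applied to the row tuple with the columns fixed,
  then to the column tuple with the rows fixed.\<close>

lemma tsum_eq_distinct:
 assumes v: "\<And>j. j < n \<Longrightarrow> (\<Sum>i<n. v i * N (i, j)) = 0" and u: "\<And>i. i < n \<Longrightarrow> (\<Sum>j<n. u j * N (i, j)) = 0"
 shows "tsum n k x v y u N =
  (\<Sum>is\<in>dtup k {..<n}. \<Sum>js\<in>dtup k {..<n}. prod_list (map2 (\<lambda>i j. x i * y j * N (i, j)) is js))"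
proof -
 define M where "M i j = N (i, j)" for i j
 have M: "prod_list (map N (zip is js)) = prod_list (map2 M is js)" for "is" js
  unfolding M_def by (intro arg_cong[of _ _ prod_list] map_cong) auto
 have 1: "(\<Sum>is\<in>tup k {..<n}. tens x v {} is * prod_list (map2 M is js)) =
   (\<Sum>is\<in>tup k {..<n}. inj_tens x {} is * prod_list (map2 M is js))" if "js \<in> tup k {..<n}" for js
  using sum_tens_eq_inj_tens[of "{..<n}" js v M x "{}"] that v by (auto simp: tup_def M_def subset_eq)
 have 2: "(\<Sum>js\<in>tup k {..<n}. tens y u {} js * prod_list (map2 M is js)) =
   (\<Sum>js\<in>tup k {..<n}. inj_tens y {} js * prod_list (map2 M is js))" if "is \<in> tup k {..<n}" for "is"
 proof -
  have l: "length is = k" "set is \<subseteq> {..<n}" using that by (auto simp: tup_def)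
  then have "(\<Sum>i\<in>{..<n}. u i * (\<lambda>j i. M i j) i j) = 0" if "j \<in> set is" for j
   using u that by (auto simp: M_def)
  from sum_tens_eq_inj_tens[where I = "{..<n}" and js = "is" and v = u and N = "\<lambda>j i. M i j" and x = y and F = "{}", OF finite_lessThan this]
  show ?thesis unfolding map2_flip[of M] l(1) .
 qed
 have "tsum n k x v y u N = (\<Sum>js\<in>tup k {..<n}. tens y u {} js * (\<Sum>is\<in>tup k {..<n}. tens x v {} is * prod_list (map2 M is js)))"
  unfolding tsum_def M sum_distrib_left by (subst sum.swap) (intro sum.cong refl, simp add: mult_ac)
 also have "\<dots> = (\<Sum>js\<in>tup k {..<n}. tens y u {} js * (\<Sum>is\<in>tup k {..<n}. inj_tens x {} is * prod_list (map2 M is js)))"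
  by (intro sum.cong refl) (simp add: 1)
 also have "\<dots> = (\<Sum>is\<in>tup k {..<n}. inj_tens x {} is * (\<Sum>js\<in>tup k {..<n}. tens y u {} js * prod_list (map2 M is js)))"
  unfolding sum_distrib_left by (subst sum.swap) (intro sum.cong refl, simp add: mult_ac)
 also have "\<dots> = (\<Sum>is\<in>tup k {..<n}. inj_tens x {} is * (\<Sum>js\<in>tup k {..<n}. inj_tens y {} js * prod_list (map2 M is js)))"
  by (intro sum.cong refl) (simp add: 2)
 also have "\<dots> = (\<Sum>is\<in>dtup k {..<n}. inj_tens x {} is * (\<Sum>js\<in>dtup k {..<n}. inj_tens y {} js * prod_list (map2 M is js)))"
 proof -
  have in0: "inj_tens y {} js = 0" if "js \<in> tup k {..<n} - dtup k {..<n}" for y js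
   using that by (auto simp: tup_def dtup_def inj_tens_eq)
  have "(\<Sum>js\<in>tup k {..<n}. inj_tens y {} js * f js) = (\<Sum>js\<in>dtup k {..<n}. inj_tens y {} js * f js)" for y f
   by (rule sum.mono_neutral_right) (use in0 dtup_subset[of k "{..<n}"] in auto)
  then show ?thesis by simp
 qed
 also have "\<dots> = (\<Sum>is\<in>dtup k {..<n}. \<Sum>js\<in>dtup k {..<n}. prod_list (map2 (\<lambda>i j. x i * y j * N (i, j)) is js))"
  unfolding sum_distrib_left
 proof (intro sum.cong refl)
  fix "is" js assume "is \<in> dtup k {..<n}" "js \<in> dtup k {..<n}"
  then have l: "length is = length js" "distinct is" "distinct js" by (auto simp: dtup_def)
  from l(1) have "prod_list (map2 (\<lambda>i j. x i * y j * N (i, j)) is js) =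
    prod_list (map x is) * (prod_list (map y js) * prod_list (map2 M is js))"
   by (induction "is" js rule: list_induct2) (auto simp: M_def mult_ac)
  then show "inj_tens x {} is * (inj_tens y {} js * prod_list (map2 M is js)) =
    prod_list (map2 (\<lambda>i j. x i * y j * N (i, j)) is js)"
   using l(2,3) by (simp add: inj_tens_eq)
 qed
 finally show ?thesis .
qed

lemma tsum_moment:
 "(\<integral>\<^sup>+W. ennreal ((cmod (tsum n k x v y u W))\<^sup>2) \<partial>gvec (sq n)) \<le>
  ennreal (4 ^ k * fact k * ((\<Sum>is\<in>tup k {..<n}. (cmod (tens x v {} is))\<^sup>2) * (\<Sum>js\<in>tup k {..<n}. (cmod (tens y u {} js))\<^sup>2)))"
proof -
 define t where "t zs = tens x v {} (map fst zs) * tens y u {} (map snd zs)" for zs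
 have re: "(\<Sum>zs\<in>tup k (sq n). f zs) = (\<Sum>is\<in>tup k {..<n}. \<Sum>js\<in>tup k {..<n}. f (zip is js))"
  for f :: "(nat \<times> nat) list \<Rightarrow> 'z::comm_monoid_add"
 proof -
  have "(\<Sum>zs\<in>tup k (sq n). f zs) = (\<Sum>(is, js)\<in>tup k {..<n} \<times> tup k {..<n}. f (zip is js))"
  proof (rule sum.reindex_bij_witness[of _ "\<lambda>(is, js). zip is js" "\<lambda>zs. (map fst zs, map snd zs)"])
   fix p assume p: "p \<in> tup k {..<n} \<times> tup k {..<n}"
   then obtain "is" js where q: "p = (is, js)" "length is = k" "length js = k" "set is \<subseteq> {..<n}" "set js \<subseteq> {..<n}"
    by (auto simp: tup_def)
   show "(\<lambda>(is, js). zip is js) p \<in> tup k (sq n)"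
    unfolding q(1) using q set_zip_leftD set_zip_rightD by (fastforce simp: tup_def)
  qed (auto simp: tup_def zip_map_fst_snd)
  then show ?thesis by (simp add: sum.cartesian_product)
 qed
 have mz: "map fst (zip is js) = is" "map snd (zip is js) = js" if "is \<in> tup k {..<n}" "js \<in> tup k {..<n}" for "is" js :: "nat list"
  using that by (auto simp: tup_def)
 have "tsum n k x v y u W = (\<Sum>zs\<in>tup k (sq n). t zs * prod_list (map W zs))" for W
  unfolding re tsum_def by (intro sum.cong refl) (simp add: t_def mz)
 moreover have "(\<Sum>zs\<in>tup k (sq n). (cmod (t zs))\<^sup>2) =
   (\<Sum>is\<in>tup k {..<n}. (cmod (tens x v {} is))\<^sup>2) * (\<Sum>js\<in>tup k {..<n}. (cmod (tens y u {} js))\<^sup>2)"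
  unfolding re sum_product by (intro sum.cong refl) (simp add: t_def mz norm_mult power_mult_distrib)
 ultimately show ?thesis using gvec_tensor_moment[of "sq n" t k] by simp
qed

lemma tsum_measurable: "tsum n k x v y u \<in> borel_measurable (gvec (sq n))"
proof -
 have "(\<lambda>W. prod_list (map W zs)) \<in> borel_measurable (gvec (sq n))" if "set zs \<subseteq> sq n" for zs
  using that by (induction zs) (auto intro!: borel_measurable_times gvec_component)
 moreover have "set (zip is js) \<subseteq> sq n" if "is \<in> tup k {..<n}" "js \<in> tup k {..<n}" for "is" js
  using that set_zip_leftD set_zip_rightD by (fastforce simp: tup_def)
 ultimately show ?thesis
  unfolding tsum_def[abs_def] by (intro borel_measurable_sum borel_measurable_times borel_measurable_const) auto
qed

text \<open>Polynomial dependence along complex lines is the source of the mean value inequality for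
  \<open>flat\<close>.\<close>

lemma tsum_pencil:
 "\<exists>p. degree p \<le> k \<and> (\<forall>c. tsum n k x v y u (\<lambda>e. W e + c * G e) = poly p c)"
proof -
 define q where "q zs = prod_list (map (\<lambda>e. [:W e, G e:]) zs)" for zs
 have q: "poly (q zs) c = prod_list (map (\<lambda>e. W e + c * G e) zs)" for zs c
  unfolding q_def by (induction zs) (auto simp: distrib_right mult.assoc)
 have dq: "degree (q zs) \<le> length zs" for zs
 proof (induction zs)
  case (Cons e zs)
  have "q (e # zs) = [:W e, G e:] * q zs" by (simp only: q_def list.map prod_list.Cons)
  then have "degree (q (e # zs)) \<le> degree [:W e, G e:] + degree (q zs)" using degree_mult_le by metis
  also have "\<dots> \<le> 1 + length zs" using Cons by (intro add_mono) auto
  finally show ?case by simp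
 qed (simp add: q_def)
 define p where "p = (\<Sum>is\<in>tup k {..<n}. \<Sum>js\<in>tup k {..<n}. smult (tens x v {} is * tens y u {} js) (q (zip is js)))"
 have "degree p \<le> k"
  unfolding p_def
 proof (intro degree_sum_le finite_tup finite_lessThan)
  fix "is" js assume "is \<in> tup k {..<n}" "js \<in> tup k {..<n}"
  then have "length (zip is js) = k" by (auto simp: tup_def)
  then show "degree (smult (tens x v {} is * tens y u {} js) (q (zip is js))) \<le> k"
   using dq[of "zip is js"] degree_smult_le order_trans by metis
 qed
 moreover have "tsum n k x v y u (\<lambda>e. W e + c * G e) = poly p c" for c
  by (simp add: p_def tsum_def poly_sum q)
 ultimately show ?thesis by blast
qed

section \<open>The permanent of the projected matrix\<close>

text \<open>An extension of the polynomial of a matrix with vanishing weighted sums to arbitrary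
  matrices: it makes sense for unrestricted Gaussian W, where its second moment can be
  computed.\<close>

definition flat :: "nat \<Rightarrow> complex \<Rightarrow> (nat \<Rightarrow> complex) \<Rightarrow> (nat \<Rightarrow> complex) \<Rightarrow> (nat \<Rightarrow> complex) \<Rightarrow> (nat \<Rightarrow> complex) \<Rightarrow>
  (nat \<times> nat \<Rightarrow> complex) \<Rightarrow> complex" where
 "flat n z x v y u W = (\<Sum>k\<le>n. z ^ k * (fact (n - k) / (fact n * fact k)) * tsum n k x v y u W)"

lemma flat_eq_perm_poly:
 assumes "\<And>j. j < n \<Longrightarrow> (\<Sum>i<n. v i * N (i, j)) = 0" and "\<And>i. i < n \<Longrightarrow> (\<Sum>j<n. u j * N (i, j)) = 0"
 shows "perm_poly n (\<lambda>i j. x i * y j * N (i, j)) z = flat n z x v y u N"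
 unfolding perm_poly_eq_sum flat_def
 by (intro sum.cong refl) (simp add: pcoeff_def tsum_eq_distinct[OF assms])

lemma flat_measurable: "flat n z x v y u \<in> borel_measurable (gvec (sq n))"
 unfolding flat_def[abs_def] using tsum_measurable
 by (intro borel_measurable_sum borel_measurable_times borel_measurable_const) auto

text \<open>Combine k^k <= e^k k! with the lower bound (n / k)^k for the binomial
  coefficient.\<close>

lemma fact_ratio_bound:
 assumes "k \<le> n" "n \<ge> 1"
 shows "fact (n - k) / fact n \<le> (exp 1 / real n) ^ k"
proof (cases "k = 0")
 case False
 have "real k ^ k / fact k \<le> (\<Sum>m\<le>k. real k ^ m / fact m)"
  by (intro member_le_sum) auto
 also have "\<dots> \<le> exp (real k)" by (rule exp_partial_sum) simp
 also have "exp (real k) = exp 1 ^ k" using exp_of_nat_mult[of k "1::real"] by simp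
 finally have kk: "real k ^ k \<le> exp 1 ^ k * fact k" by (simp add: divide_le_eq)
 have "(real n / real k) ^ k \<le> fact n / (fact k * fact (n - k))"
  using binomial_ge_n_over_k_pow_k[OF assms(1), where 'a = real] by (simp add: binomial_fact[OF assms(1)])
 then have "real n ^ k \<le> real k ^ k * (fact n / (fact k * fact (n - k)))"
  using False by (simp add: power_divide divide_le_eq mult.commute)
 also have "\<dots> \<le> (exp 1 ^ k * fact k) * (fact n / (fact k * fact (n - k)))"
  by (intro mult_right_mono kk) auto
 also have "\<dots> = exp 1 ^ k * (fact n / fact (n - k))" by simp
 finally have "real n ^ k * fact (n - k) \<le> exp 1 ^ k * fact n"
  by (simp add: pos_le_divide_eq)
 then show ?thesis using assms(2) by (simp add: power_divide divide_le_eq le_divide_eq mult.commute)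
qed simp

text \<open>The loss per degree in \<open>tens_power_bound\<close>: 64 stems from the bound on |x -
  v|^2 and exp 16 from the terms of higher order in \<sigma>.\<close>

definition Bflat :: real where "Bflat = exp (64 + exp 16)"

lemma tens_power_bound:
 assumes n: "n \<ge> 1" and k: "1 \<le> k" "k \<le> n"
  and x: "\<And>i. i < n \<Longrightarrow> cmod (x i) \<le> 2" and v: "\<And>i. i < n \<Longrightarrow> cmod (v i) \<le> 2"
  and xv: "\<And>i. i < n \<Longrightarrow> (cmod (x i - v i))\<^sup>2 \<le> 64 * real n powr (- (1/3))"
 shows "(\<Sum>is\<in>tup k {..<n}. (cmod (tens x v {} is))\<^sup>2) \<le> fact k / (sqrt k * real n powr (- (2/3))) ^ k * Bflat ^ k"
proof -
 \<comment> \<open>With |x - v|^2 of order n^(-1/3) this choice keeps both n \<sigma> |x - v|^2 and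
   n \<sigma>^2 of order at most k. The factor sqrt k lets \<sigma>^(2 k) absorb the k! that is left
   over in \<open>flat_moment\<close>.\<close>
 define \<sigma> where "\<sigma> = sqrt k * real n powr (- (2/3))"
 have n0: "real n > 0" using n by simp
 have s0: "\<sigma> > 0" using n k by (simp add: \<sigma>_def)
 have rs: "sqrt k \<le> real k" using k by (intro real_le_lsqrt) (auto simp: power2_eq_square)
 have "sqrt k \<le> sqrt n" using k by simp
 also have "\<dots> = real n powr (1/2)" using n by (simp add: powr_half_sqrt)
 also have "\<dots> \<le> real n powr (2/3)" using n by (intro powr_mono) auto
 finally have "sqrt k * real n powr (- (2/3)) \<le> real n powr (2/3) * real n powr (- (2/3))" by (intro mult_right_mono) auto
 also have "\<dots> = 1" using n0 by (simp flip: powr_add)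
 finally have s1: "\<sigma> \<le> 1" unfolding \<sigma>_def .
 have e1: "real n * (\<sigma> * (64 * real n powr (- (1/3)))) \<le> 64 * real k"
 proof -
  have "real n powr (- (2/3)) * real n powr (- (1/3)) = real n powr (- 1)" by (simp flip: powr_add)
  also have "\<dots> = 1 / real n" using n0 by (simp add: powr_neg_one)
  finally have "real n powr (- (2/3)) * real n powr (- (1/3)) = 1 / real n" .
  then have p: "real n * (real n powr (- (2/3)) * real n powr (- (1/3))) = 1" using n0 by simp
  have "real n * (\<sigma> * (64 * real n powr (- (1/3)))) =
    64 * sqrt k * (real n * (real n powr (- (2/3)) * real n powr (- (1/3))))"
   unfolding \<sigma>_def by (simp only: mult_ac)
  then have "real n * (\<sigma> * (64 * real n powr (- (1/3)))) = 64 * sqrt k" unfolding p by simp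
  then show ?thesis using rs by simp
 qed
 have e2: "real n * (exp 16 * \<sigma>\<^sup>2) \<le> exp 16 * real k"
 proof -
  have "\<sigma>\<^sup>2 = real k * real n powr (- (4/3))"
   unfolding \<sigma>_def power_mult_distrib using n0 by (simp add: powr_power)
  also have "\<dots> \<le> real k * real n powr (- 1)" using n by (intro mult_left_mono powr_mono) auto
  also have "\<dots> = real k / real n" using n0 by (simp add: powr_neg_one)
  finally have "real n * \<sigma>\<^sup>2 \<le> real k" using n0 by (simp add: le_divide_eq mult.commute)
  then have "exp 16 * (real n * \<sigma>\<^sup>2) \<le> exp 16 * real k" by (intro mult_left_mono) auto
  then show ?thesis by (simp add: mult.left_commute)
 qed
 have "(\<Sum>is\<in>tup k {..<n}. (cmod (tens x v {} is))\<^sup>2) \<le>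
   fact k / \<sigma> ^ k * exp (real (card {..<n}) * (\<sigma> * (64 * real n powr (- (1/3))) + exp 16 * \<sigma>\<^sup>2))"
  using x v xv s0 s1 by (intro sum_tens_bound) auto
 also have "\<dots> \<le> fact k / \<sigma> ^ k * exp ((64 + exp 16) * real k)"
 proof (rule mult_left_mono)
  have "real (card {..<n}) * (\<sigma> * (64 * real n powr (- (1/3))) + exp 16 * \<sigma>\<^sup>2) \<le> (64 + exp 16) * real k"
   using add_mono[OF e1 e2] by (simp only: distrib_left distrib_right card_lessThan)
  then show "exp (real (card {..<n}) * (\<sigma> * (64 * real n powr (- (1/3))) + exp 16 * \<sigma>\<^sup>2)) \<le> exp ((64 + exp 16) * real k)"
   by (simp only: exp_le_cancel_iff)
  show "0 \<le> fact k / \<sigma> ^ k" using s0 by simp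
 qed
 also have "exp ((64 + exp 16) * real k) = Bflat ^ k"
  unfolding Bflat_def using exp_of_nat_mult[of k "64 + exp 16 :: real"] by (simp add: mult.commute)
 finally show ?thesis unfolding \<sigma>_def .
qed

text \<open>The term of degree k has second moment at most (C |z|^2 n^(-2/3))^k, and this is where
  the exponent 1/3 comes from. Cauchy-Schwarz with weights s^k sums the terms and yields the factor
  1 / (1 - s^2) twice. It is essential that the bound tends to 1 as s tends to 0.\<close>

lemma flat_moment:
 assumes n: "n \<ge> 1"
  and x: "\<And>i. i < n \<Longrightarrow> cmod (x i) \<le> 2" and v: "\<And>i. i < n \<Longrightarrow> cmod (v i) \<le> 2"
  and xv: "\<And>i. i < n \<Longrightarrow> (cmod (x i - v i))\<^sup>2 \<le> 64 * real n powr (- (1/3))"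
  and y: "\<And>i. i < n \<Longrightarrow> cmod (y i) \<le> 2" and u: "\<And>i. i < n \<Longrightarrow> cmod (u i) \<le> 2"
  and yu: "\<And>i. i < n \<Longrightarrow> (cmod (y i - u i))\<^sup>2 \<le> 64 * real n powr (- (1/3))"
  and s: "0 < s" "s < 1" and z: "4 * exp 2 * Bflat\<^sup>2 * (cmod z)\<^sup>2 * real n powr (- (2/3)) \<le> s ^ 4"
 shows "(\<integral>\<^sup>+W. ennreal ((cmod (flat n z x v y u W))\<^sup>2) \<partial>gvec (sq n)) \<le> ennreal (1 / (1 - s\<^sup>2)\<^sup>2)"
proof -
 define t where "t k W = z ^ k * (fact (n - k) / (fact n * fact k)) * tsum n k x v y u W" for k W
 have tm: "t k \<in> borel_measurable (gvec (sq n))" for k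
  unfolding t_def[abs_def] using tsum_measurable by (intro borel_measurable_times borel_measurable_const) auto
 have n0: "real n > 0" using n by simp
 have nz: "g / b * (b * b) = g * b" if "b \<noteq> 0" for g b :: real using that by simp
 have tb: "(\<integral>\<^sup>+W. ennreal ((cmod (t k W))\<^sup>2) \<partial>gvec (sq n)) \<le> ennreal ((s ^ 4) ^ k)" if k: "k \<le> n" for k
 proof -
  define q where "q = (cmod z) ^ k * (fact (n - k) / (fact n * fact k))"
  define Tx where "Tx = (\<Sum>is\<in>tup k {..<n}. (cmod (tens x v {} is))\<^sup>2)"
  define Ty where "Ty = (\<Sum>is\<in>tup k {..<n}. (cmod (tens y u {} is))\<^sup>2)"
  have q: "(cmod (t k W))\<^sup>2 = q\<^sup>2 * (cmod (tsum n k x v y u W))\<^sup>2" for W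
   unfolding t_def q_def norm_mult power_mult_distrib[symmetric]
   by (simp add: norm_mult norm_divide norm_power)
  have real: "q\<^sup>2 * (4 ^ k * fact k * (Tx * Ty)) \<le> (s ^ 4) ^ k"
  proof (cases "k = 0")
   case True
   then show ?thesis by (simp add: q_def Tx_def Ty_def)
  next
   case False
   define T where "T = fact k / (sqrt k * real n powr (- (2/3))) ^ k * Bflat ^ k"
   have T: "Tx \<le> T" "Ty \<le> T"
    unfolding Tx_def Ty_def T_def using False k by (intro tens_power_bound n x v xv y u yu; simp)+
   have T0: "T \<ge> 0" "Tx \<ge> 0" "Ty \<ge> 0" unfolding T_def Tx_def Ty_def Bflat_def by (auto intro!: sum_nonneg)
   define r :: real where "r = fact (n - k) / fact n"
   have r: "0 \<le> r" "r \<le> (exp 1 / real n) ^ k" unfolding r_def using fact_ratio_bound[OF k n] by auto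
   have "q\<^sup>2 * (4 ^ k * fact k * (Tx * Ty)) \<le> q\<^sup>2 * (4 ^ k * fact k * (T * T))"
    using T T0 by (intro mult_left_mono mult_mono) auto
   also have "\<dots> = (cmod z ^ k)\<^sup>2 * r\<^sup>2 * (4 ^ k * (fact k / ((sqrt k * real n powr (- (2/3))) ^ k)\<^sup>2)) * (Bflat ^ k)\<^sup>2"
    unfolding q_def T_def r_def by (simp add: power_mult_distrib power_divide power2_eq_square mult_ac)
   also have "((sqrt k * real n powr (- (2/3))) ^ k)\<^sup>2 = (real k * real n powr (- (4/3))) ^ k"
   proof -
    have "(sqrt k * real n powr (- (2/3)))\<^sup>2 = real k * real n powr (- (4/3))"
     unfolding power_mult_distrib using n0 by (simp add: powr_power)
    then show ?thesis by (metis power_mult mult.commute)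
   qed
   also have "(cmod z ^ k)\<^sup>2 * r\<^sup>2 * (4 ^ k * (fact k / (real k * real n powr (- (4/3))) ^ k)) * (Bflat ^ k)\<^sup>2 \<le>
     (cmod z ^ k)\<^sup>2 * ((exp 1 / real n) ^ k)\<^sup>2 * (4 ^ k * (real k ^ k / (real k * real n powr (- (4/3))) ^ k)) * (Bflat ^ k)\<^sup>2"
   proof -
    have "fact k \<le> real k ^ k" using fact_le_power[of k, where 'a = real] by simp
    then have "fact k / (real k * real n powr (- (4/3))) ^ k \<le> real k ^ k / (real k * real n powr (- (4/3))) ^ k"
     by (intro divide_right_mono) auto
    moreover have "r\<^sup>2 \<le> ((exp 1 / real n) ^ k)\<^sup>2" using r by (intro power_mono) auto
    ultimately show ?thesis
     by (intro mult_mono order_refl mult_nonneg_nonneg divide_nonneg_nonneg zero_le_power zero_le_power2) auto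
   qed
   also have "\<dots> = ((cmod z)\<^sup>2 * (exp 1 / real n)\<^sup>2 * (4 * (real k / (real k * real n powr (- (4/3))))) * Bflat\<^sup>2) ^ k"
    by (simp add: power_mult_distrib power_divide flip: power_mult) (simp add: mult.commute[of k 2], arith)
   also have "(cmod z)\<^sup>2 * (exp 1 / real n)\<^sup>2 * (4 * (real k / (real k * real n powr (- (4/3))))) * Bflat\<^sup>2 =
     4 * exp 2 * Bflat\<^sup>2 * (cmod z)\<^sup>2 * real n powr (- (2/3))"
   proof -
    have "real n powr (4/3) = real n powr (2 + - (2/3))" by simp
    also have "\<dots> = (real n)\<^sup>2 * real n powr (- (2/3))" unfolding powr_add using n0 by simp
    finally have p4: "real n powr (4/3) = (real n)\<^sup>2 * real n powr (- (2/3))" .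
    have "1 / real n powr (- (4/3)) = real n powr (4/3)" by (simp add: powr_minus inverse_eq_divide)
    then have p: "1 / real n powr (- (4/3)) = (real n)\<^sup>2 * real n powr (- (2/3))" unfolding p4 .
    have e: "(exp 1)\<^sup>2 = (exp 2 :: real)" using exp_of_nat_mult[of 2 "1::real"] by simp
    have "real k / (real k * real n powr (- (4/3))) = 1 / real n powr (- (4/3))" using False by simp
    then show ?thesis unfolding p power_divide e using n0 by (simp add: mult_ac)
   qed
   also have "(4 * exp 2 * Bflat\<^sup>2 * (cmod z)\<^sup>2 * real n powr (- (2/3))) ^ k \<le> (s ^ 4) ^ k"
    using z by (intro power_mono) auto
   finally show ?thesis .
  qed
  have "(\<integral>\<^sup>+W. ennreal ((cmod (t k W))\<^sup>2) \<partial>gvec (sq n)) =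
    ennreal (q\<^sup>2) * (\<integral>\<^sup>+W. ennreal ((cmod (tsum n k x v y u W))\<^sup>2) \<partial>gvec (sq n))"
  proof -
   have "(\<lambda>W. ennreal ((cmod (tsum n k x v y u W))\<^sup>2)) \<in> borel_measurable (gvec (sq n))"
    by (rule measurable_compose[OF tsum_measurable]) measurable
   then show ?thesis unfolding q by (simp add: ennreal_mult nn_integral_cmult)
  qed
  also have "\<dots> \<le> ennreal (q\<^sup>2) * ennreal (4 ^ k * fact k * (Tx * Ty))"
   unfolding Tx_def Ty_def by (intro mult_left_mono tsum_moment) auto
  also have "\<dots> = ennreal (q\<^sup>2 * (4 ^ k * fact k * (Tx * Ty)))"
   by (rule ennreal_mult[symmetric]) (auto simp: Tx_def Ty_def intro!: mult_nonneg_nonneg sum_nonneg)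
  also have "\<dots> \<le> ennreal ((s ^ 4) ^ k)" by (intro ennreal_leI real)
  finally show ?thesis .
 qed
 have geo: "(\<Sum>k\<le>n. (s\<^sup>2) ^ k) \<le> 1 / (1 - s\<^sup>2)"
 proof -
  have s2: "s\<^sup>2 < 1" using s by (simp add: power_less_one_iff)
  then have "(\<Sum>k\<le>n. (s\<^sup>2) ^ k) \<le> (\<Sum>k. (s\<^sup>2) ^ k)" by (intro sum_le_suminf summable_geometric) auto
  also have "\<dots> = 1 / (1 - s\<^sup>2)" using s2 by (intro suminf_geometric) auto
  finally show ?thesis .
 qed
 define g where "g = 1 / (1 - s\<^sup>2)"
 have g0: "g \<ge> 0" using s by (simp add: g_def power_le_one)
 have cs: "(cmod (flat n z x v y u W))\<^sup>2 \<le> g * (\<Sum>k\<le>n. (cmod (t k W))\<^sup>2 / (s\<^sup>2) ^ k)" for W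
 proof -
  have "cmod (flat n z x v y u W) \<le> (\<Sum>k\<le>n. cmod (t k W))" unfolding flat_def t_def[symmetric] by (rule norm_sum)
  also have "\<dots> = (\<Sum>k\<le>n. s ^ k * (cmod (t k W) / s ^ k))" using s by simp
  finally have "(cmod (flat n z x v y u W))\<^sup>2 \<le> (\<Sum>k\<le>n. s ^ k * (cmod (t k W) / s ^ k))\<^sup>2"
   by (intro power_mono) auto
  also have "\<dots> \<le> (\<Sum>k\<le>n. (s ^ k)\<^sup>2) * (\<Sum>k\<le>n. (cmod (t k W) / s ^ k)\<^sup>2)" by (rule Cauchy_Schwarz_ineq_sum)
  also have "\<dots> = (\<Sum>k\<le>n. (s\<^sup>2) ^ k) * (\<Sum>k\<le>n. (cmod (t k W))\<^sup>2 / (s\<^sup>2) ^ k)"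
   by (simp add: power_divide power_mult[symmetric] mult.commute)
  also have "\<dots> \<le> g * (\<Sum>k\<le>n. (cmod (t k W))\<^sup>2 / (s\<^sup>2) ^ k)"
   unfolding g_def by (intro mult_right_mono geo sum_nonneg) auto
  finally show ?thesis .
 qed
 have "(\<integral>\<^sup>+W. ennreal ((cmod (flat n z x v y u W))\<^sup>2) \<partial>gvec (sq n)) \<le>
   (\<integral>\<^sup>+W. (\<Sum>k\<le>n. ennreal (g / (s\<^sup>2) ^ k) * ennreal ((cmod (t k W))\<^sup>2)) \<partial>gvec (sq n))"
 proof (rule nn_integral_mono)
  fix W
  have "ennreal ((cmod (flat n z x v y u W))\<^sup>2) \<le> ennreal (\<Sum>k\<le>n. g / (s\<^sup>2) ^ k * (cmod (t k W))\<^sup>2)"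
   using cs[of W] by (intro ennreal_leI) (simp add: sum_distrib_left)
  also have "\<dots> = (\<Sum>k\<le>n. ennreal (g / (s\<^sup>2) ^ k * (cmod (t k W))\<^sup>2))"
   using g0 by (intro sum_ennreal[symmetric]) auto
  also have "\<dots> = (\<Sum>k\<le>n. ennreal (g / (s\<^sup>2) ^ k) * ennreal ((cmod (t k W))\<^sup>2))"
   using g0 by (intro sum.cong refl ennreal_mult) auto
  finally show "ennreal ((cmod (flat n z x v y u W))\<^sup>2) \<le> (\<Sum>k\<le>n. ennreal (g / (s\<^sup>2) ^ k) * ennreal ((cmod (t k W))\<^sup>2))" .
 qed
 also have "\<dots> = (\<Sum>k\<le>n. ennreal (g / (s\<^sup>2) ^ k) * (\<integral>\<^sup>+W. ennreal ((cmod (t k W))\<^sup>2) \<partial>gvec (sq n)))"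
 proof -
  have "(\<lambda>W. ennreal ((cmod (t k W))\<^sup>2)) \<in> borel_measurable (gvec (sq n))" for k
   by (rule measurable_compose[OF tm]) measurable
  then show ?thesis
   by (subst nn_integral_sum) (auto intro!: borel_measurable_times_ennreal sum.cong nn_integral_cmult)
 qed
 also have "\<dots> \<le> (\<Sum>k\<le>n. ennreal (g / (s\<^sup>2) ^ k) * ennreal ((s ^ 4) ^ k))"
  by (intro sum_mono mult_left_mono tb) auto
 also have "\<dots> = (\<Sum>k\<le>n. ennreal (g * (s\<^sup>2) ^ k))"
 proof (rule sum.cong[OF refl])
  fix k
  have "s ^ 4 = s\<^sup>2 * s\<^sup>2" by (simp flip: power_add)
  then have h: "(s ^ 4) ^ k = (s\<^sup>2) ^ k * (s\<^sup>2) ^ k" by (simp only: power_mult_distrib)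
  have "g / (s\<^sup>2) ^ k * (s ^ 4) ^ k = g * (s\<^sup>2) ^ k" unfolding h by (rule nz) (use s in simp)
  then show "ennreal (g / (s\<^sup>2) ^ k) * ennreal ((s ^ 4) ^ k) = ennreal (g * (s\<^sup>2) ^ k)"
   using g0 s by (subst ennreal_mult[symmetric]) auto
 qed
 also have "\<dots> = ennreal (g * (\<Sum>k\<le>n. (s\<^sup>2) ^ k))" using g0 by (subst sum_ennreal) (auto simp: sum_distrib_left)
 also have "\<dots> \<le> ennreal (g * g)" using geo g0 by (intro ennreal_leI mult_left_mono) (auto simp: g_def)
 also have "g * g = 1 / (1 - s\<^sup>2)\<^sup>2" by (simp add: g_def power2_eq_square)
 finally show ?thesis .
qed

section \<open>Mean value inequalities, and projections instead of resampling\<close>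

definition unity_root :: "nat \<Rightarrow> complex" where
 "unity_root m = exp (2 * of_real pi * \<i> / of_nat m)"

lemma unity_root_power: "unity_root m ^ j = exp (2 * of_real pi * \<i> * of_nat j / of_nat m)"
 unfolding unity_root_def exp_of_nat_mult[symmetric] by (simp add: mult_ac)

lemma norm_unity_root [simp]: "cmod (unity_root m) = 1"
 unfolding unity_root_def by (simp add: norm_exp_eq_Re)

lemma sum_unity_root_power:
 assumes "0 < i" "i < m"
 shows "(\<Sum>r<m. (unity_root m ^ r) ^ i) = 0"
proof -
 have ne: "unity_root m ^ i \<noteq> 1"
  unfolding unity_root_power using complex_root_unity_eq_1[of m i] assms by (auto dest: dvd_imp_le)
 have "unity_root m ^ m = 1" unfolding unity_root_power using complex_root_unity_eq_1[of m m] assms by auto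
 then have one: "(unity_root m ^ i) ^ m = 1" by (metis mult.commute power_mult power_one)
 have "(\<Sum>r<m. (unity_root m ^ r) ^ i) = (\<Sum>r<m. (unity_root m ^ i) ^ r)"
  by (simp only: power_mult[symmetric] mult.commute)
 also have "\<dots> = 0" using geometric_sum[OF ne, of m] one by simp
 finally show ?thesis .
qed

text \<open>The average of p over more than deg p roots of unity is p(0); then
  Cauchy-Schwarz.\<close>

lemma poly_mean_value:
 assumes "degree p < m"
 shows "real m * (cmod (poly p 0))\<^sup>2 \<le> (\<Sum>r<m. (cmod (poly p (unity_root m ^ r)))\<^sup>2)"
proof -
 have "(\<Sum>r<m. poly p (unity_root m ^ r)) = (\<Sum>i\<le>degree p. coeff p i * (\<Sum>r<m. (unity_root m ^ r) ^ i))"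
  unfolding poly_altdef by (subst sum.swap) (simp add: sum_distrib_left)
 also have "\<dots> = (\<Sum>i\<le>degree p. if i = 0 then of_nat m * coeff p 0 else 0)"
  using assms sum_unity_root_power[of _ m] by (intro sum.cong refl) auto
 also have "\<dots> = of_nat m * poly p 0" by (simp add: poly_0_coeff_0)
 finally have "real m * cmod (poly p 0) = cmod (\<Sum>r<m. poly p (unity_root m ^ r))" by (simp add: norm_mult)
 also have "\<dots> \<le> (\<Sum>r<m. cmod (poly p (unity_root m ^ r)))" by (rule norm_sum)
 finally have "(real m * cmod (poly p 0))\<^sup>2 \<le> (\<Sum>r<m. cmod (poly p (unity_root m ^ r)))\<^sup>2" by (intro power_mono) auto
 also have "\<dots> \<le> (\<Sum>r<m. (cmod (poly p (unity_root m ^ r)))\<^sup>2) * real m"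
  using sum_squared_le_sum_of_squares[of "\<lambda>r. cmod (poly p (unity_root m ^ r))" "{..<m}"] by simp
 finally have "real m * (real m * (cmod (poly p 0))\<^sup>2) \<le> real m * (\<Sum>r<m. (cmod (poly p (unity_root m ^ r)))\<^sup>2)"
  by (simp add: power2_eq_square mult_ac)
 then show ?thesis using assms by (subst (asm) mult_le_cancel_left_pos) auto
qed

text \<open>A discrete version of plurisubharmonicity: on a complex line the value at the centre is
  at most the mean over the m-th roots of unity.\<close>

definition mean_value :: "'a set \<Rightarrow> nat \<Rightarrow> (('a \<Rightarrow> complex) \<Rightarrow> ennreal) \<Rightarrow> bool" where
 "mean_value A m F \<longleftrightarrow>
  (\<forall>W G. of_nat m * F (\<lambda>a\<in>A. W a) \<le> (\<Sum>r<m. F (\<lambda>a\<in>A. W a + unity_root m ^ r * G a)))"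

context coisometry
begin

lemma resample_measurable_gvec: "(\<lambda>p. resample (snd p) (fst p)) \<in> gvec B \<Otimes>\<^sub>M gvec A \<rightarrow>\<^sub>M gvec A"
proof -
 have "(\<lambda>p. resample (fst p) (snd p)) \<in> gvec A \<Otimes>\<^sub>M gvec B \<rightarrow>\<^sub>M gvec A"
 proof -
  have "sets (gvec A) = sets (lvec A)" "sets (gvec B) = sets (lvec B)" by (rule sets_PiM_cong; simp)+
  then show ?thesis
   using resample_measurable measurable_cong_sets[OF sets_pair_measure_cong, of "gvec A" "lvec A" "gvec B" "lvec B" "gvec A" "lvec A"] by blast
 qed
 from measurable_compose[OF measurable_pair_swap' this] show ?thesis by (simp add: split_beta')
qed

lemma resample_measurable_left:
 assumes "g \<in> space (gvec B)"
 shows "(\<lambda>W. resample W g) \<in> gvec A \<rightarrow>\<^sub>M gvec A"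
 using measurable_compose[OF measurable_Pair1'[OF assms] resample_measurable_gvec] by simp

lemma nn_integral_resample_measurable:
 assumes f: "f \<in> borel_measurable (gvec A)"
 shows "(\<lambda>g. \<integral>\<^sup>+W. f (resample W g) \<partial>gvec A) \<in> borel_measurable (gvec B)"
proof -
 interpret prob_space "gvec A" by (rule prob_space_gvec)
 show ?thesis
  by (rule borel_measurable_nn_integral)
    (use measurable_compose[OF resample_measurable_gvec f] in \<open>simp add: split_beta'\<close>)
qed

text \<open>The mean value property bounds \<open>F\<close> at the projection by its average over the
 resampled directions.\<close>

lemma nn_integral_project_le:
 assumes F: "F \<in> borel_measurable (gvec A)" and m: "m > 0" and mv: "mean_value A m F"
 shows "(\<integral>\<^sup>+W. F (resample W (\<lambda>b\<in>B. 0)) \<partial>gvec A) \<le> (\<integral>\<^sup>+W. F W \<partial>gvec A)"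
proof -
 interpret PB: prob_space "gvec B" by (rule prob_space_gvec)
 have sp: "(\<lambda>b\<in>B. c b) \<in> space (gvec B)" for c by (auto simp: space_PiM)
 define \<Phi> where "\<Phi> g = (\<integral>\<^sup>+W. F (resample W g) \<partial>gvec A)" for g
 have \<Phi>: "\<Phi> \<in> borel_measurable (gvec B)"
  unfolding \<Phi>_def[abs_def] by (rule nn_integral_resample_measurable[OF F])
 have Fm: "(\<lambda>W. F (resample W (\<lambda>b\<in>B. c b))) \<in> borel_measurable (gvec A)" for c
  by (rule measurable_compose[OF resample_measurable_left[OF sp] F])
 have res: "resample W (\<lambda>b\<in>B. c * g b) = (\<lambda>a\<in>A. (W a - adj (fwd W) a) + c * adj g a)" for W c g
  unfolding resample_def by (intro restrict_ext) (simp add: adj_def[of "restrict _ _"] adj_def[of g] sum_distrib_left mult_ac)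
 have pt: "of_nat m * \<Phi> (\<lambda>b\<in>B. 0) \<le> (\<Sum>r<m. \<Phi> (\<lambda>b\<in>B. unity_root m ^ r * g b))" for g
 proof -
  have "of_nat m * \<Phi> (\<lambda>b\<in>B. 0) = (\<integral>\<^sup>+W. of_nat m * F (resample W (\<lambda>b\<in>B. 0)) \<partial>gvec A)"
   unfolding \<Phi>_def by (rule nn_integral_cmult[OF Fm, symmetric])
  also have "\<dots> \<le> (\<integral>\<^sup>+W. (\<Sum>r<m. F (resample W (\<lambda>b\<in>B. unity_root m ^ r * g b))) \<partial>gvec A)"
  proof (rule nn_integral_mono)
   fix W
   have 0: "resample W (\<lambda>b\<in>B. 0) = (\<lambda>a\<in>A. W a - adj (fwd W) a)" using res[of W 0 "\<lambda>_. 0"] by simp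
   show "of_nat m * F (resample W (\<lambda>b\<in>B. 0)) \<le> (\<Sum>r<m. F (resample W (\<lambda>b\<in>B. unity_root m ^ r * g b)))"
    unfolding 0 res using mv unfolding mean_value_def by blast
  qed
  also have "\<dots> = (\<Sum>r<m. \<Phi> (\<lambda>b\<in>B. unity_root m ^ r * g b))"
   unfolding \<Phi>_def by (rule nn_integral_sum) (rule Fm)
  finally show ?thesis .
 qed
 have \<Phi>r: "(\<lambda>g. \<Phi> (\<lambda>b\<in>B. unity_root m ^ r * g b)) \<in> borel_measurable (gvec B)" for r
 proof (rule measurable_compose[OF _ \<Phi>])
  have sC: "sets cgauss = sets borel" by simp
  show "(\<lambda>g. \<lambda>b\<in>B. unity_root m ^ r * g b) \<in> gvec B \<rightarrow>\<^sub>M gvec B"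
  proof (rule measurable_restrict)
   fix b assume "b \<in> B"
   then have "(\<lambda>g. unity_root m ^ r * g b) \<in> borel_measurable (gvec B)"
    by (intro borel_measurable_times borel_measurable_const gvec_component)
   then show "(\<lambda>g. unity_root m ^ r * g b) \<in> gvec B \<rightarrow>\<^sub>M cgauss" using measurable_cong_sets[OF refl sC] by blast
  qed
 qed
 have "of_nat m * \<Phi> (\<lambda>b\<in>B. 0) = (\<integral>\<^sup>+g. of_nat m * \<Phi> (\<lambda>b\<in>B. 0) \<partial>gvec B)"
  by (simp add: PB.emeasure_space_1)
 also have "\<dots> \<le> (\<integral>\<^sup>+g. (\<Sum>r<m. \<Phi> (\<lambda>b\<in>B. unity_root m ^ r * g b)) \<partial>gvec B)"
  by (intro nn_integral_mono pt)
 also have "\<dots> = (\<Sum>r<m. \<integral>\<^sup>+g. \<Phi> (\<lambda>b\<in>B. unity_root m ^ r * g b) \<partial>gvec B)"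
  by (rule nn_integral_sum) (rule \<Phi>r)
 also have "\<dots> = (\<Sum>r<m. \<integral>\<^sup>+g. \<Phi> g \<partial>gvec B)"
  by (intro sum.cong refl nn_integral_gvec_rotate[OF finB _ \<Phi>]) (simp add: norm_power)
 also have "\<dots> = of_nat m * (\<integral>\<^sup>+W. F W \<partial>gvec A)"
  unfolding gvec_resample[OF F] \<Phi>_def by simp
 finally show ?thesis unfolding \<Phi>_def using m
  by (subst (asm) ennreal_mult_le_mult_iff) (auto simp: top_unique)
qed

end

section \<open>Resampling the row means and the components of the columns along e\<close>

definition rrow :: "nat \<Rightarrow> (nat \<times> nat \<Rightarrow> complex) \<Rightarrow> (nat \<Rightarrow> complex) \<Rightarrow> nat \<times> nat \<Rightarrow> complex" where
 "rrow n W h = (\<lambda>p\<in>sq n. W p - (\<Sum>l<n. W (fst p, l)) / of_nat n + h (fst p) / sqrt n)"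

definition rcol :: "nat \<Rightarrow> (nat \<Rightarrow> complex) \<Rightarrow> (nat \<times> nat \<Rightarrow> complex) \<Rightarrow> (nat \<Rightarrow> complex) \<Rightarrow> nat \<times> nat \<Rightarrow> complex" where
 "rcol n e W g = (\<lambda>p\<in>sq n. W p - e (fst p) * (\<Sum>l<n. cnj (e l) * W (l, snd p)) + e (fst p) * g (snd p))"

definition rowS :: "nat \<Rightarrow> nat \<Rightarrow> nat \<times> nat \<Rightarrow> complex" where
 "rowS n i p = (if fst p = i then 1 / sqrt n else 0)"

definition colS :: "(nat \<Rightarrow> complex) \<Rightarrow> nat \<Rightarrow> nat \<times> nat \<Rightarrow> complex" where
 "colS e j p = (if snd p = j then cnj (e (fst p)) else 0)"

lemma sum_sq: "(\<Sum>p\<in>sq n. f p) = (\<Sum>i<n. \<Sum>j<n. f (i, j))"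
 by (simp add: sum.cartesian_product)

lemma inverse_sqrt_square: "1 / complex_of_real (sqrt n) * (1 / complex_of_real (sqrt n)) = 1 / of_nat n"
 by (simp flip: of_real_mult)

lemma sqrt_square_complex: "complex_of_real (sqrt (real n)) * complex_of_real (sqrt (real n)) = of_nat n"
 by (simp flip: of_real_mult)

lemma coisometry_row:
 assumes "n > 0"
 shows "coisometry (sq n) {..<n} (rowS n)"
proof
 fix b b' assume "b \<in> {..<n}" "b' \<in> {..<n}"
 have "(\<Sum>p\<in>sq n. rowS n b p * cnj (rowS n b' p)) = (\<Sum>i<n. if i = b \<and> i = b' then of_nat n * (1 / of_nat n) else 0)"
  unfolding sum_sq by (intro sum.cong refl) (auto simp: rowS_def inverse_sqrt_square sqrt_square_complex)
 also have "\<dots> = (\<Sum>i<n. if i = b then (if b = b' then 1 else 0) else 0)"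
  using assms by (intro sum.cong refl) auto
 also have "\<dots> = (if b = b' then 1 else 0)" using \<open>b \<in> {..<n}\<close> by simp
 finally show "(\<Sum>p\<in>sq n. rowS n b p * cnj (rowS n b' p)) = (if b = b' then 1 else 0)" .
qed auto

lemma coisometry_col:
 assumes e: "(\<Sum>i<n. (cmod (e i))\<^sup>2) = 1"
 shows "coisometry (sq n) {..<n} (colS e)"
proof
 fix b b' assume b: "b \<in> {..<n}" "b' \<in> {..<n}"
 have e1: "(\<Sum>i<n. cnj (e i) * e i) = 1"
 proof -
  have "(\<Sum>i<n. cnj (e i) * e i) = complex_of_real (\<Sum>i<n. (cmod (e i))\<^sup>2)"
   unfolding of_real_sum by (intro sum.cong refl) (simp add: complex_norm_square mult.commute del: of_real_power)
  then show ?thesis by (simp only: e of_real_1)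
 qed
 have "(\<Sum>p\<in>sq n. colS e b p * cnj (colS e b' p)) = (\<Sum>i<n. \<Sum>j<n. if j = b then (if b = b' then cnj (e i) * e i else 0) else 0)"
  unfolding sum_sq by (intro sum.cong refl) (auto simp: colS_def)
 also have "\<dots> = (if b = b' then (\<Sum>i<n. cnj (e i) * e i) else 0)" using b by simp
 finally show "(\<Sum>p\<in>sq n. colS e b p * cnj (colS e b' p)) = (if b = b' then 1 else 0)" unfolding e1 .
qed auto

lemma resample_row:
 assumes n: "n > 0"
 shows "coisometry.resample (sq n) {..<n} (rowS n) W h = rrow n W h"
proof -
 interpret coisometry "sq n" "{..<n}" "rowS n" by (rule coisometry_row[OF n])
 have fwd: "fwd W i = 1 / sqrt n * (\<Sum>l<n. W (i, l))" if "i < n" for i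
 proof -
  have "fwd W i = (\<Sum>i'<n. if i' = i then 1 / sqrt n * (\<Sum>l<n. W (i, l)) else 0)"
   unfolding fwd_def sum_sq by (intro sum.cong refl) (auto simp: rowS_def sum_distrib_left)
  then show ?thesis using that by simp
 qed
 have adj: "adj g p = 1 / sqrt n * g (fst p)" if "p \<in> sq n" for g :: "nat \<Rightarrow> complex" and p
 proof -
  have "adj g p = (\<Sum>i<n. if i = fst p then 1 / sqrt n * g (fst p) else 0)"
   unfolding adj_def by (intro sum.cong refl) (auto simp: rowS_def)
  then show ?thesis using that by auto
 qed
 have "adj (fwd W) p = (\<Sum>l<n. W (fst p, l)) / of_nat n" if "p \<in> sq n" for p
 proof -
  have "adj (fwd W) p = (1 / complex_of_real (sqrt n) * (1 / complex_of_real (sqrt n))) * (\<Sum>l<n. W (fst p, l))"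
   using adj[OF that, of "fwd W"] fwd[of "fst p"] that by (auto simp: mult.assoc)
  then show ?thesis unfolding inverse_sqrt_square by simp
 qed
 then show ?thesis unfolding resample_def rrow_def using adj by (intro restrict_ext) (simp del: mem_Sigma_iff)
qed

lemma resample_col:
 assumes e: "(\<Sum>i<n. (cmod (e i))\<^sup>2) = 1"
 shows "coisometry.resample (sq n) {..<n} (colS e) W g = rcol n e W g"
proof -
 interpret coisometry "sq n" "{..<n}" "colS e" by (rule coisometry_col[OF e])
 have fwd: "fwd W j = (\<Sum>l<n. cnj (e l) * W (l, j))" if "j < n" for j
  unfolding fwd_def sum_sq
 proof (rule sum.cong[OF refl])
  fix i
  have "(\<Sum>j'<n. colS e j (i, j') * W (i, j')) = (\<Sum>j'<n. if j' = j then cnj (e i) * W (i, j) else 0)"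
   by (intro sum.cong refl) (auto simp: colS_def)
  then show "(\<Sum>j'<n. colS e j (i, j') * W (i, j')) = cnj (e i) * W (i, j)" using that by simp
 qed
 have adj: "adj g p = e (fst p) * g (snd p)" if "p \<in> sq n" for g :: "nat \<Rightarrow> complex" and p
 proof -
  have "adj g p = (\<Sum>j<n. if j = snd p then e (fst p) * g (snd p) else 0)"
   unfolding adj_def by (intro sum.cong refl) (auto simp: colS_def)
  then show ?thesis using that by auto
 qed
 have "adj (fwd W) p = e (fst p) * (\<Sum>l<n. cnj (e l) * W (l, snd p))" if "p \<in> sq n" for p
  using adj[OF that, of "fwd W"] fwd[of "snd p"] that by auto
 then show ?thesis unfolding resample_def rcol_def using adj by (intro restrict_ext) (simp del: mem_Sigma_iff)
qed

lemma nn_integral_rrow: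
 assumes n: "n > 0" and f: "f \<in> borel_measurable (gvec (sq n))"
 shows "(\<integral>\<^sup>+W. f W \<partial>gvec (sq n)) = (\<integral>\<^sup>+g. \<integral>\<^sup>+W. f (rrow n W g) \<partial>gvec (sq n) \<partial>gvec {..<n})"
 using coisometry.gvec_resample[OF coisometry_row[OF n] f] unfolding resample_row[OF n] .

lemma rrow_measurable:
 assumes n: "n > 0" and g: "g \<in> space (gvec {..<n})"
 shows "(\<lambda>W. rrow n W g) \<in> gvec (sq n) \<rightarrow>\<^sub>M gvec (sq n)"
 using coisometry.resample_measurable_left[OF coisometry_row[OF n] g] unfolding resample_row[OF n] .

lemma rrow_project:
 assumes n: "n > 0" and F: "F \<in> borel_measurable (gvec (sq n))" "m > 0" "mean_value (sq n) m F"
 shows "(\<integral>\<^sup>+W. F (rrow n W (\<lambda>b\<in>{..<n}. 0)) \<partial>gvec (sq n)) \<le> (\<integral>\<^sup>+W. F W \<partial>gvec (sq n))"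
 using coisometry.nn_integral_project_le[OF coisometry_row[OF n] F] unfolding resample_row[OF n] .

lemma nn_integral_rrow_measurable:
 assumes n: "n > 0" and f: "f \<in> borel_measurable (gvec (sq n))"
 shows "(\<lambda>g. \<integral>\<^sup>+W. f (rrow n W g) \<partial>gvec (sq n)) \<in> borel_measurable (gvec {..<n})"
 using coisometry.nn_integral_resample_measurable[OF coisometry_row[OF n] f] unfolding resample_row[OF n] .

lemma nn_integral_rcol:
 assumes n: "(\<Sum>i<n. (cmod (e i))\<^sup>2) = 1" and f: "f \<in> borel_measurable (gvec (sq n))"
 shows "(\<integral>\<^sup>+W. f W \<partial>gvec (sq n)) = (\<integral>\<^sup>+g. \<integral>\<^sup>+W. f (rcol n e W g) \<partial>gvec (sq n) \<partial>gvec {..<n})"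
 using coisometry.gvec_resample[OF coisometry_col[OF n] f] unfolding resample_col[OF n] .

lemma rcol_measurable:
 assumes n: "(\<Sum>i<n. (cmod (e i))\<^sup>2) = 1" and g: "g \<in> space (gvec {..<n})"
 shows "(\<lambda>W. rcol n e W g) \<in> gvec (sq n) \<rightarrow>\<^sub>M gvec (sq n)"
 using coisometry.resample_measurable_left[OF coisometry_col[OF n] g] unfolding resample_col[OF n] .

lemma rcol_project:
 assumes n: "(\<Sum>i<n. (cmod (e i))\<^sup>2) = 1" and F: "F \<in> borel_measurable (gvec (sq n))" "m > 0" "mean_value (sq n) m F"
 shows "(\<integral>\<^sup>+W. F (rcol n e W (\<lambda>b\<in>{..<n}. 0)) \<partial>gvec (sq n)) \<le> (\<integral>\<^sup>+W. F W \<partial>gvec (sq n))"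
 using coisometry.nn_integral_project_le[OF coisometry_col[OF n] F] unfolding resample_col[OF n] .

lemma nn_integral_rcol_measurable:
 assumes n: "(\<Sum>i<n. (cmod (e i))\<^sup>2) = 1" and f: "f \<in> borel_measurable (gvec (sq n))"
 shows "(\<lambda>g. \<integral>\<^sup>+W. f (rcol n e W g) \<partial>gvec (sq n)) \<in> borel_measurable (gvec {..<n})"
 using coisometry.nn_integral_resample_measurable[OF coisometry_col[OF n] f] unfolding resample_col[OF n] .

lemma flat_restrict: "flat n z x v y u (\<lambda>a\<in>sq n. W a) = flat n z x v y u W"
proof -
 have *: "map (\<lambda>a\<in>sq n. W a) (zip is js) = map W (zip is js)" if "is \<in> tup k {..<n}" "js \<in> tup k {..<n}" for "is" js k
  using that set_zip_leftD set_zip_rightD by (fastforce simp: tup_def)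
 show ?thesis unfolding flat_def tsum_def
  by (intro sum.cong refl arg_cong2[where f = "(*)"] arg_cong[where f = prod_list] *) auto
qed

lemma flat_pencil: "\<exists>p. degree p \<le> n \<and> (\<forall>c. flat n z x v y u (\<lambda>e. W e + c * G e) = poly p c)"
proof -
 have "\<forall>k. \<exists>p. degree p \<le> k \<and> (\<forall>c. tsum n k x v y u (\<lambda>e. W e + c * G e) = poly p c)"
  using tsum_pencil by blast
 from choice[OF this] obtain p where p0: "\<forall>k. degree (p k) \<le> k \<and> (\<forall>c. tsum n k x v y u (\<lambda>e. W e + c * G e) = poly (p k) c)" ..
 then have p: "\<And>k. degree (p k) \<le> k" "\<And>k c. tsum n k x v y u (\<lambda>e. W e + c * G e) = poly (p k) c" by blast+
 have "degree (\<Sum>k\<le>n. smult (z ^ k * (fact (n - k) / (fact n * fact k))) (p k)) \<le> n"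
 proof (rule degree_sum_le)
  fix k assume "k \<in> {..n}"
  have "degree (smult (z ^ k * (fact (n - k) / (fact n * fact k))) (p k)) \<le> degree (p k)" by (rule degree_smult_le)
  also have "\<dots> \<le> k" by (rule p(1))
  finally show "degree (smult (z ^ k * (fact (n - k) / (fact n * fact k))) (p k)) \<le> n" using \<open>k \<in> {..n}\<close> by simp
 qed simp
 then show ?thesis
  by (intro exI[of _ "\<Sum>k\<le>n. smult (z ^ k * (fact (n - k) / (fact n * fact k))) (p k)"])
    (simp add: poly_sum flat_def p(2))
qed

lemma flat_mean_value: "mean_value (sq n) (Suc n) (\<lambda>W. ennreal ((cmod (flat n z x v y u W))\<^sup>2))"
 unfolding mean_value_def
proof (intro allI)
 fix W G :: "nat \<times> nat \<Rightarrow> complex"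
 obtain p where p: "degree p \<le> n" "\<And>c. flat n z x v y u (\<lambda>e. W e + c * G e) = poly p c" using flat_pencil by blast
 have p0: "flat n z x v y u W = poly p 0" using p(2)[of 0] by simp
 have "real (Suc n) * (cmod (poly p 0))\<^sup>2 \<le> (\<Sum>r<Suc n. (cmod (poly p (unity_root (Suc n) ^ r)))\<^sup>2)"
  using p(1) by (intro poly_mean_value) simp
 then have "ennreal (real (Suc n)) * ennreal ((cmod (poly p 0))\<^sup>2) \<le>
   (\<Sum>r<Suc n. ennreal ((cmod (poly p (unity_root (Suc n) ^ r)))\<^sup>2))"
  by (subst ennreal_mult[symmetric], simp, simp, subst sum_ennreal, simp, rule ennreal_leI)
 then show "of_nat (Suc n) * ennreal ((cmod (flat n z x v y u (\<lambda>a\<in>sq n. W a)))\<^sup>2) \<le>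
   (\<Sum>r<Suc n. ennreal ((cmod (flat n z x v y u (\<lambda>a\<in>sq n. W a + unity_root (Suc n) ^ r * G a)))\<^sup>2))"
  unfolding flat_restrict p(2) p0 by (simp only: ennreal_of_nat_eq_real_of_nat)
qed

lemma rrow_linear: "rrow n (\<lambda>a\<in>sq n. W a + c * G a) (\<lambda>b\<in>{..<n}. 0) =
  (\<lambda>a\<in>sq n. rrow n W (\<lambda>b\<in>{..<n}. 0) a + c * rrow n G (\<lambda>b\<in>{..<n}. 0) a)"
proof (rule ext)
 fix a
 show "rrow n (\<lambda>a\<in>sq n. W a + c * G a) (\<lambda>b\<in>{..<n}. 0) a =
   (\<lambda>a\<in>sq n. rrow n W (\<lambda>b\<in>{..<n}. 0) a + c * rrow n G (\<lambda>b\<in>{..<n}. 0) a) a"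
 proof (cases "a \<in> sq n")
  case True
  then have "(\<Sum>l<n. (\<lambda>a\<in>sq n. W a + c * G a) (fst a, l)) = (\<Sum>l<n. W (fst a, l)) + c * (\<Sum>l<n. G (fst a, l))"
   by (auto simp: sum.distrib sum_distrib_left)
  then show ?thesis using True by (simp add: rrow_def del: mem_Sigma_iff) (auto simp: algebra_simps add_divide_distrib)
 qed (simp add: rrow_def)
qed

text \<open>Both resampling steps with the fresh Gaussians set to 0: the columns become orthogonal
  to e and the rows sum to 0.\<close>

definition proj :: "nat \<Rightarrow> (nat \<Rightarrow> complex) \<Rightarrow> (nat \<times> nat \<Rightarrow> complex) \<Rightarrow> nat \<times> nat \<Rightarrow> complex" where
 "proj n e W = rrow n (rcol n e W (\<lambda>b\<in>{..<n}. 0)) (\<lambda>b\<in>{..<n}. 0)"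

text \<open>The entries of the projected matrix are dependent, so \<open>flat_moment\<close> does
  not apply to it. The mean value inequality passes to the Gaussian matrix, one projection at a
  time; the property survives composition with the linear map of the first.\<close>

lemma flat_proj_moment:
 assumes n: "n > 0" and e: "(\<Sum>i<n. (cmod (e i))\<^sup>2) = 1"
 shows "(\<integral>\<^sup>+W. ennreal ((cmod (flat n z x v y u (proj n e W)))\<^sup>2) \<partial>gvec (sq n)) \<le>
     (\<integral>\<^sup>+W. ennreal ((cmod (flat n z x v y u W))\<^sup>2) \<partial>gvec (sq n))"
proof -
 define F where "F W = ennreal ((cmod (flat n z x v y u W))\<^sup>2)" for W
 define F2 where "F2 W = F (rrow n W (\<lambda>b\<in>{..<n}. 0))" for W
 have F: "F \<in> borel_measurable (gvec (sq n))"
  unfolding F_def[abs_def] by (rule measurable_compose[OF flat_measurable]) measurable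
 have sp: "(\<lambda>b\<in>{..<n}. 0) \<in> space (gvec {..<n})" by (auto simp: space_PiM)
 have F2: "F2 \<in> borel_measurable (gvec (sq n))"
  unfolding F2_def[abs_def] by (rule measurable_compose[OF rrow_measurable[OF n sp] F])
 have mF: "mean_value (sq n) (Suc n) F" unfolding F_def[abs_def] by (rule flat_mean_value)
 have mF2: "mean_value (sq n) (Suc n) F2"
  unfolding mean_value_def
 proof (intro allI)
  fix W G :: "nat \<times> nat \<Rightarrow> complex"
  have "rrow n (\<lambda>a\<in>sq n. W a) (\<lambda>b\<in>{..<n}. 0) = (\<lambda>a\<in>sq n. rrow n W (\<lambda>b\<in>{..<n}. 0) a)"
   using rrow_linear[of n W 0 W] by simp
  then show "of_nat (Suc n) * F2 (\<lambda>a\<in>sq n. W a) \<le> (\<Sum>r<Suc n. F2 (\<lambda>a\<in>sq n. W a + unity_root (Suc n) ^ r * G a))"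
   unfolding F2_def rrow_linear using mF unfolding mean_value_def by simp
 qed
 have "(\<integral>\<^sup>+W. F (proj n e W) \<partial>gvec (sq n)) \<le> (\<integral>\<^sup>+W. F2 W \<partial>gvec (sq n))"
  using rcol_project[OF e F2 zero_less_Suc mF2] unfolding F2_def proj_def .
 also have "\<dots> \<le> (\<integral>\<^sup>+W. F W \<partial>gvec (sq n))"
  using rrow_project[OF n F zero_less_Suc mF] unfolding F2_def .
 finally show ?thesis unfolding F_def .
qed

lemma proj_sums:
 assumes n: "n > 0" and e: "(\<Sum>i<n. (cmod (e i))\<^sup>2) = 1"
 shows "j < n \<Longrightarrow> (\<Sum>i<n. cnj (e i) * proj n e W (i, j)) = 0" and "i < n \<Longrightarrow> (\<Sum>j<n. proj n e W (i, j)) = 0"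
proof -
 define M where "M i j = W (i, j) - e i * (\<Sum>l<n. cnj (e l) * W (l, j))" for i j
 have e1: "(\<Sum>i<n. cnj (e i) * e i) = 1"
 proof -
  have "(\<Sum>i<n. cnj (e i) * e i) = complex_of_real (\<Sum>i<n. (cmod (e i))\<^sup>2)"
   unfolding of_real_sum by (intro sum.cong refl) (simp add: complex_norm_square mult.commute del: of_real_power)
  then show ?thesis by (simp only: e of_real_1)
 qed
 have M0: "(\<Sum>i<n. cnj (e i) * M i j) = 0" for j
  unfolding M_def right_diff_distrib sum_subtractf mult.assoc[symmetric] sum_distrib_right[symmetric] e1 by simp
 have pr: "proj n e W (i, j) = M i j - (\<Sum>l<n. M i l) / of_nat n" if "i < n" "j < n" for i j
  using that by (simp add: proj_def rrow_def rcol_def M_def)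
 show "(\<Sum>i<n. cnj (e i) * proj n e W (i, j)) = 0" if j: "j < n"
 proof -
  have "(\<Sum>i<n. cnj (e i) * (\<Sum>l<n. M i l)) = (\<Sum>l<n. \<Sum>i<n. cnj (e i) * M i l)"
   unfolding sum_distrib_left by (rule sum.swap)
  then have sw: "(\<Sum>i<n. cnj (e i) * (\<Sum>l<n. M i l)) = 0" by (simp add: M0)
  show ?thesis using j by (simp add: pr right_diff_distrib sum_subtractf M0 sum_divide_distrib[symmetric] sw)
 qed
 show "(\<Sum>j<n. proj n e W (i, j)) = 0" if i: "i < n"
  using i n by (simp add: pr sum_subtractf)
qed

text \<open>The outer step also removes the row means of the rank one term e_i g_j, which is why g
  appears centred.\<close>

lemma rrow_rcol:
 assumes ij: "i < n" "j < n"
 shows "rrow n (rcol n e W g) h (i, j) = h i / sqrt n + e i * (g j - (\<Sum>l<n. g l) / of_nat n) + proj n e W (i, j)"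
 using ij by (simp add: proj_def rrow_def rcol_def sum.distrib sum_subtractf add_divide_distrib diff_divide_distrib
   sum_distrib_left[symmetric] algebra_simps)

section \<open>Moments of the polynomial\<close>

lemma card_dtup:
 assumes "finite S" "k \<le> card S"
 shows "real (card (dtup k S)) * fact (card S - k) = fact (card S)"
 using assms
proof (induction k arbitrary: S)
 case (Suc k)
 have "real (card (dtup (Suc k) S)) = (\<Sum>x\<in>S. real (card (dtup k (S - {x}))))"
  using sum_dtup_Suc[OF Suc.prems(1), of "\<lambda>_. 1::real" k] by simp
 then have "real (card (dtup (Suc k) S)) * fact (card S - Suc k) =
   (\<Sum>x\<in>S. real (card (dtup k (S - {x}))) * fact (card (S - {x}) - k))"
  unfolding sum_distrib_right using Suc.prems by (auto intro!: sum.cong simp: sum_distrib_right)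
 also have "\<dots> = (\<Sum>x\<in>S. fact (card S - 1))"
 proof (rule sum.cong[OF refl])
  fix x assume "x \<in> S"
  then show "real (card (dtup k (S - {x}))) * fact (card (S - {x}) - k) = fact (card S - 1)"
   using Suc.IH[of "S - {x}"] Suc.prems by simp
 qed
 also have "\<dots> = fact (card S)" using Suc.prems by (cases "card S") auto
 finally show ?case .
qed simp

lemma pcoeff_eq_tsum:
 assumes "k \<le> n"
 shows "pcoeff n (curry W) k = fact (n - k) / (fact n * fact k) * tsum n k (\<lambda>_. 1) (\<lambda>_. 0) (\<lambda>_. 1) (\<lambda>_. 0) W"
proof -
 have "tsum n k (\<lambda>_. 1) (\<lambda>_. 0) (\<lambda>_. 1) (\<lambda>_. 0) W =
   (\<Sum>is\<in>dtup k {..<n}. \<Sum>js\<in>dtup k {..<n}. prod_list (map2 (\<lambda>i j. 1 * 1 * W (i, j)) is js))"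
  by (rule tsum_eq_distinct) auto
 then show ?thesis using assms by (simp add: pcoeff_def curry_def)
qed

lemma pcoeff_measurable: "(\<lambda>W. pcoeff n (curry W) k) \<in> borel_measurable (gvec (sq n))"
proof (cases "k \<le> n")
 case True
 show ?thesis unfolding pcoeff_eq_tsum[OF True]
  by (rule measurable_compose[OF tsum_measurable]) measurable
qed (simp add: pcoeff_def)

text \<open>For v = u = 0 the weights are indicators of injective tuples, so the general bound for
  \<open>tsum\<close> applies and the counts of tuples cancel the factorials.\<close>

lemma pcoeff_moment:
 assumes k: "k \<le> n"
 shows "(\<integral>\<^sup>+W. ennreal ((cmod (pcoeff n (curry W) k))\<^sup>2) \<partial>gvec (sq n)) \<le> ennreal (4 ^ k / fact k)"
proof -
 define T where "T = tsum n k (\<lambda>_. 1) (\<lambda>_. 0) (\<lambda>_. 1) (\<lambda>_. 0)"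
 define c where "c = real (card (dtup k {..<n}))"
 define r :: real where "r = fact (n - k) / (fact n * fact k)"
 have t0: "tens x (\<lambda>_. 0) F is = inj_tens x F is" for x :: "nat \<Rightarrow> complex" and F "is"
  by (induction "is" arbitrary: F) auto
 have "(\<Sum>is\<in>tup k {..<n}. (cmod (tens (\<lambda>_. 1) (\<lambda>_. 0) {} is))\<^sup>2) = (\<Sum>is\<in>dtup k {..<n}. 1)"
 proof (rule sum.mono_neutral_cong_right)
  show "\<forall>is\<in>tup k {..<n} - dtup k {..<n}. (cmod (tens (\<lambda>_. 1) (\<lambda>_. 0) {} is))\<^sup>2 = 0"
   by (auto simp: t0 inj_tens_eq tup_def dtup_def)
  show "(cmod (tens (\<lambda>_. 1) (\<lambda>_. 0) {} is))\<^sup>2 = 1" if "is \<in> dtup k {..<n}" for "is"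
  proof -
   have "prod_list (map (\<lambda>_. 1::complex) is) = 1" by (induction "is") auto
   then show ?thesis using that by (simp add: t0 inj_tens_eq dtup_def)
  qed
 qed (auto simp: dtup_subset)
 then have s: "(\<Sum>is\<in>tup k {..<n}. (cmod (tens (\<lambda>_. 1) (\<lambda>_. 0) {} is))\<^sup>2) = c" by (simp add: c_def)
 have rc: "r * c = 1 / fact k"
  using card_dtup[of "{..<n}" k] k by (simp add: r_def c_def field_simps)
 have "(\<integral>\<^sup>+W. ennreal ((cmod (pcoeff n (curry W) k))\<^sup>2) \<partial>gvec (sq n)) =
   (\<integral>\<^sup>+W. ennreal (r\<^sup>2) * ennreal ((cmod (T W))\<^sup>2) \<partial>gvec (sq n))"
 proof (rule nn_integral_cong)
  fix W
  have "cmod (pcoeff n (curry W) k) = r * cmod (T W)"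
   unfolding pcoeff_eq_tsum[OF k] T_def r_def by (simp add: norm_mult norm_divide)
  then show "ennreal ((cmod (pcoeff n (curry W) k))\<^sup>2) = ennreal (r\<^sup>2) * ennreal ((cmod (T W))\<^sup>2)"
   by (simp add: power_mult_distrib ennreal_mult)
 qed
 also have "\<dots> = ennreal (r\<^sup>2) * (\<integral>\<^sup>+W. ennreal ((cmod (T W))\<^sup>2) \<partial>gvec (sq n))"
  unfolding T_def by (intro nn_integral_cmult measurable_compose[OF tsum_measurable]) measurable
 also have "\<dots> \<le> ennreal (r\<^sup>2) * ennreal (4 ^ k * fact k * (c * c))"
  unfolding T_def using tsum_moment[of n k "\<lambda>_. 1" "\<lambda>_. 0" "\<lambda>_. 1" "\<lambda>_. 0"]
  by (intro mult_left_mono) (simp_all only: s zero_le)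
 also have "\<dots> = ennreal (4 ^ k * fact k * ((r * c) * (r * c)))"
  by (subst ennreal_mult[symmetric]) (auto simp: c_def power2_eq_square mult_ac)
 also have "4 ^ k * fact k * ((r * c) * (r * c)) = 4 ^ k / fact k"
  unfolding rc by simp
 finally show ?thesis .
qed

text \<open>An envelope for |P|^2 that does not depend on z. The weights k! / 8^k leave a geometric
  series when E |a_k|^2 <= 4^k / k!, and in the Cauchy-Schwarz inequality they produce exp (8
  |z|^2).\<close>

definition penv :: "nat \<Rightarrow> (nat \<times> nat \<Rightarrow> complex) \<Rightarrow> real" where
 "penv n W = (\<Sum>k\<le>n. (cmod (pcoeff n (curry W) k))\<^sup>2 * (fact k / 8 ^ k))"

lemma penv_nonneg: "penv n W \<ge> 0"
 unfolding penv_def by (intro sum_nonneg) auto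

lemma penv_measurable: "penv n \<in> borel_measurable (gvec (sq n))"
 unfolding penv_def[abs_def]
 by (intro borel_measurable_sum borel_measurable_times borel_measurable_const)
   (rule measurable_compose[OF pcoeff_measurable], measurable)

lemma penv_integral: "(\<integral>\<^sup>+W. ennreal (penv n W) \<partial>gvec (sq n)) \<le> 2"
proof -
 have m: "(\<lambda>W. ennreal ((cmod (pcoeff n (curry W) k))\<^sup>2)) \<in> borel_measurable (gvec (sq n))" for k
  by (rule measurable_compose[OF pcoeff_measurable]) measurable
 have "(\<integral>\<^sup>+W. ennreal (penv n W) \<partial>gvec (sq n)) =
   (\<integral>\<^sup>+W. (\<Sum>k\<le>n. ennreal ((cmod (pcoeff n (curry W) k))\<^sup>2) * ennreal (fact k / 8 ^ k)) \<partial>gvec (sq n))"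
  unfolding penv_def by (simp add: ennreal_mult[symmetric])
 also have "\<dots> = (\<Sum>k\<le>n. (\<integral>\<^sup>+W. ennreal ((cmod (pcoeff n (curry W) k))\<^sup>2) \<partial>gvec (sq n)) * ennreal (fact k / 8 ^ k))"
  using m by (subst nn_integral_sum) (auto intro!: borel_measurable_times_ennreal nn_integral_multc sum.cong)
 also have "\<dots> \<le> (\<Sum>k\<le>n. ennreal (4 ^ k / fact k) * ennreal (fact k / 8 ^ k))"
  by (intro sum_mono mult_right_mono pcoeff_moment) auto
 also have "\<dots> = (\<Sum>k\<le>n. ennreal ((1/2) ^ k))"
 proof (rule sum.cong[OF refl])
  fix k :: nat
  have "(4::real) ^ k / fact k * (fact k / 8 ^ k) = (1/2) ^ k" by (simp flip: power_divide)
  then show "ennreal (4 ^ k / fact k) * ennreal (fact k / 8 ^ k) = ennreal ((1/2) ^ k)"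
   by (subst ennreal_mult[symmetric]) auto
 qed
 also have "\<dots> = ennreal (\<Sum>k\<le>n. (1/2) ^ k)" by (rule sum_ennreal) simp
 also have "\<dots> \<le> ennreal 2"
 proof (rule ennreal_leI)
  have "(\<Sum>k\<le>n. (1/2) ^ k) \<le> (\<Sum>k. (1/2::real) ^ k)" by (intro sum_le_suminf summable_geometric) auto
  also have "\<dots> = 2" by (subst suminf_geometric) auto
  finally show "(\<Sum>k\<le>n. (1/2) ^ k) \<le> (2::real)" .
 qed
 finally show ?thesis by simp
qed

lemma perm_poly_le_penv: "(cmod (perm_poly n (curry W) z))\<^sup>2 \<le> exp (8 * (cmod z)\<^sup>2) * penv n W"
proof -
 define a where "a k = cmod (pcoeff n (curry W) k)" for k
 define d :: "nat \<Rightarrow> real" where "d k = sqrt (fact k / 8 ^ k)" for k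
 have d: "d k > 0" "(d k)\<^sup>2 = fact k / 8 ^ k" for k by (auto simp: d_def)
 have "cmod (perm_poly n (curry W) z) \<le> (\<Sum>k\<le>n. a k * cmod z ^ k)"
  unfolding perm_poly_eq_sum a_def norm_power[symmetric] norm_mult[symmetric] by (rule norm_sum)
 also have "\<dots> = (\<Sum>k\<le>n. (a k * d k) * (cmod z ^ k / d k))"
 proof (rule sum.cong[OF refl])
  fix k
  have "d k \<noteq> 0" using d(1)[of k] by simp
  then show "a k * cmod z ^ k = (a k * d k) * (cmod z ^ k / d k)" by simp
 qed
 finally have "(cmod (perm_poly n (curry W) z))\<^sup>2 \<le> (\<Sum>k\<le>n. (a k * d k) * (cmod z ^ k / d k))\<^sup>2"
  by (intro power_mono) auto
 also have "\<dots> \<le> (\<Sum>k\<le>n. (a k * d k)\<^sup>2) * (\<Sum>k\<le>n. (cmod z ^ k / d k)\<^sup>2)" by (rule Cauchy_Schwarz_ineq_sum)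
 also have "(\<Sum>k\<le>n. (a k * d k)\<^sup>2) = penv n W"
  unfolding penv_def by (simp add: power_mult_distrib d(2) a_def)
 also have "(\<Sum>k\<le>n. (cmod z ^ k / d k)\<^sup>2) = (\<Sum>k\<le>n. (8 * (cmod z)\<^sup>2) ^ k / fact k)"
  by (intro sum.cong refl) (simp add: power_divide d(2) power_mult_distrib power_mult[symmetric] mult.commute)
 also have "penv n W * \<dots> \<le> penv n W * exp (8 * (cmod z)\<^sup>2)"
  by (intro mult_left_mono exp_partial_sum penv_nonneg) auto
 finally show ?thesis by (simp only: mult.commute[of "exp (8 * (cmod z)\<^sup>2)"])
qed

lemma perm_poly_measurable: "(\<lambda>W. perm_poly n (curry W) z) \<in> borel_measurable (gvec (sq n))"
 unfolding perm_poly_eq_sum using pcoeff_measurable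
 by (intro borel_measurable_sum borel_measurable_times borel_measurable_const)

section \<open>The regularized logarithm\<close>

text \<open>A regularization of 2 n + ln |p|. The least value of the logarithmic term is -2 n, so
  the function is nonnegative, and integrals over nonnegative functions and Fatou's lemma are
  available.\<close>

definition lpsi :: "nat \<Rightarrow> complex \<Rightarrow> real" where
 "lpsi n p = 2 * real n + ln ((cmod p)\<^sup>2 + exp (- (4 * real n))) / 2"

lemma lpsi_nonneg: "lpsi n p \<ge> 0"
proof -
 have "ln (exp (- (4 * real n))) \<le> ln ((cmod p)\<^sup>2 + exp (- (4 * real n)))"
  by (subst ln_le_cancel_iff) (auto intro: add_nonneg_pos)
 then show ?thesis by (simp add: lpsi_def)
qed

text \<open>The tangent to ln at D^2, that is, Jensen's inequality before taking means. If |p| / D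
  has second moment near 1, the terms -1/2 and + 1/2 cancel.\<close>

lemma lpsi_le:
 assumes D: "D > 0"
 shows "lpsi n p \<le> 2 * real n + ln D - 1/2 + ((cmod p)\<^sup>2 + exp (- (4 * real n))) / D\<^sup>2 / 2"
proof -
 define x where "x = (cmod p)\<^sup>2 + exp (- (4 * real n))"
 have x: "x > 0" by (auto simp: x_def intro: add_nonneg_pos)
 have "ln (D\<^sup>2 * (x / D\<^sup>2)) = ln (D\<^sup>2) + ln (x / D\<^sup>2)" using x D by (intro ln_mult_pos) auto
 then have "ln x = ln (D\<^sup>2) + ln (x / D\<^sup>2)" using D by simp
 also have "\<dots> \<le> 2 * ln D + (x / D\<^sup>2 - 1)"
  using x D ln_le_minus_one[of "x / D\<^sup>2"] by (simp add: ln_realpow)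
 finally have le: "ln x \<le> 2 * ln D + (x / D\<^sup>2 - 1)" .
 define q where "q = x / D\<^sup>2"
 show ?thesis using le unfolding lpsi_def x_def[symmetric] q_def[symmetric] by simp
qed

text \<open>For use on bad events: the choice D = exp (n / 2) makes the part that depends on p
  negligible in mean, and leaves a constant linear in n to be multiplied by a small
  probability.\<close>

lemma lpsi_crude: "lpsi n p \<le> 5/2 * real n + exp (- real n) / 2 * ((cmod p)\<^sup>2 + 1)"
proof -
 have sq: "(exp (real n / 2))\<^sup>2 = exp (real n)" by (simp flip: exp_double)
 have "((cmod p)\<^sup>2 + exp (- (4 * real n))) / exp (real n) / 2 \<le> ((cmod p)\<^sup>2 + 1) / exp (real n) / 2"
  by (intro divide_right_mono add_left_mono) auto
 also have "\<dots> = exp (- real n) / 2 * ((cmod p)\<^sup>2 + 1)" by (simp add: exp_minus inverse_eq_divide)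
 finally show ?thesis using lpsi_le[OF exp_gt_zero[of "real n / 2"], of n p] unfolding sq ln_exp by linarith
qed

lemma lpsi_measurable: "(\<lambda>W. ennreal (lpsi n (perm_poly n (curry W) z))) \<in> borel_measurable (gvec (sq n))"
 unfolding lpsi_def by (rule measurable_compose[OF perm_poly_measurable]) measurable

section \<open>Factoring out the row and column means\<close>

lemma per_scale: "per n (\<lambda>i j. r i * c j * M i j) = (\<Prod>i<n. r i) * (\<Prod>j<n. c j) * per n M"
 unfolding per_def sum_distrib_left
proof (rule sum.cong[OF refl])
 fix \<sigma> assume "\<sigma> \<in> {\<sigma>. \<sigma> permutes {..<n}}"
 then have "(\<Prod>j<n. c j) = (\<Prod>i<n. c (\<sigma> i))" using prod.permute[of \<sigma> "{..<n}" c] by (simp add: o_def)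
 then show "(\<Prod>i<n. r i * c (\<sigma> i) * M i (\<sigma> i)) = (\<Prod>i<n. r i) * (\<Prod>j<n. c j) * (\<Prod>i<n. M i (\<sigma> i))"
  by (simp add: prod.distrib)
qed

lemma per_cong:
 assumes "\<And>i j. i < n \<Longrightarrow> j < n \<Longrightarrow> A i j = B i j"
 shows "per n A = per n B"
 unfolding per_def
proof (intro sum.cong prod.cong refl)
 fix \<sigma> i assume "\<sigma> \<in> {\<sigma>. \<sigma> permutes {..<n}}" "i \<in> {..<n}"
 then have "\<sigma> i \<in> {..<n}" using permutes_in_image[of \<sigma> "{..<n}" i] by blast
 then show "A i (\<sigma> i) = B i (\<sigma> i)" using assms \<open>i \<in> {..<n}\<close> by simp
qed

text \<open>Since e is proportional to A, the entries 1 + z W_ij take the form A_i B_j + z N_ij with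
  N = \<open>proj n e W\<close>. Orthogonality to e says that the sums of \<open>cnj (A i)\<close>
  N_ij over i vanish; so x = 1 / A goes with v = \<open>cnj A\<close>, and y = 1 / B with u =
  1.\<close>

lemma perm_poly_factor:
 fixes \<kappa> :: real and A B e g h :: "nat \<Rightarrow> complex" and z :: complex
 assumes n: "n > 0" and e: "(\<Sum>i<n. (cmod (e i))\<^sup>2) = 1" and \<kappa>: "\<kappa> \<noteq> 0"
  and A: "\<And>i. i < n \<Longrightarrow> A i = 1 + z * (h i / sqrt n)" "\<And>i. i < n \<Longrightarrow> A i \<noteq> 0" and eA: "\<And>i. i < n \<Longrightarrow> e i = of_real \<kappa> * A i"
  and B: "\<And>j. j < n \<Longrightarrow> B j = 1 + z * of_real \<kappa> * (g j - (\<Sum>l<n. g l) / of_nat n)" "\<And>j. j < n \<Longrightarrow> B j \<noteq> 0"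
 shows "perm_poly n (curry (rrow n (rcol n e W g) h)) z =
  (\<Prod>i<n. A i) * (\<Prod>j<n. B j) * flat n z (\<lambda>i. 1 / A i) (\<lambda>i. cnj (A i)) (\<lambda>j. 1 / B j) (\<lambda>_. 1) (proj n e W)"
proof -
 define N where "N = proj n e W"
 have r: "(\<Sum>i<n. cnj (A i) * N (i, j)) = 0" if "j < n" for j
 proof -
  have "(\<Sum>i<n. cnj (e i) * N (i, j)) = of_real \<kappa> * (\<Sum>i<n. cnj (A i) * N (i, j))"
   unfolding sum_distrib_left by (intro sum.cong refl) (simp add: eA)
  then show ?thesis using proj_sums(1)[OF n e that, of W] \<kappa> by (simp add: N_def)
 qed
 have c: "(\<Sum>j<n. 1 * N (i, j)) = 0" if "i < n" for i
  using proj_sums(2)[OF n e that, of W] by (simp add: N_def)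
 have f: "perm_poly n (\<lambda>i j. 1 / A i * (1 / B j) * N (i, j)) z =
   flat n z (\<lambda>i. 1 / A i) (\<lambda>i. cnj (A i)) (\<lambda>j. 1 / B j) (\<lambda>_. 1) N"
  using r c by (rule flat_eq_perm_poly)
 have "per n (\<lambda>i j. 1 + z * curry (rrow n (rcol n e W g) h) i j) =
   per n (\<lambda>i j. A i * B j * (1 + z * (1 / A i * (1 / B j) * N (i, j))))"
 proof (rule per_cong)
  fix i j assume ij: "i < n" "j < n"
  have "1 + z * curry (rrow n (rcol n e W g) h) i j =
    1 + z * (h i / sqrt n + of_real \<kappa> * A i * (g j - (\<Sum>l<n. g l) / of_nat n) + N (i, j))"
   using ij by (simp add: rrow_rcol eA N_def)
  also have "\<dots> = A i + A i * (z * of_real \<kappa> * (g j - (\<Sum>l<n. g l) / of_nat n)) + z * N (i, j)"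
   by (simp add: A(1)[OF ij(1)] distrib_left mult_ac)
  also have "\<dots> = A i * B j + z * N (i, j)"
   by (simp add: B(1)[OF ij(2)] distrib_left)
  also have "\<dots> = A i * B j * (1 + z * (1 / A i * (1 / B j) * N (i, j)))"
   using A(2)[OF ij(1)] B(2)[OF ij(2)] by (simp add: distrib_left)
  finally show "1 + z * curry (rrow n (rcol n e W g) h) i j = A i * B j * (1 + z * (1 / A i * (1 / B j) * N (i, j)))" .
 qed
 then show ?thesis unfolding f[symmetric] N_def[symmetric] perm_poly_def per_scale by simp
qed

lemma one_plus_bounds:
 assumes "cmod w \<le> 1/2"
 shows "cmod (1 + w) \<ge> 1/2" "cmod (1 / (1 + w)) \<le> 2" "cmod (1 + w) \<le> 2" "1 + w \<noteq> 0"
  "cmod (1 / (1 + w) - 1) \<le> 2 * cmod w"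
proof -
 have 1: "cmod (1 + w) \<ge> 1 - cmod w" using norm_diff_ineq[of 1 w] by simp
 then show g: "cmod (1 + w) \<ge> 1/2" using assms by linarith
 then show ne: "1 + w \<noteq> 0" by auto
 show le: "cmod (1 / (1 + w)) \<le> 2" using g by (simp add: norm_divide divide_le_eq)
 show "cmod (1 + w) \<le> 2" using norm_triangle_ineq[of 1 w] assms by simp
 have "1 / (1 + w) - 1 = - w * (1 / (1 + w))" using ne by (simp add: divide_simps)
 then have "cmod (1 / (1 + w) - 1) = cmod w * cmod (1 / (1 + w))" by (simp only: norm_mult norm_minus_cancel)
 also have "\<dots> \<le> cmod w * 2" using le by (intro mult_left_mono) auto
 finally show "cmod (1 / (1 + w) - 1) \<le> 2 * cmod w" by simp
qed

text \<open>Both terms are 1 + O(w). This is the smallness of x - v for the row weights.\<close>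

lemma inverse_minus_cnj:
 assumes "cmod w \<le> 1/8"
 shows "cmod (1 / (1 + w) - cnj (1 + w)) \<le> 4 * cmod w"
proof -
 have ne: "1 + w \<noteq> 0" and b: "cmod (1 / (1 + w) - 1) \<le> 2 * cmod w"
  using one_plus_bounds[of w] assms by auto
 have "1 / (1 + w) - cnj (1 + w) = (1 / (1 + w) - 1) - cnj w" by simp
 then have "cmod (1 / (1 + w) - cnj (1 + w)) \<le> cmod (1 / (1 + w) - 1) + cmod (cnj w)"
  by (simp only: norm_triangle_ineq4)
 then show ?thesis using b norm_ge_zero[of w] unfolding complex_mod_cnj by linarith
qed

lemma ln_one_plus_lower: "cmod w \<le> 1/2 \<Longrightarrow> ln (cmod (1 + w)) \<ge> - ln 2"
proof -
 assume "cmod w \<le> 1/2"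
 then have "1/2 \<le> cmod (1 + w)" by (rule one_plus_bounds(1))
 then have "ln (1/2) \<le> ln (cmod (1 + w))" by (subst ln_le_cancel_iff) linarith+
 then show ?thesis by (simp add: ln_div)
qed

text \<open>With g and h fixed, only N is random. Taking D as the modulus of the two products in
  \<open>lpsi_le\<close> leaves half the second moment of \<open>flat\<close> at N, which is nearly
  1/2.\<close>

lemma good_log_integral:
 fixes \<kappa> :: real and a b e g h :: "nat \<Rightarrow> complex" and z :: complex
 assumes n: "n > 0" and e: "(\<Sum>i<n. (cmod (e i))\<^sup>2) = 1" and \<kappa>: "\<kappa> \<noteq> 0"
  and a: "\<And>i. i < n \<Longrightarrow> cmod (a i) \<le> 2 * real n powr (- (1/6))" and b: "\<And>i. i < n \<Longrightarrow> cmod (b i) \<le> 4 * real n powr (- (1/6))"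
  and small: "real n powr (- (1/6)) \<le> 1/16"
  and A: "\<And>i. i < n \<Longrightarrow> a i = z * (h i / sqrt n)" and eA: "\<And>i. i < n \<Longrightarrow> e i = of_real \<kappa> * (1 + a i)"
  and B: "\<And>j. j < n \<Longrightarrow> b j = z * of_real \<kappa> * (g j - (\<Sum>l<n. g l) / of_nat n)"
  and s: "0 < s" "s < 1" and z: "4 * exp 2 * Bflat\<^sup>2 * (cmod z)\<^sup>2 * real n powr (- (2/3)) \<le> s ^ 4"
 shows "(\<integral>\<^sup>+W. ennreal (lpsi n (perm_poly n (curry (rrow n (rcol n e W g) h)) z)) \<partial>gvec (sq n)) \<le>
  ennreal (2 * real n + (\<Sum>i<n. ln (cmod (1 + a i))) + (\<Sum>j<n. ln (cmod (1 + b j))) - 1/2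
   + (1 / (1 - s\<^sup>2)\<^sup>2 + (16 * exp (- 4)) ^ n) / 2)"
proof -
 have a8: "cmod (a i) \<le> 1/8" "cmod (a i) \<le> 1/2" if "i < n" for i using a[OF that] small by auto
 have b2: "cmod (b i) \<le> 1/2" if "i < n" for i using b[OF that] small by auto
 define F where "F W = flat n z (\<lambda>i. 1 / (1 + a i)) (\<lambda>i. cnj (1 + a i)) (\<lambda>j. 1 / (1 + b j)) (\<lambda>_. 1) (proj n e W)" for W
 define D where "D = (\<Prod>i<n. cmod (1 + a i)) * (\<Prod>j<n. cmod (1 + b j))"
 have pos: "cmod (1 + a i) > 0" "cmod (1 + b i) > 0" if "i < n" for i
  using one_plus_bounds(4)[OF a8(2)[OF that]] one_plus_bounds(4)[OF b2[OF that]] by auto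
 have D0: "D > 0" unfolding D_def using pos by (intro mult_pos_pos prod_pos) auto
 have lnD: "ln D = (\<Sum>i<n. ln (cmod (1 + a i))) + (\<Sum>j<n. ln (cmod (1 + b j)))"
 proof -
  have "ln (\<Prod>i<n. cmod (1 + a i)) = (\<Sum>i<n. ln (cmod (1 + a i)))" "ln (\<Prod>i<n. cmod (1 + b i)) = (\<Sum>i<n. ln (cmod (1 + b i)))"
   using pos by (auto intro!: ln_prod)
  moreover have "ln D = ln (\<Prod>i<n. cmod (1 + a i)) + ln (\<Prod>i<n. cmod (1 + b i))"
   unfolding D_def by (rule ln_mult_pos) (use pos in \<open>auto intro!: prod_pos\<close>)
  ultimately show ?thesis by simp
 qed
 have P: "perm_poly n (curry (rrow n (rcol n e W g) h)) z = (\<Prod>i<n. 1 + a i) * (\<Prod>j<n. 1 + b j) * F W" for W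
  unfolding F_def
  by (rule perm_poly_factor[OF n e \<kappa>]) (use A B eA one_plus_bounds(4) a8 b2 in auto)
 have cP: "(cmod (perm_poly n (curry (rrow n (rcol n e W g) h)) z))\<^sup>2 = D\<^sup>2 * (cmod (F W))\<^sup>2" for W
  unfolding P by (simp add: norm_mult D_def power_mult_distrib flip: prod_norm)
 have lnD2: "ln D \<ge> - (2 * real n * ln 2)"
 proof -
  have "(\<Sum>i<n. - ln 2) \<le> (\<Sum>i<n. ln (cmod (1 + a i)))" "(\<Sum>i<n. - ln 2) \<le> (\<Sum>j<n. ln (cmod (1 + b j)))"
   using ln_one_plus_lower a8(2) b2 by (intro sum_mono; simp)+
  then show ?thesis unfolding lnD by simp
 qed
 \<comment> \<open>All factors have modulus at least 1/2, so D^2 >= 16^(-n); since 16 < e^4, the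
   regularization exp (-4 n) is negligible against D^2.\<close>
 have ee: "exp (- (4 * real n)) / D\<^sup>2 \<le> (16 * exp (- 4)) ^ n"
 proof -
  have "exp (- (4 * real n)) / D\<^sup>2 = exp (- (4 * real n)) / exp (2 * ln D)"
   using D0 by (simp add: exp_double)
  also have "\<dots> = exp (- (4 * real n) - 2 * ln D)" by (simp add: exp_diff)
  also have "\<dots> \<le> exp (real n * (ln 16 + (- 4)))"
  proof -
   have "ln (16::real) = 4 * ln 2" using ln_realpow[of 2 4] by simp
   then show ?thesis using lnD2 by (simp add: algebra_simps)
  qed
  also have "\<dots> = (16 * exp (- 4)) ^ n" unfolding exp_of_nat_mult exp_add by simp
  finally show ?thesis .
 qed
 define c where "c = 2 * real n + ln D - 1/2 + (16 * exp (- 4)) ^ n / 2"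
 have c0: "c \<ge> 0"
 proof -
  have "ln (2::real) \<le> 3/4" using ln2_le_25_over_36 by simp
  then have "real n * ln 2 \<le> real n * (3/4)" by (intro mult_left_mono) auto
  moreover have "real n \<ge> 1" using n by simp
  ultimately have "2 * real n + ln D - 1/2 \<ge> 0" using lnD2 by linarith
  then show ?thesis by (simp add: c_def)
 qed
 have pt: "lpsi n (perm_poly n (curry (rrow n (rcol n e W g) h)) z) \<le> c + 1/2 * (cmod (F W))\<^sup>2" for W
 proof -
  have "lpsi n (perm_poly n (curry (rrow n (rcol n e W g) h)) z) \<le>
    2 * real n + ln D - 1/2 + (D\<^sup>2 * (cmod (F W))\<^sup>2 + exp (- (4 * real n))) / D\<^sup>2 / 2"
   using lpsi_le[OF D0, of n "perm_poly n (curry (rrow n (rcol n e W g) h)) z"] unfolding cP .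
  also have "\<dots> = 2 * real n + ln D - 1/2 + (exp (- (4 * real n)) / D\<^sup>2) / 2 + 1/2 * (cmod (F W))\<^sup>2"
   using D0 by (simp add: add_divide_distrib)
  also have "\<dots> \<le> c + 1/2 * (cmod (F W))\<^sup>2" using ee by (simp add: c_def)
  finally show ?thesis .
 qed
 interpret prob_space "gvec (sq n)" by (rule prob_space_gvec)
 have sp: "(\<lambda>b\<in>{..<n}. 0) \<in> space (gvec {..<n})" by (auto simp: space_PiM)
 have Fm: "F \<in> borel_measurable (gvec (sq n))"
  unfolding F_def[abs_def] proj_def
  by (rule measurable_compose[OF measurable_compose[OF rcol_measurable[OF e sp] rrow_measurable[OF n sp]] flat_measurable])
 have F2: "(\<lambda>W. ennreal ((cmod (F W))\<^sup>2)) \<in> borel_measurable (gvec (sq n))"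
  by (rule measurable_compose[OF Fm]) measurable
 have sq16: "(cmod w)\<^sup>2 \<le> 64 * real n powr (- (1/3))" if "cmod w \<le> 8 * real n powr (- (1/6))" for w
 proof -
  have "(cmod w)\<^sup>2 \<le> (8 * real n powr (- (1/6)))\<^sup>2" using that by (intro power_mono) auto
  also have "\<dots> = 64 * real n powr (- (1/3))" using n by (simp add: power_mult_distrib powr_power)
  finally show ?thesis .
 qed
 have "(\<integral>\<^sup>+W. ennreal ((cmod (F W))\<^sup>2) \<partial>gvec (sq n)) \<le> ennreal (1 / (1 - s\<^sup>2)\<^sup>2)"
  unfolding F_def
 proof (rule order_trans[OF flat_proj_moment[OF n e] flat_moment])
  fix i assume i: "i < n"
  note ai = one_plus_bounds[OF a8(2)[OF i]] and bi = one_plus_bounds[OF b2[OF i]]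
  show "cmod (1 / (1 + a i)) \<le> 2" "cmod (cnj (1 + a i)) \<le> 2" "cmod (1 / (1 + b i)) \<le> 2"
   using ai bi by (auto simp only: complex_mod_cnj)
  show "cmod 1 \<le> 2" by simp
  show "(cmod (1 / (1 + a i) - cnj (1 + a i)))\<^sup>2 \<le> 64 * real n powr (- (1/3))"
   by (rule sq16) (use inverse_minus_cnj[OF a8(1)[OF i]] a[OF i] in linarith)
  show "(cmod (1 / (1 + b i) - 1))\<^sup>2 \<le> 64 * real n powr (- (1/3))"
   by (rule sq16) (use bi(5) b[OF i] in linarith)
 qed (use n s z in auto)
 note F2i = this
 have "(\<integral>\<^sup>+W. ennreal (lpsi n (perm_poly n (curry (rrow n (rcol n e W g) h)) z)) \<partial>gvec (sq n)) \<le>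
   (\<integral>\<^sup>+W. ennreal c + ennreal (1/2) * ennreal ((cmod (F W))\<^sup>2) \<partial>gvec (sq n))"
 proof (rule nn_integral_mono)
  fix W
  have "ennreal (lpsi n (perm_poly n (curry (rrow n (rcol n e W g) h)) z)) \<le> ennreal (c + 1/2 * (cmod (F W))\<^sup>2)"
   by (intro ennreal_leI pt)
  also have "\<dots> = ennreal c + ennreal (1/2) * ennreal ((cmod (F W))\<^sup>2)"
   using c0 by (subst ennreal_mult[symmetric], simp, simp, subst ennreal_plus[symmetric]) auto
  finally show "ennreal (lpsi n (perm_poly n (curry (rrow n (rcol n e W g) h)) z)) \<le> ennreal c + ennreal (1/2) * ennreal ((cmod (F W))\<^sup>2)" .
 qed
 also have "\<dots> = ennreal c + ennreal (1/2) * (\<integral>\<^sup>+W. ennreal ((cmod (F W))\<^sup>2) \<partial>gvec (sq n))"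
  using F2 by (subst nn_integral_add) (auto simp: emeasure_space_1 nn_integral_cmult)
 also have "\<dots> \<le> ennreal c + ennreal (1/2) * ennreal (1 / (1 - s\<^sup>2)\<^sup>2)"
  by (intro add_left_mono mult_left_mono F2i) auto
 also have "\<dots> = ennreal (c + 1/2 * (1 / (1 - s\<^sup>2)\<^sup>2))"
  using c0 by (subst ennreal_mult[symmetric], simp, simp, subst ennreal_plus[symmetric]) auto
 also have "c + 1/2 * (1 / (1 - s\<^sup>2)\<^sup>2) = 2 * real n + (\<Sum>i<n. ln (cmod (1 + a i))) + (\<Sum>j<n. ln (cmod (1 + b j))) - 1/2
   + (1 / (1 - s\<^sup>2)\<^sup>2 + (16 * exp (- 4)) ^ n) / 2"
  by (simp add: c_def lnD)
 finally show ?thesis .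
qed

lemma unity_root_double:
 assumes "M > 0"
 shows "unity_root (2 * M) ^ 2 = unity_root M" "unity_root (2 * M) ^ M = -1"
proof -
 show "unity_root (2 * M) ^ 2 = unity_root M"
 proof -
  have "unity_root (2 * M) ^ 2 = exp (2 * of_real pi * \<i> * of_nat 2 / of_nat (2 * M))" by (rule unity_root_power)
  also have "2 * of_real pi * \<i> * of_nat 2 / of_nat (2 * M) = 2 * of_real pi * \<i> / of_nat M" by simp
  finally show ?thesis by (simp only: unity_root_def)
 qed
 have "unity_root (2 * M) ^ M = exp (of_real pi * \<i>)"
  unfolding unity_root_power using assms by simp
 then show "unity_root (2 * M) ^ M = -1" by simp
qed

text \<open>Halving: the factors for r and r + M belong to opposite roots and multiply to a factor
  in the squares of x and y. Powers of 2 cover both averages used below, over eighth roots and over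
  finer and finer ones.\<close>

lemma prod_unity_root: "(\<Prod>r<2 ^ j. x - unity_root (2 ^ j) ^ r * y) = x ^ (2 ^ j) - y ^ (2 ^ j)"
proof (induction j arbitrary: x y)
 case (Suc j)
 define M :: nat where "M = 2 ^ j"
 have M: "M > 0" by (simp add: M_def)
 define f where "f r = x - unity_root (2 * M) ^ r * y" for r
 have "(\<Prod>r<2 * M. f r) = (\<Prod>r=0..<M. f r) * (\<Prod>r=M..<M + M. f r)"
  by (simp add: prod.atLeastLessThan_concat lessThan_atLeast0 mult_2)
 also have "(\<Prod>r=M..<M + M. f r) = (\<Prod>r=0..<M. f (r + M))"
  using prod.shift_bounds_nat_ivl[of f 0 M M] by simp
 also have "(\<Prod>r=0..<M. f r) * (\<Prod>r=0..<M. f (r + M)) = (\<Prod>r<M. x\<^sup>2 - unity_root M ^ r * y\<^sup>2)"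
  unfolding prod.distrib[symmetric] lessThan_atLeast0
 proof (rule prod.cong[OF refl])
  fix r
  define u where "u = unity_root (2 * M) ^ r"
  have "u\<^sup>2 = (unity_root (2 * M) ^ 2) ^ r" unfolding u_def by (simp only: power_mult[symmetric] mult.commute)
  then have u2: "u\<^sup>2 = unity_root M ^ r" by (simp only: unity_root_double(1)[OF M])
  have "f (r + M) = x + u * y" unfolding f_def power_add unity_root_double(2)[OF M] u_def by simp
  moreover have "f r = x - u * y" by (simp add: f_def u_def)
  ultimately have "f r * f (r + M) = (x - u * y) * (x + u * y)" by (simp only:)
  also have "\<dots> = x\<^sup>2 - u\<^sup>2 * y\<^sup>2" by (simp add: algebra_simps power2_eq_square)
  finally have "f r * f (r + M) = x\<^sup>2 - u\<^sup>2 * y\<^sup>2" .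
  then show "f r * f (r + M) = x\<^sup>2 - unity_root M ^ r * y\<^sup>2" by (simp only: u2)
 qed
 also have "\<dots> = (x\<^sup>2) ^ M - (y\<^sup>2) ^ M" unfolding M_def by (rule Suc)
 finally show ?case unfolding f_def M_def by (simp add: power_mult)
qed (simp add: unity_root_def)

lemma prod_unity_root_8: "(\<Prod>r<8. 1 + unity_root 8 ^ r * w) = 1 - w ^ 8"
 using prod_unity_root[of 1 3 "- w"] by simp

text \<open>Averaging over rotations by eighth roots of unity replaces \<open>1 + f\<close> by \<open>1 - f ^ 8\<close>.\<close>

lemma log_rotation:
 fixes f :: "nat \<Rightarrow> (nat \<Rightarrow> complex) \<Rightarrow> complex"
 assumes meas: "\<And>i. i < n \<Longrightarrow> f i \<in> borel_measurable (gvec {..<n})"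
  and good: "{g \<in> space (gvec {..<n}). good g} \<in> sets (gvec {..<n})"
  and hom: "\<And>i u g. i < n \<Longrightarrow> f i (\<lambda>b\<in>{..<n}. u * g b) = u * f i g"
  and inv: "\<And>u g. cmod u = 1 \<Longrightarrow> good (\<lambda>b\<in>{..<n}. u * g b) = good g"
  and bd: "\<And>i g. i < n \<Longrightarrow> good g \<Longrightarrow> cmod (f i g) \<le> t" and t: "0 \<le> t" "t \<le> 1/2"
 shows "(\<lambda>g. if good g then ennreal (real n + (\<Sum>i<n. ln (cmod (1 + f i g)))) else 0) \<in> borel_measurable (gvec {..<n})"
  and "(\<integral>\<^sup>+g. (if good g then ennreal (real n + (\<Sum>i<n. ln (cmod (1 + f i g)))) else 0) \<partial>gvec {..<n}) \<le> ennreal (real n + real n * t ^ 8)"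
proof -
 define F where "F g = (if good g then ennreal (real n + (\<Sum>i<n. ln (cmod (1 + f i g)))) else 0)" for g
 have "(\<lambda>g. real n + (\<Sum>i<n. ln (cmod (1 + f i g)))) \<in> borel_measurable (gvec {..<n})"
 proof (intro borel_measurable_add borel_measurable_const borel_measurable_sum)
  fix i assume "i \<in> {..<n}"
  then show "(\<lambda>g. ln (cmod (1 + f i g))) \<in> borel_measurable (gvec {..<n})"
   by (intro measurable_compose[OF meas[of i], of "\<lambda>w. ln (cmod (1 + w))"]) auto
 qed
 then show F: "F \<in> borel_measurable (gvec {..<n})"
  unfolding F_def[abs_def] using good
  by (intro measurable_If measurable_compose[OF _ measurable_ennreal]) auto
 \<comment> \<open>Each logarithm is at least - ln 2 >= -1, so the offset n makes the sum
   nonnegative and \<open>ennreal\<close> keeps its value.\<close>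
 have low: "real n + (\<Sum>i<n. ln (cmod (1 + u * f i g))) \<ge> 0" if g: "good g" and u: "cmod u = 1" for g u
 proof -
  have "(\<Sum>i<n. - 1) \<le> (\<Sum>i<n. ln (cmod (1 + u * f i g)))"
  proof (rule sum_mono)
   fix i assume "i \<in> {..<n}"
   then have "cmod (u * f i g) \<le> 1/2" using bd[of i g] g u t by (simp add: norm_mult)
   from ln_one_plus_lower[OF this] show "- 1 \<le> ln (cmod (1 + u * f i g))" using ln2_le_25_over_36 by linarith
  qed
  then show ?thesis by simp
 qed
 define R where "R r g = (\<lambda>b\<in>{..<n}. unity_root 8 ^ r * g b)" for r g
 have u1: "cmod (unity_root 8 ^ r) = 1" for r by (simp add: norm_power)
 have pt: "(\<Sum>r<8. F (R r g)) \<le> ennreal (8 * (real n + real n * t ^ 8))" for g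
 proof (cases "good g")
  case False
  then have "F (R r g) = 0" for r using inv[OF u1, of r g] by (simp add: F_def R_def)
  then show ?thesis by simp
 next
  case True
  have "F (R r g) = ennreal (real n + (\<Sum>i<n. ln (cmod (1 + unity_root 8 ^ r * f i g))))" for r
  proof -
   have "(\<Sum>i<n. ln (cmod (1 + f i (R r g)))) = (\<Sum>i<n. ln (cmod (1 + unity_root 8 ^ r * f i g)))"
    by (intro sum.cong refl) (simp add: R_def hom)
   moreover have "good (R r g)" using inv[OF u1, of r g] True by (simp add: R_def)
   ultimately show ?thesis by (simp add: F_def)
  qed
  then have "(\<Sum>r<8. F (R r g)) = ennreal (\<Sum>r<8. real n + (\<Sum>i<n. ln (cmod (1 + unity_root 8 ^ r * f i g))))"
   using low[OF True u1] by (simp add: sum_ennreal)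
  also have "(\<Sum>r<8. real n + (\<Sum>i<n. ln (cmod (1 + unity_root 8 ^ r * f i g)))) =
    8 * real n + (\<Sum>i<n. \<Sum>r<8. ln (cmod (1 + unity_root 8 ^ r * f i g)))"
   unfolding sum.distrib by (subst sum.swap) simp
  also have "(\<Sum>i<n. \<Sum>r<8. ln (cmod (1 + unity_root 8 ^ r * f i g))) \<le> (\<Sum>i<n. t ^ 8)"
  proof (rule sum_mono)
   fix i assume i: "i \<in> {..<n}"
   have h: "cmod (unity_root 8 ^ r * f i g) \<le> 1/2" for r
    using bd[of i g] i True t by (simp add: norm_mult norm_power)
   have "(\<Sum>r<8. ln (cmod (1 + unity_root 8 ^ r * f i g))) = ln (\<Prod>r<8. cmod (1 + unity_root 8 ^ r * f i g))"
    using one_plus_bounds(4)[OF h] by (intro ln_prod[symmetric]) auto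
   also have "\<dots> = ln (cmod (1 - f i g ^ 8))" unfolding prod_norm prod_unity_root_8 ..
   also have "\<dots> \<le> cmod (1 - f i g ^ 8) - 1"
   proof (rule ln_le_minus_one)
    have "(\<Prod>r<8. 1 + unity_root 8 ^ r * f i g) \<noteq> 0" using one_plus_bounds(4)[OF h] by simp
    then show "cmod (1 - f i g ^ 8) > 0" unfolding prod_unity_root_8 by simp
   qed
   also have "\<dots> \<le> cmod (f i g) ^ 8" using norm_triangle_ineq4[of 1 "f i g ^ 8"] by (simp add: norm_power)
   also have "\<dots> \<le> t ^ 8" using bd[of i g] i True by (intro power_mono) auto
   finally show "(\<Sum>r<8. ln (cmod (1 + unity_root 8 ^ r * f i g))) \<le> t ^ 8" .
  qed
  finally have le: "(\<Sum>r<8. F (R r g)) \<le> ennreal (8 * real n + (\<Sum>i<n. t ^ 8))" by (simp add: ennreal_leI)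
  have "0 \<le> real n * t ^ 8" "(\<Sum>i<n. t ^ 8) = real n * t ^ 8" using t by simp_all
  moreover have "8 * x + y \<le> 8 * (x + y)" if "0 \<le> y" for x y :: real using that by simp
  ultimately have "8 * real n + (\<Sum>i<n. t ^ 8) \<le> 8 * (real n + real n * t ^ 8)" by metis
  then have "ennreal (8 * real n + (\<Sum>i<n. t ^ 8)) \<le> ennreal (8 * (real n + real n * t ^ 8))"
   by (rule ennreal_leI)
  with le show ?thesis by (rule order_trans)
 qed
 have Rm: "(\<lambda>g. F (R r g)) \<in> borel_measurable (gvec {..<n})" for r
 proof (rule measurable_compose[OF _ F])
  have sC: "sets cgauss = sets borel" by simp
  show "R r \<in> gvec {..<n} \<rightarrow>\<^sub>M gvec {..<n}"
   unfolding R_def[abs_def]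
  proof (rule measurable_restrict)
   fix b assume "b \<in> {..<n}"
   then have "(\<lambda>g. unity_root 8 ^ r * g b) \<in> borel_measurable (gvec {..<n})"
    by (intro borel_measurable_times borel_measurable_const gvec_component)
   then show "(\<lambda>g. unity_root 8 ^ r * g b) \<in> gvec {..<n} \<rightarrow>\<^sub>M cgauss" using measurable_cong_sets[OF refl sC] by blast
  qed
 qed
 interpret prob_space "gvec {..<n}" by (rule prob_space_gvec)
 have "8 * (\<integral>\<^sup>+g. F g \<partial>gvec {..<n}) = (\<Sum>r<8::nat. \<integral>\<^sup>+g. F g \<partial>gvec {..<n})" by simp
 also have "\<dots> = (\<Sum>r<8. \<integral>\<^sup>+g. F (R r g) \<partial>gvec {..<n})"
  unfolding R_def by (intro sum.cong refl nn_integral_gvec_rotate[symmetric] F) (auto simp: norm_power)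
 also have "\<dots> = (\<integral>\<^sup>+g. (\<Sum>r<8. F (R r g)) \<partial>gvec {..<n})" by (rule nn_integral_sum[symmetric]) (rule Rm)
 also have "\<dots> \<le> (\<integral>\<^sup>+g. ennreal (8 * (real n + real n * t ^ 8)) \<partial>gvec {..<n})" by (intro nn_integral_mono pt)
 also have "\<dots> = ennreal 8 * ennreal (real n + real n * t ^ 8)" using t by (simp add: emeasure_space_1 ennreal_mult')
 finally have "ennreal 8 * (\<integral>\<^sup>+g. F g \<partial>gvec {..<n}) \<le> ennreal 8 * ennreal (real n + real n * t ^ 8)" by simp
 then have "(\<integral>\<^sup>+g. F g \<partial>gvec {..<n}) \<le> ennreal (real n + real n * t ^ 8)"
  by (subst (asm) ennreal_mult_le_mult_iff) auto
 then show "(\<integral>\<^sup>+g. (if good g then ennreal (real n + (\<Sum>i<n. ln (cmod (1 + f i g)))) else 0) \<partial>gvec {..<n}) \<le> ennreal (real n + real n * t ^ 8)"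
  unfolding F_def .
qed

text \<open>Union bound and Markov's inequality for moment 2 p. With p large in terms of \<beta>,
  even a threshold that is a tiny power of n gives any polynomial decay.\<close>

lemma sup_tail:
 assumes c: "c > 0"
 shows "{h \<in> space (gvec {..<n}). \<forall>i<n. cmod (h i) \<le> c} \<in> sets (gvec {..<n})"
  and "(\<integral>\<^sup>+h. (if \<forall>i<n. cmod (h i) \<le> c then 0 else 1) \<partial>gvec {..<n}) \<le> ennreal (real n * (4 ^ p * fact p) / c ^ (2 * p))"
proof -
 have m: "(\<lambda>h. cmod (h i)) \<in> borel_measurable (gvec {..<n})" if "i < n" for i
  by (rule measurable_compose[OF gvec_component[of i "{..<n}"]]) (use that in auto)
 have "{h \<in> space (gvec {..<n}). \<forall>i\<in>{..<n}. cmod (h i) \<le> c} \<in> sets (gvec {..<n})"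
  using m by (intro sets.sets_Collect_finite_All borel_measurable_le borel_measurable_const) auto
 then show "{h \<in> space (gvec {..<n}). \<forall>i<n. cmod (h i) \<le> c} \<in> sets (gvec {..<n})" by (simp add: Ball_def)
 have mp: "(\<lambda>h. ennreal (cmod (h i) ^ (2 * p))) \<in> borel_measurable (gvec {..<n})" if "i < n" for i
  using m[OF that] by (intro measurable_compose[OF _ measurable_ennreal] borel_measurable_power)
 have mom: "(\<integral>\<^sup>+h. ennreal (cmod (h i) ^ (2 * p)) \<partial>gvec {..<n}) \<le> ennreal (4 ^ p * fact p)" if i: "i < n" for i
 proof -
  have 1: "(\<Sum>e<n. w e * (if e = i then 1 else 0)) = w i" for w :: "nat \<Rightarrow> complex"
   using i by (simp add: if_distrib cong: if_cong)
  have 2: "(\<Sum>e<n. (cmod (if e = i then 1 else 0))\<^sup>2) = 1"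
  proof -
   have "(\<Sum>e<n. (cmod (if e = i then 1 else 0))\<^sup>2) = (\<Sum>e<n. if e = i then 1 else 0)"
    by (intro sum.cong refl) auto
   then show ?thesis using i by simp
  qed
  show ?thesis using gvec_linear_moment[of "{..<n}" "\<lambda>e. if e = i then 1 else 0" p] unfolding 1 2 by simp
 qed
 have "(\<integral>\<^sup>+h. (if \<forall>i<n. cmod (h i) \<le> c then 0 else 1) \<partial>gvec {..<n}) \<le>
   (\<integral>\<^sup>+h. (\<Sum>i<n. ennreal (cmod (h i) ^ (2 * p)) * ennreal (1 / c ^ (2 * p))) \<partial>gvec {..<n})"
 proof (rule nn_integral_mono)
  fix h :: "nat \<Rightarrow> complex"
  show "(if \<forall>i<n. cmod (h i) \<le> c then 0 else 1) \<le> (\<Sum>i<n. ennreal (cmod (h i) ^ (2 * p)) * ennreal (1 / c ^ (2 * p)))"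
  proof (cases "\<forall>i<n. cmod (h i) \<le> c")
   case False
   then obtain i where i: "i < n" "cmod (h i) > c" by auto
   have "c ^ (2 * p) \<le> cmod (h i) ^ (2 * p)" using i c by (intro power_mono) auto
   then have "1 \<le> cmod (h i) ^ (2 * p) * (1 / c ^ (2 * p))" using c by simp
   then have "1 \<le> ennreal (cmod (h i) ^ (2 * p) * (1 / c ^ (2 * p)))" by (metis ennreal_1 ennreal_leI)
   also have "\<dots> = ennreal (cmod (h i) ^ (2 * p)) * ennreal (1 / c ^ (2 * p))" using c by (intro ennreal_mult) auto
   also have "\<dots> \<le> (\<Sum>i<n. ennreal (cmod (h i) ^ (2 * p)) * ennreal (1 / c ^ (2 * p)))"
    using i by (intro member_le_sum) auto
   finally show ?thesis using False by simp
  qed simp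
 qed
 also have "\<dots> = (\<Sum>i<n. (\<integral>\<^sup>+h. ennreal (cmod (h i) ^ (2 * p)) \<partial>gvec {..<n}) * ennreal (1 / c ^ (2 * p)))"
  using mp by (subst nn_integral_sum) (auto intro!: borel_measurable_times_ennreal sum.cong nn_integral_multc)
 also have "\<dots> \<le> (\<Sum>i<n. ennreal (4 ^ p * fact p) * ennreal (1 / c ^ (2 * p)))"
  by (intro sum_mono mult_right_mono mom) auto
 also have "\<dots> = ennreal (real n) * ennreal (4 ^ p * fact p * (1 / c ^ (2 * p)))"
  using c by (simp add: ennreal_of_nat_eq_real_of_nat flip: ennreal_mult)
 also have "\<dots> = ennreal (real n * (4 ^ p * fact p) / c ^ (2 * p))"
  using c by (subst ennreal_mult[symmetric]) auto
 finally show "(\<integral>\<^sup>+h. (if \<forall>i<n. cmod (h i) \<le> c then 0 else 1) \<partial>gvec {..<n}) \<le> ennreal (real n * (4 ^ p * fact p) / c ^ (2 * p))" .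
qed

section \<open>The mean of the regularized logarithm\<close>

lemma ennreal_add_le: "ennreal (a + b) \<le> ennreal a + ennreal b"
proof (cases "a \<ge> 0 \<and> b \<ge> 0")
 case False
 then have "a + b \<le> a \<or> a + b \<le> b" by auto
 then have "ennreal (a + b) \<le> ennreal a \<or> ennreal (a + b) \<le> ennreal b" by (auto intro: ennreal_leI)
 then show ?thesis by (meson add_increasing add_increasing2 zero_le)
qed simp

text \<open>The error terms are, in order: the rotation averages over rows and over columns, the
  excess of the second moment of the flat part together with the regularization, the two bad events
  paid for by the linear term of \<open>lpsi_crude\<close>, and its quadratic term.\<close>

lemma log_mean_le:
 fixes \<beta> s :: real and n p :: nat and z :: complex
 assumes n: "n > 0" and z: "cmod z = 2 * real n powr (1/3 - \<beta>/2)" and small: "real n powr (- (1/6)) \<le> 1/16"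
  and s: "0 < s" "s < 1" and C: "16 * exp 2 * Bflat\<^sup>2 * real n powr (- \<beta>) \<le> s ^ 4"
 shows "(\<integral>\<^sup>+W. ennreal (lpsi n (perm_poly n (curry W) z)) \<partial>gvec (sq n)) \<le>
  ennreal (2 * real n + (real n * (2 * real n powr (- (1/6))) ^ 8 + real n * (4 * real n powr (- (1/6))) ^ 8
   + ((1 / (1 - s\<^sup>2)\<^sup>2 + (16 * exp (- 4)) ^ n) / 2 - 1/2)
   + 5/2 * real n * (real n * (4 ^ p * fact p) / (real n powr (\<beta>/2)) ^ (2 * p))
   + 5/2 * real n * (real n * (4 ^ p * fact p) / (real n powr (\<beta>/2) / 2) ^ (2 * p))
   + exp (- real n) / 2 * (2 * exp (8 * (cmod z)\<^sup>2) + 1)))"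
proof -
 define t where "t = real n powr (- (1/6))"
 \<comment> \<open>The threshold for the Gaussians h_i, for which |z| c / sqrt n is exactly 2
   n^(-1/6).\<close>
 define c where "c = real n powr (\<beta>/2)"
 define \<eta> where "\<eta> = (1 / (1 - s\<^sup>2)\<^sup>2 + (16 * exp (- 4)) ^ n) / 2 - 1/2"
 define pb1 where "pb1 = real n * (4 ^ p * fact p) / c ^ (2 * p)"
 define pb2 where "pb2 = real n * (4 ^ p * fact p) / (c / 2) ^ (2 * p)"
 define a where "a h i = z * (h i / sqrt n)" for h :: "nat \<Rightarrow> complex" and i
 define goodh where "goodh h \<longleftrightarrow> (\<forall>i<n. cmod (h i) \<le> c)" for h :: "nat \<Rightarrow> complex"
 \<comment> \<open>Half the threshold, because centring g may double the modulus.\<close>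
 define goodg where "goodg g \<longleftrightarrow> (\<forall>i<n. cmod (g i) \<le> c / 2)" for g :: "nat \<Rightarrow> complex"
 define badh where "badh h = (if goodh h then 0 else 1 :: ennreal)" for h
 define badg where "badg g = (if goodg g then 0 else 1 :: ennreal)" for g
 define B where "B W = ennreal (lpsi n (perm_poly n (curry W) z))" for W
 define Q where "Q W = ennreal (exp (- real n) / 2 * ((cmod (perm_poly n (curry W) z))\<^sup>2 + 1))" for W
 define c1 where "c1 = ennreal (5/2 * real n)"
 let ?M = "gvec (sq n)" and ?V = "gvec {..<n}"
 interpret M: prob_space ?M by (rule prob_space_gvec)
 interpret V: prob_space ?V by (rule prob_space_gvec)
 have n0: "real n > 0" using n by simp
 have t: "0 < t" "t \<le> 1/16" using small n0 by (auto simp: t_def)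
 have c0: "c > 0" using n0 by (simp add: c_def)
 have zc: "cmod z * c / sqrt n = 2 * t"
 proof -
  have "cmod z * c / sqrt n = 2 * (real n powr (1/3 - \<beta>/2) * real n powr (\<beta>/2) / real n powr (1/2))"
   using n0 by (simp add: z c_def powr_half_sqrt)
  also have "\<dots> = 2 * real n powr (1/3 - \<beta>/2 + \<beta>/2 - 1/2)" by (simp only: powr_add powr_diff)
  finally show ?thesis by (simp add: t_def)
 qed
 have \<eta>0: "\<eta> \<ge> 0"
 proof -
  have "s\<^sup>2 < 1" using s by (simp add: power_less_one_iff)
  then have "(1 - s\<^sup>2)\<^sup>2 \<le> 1" "(1 - s\<^sup>2)\<^sup>2 > 0" using s by (auto intro!: power_le_one)
  then have "1 \<le> 1 / (1 - s\<^sup>2)\<^sup>2" by simp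
  moreover have "0 \<le> (16 * exp (- 4) :: real) ^ n" by simp
  moreover have "0 \<le> (x + y) / 2 - 1 / 2" if "1 \<le> x" "0 \<le> y" for x y :: real using that by simp
  ultimately show ?thesis unfolding \<eta>_def by blast
 qed
 have Bm: "B \<in> borel_measurable ?M" unfolding B_def[abs_def] by (rule lpsi_measurable)
 have Qm: "Q \<in> borel_measurable ?M"
  unfolding Q_def[abs_def] by (rule measurable_compose[OF perm_poly_measurable]) measurable
 have BQ: "B W \<le> c1 + Q W" for W
  unfolding B_def c1_def Q_def by (rule order_trans[OF ennreal_leI[OF lpsi_crude] ennreal_add_le])
 have goodh_m: "{h \<in> space ?V. goodh h} \<in> sets ?V" and goodg_m: "{g \<in> space ?V. goodg g} \<in> sets ?V"
  unfolding goodh_def goodg_def using c0 by (auto intro!: sup_tail(1))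
 have badh_m: "badh \<in> borel_measurable ?V" and badg_m: "badg \<in> borel_measurable ?V"
  unfolding badh_def[abs_def] badg_def[abs_def] using goodh_m goodg_m by (auto intro!: measurable_If)
 have Ibadh: "(\<integral>\<^sup>+h. badh h \<partial>?V) \<le> ennreal pb1" and Ibadg: "(\<integral>\<^sup>+g. badg g \<partial>?V) \<le> ennreal pb2"
  unfolding badh_def badg_def goodh_def goodg_def pb1_def pb2_def
  by (rule sup_tail(2), rule c0, rule sup_tail(2), use c0 in simp)
 have ab: "cmod (a h i) \<le> 2 * t" if "goodh h" "i < n" for h i
 proof -
  have "cmod (a h i) = cmod z * cmod (h i) / sqrt n" by (simp add: a_def norm_mult norm_divide)
  also have "\<dots> \<le> cmod z * c / sqrt n" using that by (intro divide_right_mono mult_left_mono) (auto simp: goodh_def)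
  finally show ?thesis unfolding zc .
 qed
 define Fa where "Fa h = (if goodh h then ennreal (real n + (\<Sum>i<n. ln (cmod (1 + a h i)))) else 0)" for h
 have Fa: "Fa \<in> borel_measurable ?V" "(\<integral>\<^sup>+h. Fa h \<partial>?V) \<le> ennreal (real n + real n * (2 * t) ^ 8)"
 proof -
  have 1: "(\<lambda>h. a h i) \<in> borel_measurable ?V" if "i < n" for i
   unfolding a_def by (rule measurable_compose[OF gvec_component[of i]]) (use that in auto)
  have 2: "a (\<lambda>b\<in>{..<n}. u * h b) i = u * a h i" if "i < n" for u h i using that by (simp add: a_def)
  have 3: "goodh (\<lambda>b\<in>{..<n}. u * h b) = goodh h" if "cmod u = 1" for u h
   using that by (simp add: goodh_def norm_mult)
  have "0 \<le> 2 * t" "2 * t \<le> 1/2" using t by auto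
  note L = log_rotation[of n "\<lambda>i h. a h i" goodh "2 * t", OF 1 goodh_m 2 3 ab this]
  show "Fa \<in> borel_measurable ?V" unfolding Fa_def[abs_def] by (rule L(1))
  show "(\<integral>\<^sup>+h. Fa h \<partial>?V) \<le> ennreal (real n + real n * (2 * t) ^ 8)" unfolding Fa_def by (rule L(2))
 qed
 have lna: "real n + (\<Sum>i<n. ln (cmod (1 + a h i))) \<ge> 0" if "goodh h" for h
 proof -
  have "(\<Sum>i<n. - 1) \<le> (\<Sum>i<n. ln (cmod (1 + a h i)))"
  proof (rule sum_mono)
   fix i assume "i \<in> {..<n}"
   then have "cmod (a h i) \<le> 1/2" using ab[OF that, of i] t by simp
   from ln_one_plus_lower[OF this] show "- 1 \<le> ln (cmod (1 + a h i))" using ln2_le_25_over_36 by linarith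
  qed
  then show ?thesis by simp
 qed
 define X where "X h = (\<integral>\<^sup>+W. B (rrow n W h) \<partial>?M)" for h
 define Y where "Y h = (\<integral>\<^sup>+W. Q (rrow n W h) \<partial>?M)" for h
 define K where "K = c1 * ennreal pb2 + ennreal (real n + real n * (4 * t) ^ 8 + \<eta>)"
 \<comment> \<open>The direction e depends on h, so rows are resampled outside and columns inside,
   with h fixed throughout.\<close>
 have good: "X h \<le> Y h + Fa h + K" if h: "h \<in> space ?V" and gh: "goodh h" for h
 proof -
  note rm = rrow_measurable[OF n h]
  define S where "S = (\<Sum>i<n. (cmod (1 + a h i))\<^sup>2)"
  define \<kappa> where "\<kappa> = 1 / sqrt S"
  define e where "e i = of_real \<kappa> * (1 + a h i)" for i
  have S: "S \<ge> real n / 4"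
  proof -
   have "(\<Sum>i<n. 1/4) \<le> S"
    unfolding S_def
   proof (rule sum_mono)
    fix i assume "i \<in> {..<n}"
    then have "cmod (a h i) \<le> 1/2" using ab[OF gh, of i] t by simp
    from one_plus_bounds(1)[OF this] have "(1/2)\<^sup>2 \<le> (cmod (1 + a h i))\<^sup>2" by (intro power_mono) auto
    then show "1/4 \<le> (cmod (1 + a h i))\<^sup>2" by (simp add: power2_eq_square)
   qed
   then show ?thesis by simp
  qed
  then have S0: "S > 0" using n0 by linarith
  have \<kappa>0: "\<kappa> > 0" using S0 by (simp add: \<kappa>_def)
  have \<kappa>1: "\<kappa> \<le> 2 / sqrt n"
  proof -
   have "sqrt (real n / 4) \<le> sqrt S" using S by simp
   then have "sqrt n / 2 \<le> sqrt S" by (simp add: real_sqrt_divide)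
   then have "1 / sqrt S \<le> 1 / (sqrt n / 2)" using n0 by (intro divide_left_mono) (auto simp: S0)
   then show ?thesis by (simp add: \<kappa>_def)
  qed
  have e1: "(\<Sum>i<n. (cmod (e i))\<^sup>2) = 1"
  proof -
   have "(\<Sum>i<n. (cmod (e i))\<^sup>2) = \<kappa>\<^sup>2 * S"
    unfolding e_def S_def by (simp add: norm_mult power_mult_distrib sum_distrib_left)
   then show ?thesis using S0 by (simp add: \<kappa>_def power_divide)
  qed
  define b where "b g j = z * of_real \<kappa> * (g j - (\<Sum>l<n. g l) / of_nat n)" for g :: "nat \<Rightarrow> complex" and j
  have bb: "cmod (b g j) \<le> 4 * t" if g: "goodg g" and j: "j < n" for g j
  proof -
   have "cmod ((\<Sum>l<n. g l) / of_nat n) \<le> (\<Sum>l<n. c / 2) / real n"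
    unfolding norm_divide norm_of_nat using g
    by (intro divide_right_mono order_trans[OF norm_sum] sum_mono) (auto simp: goodg_def)
   also have "\<dots> = c / 2" using n0 by simp
   finally have "cmod (g j - (\<Sum>l<n. g l) / of_nat n) \<le> c"
    using norm_triangle_ineq4[of "g j" "(\<Sum>l<n. g l) / of_nat n"] g j by (auto simp: goodg_def)
   then have "cmod z * \<kappa> * cmod (g j - (\<Sum>l<n. g l) / of_nat n) \<le> cmod z * (2 / sqrt n) * c"
    using \<kappa>0 \<kappa>1 by (intro mult_mono mult_left_mono) auto
   moreover have "cmod (b g j) = cmod z * \<kappa> * cmod (g j - (\<Sum>l<n. g l) / of_nat n)"
    using \<kappa>0 by (simp add: b_def norm_mult)
   moreover have "cmod z * (2 / sqrt n) * c = 2 * (cmod z * c / sqrt n)" by simp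
   ultimately show ?thesis unfolding zc by simp
  qed
  define Fb where "Fb g = (if goodg g then ennreal (real n + (\<Sum>j<n. ln (cmod (1 + b g j)))) else 0)" for g
  have Fb: "Fb \<in> borel_measurable ?V" "(\<integral>\<^sup>+g. Fb g \<partial>?V) \<le> ennreal (real n + real n * (4 * t) ^ 8)"
  proof -
   have 1: "(\<lambda>g. b g j) \<in> borel_measurable ?V" if "j < n" for j
    unfolding b_def divide_inverse using that
    by (intro borel_measurable_times borel_measurable_const borel_measurable_diff borel_measurable_sum gvec_component) auto
   have 2: "b (\<lambda>b\<in>{..<n}. u * g b) j = u * b g j" if "j < n" for u g j
    using that by (simp add: b_def right_diff_distrib sum_distrib_left[symmetric] mult_ac)
   have 3: "goodg (\<lambda>b\<in>{..<n}. u * g b) = goodg g" if "cmod u = 1" for u g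
    using that by (simp add: goodg_def norm_mult)
   have "0 \<le> 4 * t" "4 * t \<le> 1/2" using t by auto
   note L = log_rotation[of n "\<lambda>j g. b g j" goodg "4 * t", OF 1 goodg_m 2 3 bb this]
   show "Fb \<in> borel_measurable ?V" unfolding Fb_def[abs_def] by (rule L(1))
   show "(\<integral>\<^sup>+g. Fb g \<partial>?V) \<le> ennreal (real n + real n * (4 * t) ^ 8)" unfolding Fb_def by (rule L(2))
  qed
  define K0 where "K0 = ennreal (real n + (\<Sum>i<n. ln (cmod (1 + a h i))) + \<eta>)"
  define Yq where "Yq g = (\<integral>\<^sup>+W. Q (rrow n (rcol n e W g) h) \<partial>?M)" for g
  have Qr: "(\<lambda>W. Q (rrow n W h)) \<in> borel_measurable ?M" by (rule measurable_compose[OF rm Qm])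
  have Br: "(\<lambda>W. B (rrow n W h)) \<in> borel_measurable ?M" by (rule measurable_compose[OF rm Bm])
  have Yq: "Yq \<in> borel_measurable ?V" "(\<integral>\<^sup>+g. Yq g \<partial>?V) = Y h"
   unfolding Yq_def[abs_def] Y_def nn_integral_rcol[OF e1 Qr]
   by (rule nn_integral_rcol_measurable[OF e1 Qr], rule refl)
  have pt: "(\<integral>\<^sup>+W. B (rrow n (rcol n e W g) h) \<partial>?M) \<le> c1 * badg g + Yq g + Fb g + K0" if g: "g \<in> space ?V" for g
  proof (cases "goodg g")
   case False
   have "(\<integral>\<^sup>+W. B (rrow n (rcol n e W g) h) \<partial>?M) \<le> (\<integral>\<^sup>+W. c1 + Q (rrow n (rcol n e W g) h) \<partial>?M)"
    by (intro nn_integral_mono BQ)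
   also have "\<dots> = c1 + Yq g"
    unfolding Yq_def using measurable_compose[OF rcol_measurable[OF e1 g] Qr]
    by (subst nn_integral_add) (auto simp: M.emeasure_space_1)
   also have "\<dots> \<le> c1 + Yq g + (Fb g + K0)" by simp
   finally show ?thesis using False by (simp add: badg_def add.assoc)
  next
   case True
   have zz: "4 * exp 2 * Bflat\<^sup>2 * (cmod z)\<^sup>2 * real n powr (- (2/3)) \<le> s ^ 4"
   proof -
    have "(cmod z)\<^sup>2 = 4 * real n powr (2/3 - \<beta>)"
     unfolding z power_mult_distrib using n0 by (simp add: powr_power)
    then have "(cmod z)\<^sup>2 * real n powr (- (2/3)) = 4 * real n powr (2/3 - \<beta> + - (2/3))"
     by (simp only: powr_add mult.assoc)
    then have "(cmod z)\<^sup>2 * real n powr (- (2/3)) = 4 * real n powr (- \<beta>)" by simp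
    then have "4 * exp 2 * Bflat\<^sup>2 * ((cmod z)\<^sup>2 * real n powr (- (2/3))) = 16 * exp 2 * Bflat\<^sup>2 * real n powr (- \<beta>)"
     by (simp only:)
    then show ?thesis using C by (simp only: mult.assoc)
   qed
   have "(\<integral>\<^sup>+W. B (rrow n (rcol n e W g) h) \<partial>?M) \<le>
     ennreal (2 * real n + (\<Sum>i<n. ln (cmod (1 + a h i))) + (\<Sum>j<n. ln (cmod (1 + b g j))) - 1/2
      + (1 / (1 - s\<^sup>2)\<^sup>2 + (16 * exp (- 4)) ^ n) / 2)"
    unfolding B_def
   proof (rule good_log_integral[OF n e1])
    show "\<kappa> \<noteq> 0" using \<kappa>0 by simp
    show "cmod (a h i) \<le> 2 * real n powr (- (1/6))" if "i < n" for i using ab[OF gh that] by (simp add: t_def)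
    show "cmod (b g i) \<le> 4 * real n powr (- (1/6))" if "i < n" for i using bb[OF True that] by (simp add: t_def)
   qed (use small s zz in \<open>auto simp: a_def e_def b_def\<close>)
   \<comment> \<open>The offset 2 n is shared: n makes the sum of logarithms for the columns
     nonnegative, n the one for the rows.\<close>
   also have "\<dots> \<le> ennreal (real n + (\<Sum>j<n. ln (cmod (1 + b g j)))) + K0"
   proof -
    have "ennreal ((real n + (\<Sum>j<n. ln (cmod (1 + b g j)))) + (real n + (\<Sum>i<n. ln (cmod (1 + a h i))) + \<eta>)) \<le>
      ennreal (real n + (\<Sum>j<n. ln (cmod (1 + b g j)))) + K0"
     unfolding K0_def by (rule ennreal_add_le)
    then show ?thesis unfolding \<eta>_def by (simp add: algebra_simps)
   qed
   also have "\<dots> = Fb g + K0" using True by (simp add: Fb_def)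
   also have "\<dots> \<le> c1 * badg g + Yq g + (Fb g + K0)" by simp
   finally show ?thesis by (simp add: add.assoc)
  qed
  have "X h = (\<integral>\<^sup>+g. \<integral>\<^sup>+W. B (rrow n (rcol n e W g) h) \<partial>?M \<partial>?V)"
   unfolding X_def by (rule nn_integral_rcol[OF e1 Br])
  also have "\<dots> \<le> (\<integral>\<^sup>+g. c1 * badg g + Yq g + Fb g + K0 \<partial>?V)"
   by (rule nn_integral_mono) (rule pt)
  also have "\<dots> = c1 * (\<integral>\<^sup>+g. badg g \<partial>?V) + Y h + (\<integral>\<^sup>+g. Fb g \<partial>?V) + K0"
   using badg_m Yq Fb(1)
   by (simp add: nn_integral_add nn_integral_cmult V.emeasure_space_1)
  also have "\<dots> \<le> c1 * ennreal pb2 + Y h + ennreal (real n + real n * (4 * t) ^ 8) + K0"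
   by (intro add_mono order_refl mult_left_mono Ibadg Fb(2)) auto
  also have "\<dots> = Y h + Fa h + K"
  proof -
   have 1: "K0 = Fa h + ennreal \<eta>"
    unfolding K0_def Fa_def using gh lna[OF gh] \<eta>0 by (simp add: ennreal_plus)
   have "0 \<le> real n + real n * (4 * t) ^ 8" using t by simp
   then have 2: "ennreal (real n + real n * (4 * t) ^ 8 + \<eta>) = ennreal (real n + real n * (4 * t) ^ 8) + ennreal \<eta>"
    using \<eta>0 by (rule ennreal_plus)
   show ?thesis unfolding K_def 1 2 by (simp only: add_ac)
  qed
  finally show ?thesis .
 qed
 have all: "X h \<le> c1 * badh h + Y h + Fa h + K" if h: "h \<in> space ?V" for h
 proof (cases "goodh h")
  case True
  have "Y h + Fa h + K \<le> c1 * badh h + (Y h + Fa h + K)" by simp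
  with good[OF h True] have "X h \<le> c1 * badh h + (Y h + Fa h + K)" by (rule order_trans)
  then show ?thesis by (simp only: add.assoc)
 next
  case False
  have "X h \<le> (\<integral>\<^sup>+W. c1 + Q (rrow n W h) \<partial>?M)" unfolding X_def by (intro nn_integral_mono BQ)
  also have "\<dots> = c1 + Y h"
   unfolding Y_def using measurable_compose[OF rrow_measurable[OF n h] Qm]
   by (subst nn_integral_add) (auto simp: M.emeasure_space_1)
  also have "\<dots> \<le> c1 + Y h + (Fa h + K)" by simp
  finally show ?thesis using False by (simp add: badh_def add.assoc)
 qed
 have Y: "Y \<in> borel_measurable ?V" "(\<integral>\<^sup>+h. Y h \<partial>?V) = (\<integral>\<^sup>+W. Q W \<partial>?M)"
  unfolding Y_def[abs_def] nn_integral_rrow[OF n Qm]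
  by (rule nn_integral_rrow_measurable[OF n Qm], rule refl)
 have IQ: "(\<integral>\<^sup>+W. Q W \<partial>?M) \<le> ennreal (exp (- real n) / 2 * (2 * exp (8 * (cmod z)\<^sup>2) + 1))"
 proof -
  define k1 where "k1 = exp (- real n) / 2"
  define k2 where "k2 = exp (8 * (cmod z)\<^sup>2)"
  have k: "k1 \<ge> 0" "k2 \<ge> 0" by (auto simp: k1_def k2_def)
  have "(\<integral>\<^sup>+W. Q W \<partial>?M) \<le> (\<integral>\<^sup>+W. ennreal (k1 * k2) * ennreal (penv n W) + ennreal k1 \<partial>?M)"
  proof (rule nn_integral_mono)
   fix W
   have "Q W \<le> ennreal (k1 * (k2 * penv n W + 1))"
    unfolding Q_def k1_def[symmetric] k2_def
    by (intro ennreal_leI mult_left_mono add_right_mono perm_poly_le_penv k)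
   also have "\<dots> = ennreal (k1 * k2) * ennreal (penv n W) + ennreal k1"
    using k penv_nonneg[of n W] by (simp add: distrib_left mult.assoc flip: ennreal_mult ennreal_plus)
   finally show "Q W \<le> ennreal (k1 * k2) * ennreal (penv n W) + ennreal k1" .
  qed
  also have "\<dots> = ennreal (k1 * k2) * (\<integral>\<^sup>+W. ennreal (penv n W) \<partial>?M) + ennreal k1"
  proof -
   have "(\<lambda>W. ennreal (penv n W)) \<in> borel_measurable ?M"
    by (rule measurable_compose[OF penv_measurable]) measurable
   then show ?thesis by (simp add: nn_integral_add nn_integral_cmult M.emeasure_space_1)
  qed
  also have "\<dots> \<le> ennreal (k1 * k2) * ennreal 2 + ennreal k1"
   using penv_integral[of n] by (intro add_right_mono mult_left_mono) auto
  also have "\<dots> = ennreal (k1 * k2 * 2 + k1)"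
   using k by (simp only: ennreal_mult[symmetric] ennreal_plus[symmetric] mult_nonneg_nonneg zero_le_numeral)
  also have "k1 * k2 * 2 + k1 = exp (- real n) / 2 * (2 * exp (8 * (cmod z)\<^sup>2) + 1)"
   unfolding k1_def[symmetric] k2_def[symmetric] by (simp add: distrib_left)
  finally show ?thesis .
 qed
 have "(\<integral>\<^sup>+W. B W \<partial>?M) = (\<integral>\<^sup>+h. X h \<partial>?V)" unfolding X_def by (rule nn_integral_rrow[OF n Bm])
 also have "\<dots> \<le> (\<integral>\<^sup>+h. c1 * badh h + Y h + Fa h + K \<partial>?V)" by (rule nn_integral_mono) (rule all)
 also have "\<dots> = c1 * (\<integral>\<^sup>+h. badh h \<partial>?V) + (\<integral>\<^sup>+W. Q W \<partial>?M) + (\<integral>\<^sup>+h. Fa h \<partial>?V) + K"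
  using badh_m Y Fa(1) by (simp add: nn_integral_add nn_integral_cmult V.emeasure_space_1)
 also have "\<dots> \<le> c1 * ennreal pb1 + ennreal (exp (- real n) / 2 * (2 * exp (8 * (cmod z)\<^sup>2) + 1)) +
   ennreal (real n + real n * (2 * t) ^ 8) + K"
  by (intro add_mono order_refl mult_left_mono Ibadh IQ Fa(2)) auto
 also have "\<dots> = ennreal (5/2 * real n * pb1 + exp (- real n) / 2 * (2 * exp (8 * (cmod z)\<^sup>2) + 1) +
   (real n + real n * (2 * t) ^ 8) + (5/2 * real n * pb2 + (real n + real n * (4 * t) ^ 8 + \<eta>)))"
 proof -
  have pb: "pb1 \<ge> 0" "pb2 \<ge> 0" using c0 by (auto simp: pb1_def pb2_def)
  define q where "q = exp (- real n) / 2 * (2 * exp (8 * (cmod z)\<^sup>2) + 1)"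
  have q: "q \<ge> 0" by (simp add: q_def)
  have tt: "0 \<le> real n + real n * (2 * t) ^ 8" "0 \<le> real n + real n * (4 * t) ^ 8 + \<eta>" using t \<eta>0 by auto
  have m: "c1 * ennreal pb1 = ennreal (5/2 * real n * pb1)" "c1 * ennreal pb2 = ennreal (5/2 * real n * pb2)"
   unfolding c1_def by (rule ennreal_mult[symmetric], simp, rule pb)+
  have pl: "ennreal x1 + ennreal x2 + ennreal x3 + (ennreal x4 + ennreal x5) = ennreal (x1 + x2 + x3 + (x4 + x5))"
   if "0 \<le> x1" "0 \<le> x2" "0 \<le> x3" "0 \<le> x4" "0 \<le> x5" for x1 x2 x3 x4 x5
   using that by simp
  have "0 \<le> 5/2 * real n * pb1" "0 \<le> 5/2 * real n * pb2" using pb by auto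
  then show ?thesis unfolding K_def m q_def[symmetric] using q tt by (intro pl)
 qed
 also have "5/2 * real n * pb1 + exp (- real n) / 2 * (2 * exp (8 * (cmod z)\<^sup>2) + 1) +
   (real n + real n * (2 * t) ^ 8) + (5/2 * real n * pb2 + (real n + real n * (4 * t) ^ 8 + \<eta>)) =
   2 * real n + (real n * (2 * t) ^ 8 + real n * (4 * t) ^ 8 + \<eta> + 5/2 * real n * pb1 + 5/2 * real n * pb2
    + exp (- real n) / 2 * (2 * exp (8 * (cmod z)\<^sup>2) + 1))"
  by linarith
 finally show ?thesis unfolding B_def pb1_def pb2_def \<eta>_def t_def c_def .
qed

text \<open>With p and s chosen in terms of n and \<beta>, all error terms of
  \<open>log_mean_le\<close> tend to 0, uniformly in the argument of z.\<close>

lemma log_mean_bound: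
 fixes \<beta> \<epsilon> :: real
 assumes \<beta>: "0 < \<beta>" and \<epsilon>: "\<epsilon> > 0"
 shows "\<exists>N. \<forall>n\<ge>N. \<forall>z. cmod z = 2 * real n powr (1/3 - \<beta>/2) \<longrightarrow>
  (\<integral>\<^sup>+W. ennreal (lpsi n (perm_poly n (curry W) z)) \<partial>gvec (sq n)) \<le> ennreal (2 * real n + \<epsilon>)"
proof -
 \<comment> \<open>Makes the 2 p-th power of the threshold at least n^3, so that n times the
   probability of a bad event is O(1/n).\<close>
 define p where "p = nat \<lceil>3 / \<beta>\<rceil>"
 have p: "\<beta> * real p \<ge> 3"
 proof -
  have "3 / \<beta> \<le> real p" unfolding p_def by linarith
  then show ?thesis using \<beta> by (simp add: divide_le_eq mult.commute)
 qed
 define C where "C = 16 * exp 2 * Bflat\<^sup>2"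
 have C: "C > 0" unfolding C_def Bflat_def by simp
 \<comment> \<open>The hypothesis of \<open>flat_moment\<close> on z with equality; s tends to 0
   since the radius is n^(1/3) times a negative power of n.\<close>
 define s where "s n = root 4 (C * real n powr (- \<beta>))" for n :: nat
 define K where "K = 4 ^ p * fact p * 4 ^ p * (5/2 :: real)"
 define E where "E n = real n * (2 * real n powr (- (1/6))) ^ 8 + real n * (4 * real n powr (- (1/6))) ^ 8
   + ((1 / (1 - (s n)\<^sup>2)\<^sup>2 + (16 * exp (- 4)) ^ n) / 2 - 1/2) + K / real n + K / real n
   + (exp (32 * real n powr (2/3) - real n) + exp (- real n))" for n :: nat
 have "(\<lambda>n::nat. real n powr (- \<beta>)) \<longlonglongrightarrow> 0"
  by (rule tendsto_neg_powr[OF _ filterlim_real_sequentially]) (use \<beta> in simp)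
 then have "(\<lambda>n. C * real n powr (- \<beta>)) \<longlonglongrightarrow> C * 0" by (intro tendsto_mult tendsto_const)
 then have "s \<longlonglongrightarrow> root 4 (C * 0)" unfolding s_def[abs_def] by (rule tendsto_real_root)
 then have s0: "s \<longlonglongrightarrow> 0" by simp
 have x16: "16 * exp (- 4) < (1::real)"
 proof -
  have "ln (16::real) = 4 * ln 2" using ln_realpow[of 2 4] by simp
  also have "\<dots> < 4" using ln2_le_25_over_36 by simp
  finally have "exp (ln 16) < exp (4::real)" by (simp only: exp_less_cancel_iff)
  then show ?thesis by (simp add: exp_minus divide_less_eq inverse_eq_divide)
 qed
 have "E \<longlonglongrightarrow> 0 + 0 + ((1 / (1 - 0\<^sup>2)\<^sup>2 + 0) / 2 - 1/2) + 0 + 0 + 0"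
  unfolding E_def[abs_def]
 proof (intro tendsto_add tendsto_diff tendsto_divide tendsto_const tendsto_power s0)
  \<comment> \<open>The eighth roots are explained here: factors 1 + w have |w| of order n^(-1/6), n
    of them are to contribute o(1), and 8 is the least power of 2 above 6.\<close>
  show "(\<lambda>n::nat. real n * (2 * real n powr (- (1/6))) ^ 8) \<longlonglongrightarrow> 0" by real_asymp
  show "(\<lambda>n::nat. real n * (4 * real n powr (- (1/6))) ^ 8) \<longlonglongrightarrow> 0" by real_asymp
  show "(\<lambda>n::nat. (16 * exp (- 4) :: real) ^ n) \<longlonglongrightarrow> 0" using x16 by (intro LIMSEQ_power_zero) simp
  show "(\<lambda>n::nat. K / real n) \<longlonglongrightarrow> 0" by (rule lim_const_over_n)
  then show "(\<lambda>n::nat. K / real n) \<longlonglongrightarrow> 0" .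
  show "(\<lambda>n::nat. exp (32 * real n powr (2/3) - real n) + exp (- real n)) \<longlonglongrightarrow> 0" by real_asymp
 qed auto
 then have "E \<longlonglongrightarrow> 0" by simp
 then have e1: "eventually (\<lambda>n. E n < \<epsilon>) sequentially" using \<epsilon> by (rule order_tendstoD)
 have e2: "eventually (\<lambda>n. s n < 1) sequentially" using s0 by (rule order_tendstoD) simp
 have e3: "eventually (\<lambda>n::nat. real n powr (- (1/6)) \<le> 1/16) sequentially" by real_asymp
 from eventually_conj[OF eventually_conj[OF e1 e2] eventually_conj[OF e3 eventually_gt_at_top[of 0]]]
 obtain N where N: "\<And>n. n \<ge> N \<Longrightarrow> (E n < \<epsilon> \<and> s n < 1) \<and> real n powr (- (1/6)) \<le> 1/16 \<and> 0 < n"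
  unfolding eventually_sequentially by blast
 show ?thesis
 proof (intro exI[of _ N] allI impI)
  fix n :: nat and z :: complex assume "n \<ge> N" and z: "cmod z = 2 * real n powr (1/3 - \<beta>/2)"
  with N have h: "E n < \<epsilon>" "s n < 1" "real n powr (- (1/6)) \<le> 1/16" "0 < n" by auto
  have n1: "real n \<ge> 1" using h(4) by simp
  have sn: "0 < s n" "(s n) ^ 4 = C * real n powr (- \<beta>)" using C h(4) by (auto simp: s_def)
  define P1 where "P1 = 5/2 * real n * (real n * (4 ^ p * fact p) / (real n powr (\<beta>/2)) ^ (2 * p))"
  define P2 where "P2 = 5/2 * real n * (real n * (4 ^ p * fact p) / (real n powr (\<beta>/2) / 2) ^ (2 * p))"
  have cp: "(real n powr (\<beta>/2)) ^ (2 * p) \<ge> real n ^ 3"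
  proof -
   have "(real n powr (\<beta>/2)) ^ (2 * p) = real n powr (\<beta> * real p)" using h(4) by (simp add: powr_power mult.commute)
   also have "\<dots> \<ge> real n powr 3" using p n1 by (intro powr_mono) auto
   finally show ?thesis using h(4) by simp
  qed
  have P2: "P2 \<le> K / real n"
  proof -
   have "(real n powr (\<beta>/2) / 2) ^ (2 * p) = (real n powr (\<beta>/2)) ^ (2 * p) / 4 ^ p"
    by (simp add: power_divide power_mult)
   then have "P2 = K * (real n)\<^sup>2 / (real n powr (\<beta>/2)) ^ (2 * p)"
    unfolding P2_def K_def by (simp add: power2_eq_square mult_ac)
   also have "\<dots> \<le> K * (real n)\<^sup>2 / real n ^ 3"
    using cp n1 by (intro divide_left_mono) (auto simp: K_def)
   also have "\<dots> = K / real n" using n1 by (simp add: power2_eq_square power3_eq_cube)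
   finally show ?thesis .
  qed
  have P1: "P1 \<le> K / real n"
  proof -
   have "(real n powr (\<beta>/2) / 2) ^ (2 * p) \<le> (real n powr (\<beta>/2)) ^ (2 * p)" by (intro power_mono) auto
   then have "P1 \<le> P2" unfolding P1_def P2_def using h(4) by (intro mult_left_mono divide_left_mono) auto
   then show ?thesis using P2 by linarith
  qed
  have Q: "exp (- real n) / 2 * (2 * exp (8 * (cmod z)\<^sup>2) + 1) \<le> exp (32 * real n powr (2/3) - real n) + exp (- real n)"
  proof -
   have "(cmod z)\<^sup>2 = 4 * real n powr (2/3 - \<beta>)"
    unfolding z power_mult_distrib using h(4) by (simp add: powr_power)
   moreover have "real n powr (2/3 - \<beta>) \<le> real n powr (2/3)" using n1 \<beta> by (intro powr_mono) auto
   ultimately have "exp (8 * (cmod z)\<^sup>2) \<le> exp (32 * real n powr (2/3))" by simp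
   then have "exp (- real n) * exp (8 * (cmod z)\<^sup>2) \<le> exp (- real n) * exp (32 * real n powr (2/3))"
    by (intro mult_left_mono) auto
   also have "\<dots> = exp (32 * real n powr (2/3) - real n)" by (simp flip: exp_add)
   finally have x: "exp (- real n) * exp (8 * (cmod z)\<^sup>2) \<le> exp (32 * real n powr (2/3) - real n)" .
   have y: "exp (- real n) / 2 \<le> exp (- real n)" by simp
   have "exp (- real n) / 2 * (2 * exp (8 * (cmod z)\<^sup>2) + 1) = exp (- real n) * exp (8 * (cmod z)\<^sup>2) + exp (- real n) / 2"
    by (simp add: distrib_left)
   with add_mono[OF x y] show ?thesis by (simp only:)
  qed
  have "(\<integral>\<^sup>+W. ennreal (lpsi n (perm_poly n (curry W) z)) \<partial>gvec (sq n)) \<le>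
   ennreal (2 * real n + (real n * (2 * real n powr (- (1/6))) ^ 8 + real n * (4 * real n powr (- (1/6))) ^ 8
   + ((1 / (1 - (s n)\<^sup>2)\<^sup>2 + (16 * exp (- 4)) ^ n) / 2 - 1/2) + P1 + P2
   + exp (- real n) / 2 * (2 * exp (8 * (cmod z)\<^sup>2) + 1)))"
   unfolding P1_def P2_def
   by (rule log_mean_le[OF h(4) z h(3) sn(1) h(2)]) (simp add: sn(2) C_def)
  also have "\<dots> \<le> ennreal (2 * real n + \<epsilon>)"
   using h(1) P1 P2 Q unfolding E_def by (intro ennreal_leI) linarith
  finally show "(\<integral>\<^sup>+W. ennreal (lpsi n (perm_poly n (curry W) z)) \<partial>gvec (sq n)) \<le> ennreal (2 * real n + \<epsilon>)" .
 qed
qed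

section \<open>A discrete Jensen inequality\<close>

text \<open>The product over the M-th roots of unity is |a^M - R^M|, where the larger of |a|^M and
  R^M wins by a fixed proportion. So the error K = ln (1 - q / m) does not grow with the number of
  points.\<close>

lemma mean_ln_lower:
 assumes a: "a \<noteq> 0" and R: "R > 0" and ne: "cmod a \<noteq> R"
 shows "\<exists>K. \<forall>j. 2 ^ j * ln (max (cmod a) R) + K \<le> (\<Sum>r<2 ^ j. ln (cmod (of_real R * unity_root (2 ^ j) ^ r - a)))"
proof -
 define m where "m = max (cmod a) R"
 define q where "q = min (cmod a) R"
 have mq: "0 < q" "q < m" using a R ne by (auto simp: m_def q_def)
 define t where "t = q / m"
 have t: "0 < t" "t < 1" using mq by (auto simp: t_def)
 have "2 ^ j * ln m + ln (1 - t) \<le> (\<Sum>r<2 ^ j. ln (cmod (of_real R * unity_root (2 ^ j) ^ r - a)))" for j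
 proof -
  define M :: nat where "M = 2 ^ j"
  have M: "M \<ge> 1" by (simp add: M_def)
  have pos: "cmod (of_real R * unity_root M ^ r - a) > 0" for r
  proof -
   have "cmod (of_real R * unity_root M ^ r) = R" using R by (simp add: norm_mult norm_power)
   then show ?thesis using ne by auto
  qed
  have "(\<Prod>r<M. cmod (of_real R * unity_root M ^ r - a)) = cmod (\<Prod>r<M. a - unity_root M ^ r * of_real R)"
   unfolding prod_norm[symmetric] by (intro prod.cong refl) (simp add: norm_minus_commute mult.commute)
  also have "\<dots> = cmod (a ^ M - of_real R ^ M)" unfolding M_def prod_unity_root ..
  finally have P: "(\<Prod>r<M. cmod (of_real R * unity_root M ^ r - a)) = cmod (a ^ M - of_real R ^ M)" .
  have "m ^ M - q ^ M \<le> cmod (a ^ M - of_real R ^ M)"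
  proof -
   have "cmod (a ^ M) = cmod a ^ M" "cmod (of_real R ^ M :: complex) = R ^ M" using R by (simp_all add: norm_power)
   then show ?thesis
    using norm_triangle_ineq2[of "a ^ M" "of_real R ^ M"] norm_triangle_ineq2[of "of_real R ^ M" "a ^ M"]
    unfolding m_def q_def by (auto simp: max_def min_def norm_minus_commute)
  qed
  moreover have "m ^ M * (1 - t) \<le> m ^ M - q ^ M"
  proof -
   have "t ^ M \<le> t ^ 1" using t M by (intro power_decreasing) auto
   then have "m ^ M * (1 - t) \<le> m ^ M * (1 - t ^ M)" using mq by (intro mult_left_mono) auto
   also have "\<dots> = m ^ M - q ^ M" using mq by (simp add: t_def power_divide right_diff_distrib)
   finally show ?thesis .
  qed
  ultimately have le: "m ^ M * (1 - t) \<le> cmod (a ^ M - of_real R ^ M)" by linarith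
  have p0: "0 < m ^ M * (1 - t)" using mq t by simp
  have "real M * ln m + ln (1 - t) = ln (m ^ M * (1 - t))"
  proof -
   have "0 < m ^ M" "0 < 1 - t" using mq t by auto
   then show ?thesis using mq by (subst ln_mult_pos) (auto simp: ln_realpow)
  qed
  also have "\<dots> \<le> ln (cmod (a ^ M - of_real R ^ M))" using le p0 by (subst ln_le_cancel_iff) auto
  also have "\<dots> = (\<Sum>r<M. ln (cmod (of_real R * unity_root M ^ r - a)))"
   unfolding P[symmetric] using pos by (intro ln_prod) auto
  finally show ?thesis by (simp add: M_def)
 qed
 then show ?thesis unfolding m_def by blast
qed

text \<open>Jensen's formula by factorization. Because p(0) = 1, the leading coefficient cancels the
  logarithms of the moduli of the zeros, and each zero a adds ln (max |a| R) - ln |a| >= 0, which is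
  at least ln 2 if |a| <= R / 2.\<close>

lemma mean_ln_poly_lower:
 fixes p :: "complex poly"
 assumes p: "poly p 0 = 1" and R: "R > 0" and ne: "\<And>a. poly p a = 0 \<Longrightarrow> cmod a \<noteq> R" and \<eta>: "\<eta> > 0"
 shows "\<exists>J. \<forall>j\<ge>J. (if \<exists>a. poly p a = 0 \<and> cmod a \<le> R / 2 then ln 2 else 0) - \<eta> \<le>
  (\<Sum>r<2 ^ j. ln (cmod (poly p (of_real R * unity_root (2 ^ j) ^ r)))) / 2 ^ j"
proof -
 define Z where "Z = {a. poly p a = 0}"
 define m where "m a = real (order a p)" for a
 have p0: "p \<noteq> 0" using p by auto
 have Z: "finite Z" unfolding Z_def using p0 by (rule poly_roots_finite)
 have Z0: "a \<noteq> 0" if "a \<in> Z" for a using that p by (auto simp: Z_def)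
 have m1: "m a \<ge> 1" if "a \<in> Z" for a using that p0 order_root[of p a] by (simp add: m_def Z_def)
 have ev: "cmod (poly p w) = cmod (lead_coeff p) * (\<Prod>a\<in>Z. cmod (w - a) ^ order a p)" for w
 proof -
  have "poly p w = poly (smult (lead_coeff p) (\<Prod>z\<in>Z. [:-z, 1:] ^ order z p)) w"
   unfolding Z_def by (simp only: complex_poly_decompose)
  then show ?thesis by (simp add: poly_prod norm_mult norm_power flip: prod_norm)
 qed
 have lc: "cmod (lead_coeff p) > 0" using p0 by simp
 have lnP: "ln (cmod (poly p w)) = ln (cmod (lead_coeff p)) + (\<Sum>a\<in>Z. m a * ln (cmod (w - a)))" if "w \<notin> Z" for w
 proof -
  have pos: "cmod (w - a) ^ order a p > 0" if "a \<in> Z" for a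
  proof -
   have "w \<noteq> a" using that \<open>w \<notin> Z\<close> by blast
   then show ?thesis by simp
  qed
  have "ln (cmod (poly p w)) = ln (cmod (lead_coeff p)) + ln (\<Prod>a\<in>Z. cmod (w - a) ^ order a p)"
   unfolding ev by (rule ln_mult_pos[OF lc prod_pos[OF pos]])
  also have "ln (\<Prod>a\<in>Z. cmod (w - a) ^ order a p) = (\<Sum>a\<in>Z. ln (cmod (w - a) ^ order a p))"
   by (rule ln_prod; (rule Z)?; metis pos less_irrefl)
  also have "\<dots> = (\<Sum>a\<in>Z. m a * ln (cmod (w - a)))"
  proof (rule sum.cong[OF refl])
   fix a assume "a \<in> Z"
   then have "cmod (w - a) > 0" using \<open>w \<notin> Z\<close> by auto
   then show "ln (cmod (w - a) ^ order a p) = m a * ln (cmod (w - a))" unfolding m_def by (simp add: ln_realpow)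
  qed
  finally show ?thesis .
 qed
 have lc_eq: "ln (cmod (lead_coeff p)) = - (\<Sum>a\<in>Z. m a * ln (cmod a))"
 proof -
  have "0 \<notin> Z" using Z0 by blast
  from lnP[OF this] have "0 = ln (cmod (lead_coeff p)) + (\<Sum>a\<in>Z. m a * ln (cmod a))" by (simp only: p) simp
  then show ?thesis by linarith
 qed
 have ex: "\<exists>K. \<forall>j. 2 ^ j * ln (max (cmod a) R) + K \<le> (\<Sum>r<2 ^ j. ln (cmod (of_real R * unity_root (2 ^ j) ^ r - a)))"
  if "a \<in> Z" for a
 proof (rule mean_ln_lower[OF Z0[OF that] R])
  show "cmod a \<noteq> R" by (rule ne) (use that in \<open>simp add: Z_def\<close>)
 qed
 define K where "K a = (SOME K. \<forall>j. 2 ^ j * ln (max (cmod a) R) + K \<le>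
   (\<Sum>r<2 ^ j. ln (cmod (of_real R * unity_root (2 ^ j) ^ r - a))))" for a
 have K: "2 ^ j * ln (max (cmod a) R) + K a \<le> (\<Sum>r<2 ^ j. ln (cmod (of_real R * unity_root (2 ^ j) ^ r - a)))"
  if "a \<in> Z" for a j
  using someI_ex[OF ex[OF that]] unfolding K_def by (rule spec)
 define K1 where "K1 = (\<Sum>a\<in>Z. m a * K a)"
 define c where "c = (if \<exists>a. poly p a = 0 \<and> cmod a \<le> R / 2 then ln 2 else 0 :: real)"
 have cle: "c \<le> (\<Sum>a\<in>Z. m a * (ln (max (cmod a) R) - ln (cmod a)))"
 proof -
  have nn: "0 \<le> ln (max (cmod a) R) - ln (cmod a)" if "a \<in> Z" for a
  proof -
   have "ln (cmod a) \<le> ln (max (cmod a) R)" using Z0[OF that] by (subst ln_le_cancel_iff) (auto simp: less_max_iff_disj)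
   then show ?thesis by simp
  qed
  then have nn': "0 \<le> m a * (ln (max (cmod a) R) - ln (cmod a))" if "a \<in> Z" for a
   using that m1[OF that] by (intro mult_nonneg_nonneg) auto
  show ?thesis
  proof (cases "\<exists>a. poly p a = 0 \<and> cmod a \<le> R / 2")
   case False
   then show ?thesis using nn' by (auto simp: c_def intro!: sum_nonneg)
  next
   case True
   then obtain a where a: "a \<in> Z" "cmod a \<le> R / 2" by (auto simp: Z_def)
   have a0: "cmod a > 0" using Z0[OF a(1)] by simp
   have "ln (2 * cmod a) \<le> ln (max (cmod a) R)" using a(2) a0 by (subst ln_le_cancel_iff) (auto simp: less_max_iff_disj)
   then have "ln 2 \<le> 1 * (ln (max (cmod a) R) - ln (cmod a))" using a0 by (simp add: ln_mult_pos)
   also have "\<dots> \<le> m a * (ln (max (cmod a) R) - ln (cmod a))" using nn[OF a(1)] m1[OF a(1)] by (intro mult_right_mono)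
   also have "\<dots> \<le> (\<Sum>a\<in>Z. m a * (ln (max (cmod a) R) - ln (cmod a)))" using nn' Z a(1) by (intro member_le_sum) auto
   finally show ?thesis using True by (simp add: c_def)
  qed
 qed
 have main: "c + K1 / 2 ^ j \<le> (\<Sum>r<2 ^ j. ln (cmod (poly p (of_real R * unity_root (2 ^ j) ^ r)))) / 2 ^ j" for j
 proof -
  have notZ: "of_real R * unity_root (2 ^ j) ^ r \<notin> Z" for r
  proof
   assume "of_real R * unity_root (2 ^ j) ^ r \<in> Z"
   then have "cmod (of_real R * unity_root (2 ^ j) ^ r) \<noteq> R" unfolding Z_def using ne by blast
   then show False using R by (simp add: norm_mult norm_power)
  qed
  have "2 ^ j * c + K1 \<le> 2 ^ j * (\<Sum>a\<in>Z. m a * (ln (max (cmod a) R) - ln (cmod a))) + K1"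
   using cle by simp
  also have "\<dots> = 2 ^ j * ln (cmod (lead_coeff p)) + (\<Sum>a\<in>Z. m a * (2 ^ j * ln (max (cmod a) R) + K a))"
   unfolding lc_eq K1_def by (simp add: right_diff_distrib distrib_left sum_subtractf sum.distrib sum_distrib_left mult_ac)
  also have "\<dots> \<le> 2 ^ j * ln (cmod (lead_coeff p)) +
    (\<Sum>a\<in>Z. m a * (\<Sum>r<2 ^ j. ln (cmod (of_real R * unity_root (2 ^ j) ^ r - a))))"
   using K by (intro add_left_mono sum_mono mult_left_mono) (auto simp: m_def)
  also have "\<dots> = (\<Sum>r<2 ^ j. ln (cmod (poly p (of_real R * unity_root (2 ^ j) ^ r))))"
   unfolding lnP[OF notZ] sum.distrib sum_distrib_left by (subst sum.swap) simp
  finally have "(2 ^ j * c + K1) / 2 ^ j \<le> (\<Sum>r<2 ^ j. ln (cmod (poly p (of_real R * unity_root (2 ^ j) ^ r)))) / 2 ^ j"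
   by (intro divide_right_mono) auto
  then show ?thesis by (simp add: add_divide_distrib)
 qed
 have "(\<lambda>j. K1 / 2 ^ j) \<longlonglongrightarrow> 0"
  using LIMSEQ_divide_realpow_zero[of 2 K1] by simp
 then have "eventually (\<lambda>j. - \<eta> < K1 / 2 ^ j) sequentially" using \<eta> by (intro order_tendstoD(1)) auto
 then obtain J where "\<And>j. j \<ge> J \<Longrightarrow> - \<eta> < K1 / 2 ^ j" unfolding eventually_sequentially by blast
 then have "c - \<eta> \<le> (\<Sum>r<2 ^ j. ln (cmod (poly p (of_real R * unity_root (2 ^ j) ^ r)))) / 2 ^ j" if "j \<ge> J" for j
  using main[of j] that by (smt (verit))
 then show ?thesis unfolding c_def by blast
qed

text \<open>Zeros on the circle of radius \<open>R\<close> are avoided by moving to a slightly larger radius.\<close>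

lemma mean_lpsi_lower:
 fixes p :: "complex poly"
 assumes p: "poly p 0 = 1" and R: "R > 0" and \<eta>: "\<eta> > 0"
 shows "\<exists>J. \<forall>j\<ge>J. 2 * real n + (if \<exists>a. poly p a = 0 \<and> cmod a \<le> R / 2 then ln 2 else 0) - \<eta> \<le>
  (\<Sum>r<2 ^ j. lpsi n (poly p (of_real R * unity_root (2 ^ j) ^ r))) / 2 ^ j"
proof -
 define g where "g w = lpsi n (poly p w)" for w
 have "continuous_on (cball 0 (2 * R)) g"
  unfolding g_def lpsi_def by (intro continuous_intros) (auto simp: add_nonneg_eq_0_iff)
 then have "uniformly_continuous_on (cball 0 (2 * R)) g"
  by (intro compact_uniformly_continuous) auto
 then obtain d where d: "d > 0" "\<And>x y. x \<in> cball 0 (2 * R) \<Longrightarrow> y \<in> cball 0 (2 * R) \<Longrightarrow> dist y x < d \<Longrightarrow> dist (g y) (g x) < \<eta> / 2"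
  unfolding uniformly_continuous_on_def using \<eta> by (meson half_gt_zero)
 have p0: "p \<noteq> 0" using p by auto
 have "infinite {R<..<R + min d R}" using d(1) R by (intro infinite_Ioo) auto
 moreover have "finite (cmod ` {a. poly p a = 0})" using poly_roots_finite[OF p0] by (intro finite_imageI)
 ultimately have "\<exists>R'. R' \<in> {R<..<R + min d R} \<and> R' \<notin> cmod ` {a. poly p a = 0}"
  by (meson finite_subset subsetI)
 then obtain R' where "R < R'" "R' < R + min d R" and "R' \<notin> cmod ` {a. poly p a = 0}" by auto
 then have R': "R < R'" "R' < R + d" "R' < 2 * R" "\<And>a. poly p a = 0 \<Longrightarrow> cmod a \<noteq> R'"
  using min.cobounded1[of d R] min.cobounded2[of d R] by auto
 have R'0: "R' > 0" using R R' by simp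
 have "\<eta> / 2 > 0" using \<eta> by simp
 from mean_ln_poly_lower[OF p R'0 R'(4) this] obtain J where J: "\<And>j. j \<ge> J \<Longrightarrow>
   (if \<exists>a. poly p a = 0 \<and> cmod a \<le> R' / 2 then ln 2 else 0) - \<eta> / 2 \<le>
   (\<Sum>r<2 ^ j. ln (cmod (poly p (of_real R' * unity_root (2 ^ j) ^ r)))) / 2 ^ j" by blast
 have c: "(if \<exists>a. poly p a = 0 \<and> cmod a \<le> R / 2 then ln 2 else 0) \<le> (if \<exists>a. poly p a = 0 \<and> cmod a \<le> R' / 2 then ln 2 else (0::real))"
 proof (cases "\<exists>a. poly p a = 0 \<and> cmod a \<le> R / 2")
  case True
  then have "\<exists>a. poly p a = 0 \<and> cmod a \<le> R' / 2" using R'(1) by (meson divide_right_mono less_imp_le order_trans zero_le_numeral)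
  then show ?thesis by simp
 qed auto
 have pt: "2 * real n + ln (cmod (poly p (of_real R' * u))) - \<eta> / 2 \<le> g (of_real R * u)" if u: "cmod u = 1" for u
 proof -
  have cm: "cmod (of_real R' * u) = R'" "cmod (of_real R * u) = R" using u R R'0 by (auto simp: norm_mult)
  have du: "of_real R' * u - of_real R * u = of_real (R' - R) * u" by (simp add: left_diff_distrib)
  have "dist (of_real R' * u) (of_real R * u) = R' - R"
   unfolding dist_norm du norm_mult norm_of_real using u R'(1) by simp
  then have "dist (g (of_real R' * u)) (g (of_real R * u)) < \<eta> / 2" using R' R cm by (intro d(2)) auto
  then have "g (of_real R' * u) - \<eta> / 2 \<le> g (of_real R * u)" unfolding dist_real_def by linarith
  moreover have "2 * real n + ln (cmod (poly p (of_real R' * u))) \<le> g (of_real R' * u)"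
  proof -
   have pos: "cmod (poly p (of_real R' * u)) > 0" using R'(4)[of "of_real R' * u"] cm by auto
   have "ln ((cmod (poly p (of_real R' * u)))\<^sup>2) \<le> ln ((cmod (poly p (of_real R' * u)))\<^sup>2 + exp (- (4 * real n)))"
    using pos by (subst ln_le_cancel_iff) (auto intro: add_pos_pos)
   then show ?thesis using pos by (simp add: g_def lpsi_def ln_realpow)
  qed
  ultimately show ?thesis by linarith
 qed
 have "2 * real n + (if \<exists>a. poly p a = 0 \<and> cmod a \<le> R / 2 then ln 2 else 0) - \<eta> \<le>
  (\<Sum>r<2 ^ j. lpsi n (poly p (of_real R * unity_root (2 ^ j) ^ r))) / 2 ^ j" if j: "j \<ge> J" for j
 proof -
  define L where "L = (\<Sum>r<2 ^ j. ln (cmod (poly p (of_real R' * unity_root (2 ^ j) ^ r))))"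
  have "(\<Sum>r<2 ^ j. 2 * real n + ln (cmod (poly p (of_real R' * unity_root (2 ^ j) ^ r))) - \<eta> / 2) \<le>
    (\<Sum>r<2 ^ j. g (of_real R * unity_root (2 ^ j) ^ r))"
   by (intro sum_mono pt) (simp add: norm_power)
  moreover have "(\<Sum>r<2 ^ j. 2 * real n + ln (cmod (poly p (of_real R' * unity_root (2 ^ j) ^ r))) - \<eta> / 2) = 2 ^ j * (2 * real n - \<eta> / 2) + L"
   unfolding L_def by (simp add: sum.distrib sum_subtractf right_diff_distrib)
  ultimately have "(2 ^ j * (2 * real n - \<eta> / 2) + L) / 2 ^ j \<le> (\<Sum>r<2 ^ j. g (of_real R * unity_root (2 ^ j) ^ r)) / 2 ^ j"
   by (intro divide_right_mono) auto
  then have "2 * real n - \<eta> / 2 + L / 2 ^ j \<le> (\<Sum>r<2 ^ j. g (of_real R * unity_root (2 ^ j) ^ r)) / 2 ^ j"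
   by (simp add: add_divide_distrib)
  with J[OF j] c show ?thesis unfolding g_def L_def by linarith
 qed
 then show ?thesis by blast
qed

lemma perm_poly_as_poly: "perm_poly n A z = poly (\<Sum>k\<le>n. monom (pcoeff n A k) k) z"
 by (simp add: perm_poly_eq_sum poly_sum poly_monom)

text \<open>The number of points needed in the discrete Jensen inequality depends on W, so the lower
  limit over finer and finer points is taken, with Fatou's lemma. It is at least 2 n - \<epsilon>
  always and ln 2 more if there is a zero, while its mean is at most 2 n + \<epsilon>: a zero has
  probability at most 2 \<epsilon> / ln 2.\<close>

theorem perm_poly_zero_free:
 fixes \<beta> \<delta> :: real
 assumes \<beta>: "0 < \<beta>" and \<delta>: "\<delta> > 0"
 shows "\<exists>N. \<forall>n\<ge>N. \<exists>E\<in>sets (gvec (sq n)). measure (gvec (sq n)) E \<le> \<delta> \<and>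
  (\<forall>W\<in>space (gvec (sq n)) - E. \<forall>z. cmod z \<le> real n powr (1/3 - \<beta>/2) \<longrightarrow> perm_poly n (curry W) z \<noteq> 0)"
proof -
 \<comment> \<open>The bound 1/4 keeps 2 n - \<epsilon> nonnegative; \<delta>/4 suffices because 2
   \<epsilon> / ln 2 <= 4 \<epsilon>.\<close>
 define \<epsilon> where "\<epsilon> = min (1/4) (\<delta> / 4)"
 have \<epsilon>: "\<epsilon> > 0" "\<epsilon> \<le> 1/4" "\<epsilon> \<le> \<delta> / 4" using \<delta> by (auto simp: \<epsilon>_def)
 from log_mean_bound[OF \<beta> \<epsilon>(1)] obtain N where N: "\<And>n z. n \<ge> N \<Longrightarrow> cmod z = 2 * real n powr (1/3 - \<beta>/2) \<Longrightarrow>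
  (\<integral>\<^sup>+W. ennreal (lpsi n (perm_poly n (curry W) z)) \<partial>gvec (sq n)) \<le> ennreal (2 * real n + \<epsilon>)" by blast
 have "\<exists>E\<in>sets (gvec (sq n)). measure (gvec (sq n)) E \<le> \<delta> \<and>
  (\<forall>W\<in>space (gvec (sq n)) - E. \<forall>z. cmod z \<le> real n powr (1/3 - \<beta>/2) \<longrightarrow> perm_poly n (curry W) z \<noteq> 0)"
  if n: "n \<ge> max N 1" for n
 proof -
  let ?M = "gvec (sq n)"
  interpret prob_space ?M by (rule prob_space_gvec)
  define R where "R = 2 * real n powr (1/3 - \<beta>/2)"
  have R: "R > 0" using n by (simp add: R_def)
  define \<Phi> where "\<Phi> j W = ennreal ((\<Sum>r<2 ^ j. lpsi n (perm_poly n (curry W) (of_real R * unity_root (2 ^ j) ^ r))) / 2 ^ j)" for j W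
  have \<Phi>_eq: "\<Phi> j W = ennreal (1 / 2 ^ j) * (\<Sum>r<2 ^ j. ennreal (lpsi n (perm_poly n (curry W) (of_real R * unity_root (2 ^ j) ^ r))))" for j W
   unfolding \<Phi>_def using lpsi_nonneg by (simp add: sum_ennreal sum_nonneg flip: ennreal_mult)
  have \<Phi>m: "\<Phi> j \<in> borel_measurable ?M" for j
   unfolding \<Phi>_eq[abs_def] by (intro borel_measurable_times_ennreal borel_measurable_const borel_measurable_sum lpsi_measurable)
  have I\<Phi>: "(\<integral>\<^sup>+W. \<Phi> j W \<partial>?M) \<le> ennreal (2 * real n + \<epsilon>)" for j
  proof -
   have "(\<integral>\<^sup>+W. \<Phi> j W \<partial>?M) = ennreal (1 / 2 ^ j) * (\<Sum>r<2 ^ j. \<integral>\<^sup>+W. ennreal (lpsi n (perm_poly n (curry W) (of_real R * unity_root (2 ^ j) ^ r))) \<partial>?M)"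
    unfolding \<Phi>_eq
    by (subst nn_integral_cmult, intro borel_measurable_sum lpsi_measurable, subst nn_integral_sum)
      (rule lpsi_measurable, rule refl)
   also have "\<dots> \<le> ennreal (1 / 2 ^ j) * (\<Sum>r<(2::nat) ^ j. ennreal (2 * real n + \<epsilon>))"
    using R n by (intro mult_left_mono sum_mono N) (auto simp: norm_mult norm_power R_def)
   also have "\<dots> = ennreal (1 / 2 ^ j) * ennreal (2 ^ j * (2 * real n + \<epsilon>))"
    using \<epsilon> by (subst sum_ennreal) auto
   also have "\<dots> = ennreal (2 * real n + \<epsilon>)" using \<epsilon> by (subst ennreal_mult[symmetric]) auto
   finally show ?thesis .
  qed
  define \<Lambda> where "\<Lambda> W = liminf (\<lambda>j. \<Phi> j W)" for W
  have \<Lambda>m: "\<Lambda> \<in> borel_measurable ?M" unfolding \<Lambda>_def[abs_def] using \<Phi>m by (intro borel_measurable_liminf) auto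
  have "(\<integral>\<^sup>+W. \<Lambda> W \<partial>?M) \<le> liminf (\<lambda>j. \<integral>\<^sup>+W. \<Phi> j W \<partial>?M)"
   unfolding \<Lambda>_def by (rule nn_integral_liminf) (rule \<Phi>m)
  also have "\<dots> \<le> liminf (\<lambda>j. ennreal (2 * real n + \<epsilon>))" by (rule Liminf_mono) (simp add: I\<Phi>)
  also have "\<dots> = ennreal (2 * real n + \<epsilon>)" by (simp add: Liminf_const)
  finally have I\<Lambda>: "(\<integral>\<^sup>+W. \<Lambda> W \<partial>?M) \<le> ennreal (2 * real n + \<epsilon>)" .
  have low: "ennreal (2 * real n + (if \<exists>a. perm_poly n (curry W) a = 0 \<and> cmod a \<le> R / 2 then ln 2 else 0) - \<epsilon>) \<le> \<Lambda> W" for W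
  proof -
   define q where "q = (\<Sum>k\<le>n. monom (pcoeff n (curry W) k) k)"
   have q: "perm_poly n (curry W) z = poly q z" for z unfolding q_def by (rule perm_poly_as_poly)
   have q0: "poly q 0 = 1" unfolding q[symmetric] by simp
   from mean_lpsi_lower[OF q0 R \<epsilon>(1), of n] obtain J where J: "\<And>j. j \<ge> J \<Longrightarrow>
     2 * real n + (if \<exists>a. poly q a = 0 \<and> cmod a \<le> R / 2 then ln 2 else 0) - \<epsilon> \<le>
     (\<Sum>r<2 ^ j. lpsi n (poly q (of_real R * unity_root (2 ^ j) ^ r))) / 2 ^ j" by blast
   show ?thesis unfolding \<Lambda>_def \<Phi>_def q
    by (rule Liminf_bounded, unfold eventually_sequentially, intro exI[of _ J] allI impI ennreal_leI J)
  qed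
  define E where "E = {W \<in> space ?M. ennreal (2 * real n + ln 2 - \<epsilon>) \<le> \<Lambda> W}"
  have E: "E \<in> sets ?M" unfolding E_def using \<Lambda>m by (intro borel_measurable_le borel_measurable_const)
  have l2: "ln 2 \<ge> (1/2::real)" using ln2_ge_two_thirds by simp
  have nn: "2 * real n - \<epsilon> \<ge> 0" using n \<epsilon> by simp
  have "measure ?M E \<le> \<delta>"
  proof -
   have "ennreal (2 * real n - \<epsilon> + ln 2 * measure ?M E) = ennreal (2 * real n - \<epsilon>) + ennreal (ln 2) * emeasure ?M E"
    using nn l2 by (simp add: emeasure_eq_measure flip: ennreal_mult ennreal_plus)
   also have "\<dots> = (\<integral>\<^sup>+W. ennreal (2 * real n - \<epsilon>) + ennreal (ln 2) * indicator E W \<partial>?M)"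
    using E by (subst nn_integral_add) (auto simp: emeasure_space_1 nn_integral_cmult_indicator)
   also have "\<dots> \<le> (\<integral>\<^sup>+W. \<Lambda> W \<partial>?M)"
   proof (rule nn_integral_mono)
    fix W
    show "ennreal (2 * real n - \<epsilon>) + ennreal (ln 2) * indicator E W \<le> \<Lambda> W"
    proof (cases "W \<in> E")
     case True
     have "ennreal (2 * real n - \<epsilon>) + ennreal (ln 2) = ennreal (2 * real n + ln 2 - \<epsilon>)"
      using nn l2 by (subst ennreal_plus[symmetric]) (auto simp: algebra_simps)
     then show ?thesis using True by (simp add: E_def)
    next
     case False
     have "ennreal (2 * real n - \<epsilon>) \<le> ennreal (2 * real n + (if \<exists>a. perm_poly n (curry W) a = 0 \<and> cmod a \<le> R / 2 then ln 2 else 0) - \<epsilon>)"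
      by (intro ennreal_leI) auto
     also note low
     finally show ?thesis using False by simp
    qed
   qed
   also note I\<Lambda>
   finally have "2 * real n - \<epsilon> + ln 2 * measure ?M E \<le> 2 * real n + \<epsilon>"
    using \<epsilon> by (subst (asm) ennreal_le_iff) auto
   moreover have "1/2 * measure ?M E \<le> ln 2 * measure ?M E" using l2 by (intro mult_right_mono) auto
   ultimately show ?thesis using \<epsilon>(3) by linarith
  qed
  moreover have "perm_poly n (curry W) z \<noteq> 0" if W: "W \<in> space ?M - E" and z: "cmod z \<le> real n powr (1/3 - \<beta>/2)" for W z
  proof
   assume "perm_poly n (curry W) z = 0"
   then have "\<exists>a. perm_poly n (curry W) a = 0 \<and> cmod a \<le> R / 2" using z by (intro exI[of _ z]) (simp add: R_def)
   then show False using low[of W] W by (auto simp: E_def)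
  qed
  ultimately show ?thesis using E by blast
 qed
 then show ?thesis by blast
qed

section \<open>Truncating the Taylor series of the logarithm\<close>

lemma log_coeff_0: "log_coeff n A 0 = 0"
 by (simp add: log_coeff_def)

text \<open>An upper bound on |P| bounds Re L from above only; Borel-Caratheodory turns this into a
  bound on |L| in the half disk, and Cauchy's inequality there gives the powers of 2 / \<rho>. The
  factor n + 1 is harmless, since the bound serves large k only.\<close>

lemma log_branch_coeff_bound:
 fixes A :: "nat \<Rightarrow> nat \<Rightarrow> complex"
 assumes \<rho>: "\<rho> > 0" and nz: "\<And>z. cmod z < \<rho> \<Longrightarrow> perm_poly n A z \<noteq> 0"
  and ub: "\<And>z. cmod z < \<rho> \<Longrightarrow> cmod (perm_poly n A z) \<le> exp (real n)"
 obtains L where "L holomorphic_on ball 0 \<rho>" "L 0 = 0" "\<And>z. z \<in> ball 0 \<rho> \<Longrightarrow> exp (L z) = perm_poly n A z"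
  "\<And>k. cmod (log_coeff n A k) \<le> 2 * (real n + 1) * (2 / \<rho>) ^ k"
  "\<And>z. z \<in> ball 0 \<rho> \<Longrightarrow> (\<lambda>k. log_coeff n A k * z ^ k) sums L z"
proof -
 have "convex (ball (0::complex) \<rho>)" by simp
 then have "contractible (ball (0::complex) \<rho>)" by (rule convex_imp_contractible)
 then obtain g where g: "g holomorphic_on ball 0 \<rho>" "\<And>z. z \<in> ball 0 \<rho> \<Longrightarrow> perm_poly n A z = exp (g z)"
  using contractible_imp_holomorphic_log[OF perm_poly_holomorphic[of n A "ball 0 \<rho>"]] nz by (metis mem_ball_0)
 define L where "L z = g z - g 0" for z
 have L: "L holomorphic_on ball 0 \<rho>" unfolding L_def by (intro holomorphic_intros g)
 have L0: "L 0 = 0" by (simp add: L_def)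
 have "exp (g 0) = 1" using g(2)[of 0] \<rho> by simp
 then have Le: "exp (L z) = perm_poly n A z" if "z \<in> ball 0 \<rho>" for z
  using g(2)[OF that] by (simp add: L_def exp_diff)
 \<comment> \<open>Larger than n by 1, to make the bound on Re L strict and so keep the map to the
   unit disk away from the boundary.\<close>
 define m where "m = real n + 1"
 have m: "m > 0" by (simp add: m_def)
 have ReL: "Re (L z) < m" if "z \<in> ball 0 \<rho>" for z
 proof -
  have "exp (Re (L z)) \<le> exp (real n)" using ub[of z] that Le[OF that] by (metis mem_ball_0 norm_exp_eq_Re)
  then show ?thesis by (simp add: m_def)
 qed
 have ne: "2 * of_real m - L z \<noteq> 0" and sq: "cmod (L z) < cmod (2 * of_real m - L z)" if "z \<in> ball 0 \<rho>" for z
 proof -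
  have "(cmod (L z))\<^sup>2 < (cmod (2 * of_real m - L z))\<^sup>2"
  proof -
   have "m * Re (L z) < m * m" using ReL[OF that] m by (intro mult_strict_left_mono) auto
   then show ?thesis unfolding cmod_power2 by (simp add: power2_eq_square algebra_simps)
  qed
  then show *: "cmod (L z) < cmod (2 * of_real m - L z)" by (rule power2_less_imp_less) simp
  show "2 * of_real m - L z \<noteq> 0" using * by (metis norm_ge_zero norm_zero not_less)
 qed
 text \<open>\<open>L / (2 m - L)\<close> maps the disk into the unit disk because \<open>Re L < m\<close>; hence the Schwarz lemma
  applies.\<close>
 define \<phi> where "\<phi> w = L (of_real \<rho> * w) / (2 * of_real m - L (of_real \<rho> * w))" for w
 have inb: "of_real \<rho> * w \<in> ball 0 \<rho>" if "cmod w < 1" for w :: complex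
  using that \<rho> by (simp add: norm_mult)
 have \<phi>: "\<phi> holomorphic_on ball 0 1"
 proof -
  have "(L \<circ> (\<lambda>w. of_real \<rho> * w)) holomorphic_on ball 0 1"
   by (rule holomorphic_on_compose_gen[OF _ L]) (use inb in \<open>auto intro!: holomorphic_intros\<close>)
  then have "(\<lambda>w. L (of_real \<rho> * w)) holomorphic_on ball 0 1" by (simp add: o_def)
  then show ?thesis unfolding \<phi>_def using ne inb by (intro holomorphic_intros) auto
 qed
 have Lb: "cmod (L z) \<le> 2 * m" if z: "cmod z \<le> \<rho> / 2" for z
 proof -
  define w where "w = z / of_real \<rho>"
  have w: "cmod w \<le> 1/2" "of_real \<rho> * w = z" using z \<rho> by (auto simp: w_def norm_divide field_simps)
  have zb: "z \<in> ball 0 \<rho>" using z \<rho> by simp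
  have "cmod (\<phi> w) \<le> cmod w"
  proof (rule Schwarz_Lemma(1)[OF \<phi>])
   show "\<phi> 0 = 0" by (simp add: \<phi>_def L0)
   show "cmod (\<phi> v) < 1" if "cmod v < 1" for v
    using sq[OF inb[OF that]] ne[OF inb[OF that]] by (simp add: \<phi>_def norm_divide)
   show "cmod w < 1" using w by simp
  qed
  then have "cmod (L z) / cmod (2 * of_real m - L z) \<le> cmod w" by (simp add: \<phi>_def norm_divide w(2))
  then have "cmod (L z) / cmod (2 * of_real m - L z) \<le> 1/2" using w(1) by (rule order_trans)
  then have "cmod (L z) \<le> 1/2 * cmod (2 * of_real m - L z)" using ne[OF zb] by (simp add: divide_le_eq)
  also have "\<dots> \<le> 1/2 * (2 * m + cmod (L z))"
   using norm_triangle_ineq4[of "2 * of_real m" "L z"] m by (intro mult_left_mono) (auto simp: norm_mult)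
  finally show ?thesis by simp
 qed
 \<comment> \<open>\<open>log_coeff\<close> is defined by the principal branch, which agrees with L
   near 0, where the imaginary part of L is below pi.\<close>
 have coeff: "log_coeff n A k = (deriv ^^ k) L 0 / fact k" for k
 proof -
  have "isCont L 0" using L \<rho> holomorphic_on_imp_continuous_on[OF L]
   by (simp add: continuous_on_eq_continuous_at)
  then have "eventually (\<lambda>z. dist (L z) (L 0) < 1) (nhds 0)"
   unfolding isCont_def by (intro tendstoD) (auto simp: tendsto_at_iff_tendsto_nhds)
  moreover have "eventually (\<lambda>z. z \<in> ball 0 \<rho>) (nhds 0)" using \<rho> by (intro eventually_nhds_in_open) auto
  ultimately have "eventually (\<lambda>z. Ln (perm_poly n A z) = L z) (nhds 0)"
  proof eventually_elim
   case (elim z)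
   have "\<bar>Im (L z)\<bar> < 1" using elim(1) abs_Im_le_cmod[of "L z"] by (simp add: L0)
   then have "Ln (exp (L z)) = L z" using pi_gt3 by (intro Ln_exp) linarith+
   then show ?case using Le[OF elim(2)] by simp
  qed
  then show ?thesis unfolding log_coeff_def by (simp add: higher_deriv_cong_ev)
 qed
 show thesis
 proof (rule that[OF L L0 Le])
  show "cmod (log_coeff n A k) \<le> 2 * (real n + 1) * (2 / \<rho>) ^ k" for k
  proof -
   have "cmod ((deriv ^^ k) L 0) \<le> fact k * (2 * m) / (\<rho> / 2) ^ k"
   proof (rule Cauchy_inequality)
    show "L holomorphic_on ball 0 (\<rho> / 2)" by (rule holomorphic_on_subset[OF L]) (use \<rho> in auto)
    show "continuous_on (cball 0 (\<rho> / 2)) L"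
     by (rule continuous_on_subset[OF holomorphic_on_imp_continuous_on[OF L]]) (use \<rho> in auto)
    show "cmod (L x) \<le> 2 * m" if "cmod (0 - x) = \<rho> / 2" for x using that by (intro Lb) simp
   qed (use \<rho> in simp)
   then have "cmod ((deriv ^^ k) L 0) / fact k \<le> (2 * m) / (\<rho> / 2) ^ k"
    by (simp add: divide_le_eq mult.commute)
   then show ?thesis unfolding coeff m_def by (simp add: norm_divide power_divide)
  qed
  show "(\<lambda>k. log_coeff n A k * z ^ k) sums L z" if "z \<in> ball 0 \<rho>" for z
   using holomorphic_power_series[OF L that] by (simp add: coeff)
 qed
qed

text \<open>The terms between d and K are bounded one by one by hypothesis. Beyond K the bound of
  \<open>log_branch_coeff_bound\<close> gives a geometric series with ratio 2 r / \<rho> <=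
  1/2.\<close>

lemma truncation_error:
 fixes A :: "nat \<Rightarrow> nat \<Rightarrow> complex"
 assumes r: "0 < r" and \<rho>: "4 * r \<le> \<rho>" and nz: "\<And>z. cmod z < \<rho> \<Longrightarrow> perm_poly n A z \<noteq> 0"
  and ub: "\<And>z. cmod z < \<rho> \<Longrightarrow> cmod (perm_poly n A z) \<le> exp (real n)"
  and mid: "\<And>k. k \<in> {d<..K} \<Longrightarrow> cmod (log_coeff n A k) * r ^ k \<le> \<eta>" and d: "d < K"
 shows "log_approx n A d r (real K * \<eta> + 4 * (real n + 1) * (2 * r / \<rho>) ^ Suc K)"
proof -
 have \<rho>0: "\<rho> > 0" using r \<rho> by simp
 obtain L where L: "L holomorphic_on ball 0 \<rho>" "L 0 = 0" "\<And>z. z \<in> ball 0 \<rho> \<Longrightarrow> exp (L z) = perm_poly n A z"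
  and b: "\<And>k. cmod (log_coeff n A k) \<le> 2 * (real n + 1) * (2 / \<rho>) ^ k"
  and s: "\<And>z. z \<in> ball 0 \<rho> \<Longrightarrow> (\<lambda>k. log_coeff n A k * z ^ k) sums L z"
  by (rule log_branch_coeff_bound[OF \<rho>0 nz ub]) (assumption+, (rule that; (assumption | blast)))
 have sub: "cball 0 r \<subseteq> ball (0::complex) \<rho>" using r \<rho> by auto
 have "log_branch r (perm_poly n A) L"
  unfolding log_branch_def
 proof (intro conjI ballI)
  show "L holomorphic_on ball 0 r" by (rule holomorphic_on_subset[OF L(1)]) (use sub in auto)
  show "continuous_on (cball 0 r) L" by (rule continuous_on_subset[OF holomorphic_on_imp_continuous_on[OF L(1)] sub])
 qed (use L sub in auto)
 moreover have "cmod (L z - log_trunc n A d z) \<le> real K * \<eta> + 4 * (real n + 1) * (2 * r / \<rho>) ^ Suc K"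
  if z: "z \<in> cball 0 r" for z
 proof -
  define a where "a k = log_coeff n A k * z ^ k" for k
  define q where "q = 2 * r / \<rho>"
  have q: "0 \<le> q" "q \<le> 1/2" using r \<rho> \<rho>0 by (auto simp: q_def divide_le_eq)
  have zr: "cmod z \<le> r" using z by simp
  have ab: "cmod (a k) \<le> 2 * (real n + 1) * q ^ k" for k
  proof -
   have "cmod (a k) = cmod (log_coeff n A k) * cmod z ^ k" by (simp add: a_def norm_mult norm_power)
   also have "\<dots> \<le> (2 * (real n + 1) * (2 / \<rho>) ^ k) * r ^ k"
    using b[of k] zr \<rho>0 by (intro mult_mono power_mono) auto
   also have "\<dots> = 2 * (real n + 1) * q ^ k" by (simp add: q_def power_divide power_mult_distrib)
   finally show ?thesis .
  qed
  have "(\<lambda>i. a (i + Suc K)) sums (L z - (\<Sum>i<Suc K. a i))"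
   using s[of z] z sub unfolding a_def by (intro sums_split_initial_segment) auto
  moreover have "(\<lambda>i. 2 * (real n + 1) * q ^ Suc K * q ^ i) sums (2 * (real n + 1) * q ^ Suc K * (1 / (1 - q)))"
   using q by (intro sums_mult geometric_sums) auto
  moreover have "cmod (a (i + Suc K)) \<le> 2 * (real n + 1) * q ^ Suc K * q ^ i" for i
   using ab[of "i + Suc K"] by (simp add: power_add mult_ac)
  ultimately have "cmod (L z - (\<Sum>i<Suc K. a i)) \<le> 2 * (real n + 1) * q ^ Suc K * (1 / (1 - q))"
   by (rule norm_sums_le)
  also have "\<dots> \<le> 2 * (real n + 1) * q ^ Suc K * 2"
   using q by (intro mult_left_mono) (auto simp: divide_le_eq)
  also have "\<dots> = 4 * (real n + 1) * q ^ Suc K"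
  proof -
   have "2 * x * y * 2 = 4 * x * y" for x y :: real by simp
   then show ?thesis .
  qed
  finally have tail: "cmod (L z - (\<Sum>i<Suc K. a i)) \<le> 4 * (real n + 1) * q ^ Suc K" .
  have sp: "(\<Sum>i<Suc K. a i) = log_trunc n A d z + (\<Sum>i\<in>{d<..K}. a i)"
  proof -
   have "{..<Suc K} = insert 0 ({1..d} \<union> {d<..K})" using d by auto
   moreover have "a 0 = 0" by (simp add: a_def log_coeff_0)
   moreover have "{1..d} \<inter> {d<..K} = {}" by auto
   ultimately show ?thesis by (simp add: sum.union_disjoint log_trunc_def a_def)
  qed
  have "cmod (\<Sum>i\<in>{d<..K}. a i) \<le> (\<Sum>i\<in>{d<..K}. \<eta>)"
  proof (rule order_trans[OF norm_sum sum_mono])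
   fix k assume k: "k \<in> {d<..K}"
   have "cmod (a k) \<le> cmod (log_coeff n A k) * r ^ k"
    unfolding a_def norm_mult norm_power using zr by (intro mult_left_mono power_mono) auto
   then show "cmod (a k) \<le> \<eta>" using mid[OF k] by linarith
  qed
  also have "\<dots> \<le> real K * \<eta>"
  proof -
   have "0 \<le> cmod (log_coeff n A K) * r ^ K" "K \<in> {d<..K}" using r d by auto
   then have "0 \<le> \<eta>" using mid[of K] by linarith
   then show ?thesis by (simp add: mult_right_mono)
  qed
  finally have "cmod (\<Sum>i\<in>{d<..K}. a i) \<le> real K * \<eta>" .
  then show ?thesis using tail norm_triangle_ineq[of "L z - (\<Sum>i<Suc K. a i)" "\<Sum>i\<in>{d<..K}. a i"]
   unfolding sp q_def[symmetric] by simp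
 qed
 ultimately show ?thesis unfolding log_approx_def by blast
qed

lemma (in prob_space) markov_measure:
 assumes f: "(\<lambda>x. ennreal (f x)) \<in> borel_measurable M" and nn: "\<And>x. f x \<ge> 0" and I: "(\<integral>\<^sup>+x. ennreal (f x) \<partial>M) \<le> ennreal c"
  and t: "t > 0" and c: "c \<ge> 0"
 shows "{x \<in> space M. t < f x} \<in> sets M" "measure M {x \<in> space M. t < f x} \<le> c / t"
proof -
 have eq: "{x \<in> space M. t < f x} = {x \<in> space M. ennreal t < ennreal (f x)}"
  using t nn by (auto simp: ennreal_less_iff)
 show S: "{x \<in> space M. t < f x} \<in> sets M" unfolding eq using f by (intro borel_measurable_less borel_measurable_const)
 define S where "S = {x \<in> space M. t < f x}"
 have "ennreal t * emeasure M S = (\<integral>\<^sup>+x. ennreal t * indicator S x \<partial>M)"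
  using S by (simp add: S_def nn_integral_cmult_indicator)
 also have "\<dots> \<le> (\<integral>\<^sup>+x. ennreal (f x) \<partial>M)"
  by (intro nn_integral_mono) (auto simp: S_def indicator_def intro!: ennreal_leI)
 also note I
 finally have "ennreal (t * measure M S) \<le> ennreal c" using t by (simp add: emeasure_eq_measure ennreal_mult)
 then have "t * measure M S \<le> c" using c by simp
 then show "measure M {x \<in> space M. t < f x} \<le> c / t" using t by (simp add: S_def le_divide_eq mult.commute)
qed

section \<open>Proof of the theorem\<close>

text \<open>Three exceptional events share \<delta>: a zero in the larger disk, an envelope
  \<open>penv\<close> above n, and a coefficient with d < k <= K that exceeds its typical size by a
  power of n.\<close>

lemma gvec_log_approx:
 fixes \<beta> \<gamma> \<delta> :: real and d :: nat
 assumes \<beta>: "0 < \<beta>" and \<gamma>: "\<gamma> < Gamma_exponent d \<beta>" and \<delta>: "\<delta> > 0"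
 shows "\<exists>N. \<forall>n\<ge>N. \<exists>E\<in>sets (gvec (sq n)). measure (gvec (sq n)) E \<le> \<delta> \<and>
  (\<forall>W\<in>space (gvec (sq n)) - E. log_approx n (curry W) d (real n powr (1/3 - \<beta>)) (real n powr (- \<gamma>)))"
proof -
 \<comment> \<open>Half of the gap to Gamma: one \<epsilon> in the exponent is spent on Markov's
   inequality, the other absorbs the number K of terms.\<close>
 define \<epsilon> where "\<epsilon> = (Gamma_exponent d \<beta> - \<gamma>) / 2"
 have \<epsilon>: "\<epsilon> > 0" using \<gamma> by (simp add: \<epsilon>_def)
 \<comment> \<open>The tail is of order n times n to the power -(K + 1) \<beta>/2; an exponent of at
   least 2 + \<gamma> brings it below n to the power -\<gamma>.\<close>
 define K where "K = d + 1 + nat \<lceil>(2 + \<bar>\<gamma>\<bar>) * 2 / \<beta>\<rceil>"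
 have K: "d < K" "\<beta> / 2 * real (Suc K) \<ge> 2 + \<gamma>"
 proof -
  show "d < K" by (simp add: K_def)
  have "(2 + \<bar>\<gamma>\<bar>) * 2 / \<beta> \<le> real (Suc K)" unfolding K_def by linarith
  then have "(2 + \<bar>\<gamma>\<bar>) * 2 \<le> real (Suc K) * \<beta>" using \<beta> by (simp only: pos_divide_le_eq)
  then have "2 + \<bar>\<gamma>\<bar> \<le> \<beta> / 2 * real (Suc K)" by (simp add: mult.commute)
  then show "\<beta> / 2 * real (Suc K) \<ge> 2 + \<gamma>" by linarith
 qed
 have "\<forall>k. \<exists>C. k \<ge> 1 \<longrightarrow> C \<ge> 0 \<and> (\<forall>n. (\<lambda>w. log_coeff n (curry w) k) \<in> borel_measurable (gvec (sq n)) \<and>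
  (\<integral>\<^sup>+w. ennreal ((cmod (log_coeff n (curry w) k))\<^sup>2) \<partial>gvec (sq n)) \<le> ennreal (C * real n / real n ^ k))"
  using log_coeff_second_moment by blast
 from choice[OF this] obtain C where C: "\<And>k. k \<ge> 1 \<Longrightarrow> C k \<ge> 0"
  "\<And>k n. k \<ge> 1 \<Longrightarrow> (\<lambda>w. log_coeff n (curry w) k) \<in> borel_measurable (gvec (sq n))"
  "\<And>k n. k \<ge> 1 \<Longrightarrow> (\<integral>\<^sup>+w. ennreal ((cmod (log_coeff n (curry w) k))\<^sup>2) \<partial>gvec (sq n)) \<le> ennreal (C k * real n / real n ^ k)"
  by blast
 define C1 where "C1 = (\<Sum>k\<in>{d<..K}. C k)"
 have "\<delta> / 3 > 0" using \<delta> by simp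
 from perm_poly_zero_free[OF \<beta> this] obtain N1 where N1: "\<And>n. n \<ge> N1 \<Longrightarrow> \<exists>E\<in>sets (gvec (sq n)). measure (gvec (sq n)) E \<le> \<delta> / 3 \<and>
  (\<forall>W\<in>space (gvec (sq n)) - E. \<forall>z. cmod z \<le> real n powr (1/3 - \<beta>/2) \<longrightarrow> perm_poly n (curry W) z \<noteq> 0)" by blast
 have lim: "(\<lambda>n::nat. real n powr (- s)) \<longlonglongrightarrow> 0" if "s > 0" for s
  by (rule tendsto_neg_powr[OF _ filterlim_real_sequentially]) (use that in simp)
 have "(\<lambda>n::nat. C1 * real n powr (- (2 * \<epsilon>))) \<longlonglongrightarrow> C1 * 0" using \<epsilon> by (intro tendsto_mult tendsto_const lim) simp
 then have e1: "eventually (\<lambda>n::nat. C1 * real n powr (- (2 * \<epsilon>)) < \<delta> / 3) sequentially"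
  using \<delta> by (intro order_tendstoD(2)) auto
 have "(\<lambda>n::nat. 2 / real n) \<longlonglongrightarrow> 0" by (rule lim_const_over_n)
 then have e2: "eventually (\<lambda>n::nat. 2 / real n < \<delta> / 3) sequentially" using \<delta> by (intro order_tendstoD(2)) auto
 have "(\<lambda>n::nat. real n powr (- (\<beta> / 2))) \<longlonglongrightarrow> 0" using \<beta> by (intro lim) simp
 then have e3: "eventually (\<lambda>n::nat. real n powr (- (\<beta> / 2)) < 1/4) sequentially" by (intro order_tendstoD(2)) auto
 have e4: "eventually (\<lambda>n::nat. exp (8 * real n powr (2/3)) * real n \<le> exp (2 * real n)) sequentially" by real_asymp
 have "(\<lambda>n::nat. real K * real n powr (- \<epsilon>) + 4 * 2 ^ Suc K * ((real n + 1) * real n powr (- 2))) \<longlonglongrightarrow>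
   real K * 0 + 4 * 2 ^ Suc K * 0"
 proof (intro tendsto_add tendsto_mult tendsto_const lim \<epsilon>)
  show "(\<lambda>n::nat. (real n + 1) * real n powr (- 2)) \<longlonglongrightarrow> 0" by real_asymp
 qed
 then have e5: "eventually (\<lambda>n::nat. real K * real n powr (- \<epsilon>) + 4 * 2 ^ Suc K * ((real n + 1) * real n powr (- 2)) < 1) sequentially"
  by (intro order_tendstoD(2)) auto
 from eventually_conj[OF eventually_conj[OF e1 e2] eventually_conj[OF eventually_conj[OF e3 e4] eventually_conj[OF e5 eventually_conj[OF eventually_gt_at_top[of 0] eventually_ge_at_top[of N1]]]]]
 obtain N where N: "\<And>n. n \<ge> N \<Longrightarrow> (C1 * real n powr (- (2 * \<epsilon>)) < \<delta> / 3 \<and> 2 / real n < \<delta> / 3) \<and>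
   (real n powr (- (\<beta> / 2)) < 1/4 \<and> exp (8 * real n powr (2/3)) * real n \<le> exp (2 * real n)) \<and>
   real K * real n powr (- \<epsilon>) + 4 * 2 ^ Suc K * ((real n + 1) * real n powr (- 2)) < 1 \<and> 0 < n \<and> N1 \<le> n"
  unfolding eventually_sequentially by blast
 have "\<exists>E\<in>sets (gvec (sq n)). measure (gvec (sq n)) E \<le> \<delta> \<and>
  (\<forall>W\<in>space (gvec (sq n)) - E. log_approx n (curry W) d (real n powr (1/3 - \<beta>)) (real n powr (- \<gamma>)))"
  if "n \<ge> N" for n
 proof -
  from N[OF that] have n: "C1 * real n powr (- (2 * \<epsilon>)) < \<delta> / 3" "2 / real n < \<delta> / 3"
   "real n powr (- (\<beta> / 2)) < 1/4" "exp (8 * real n powr (2/3)) * real n \<le> exp (2 * real n)"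
   "real K * real n powr (- \<epsilon>) + 4 * 2 ^ Suc K * ((real n + 1) * real n powr (- 2)) < 1" "0 < n" "N1 \<le> n" by auto
  have n1: "real n \<ge> 1" "real n > 0" using n(6) by auto
  let ?M = "gvec (sq n)"
  interpret prob_space ?M by (rule prob_space_gvec)
  obtain E1 where E1: "E1 \<in> sets ?M" "measure ?M E1 \<le> \<delta> / 3"
   "\<And>W z. W \<in> space ?M - E1 \<Longrightarrow> cmod z \<le> real n powr (1/3 - \<beta>/2) \<Longrightarrow> perm_poly n (curry W) z \<noteq> 0"
   using N1[OF n(7)] by blast
  define E2 where "E2 = {W \<in> space ?M. real n < penv n W}"
  have pm: "(\<lambda>W. ennreal (penv n W)) \<in> borel_measurable ?M" by (rule measurable_compose[OF penv_measurable]) measurable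
  have pI: "(\<integral>\<^sup>+W. ennreal (penv n W) \<partial>?M) \<le> ennreal 2" using penv_integral[of n] by simp
  have E2: "E2 \<in> sets ?M" "measure ?M E2 \<le> 2 / real n"
   unfolding E2_def by (rule markov_measure[OF pm penv_nonneg pI n1(2)]; simp)+
  define \<tau> where "\<tau> k = real n powr (1 - real k + 2 * \<epsilon>)" for k :: nat
  define E3 where "E3 k = {W \<in> space ?M. \<tau> k < (cmod (log_coeff n (curry W) k))\<^sup>2}" for k
  have E3: "E3 k \<in> sets ?M \<and> measure ?M (E3 k) \<le> C k * real n powr (- (2 * \<epsilon>))" if k: "k \<ge> 1" for k
  proof -
   have m: "(\<lambda>W. ennreal ((cmod (log_coeff n (curry W) k))\<^sup>2)) \<in> borel_measurable ?M"
    by (rule measurable_compose[OF C(2)[OF k]]) measurable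
   have \<tau>: "\<tau> k > 0" using n1 by (simp add: \<tau>_def)
   have c: "C k * real n / real n ^ k \<ge> 0" using C(1)[OF k] by simp
   note mm = markov_measure[OF m _ C(3)[OF k] \<tau> c]
   have "C k * real n / real n ^ k / \<tau> k = C k * (real n powr 1 / real n powr real k / real n powr (1 - real k + 2 * \<epsilon>))"
    using n1 by (simp add: \<tau>_def powr_realpow)
   also have "real n powr 1 / real n powr real k / real n powr (1 - real k + 2 * \<epsilon>) = real n powr (1 - real k - (1 - real k + 2 * \<epsilon>))"
    by (simp only: powr_diff)
   also have "\<dots> = real n powr (- (2 * \<epsilon>))" by simp
   finally show ?thesis using mm unfolding E3_def by simp
  qed
  define E where "E = E1 \<union> E2 \<union> (\<Union>k\<in>{d<..K}. E3 k)"
  have E3s: "(\<Union>k\<in>{d<..K}. E3 k) \<in> sets ?M" using E3 by (intro sets.finite_UN) auto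
  have "E \<in> sets ?M" unfolding E_def using E1 E2 E3s by auto
  moreover have "measure ?M E \<le> \<delta>"
  proof -
   have "measure ?M E \<le> measure ?M (E1 \<union> E2) + measure ?M (\<Union>k\<in>{d<..K}. E3 k)"
    unfolding E_def using E1 E2 E3s by (intro measure_Un_le) auto
   also have "measure ?M (E1 \<union> E2) \<le> measure ?M E1 + measure ?M E2" using E1 E2 by (intro measure_Un_le) auto
   also have "measure ?M (\<Union>k\<in>{d<..K}. E3 k) \<le> (\<Sum>k\<in>{d<..K}. measure ?M (E3 k))"
    using E3 by (intro measure_UNION_le) auto
   also have "\<dots> \<le> (\<Sum>k\<in>{d<..K}. C k * real n powr (- (2 * \<epsilon>)))" using E3 by (intro sum_mono) auto
   also have "\<dots> = C1 * real n powr (- (2 * \<epsilon>))" by (simp add: C1_def sum_distrib_right)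
   finally show ?thesis using E1(2) E2(2) n(1,2) by linarith
  qed
  moreover have "log_approx n (curry W) d (real n powr (1/3 - \<beta>)) (real n powr (- \<gamma>))" if W: "W \<in> space ?M - E" for W
  proof -
   define r where "r = real n powr (1/3 - \<beta>)"
   define \<rho> where "\<rho> = real n powr (1/3 - \<beta>/2)"
   have r0: "r > 0" "\<rho> > 0" using n1 by (auto simp: r_def \<rho>_def)
   have rr: "r / \<rho> = real n powr (- (\<beta> / 2))"
    unfolding r_def \<rho>_def powr_diff[symmetric] by simp
   have r4: "4 * r \<le> \<rho>"
   proof -
    have "r / \<rho> < 1/4" using n(3) by (simp only: rr)
    then show ?thesis using r0 by (simp add: divide_less_eq)
   qed
   have nz: "perm_poly n (curry W) z \<noteq> 0" if "cmod z < \<rho>" for z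
    using E1(3)[of W z] W that by (simp add: E_def \<rho>_def)
   have ub: "cmod (perm_poly n (curry W) z) \<le> exp (real n)" if "cmod z < \<rho>" for z
   proof -
    have "(cmod z)\<^sup>2 \<le> \<rho>\<^sup>2" using that by (intro power_mono) auto
    also have "\<rho>\<^sup>2 = real n powr (2/3 - \<beta>)" using n1 by (simp add: \<rho>_def powr_power)
    also have "\<dots> \<le> real n powr (2/3)" using n1 \<beta> by (intro powr_mono) auto
    finally have z2: "exp (8 * (cmod z)\<^sup>2) \<le> exp (8 * real n powr (2/3))" by simp
    have pe: "penv n W \<le> real n" using W by (auto simp: E_def E2_def)
    have "(cmod (perm_poly n (curry W) z))\<^sup>2 \<le> exp (8 * (cmod z)\<^sup>2) * penv n W" by (rule perm_poly_le_penv)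
    also have "\<dots> \<le> exp (8 * real n powr (2/3)) * real n" using z2 pe penv_nonneg by (intro mult_mono) auto
    also have "\<dots> \<le> (exp (real n))\<^sup>2" using n(4) by (simp add: exp_double)
    finally show ?thesis by (rule power2_le_imp_le) simp
   qed
   define \<eta> where "\<eta> = real n powr (- \<gamma> - \<epsilon>)"
   have mid: "cmod (log_coeff n (curry W) k) * r ^ k \<le> \<eta>" if k: "k \<in> {d<..K}" for k
   proof -
    have "(cmod (log_coeff n (curry W) k))\<^sup>2 \<le> \<tau> k" using W k by (auto simp: E_def E3_def not_less)
    also have "\<tau> k = (real n powr ((1 - real k + 2 * \<epsilon>) / 2))\<^sup>2"
     by (simp only: \<tau>_def power2_eq_square powr_add[symmetric] field_sum_of_halves)
    finally have "cmod (log_coeff n (curry W) k) \<le> real n powr ((1 - real k + 2 * \<epsilon>) / 2)" by (rule power2_le_imp_le) simp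
    then have "cmod (log_coeff n (curry W) k) * r ^ k \<le> real n powr ((1 - real k + 2 * \<epsilon>) / 2) * r ^ k"
     using r0 by (intro mult_right_mono) auto
    also have rk: "r ^ k = real n powr (real k * (1/3 - \<beta>))" using n1 by (simp add: r_def powr_power mult.commute)
    also have "real n powr ((1 - real k + 2 * \<epsilon>) / 2) * real n powr (real k * (1/3 - \<beta>)) =
      real n powr ((1 - real k + 2 * \<epsilon>) / 2 + real k * (1/3 - \<beta>))" by (simp only: powr_add)
    also have "\<dots> \<le> \<eta>"
     unfolding \<eta>_def
    proof (rule powr_mono)
     \<comment> \<open>The exponent of the k-th term decreases in k, so k = d + 1 is the worst case,
       and there Gamma appears.\<close>
     have "(real d + 1) * (1/6 + \<beta>) \<le> real k * (1/6 + \<beta>)" using k \<beta> by (intro mult_right_mono) auto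
     moreover have "(1 - real k + 2 * \<epsilon>) / 2 + real k * (1/3 - \<beta>) = 1/2 + \<epsilon> - real k * (1/6 + \<beta>)"
      by (simp add: algebra_simps add_divide_distrib diff_divide_distrib)
     moreover have "- \<gamma> - \<epsilon> = 1/2 + \<epsilon> - (real d + 1) * (1/6 + \<beta>)"
      unfolding \<epsilon>_def Gamma_exponent_def by (simp add: algebra_simps add_divide_distrib diff_divide_distrib)
     ultimately show "(1 - real k + 2 * \<epsilon>) / 2 + real k * (1/3 - \<beta>) \<le> - \<gamma> - \<epsilon>" by linarith
    qed (use n1 in simp)
    finally show ?thesis unfolding rk .
   qed
   have "log_approx n (curry W) d r (real K * \<eta> + 4 * (real n + 1) * (2 * r / \<rho>) ^ Suc K)"
    using r0(1) r4 nz ub mid by (rule truncation_error) (use K in simp_all)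
   moreover have "real K * \<eta> + 4 * (real n + 1) * (2 * r / \<rho>) ^ Suc K \<le> real n powr (- \<gamma>)"
   proof -
    have "(r / \<rho>) ^ Suc K = real n powr (- (\<beta> / 2 * real (Suc K)))"
     unfolding rr using n1 by (simp add: powr_power mult.commute del: power_Suc of_nat_Suc)
    also have "\<dots> \<le> real n powr (- 2 - \<gamma>)" using n1 K(2) by (intro powr_mono) linarith+
    also have "\<dots> = real n powr (- 2) * real n powr (- \<gamma>)" by (simp flip: powr_add)
    finally have t: "(r / \<rho>) ^ Suc K \<le> real n powr (- 2) * real n powr (- \<gamma>)" .
    have "4 * (real n + 1) * (2 * r / \<rho>) ^ Suc K = 4 * (real n + 1) * 2 ^ Suc K * (r / \<rho>) ^ Suc K"
     by (simp only: times_divide_eq_right[symmetric] power_mult_distrib mult.assoc)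
    also have "\<dots> \<le> 4 * (real n + 1) * 2 ^ Suc K * (real n powr (- 2) * real n powr (- \<gamma>))"
     by (intro mult_left_mono t) auto
    finally have a: "4 * (real n + 1) * (2 * r / \<rho>) ^ Suc K \<le> 4 * 2 ^ Suc K * ((real n + 1) * real n powr (- 2)) * real n powr (- \<gamma>)"
     by (simp only: mult_ac)
    have b: "real K * \<eta> = real K * real n powr (- \<epsilon>) * real n powr (- \<gamma>)"
    proof -
     have "\<eta> = real n powr (- \<epsilon> + - \<gamma>)"
      unfolding \<eta>_def by (rule arg_cong[where f = "\<lambda>x. real n powr x"]) simp
     then show ?thesis by (simp only: powr_add mult.assoc)
    qed
    have "real K * \<eta> + 4 * (real n + 1) * (2 * r / \<rho>) ^ Suc K \<le>
      (real K * real n powr (- \<epsilon>) + 4 * 2 ^ Suc K * ((real n + 1) * real n powr (- 2))) * real n powr (- \<gamma>)"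
     unfolding distrib_right[of "real K * real n powr (- \<epsilon>)"] b by (intro add_left_mono a)
    also have "\<dots> \<le> 1 * real n powr (- \<gamma>)" using n(5) by (intro mult_right_mono) auto
    finally show ?thesis by simp
   qed
   ultimately show ?thesis unfolding r_def[symmetric] log_approx_def by (meson order_trans)
  qed
  ultimately show ?thesis by blast
 qed
 then show ?thesis by blast
qed

lemma log_approx_cong:
 assumes "\<And>i j. i < n \<Longrightarrow> j < n \<Longrightarrow> A i j = B i j"
 shows "log_approx n A d r \<epsilon> = log_approx n B d r \<epsilon>"
proof -
 have "perm_poly n A = perm_poly n B"
  unfolding perm_poly_def using per_cong[of n "\<lambda>i j. 1 + _ * A i j" "\<lambda>i j. 1 + _ * B i j"] assms
  by (intro ext arg_cong2[where f = "(/)"] per_cong) auto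
 then show ?thesis unfolding log_approx_def log_trunc_def log_coeff_def by simp
qed

text \<open>Independence identifies the joint law of the entries with the product measure, so
  everything proved for \<open>gvec\<close> transfers to an arbitrary probability space. The index
  set has to be nonempty for this, hence n > 0.\<close>

lemma gaussian_matrix_distr:
 assumes G: "gaussian_matrix M n W" and n: "n > 0"
 shows "(\<lambda>\<omega>. \<lambda>p\<in>sq n. W (fst p) (snd p) \<omega>) \<in> M \<rightarrow>\<^sub>M gvec (sq n)"
  and "distr M (gvec (sq n)) (\<lambda>\<omega>. \<lambda>p\<in>sq n. W (fst p) (snd p) \<omega>) = gvec (sq n)"
proof -
 interpret prob_space M using G by (simp add: gaussian_matrix_def)
 define X where "X p = W (fst p) (snd p)" for p
 have ind: "indep_vars (\<lambda>_. borel) X (sq n)"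
  using G unfolding gaussian_matrix_def X_def by (simp add: split_beta')
 have g: "distributed M lborel (X p) (\<lambda>w. ennreal (exp (- (cmod w)\<^sup>2) / pi))" if "p \<in> sq n" for p
  using G that by (auto simp: gaussian_matrix_def X_def std_complex_gaussian_def)
 have rv: "random_variable borel (X p)" if "p \<in> sq n" for p
  using distributed_measurable[OF g[OF that]] by simp
 have d: "distr M borel (X p) = cgauss" if "p \<in> sq n" for p
 proof -
  have "distr M borel (X p) = distr M lborel (X p)" by (rule distr_cong) auto
  also have "\<dots> = cgauss" unfolding cgauss_def by (rule distributed_distr_eq_density[OF g[OF that]])
  finally show ?thesis .
 qed
 have sets: "sets (PiM (sq n) (\<lambda>_. borel :: complex measure)) = sets (gvec (sq n))"
  by (rule sets_PiM_cong) auto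
 have ne: "sq n \<noteq> {}" using n by auto
 have "(\<lambda>\<omega>. \<lambda>p\<in>sq n. X p \<omega>) \<in> M \<rightarrow>\<^sub>M PiM (sq n) (\<lambda>_. borel)"
  by (rule measurable_restrict) (rule rv)
 then show "(\<lambda>\<omega>. \<lambda>p\<in>sq n. W (fst p) (snd p) \<omega>) \<in> M \<rightarrow>\<^sub>M gvec (sq n)"
  unfolding X_def using measurable_cong_sets[OF refl sets] by blast
 have "distr M (PiM (sq n) (\<lambda>_. borel)) (\<lambda>\<omega>. \<lambda>p\<in>sq n. X p \<omega>) = PiM (sq n) (\<lambda>p. distr M borel (X p))"
  by (rule iffD1[OF indep_vars_iff_distr_eq_PiM'[where I = "sq n" and M' = "\<lambda>_. borel" and X = X, OF ne rv] ind])
 also have "\<dots> = gvec (sq n)" by (rule PiM_cong) (auto simp: d)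
 finally show "distr M (gvec (sq n)) (\<lambda>\<omega>. \<lambda>p\<in>sq n. W (fst p) (snd p) \<omega>) = gvec (sq n)"
  unfolding X_def using distr_cong[OF refl sets, of M] by (metis (no_types, lifting))
qed

lemma gaussian_log_approx:
 fixes \<beta> \<gamma> \<delta> :: real and d :: nat
 assumes \<beta>: "0 < \<beta>" and \<gamma>: "\<gamma> < Gamma_exponent d \<beta>" and \<delta>: "\<delta> > 0"
 shows "\<exists>N. \<forall>n\<ge>N. \<forall>(M :: 'w measure) W. gaussian_matrix M n W \<longrightarrow>
  with_prob_at_least M (1 - \<delta>) (\<lambda>\<omega>.
   log_approx n (\<lambda>i j. W i j \<omega>) d (real n powr (1 / 3 - \<beta>)) (real n powr (- \<gamma>)))"
proof -
 from gvec_log_approx[OF assms] obtain N where N: "\<And>n. n \<ge> N \<Longrightarrow> \<exists>E\<in>sets (gvec (sq n)). measure (gvec (sq n)) E \<le> \<delta> \<and>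
  (\<forall>W\<in>space (gvec (sq n)) - E. log_approx n (curry W) d (real n powr (1/3 - \<beta>)) (real n powr (- \<gamma>)))" by blast
 show ?thesis
 proof (intro exI[of _ "max N 1"] allI impI)
  fix n :: nat and M :: "'w measure" and W assume n: "n \<ge> max N 1" and G: "gaussian_matrix M n W"
  interpret prob_space M using G by (simp add: gaussian_matrix_def)
  interpret V: prob_space "gvec (sq n)" by (rule prob_space_gvec)
  define X where "X \<omega> = (\<lambda>p\<in>sq n. W (fst p) (snd p) \<omega>)" for \<omega>
  have "n > 0" using n by simp
  from gaussian_matrix_distr[OF G this] have X: "X \<in> M \<rightarrow>\<^sub>M gvec (sq n)" "distr M (gvec (sq n)) X = gvec (sq n)"
   unfolding X_def[abs_def] by blast+
  obtain E where E: "E \<in> sets (gvec (sq n))" "measure (gvec (sq n)) E \<le> \<delta>"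
   "\<And>w. w \<in> space (gvec (sq n)) - E \<Longrightarrow> log_approx n (curry w) d (real n powr (1/3 - \<beta>)) (real n powr (- \<gamma>))"
   using N[of n] n by auto
  define S where "S = X -` (space (gvec (sq n)) - E) \<inter> space M"
  have cE: "space (gvec (sq n)) - E \<in> sets (gvec (sq n))" using E(1) by auto
  have "S \<in> sets M" unfolding S_def by (rule measurable_sets[OF X(1) cE])
  moreover have "1 - \<delta> \<le> measure M S"
  proof -
   have "measure M S = measure (distr M (gvec (sq n)) X) (space (gvec (sq n)) - E)"
    unfolding S_def using measure_distr[OF X(1) cE] by simp
   also have "\<dots> = 1 - measure (gvec (sq n)) E" unfolding X(2) by (rule V.prob_compl[OF E(1)])
   finally show ?thesis using E(2) by simp
  qed
  moreover have "log_approx n (\<lambda>i j. W i j \<omega>) d (real n powr (1 / 3 - \<beta>)) (real n powr (- \<gamma>))" if "\<omega> \<in> S" for \<omega>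
  proof -
   have "log_approx n (curry (X \<omega>)) d (real n powr (1 / 3 - \<beta>)) (real n powr (- \<gamma>))"
    using that by (intro E(3)) (auto simp: S_def)
   moreover have "log_approx n (curry (X \<omega>)) d (real n powr (1 / 3 - \<beta>)) (real n powr (- \<gamma>)) =
     log_approx n (\<lambda>i j. W i j \<omega>) d (real n powr (1 / 3 - \<beta>)) (real n powr (- \<gamma>))"
    by (rule log_approx_cong) (simp add: X_def)
   ultimately show ?thesis by simp
  qed
  ultimately show "with_prob_at_least M (1 - \<delta>) (\<lambda>\<omega>.
   log_approx n (\<lambda>i j. W i j \<omega>) d (real n powr (1 / 3 - \<beta>)) (real n powr (- \<gamma>)))"
   unfolding with_prob_at_least_def by blast
 qed
qed

text \<open>If d >= 6 \<gamma> + 3 then (d + 1)/6 - 1/2 is already at least \<gamma> + 1/6, and the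
  term with \<beta> only adds to it. The lower bound on the ceiling ensures that \<open>nat\<close>
  does not change its value.\<close>

lemma ceiling_Gamma_exponent:
 assumes "0 < \<beta>" "2 \<le> \<lceil>6 * \<gamma> + 3\<rceil>"
 shows "\<gamma> < Gamma_exponent (nat \<lceil>6 * \<gamma> + 3\<rceil>) \<beta>"
proof -
 define d where "d = nat \<lceil>6 * \<gamma> + 3\<rceil>"
 have d: "real d \<ge> 6 * \<gamma> + 3" using assms(2) unfolding d_def by linarith
 have "0 < \<beta> * (real d + 1)" using assms(1) by simp
 moreover have "\<gamma> < (real d + 1) / 6 + x - 1 / 2" if "0 < x" for x using d that by (simp add: field_simps)
 ultimately show ?thesis unfolding d_def[symmetric] Gamma_exponent_def by blast
qed

theorem mainTheorem1:
  fixes \<beta> :: real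
  assumes "0 < \<beta>" and "\<beta> < 1 / 3"
  shows
    "(\<forall>d\<ge>2. \<forall>\<gamma><Gamma_exponent d \<beta>. \<forall>\<delta>\<in>{0<..<1}. \<exists>N. \<forall>n\<ge>N.
        \<forall>(M :: 'w measure) W. gaussian_matrix M n W \<longrightarrow>
          with_prob_at_least M (1 - \<delta>) (\<lambda>\<omega>.
            log_approx n (\<lambda>i j. W i j \<omega>) d (real n powr (1 / 3 - \<beta>)) (real n powr (- \<gamma>)))) \<and>
     (\<forall>\<gamma>::real. 2 \<le> \<lceil>6 * \<gamma> + 3\<rceil> \<longrightarrow> (\<forall>\<delta>\<in>{0<..<1}. \<exists>N. \<forall>n\<ge>N.
        \<forall>(M :: 'w measure) W. gaussian_matrix M n W \<longrightarrow>
          with_prob_at_least M (1 - \<delta>) (\<lambda>\<omega>.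
            log_approx n (\<lambda>i j. W i j \<omega>) (nat \<lceil>6 * \<gamma> + 3\<rceil>)
              (real n powr (1 / 3 - \<beta>)) (real n powr (- \<gamma>))))) \<and>
     (\<forall>\<gamma>\<^sub>0>0. \<exists>C::real. \<forall>\<gamma>\<ge>\<gamma>\<^sub>0. \<exists>p (K::real). \<forall>n\<ge>1. \<forall>A z.
        computes_within p n A z (log_trunc n A (nat \<lceil>6 * \<gamma> + 3\<rceil>) z)
          (K * real n powr (C * \<gamma>)))"
proof (intro conjI allI impI ballI)
 fix d :: nat and \<gamma> \<delta> :: real
 assume "\<gamma> < Gamma_exponent d \<beta>" "\<delta> \<in> {0<..<1}"
 then show "\<exists>N. \<forall>n\<ge>N. \<forall>(M :: 'w measure) W. gaussian_matrix M n W \<longrightarrow>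
   with_prob_at_least M (1 - \<delta>) (\<lambda>\<omega>.
    log_approx n (\<lambda>i j. W i j \<omega>) d (real n powr (1 / 3 - \<beta>)) (real n powr (- \<gamma>)))"
  using assms(1) by (intro gaussian_log_approx) auto
next
 fix \<gamma> \<delta> :: real
 assume "2 \<le> \<lceil>6 * \<gamma> + 3\<rceil>" "\<delta> \<in> {0<..<1}"
 then show "\<exists>N. \<forall>n\<ge>N. \<forall>(M :: 'w measure) W. gaussian_matrix M n W \<longrightarrow>
   with_prob_at_least M (1 - \<delta>) (\<lambda>\<omega>.
    log_approx n (\<lambda>i j. W i j \<omega>) (nat \<lceil>6 * \<gamma> + 3\<rceil>)
     (real n powr (1 / 3 - \<beta>)) (real n powr (- \<gamma>)))"
  using assms(1) by (intro gaussian_log_approx ceiling_Gamma_exponent) auto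
next
 fix \<gamma>\<^sub>0 :: real
 assume "\<gamma>\<^sub>0 > 0"
 then show "\<exists>C::real. \<forall>\<gamma>\<ge>\<gamma>\<^sub>0. \<exists>p (K::real). \<forall>n\<ge>1. \<forall>A z.
   computes_within p n A z (log_trunc n A (nat \<lceil>6 * \<gamma> + 3\<rceil>) z) (K * real n powr (C * \<gamma>))"
  by (rule truncation_polynomial_time)
qed

end
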